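(* Let $k$ be an algebraically closed field and let $\mathcal C$ and $\mathcal D$ be essentially small locally finite semisimple tensor categories over $k$. Let $F:D^b(\mathcal C)\to D^b(\mathcal D)$ be a monoidal triangulated equivalence. There is a unique $\chi_F\in\operatorname{Hom}(U_{\mathcal D},\mathbb Z)$ such that $T_{-\chi_F}\circ F$ is $t$-exact for the standard $t$-structures. If $\operatorname{Hom}(U_{\mathcal D},\mathbb Z)=0$, then every monoidal triangulated equivalence $D^b(\mathcal C)\to D^b(\mathcal D)$ is $t$-exact for the standard $t$-structures.
   Context: Tensor categories are as in Etingof–Gelaki–Nikshych–Ostrik: $k$-linear abelian rigid monoidal categories with $k$-bilinear tensor product, finite-dimensional Hom spaces, every object of finite length, and simple unit $\mathbf 1$ with $\operatorname{End}(\mathbf 1)=k$. Sets $\operatorname{Irr}$ of simple isomorphism classes may be infinite. All functors are $k$-linear; monoidal functors are strong monoidal; a monoidal triangulated equivalence is a triangulated equivalence equipped with a strong monoidal structure. Bounded derived categories carry the induced (total complex) tensor product. Shifts: $(K[a])^i=K^{i+a}$. $U_{\mathcal D}$ is the universal grading group, with degree map $\deg:\operatorname{Irr}(\mathcal D)\to U_{\mathcal D}$: the universal map to a group satisfying $\deg Z=\deg X\deg Y$ whenever $Z$ is a direct summand of $X\otimes Y$. For $\eta\in\operatorname{Hom}(U_{\mathcal D},\mathbb Z)$ write $\mathcal D=\bigoplus_n\mathcal D_n$, with $\mathcal D_n$ generated by the simple objects $X$ with $\eta(\deg X)=n$; applying the exact homogeneous projections termwise gives $K=\bigoplus_nK_n$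 for $K\in D^b(\mathcal D)$. The autoequivalence $T_\eta:D^b(\mathcal D)\to D^b(\mathcal D)$ is $T_\eta(K)=\bigoplus_nK_n[n]$. *)

theory Defs
  imports
    "HOL-Algebra.Module"
    "HOL-Algebra.Elementary_Groups"
    "HOL-Computational_Algebra.Polynomial"
begin

section \<open>Linear and abelian categories\<close>

text \<open>Objects and morphisms form sets, so a category is small here.  Morphisms know their domain and
  codomain; all operations are meaningful only on composable (resp. parallel) morphisms.\<close>

record ('o, 'm) cat =
  Ob :: "'o set"
  Mor :: "'m set"
  Dom :: "'m \<Rightarrow> 'o"
  Cod :: "'m \<Rightarrow> 'o"
  Id :: "'o \<Rightarrow> 'm"
  Cmp :: "'m \<Rightarrow> 'm \<Rightarrow> 'm" (infixr \<open>\<bullet>\<index>\<close> 75)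

definition Hom :: "('o, 'm, 'x) cat_scheme \<Rightarrow> 'o \<Rightarrow> 'o \<Rightarrow> 'm set" where
  "Hom C X Y = {f \<in> Mor C. Dom C f = X \<and> Cod C f = Y}"

locale category =
  fixes C :: "('o, 'm, 'x) cat_scheme" (structure)
  assumes dom_cod: "f \<in> Mor C \<Longrightarrow> Dom C f \<in> Ob C \<and> Cod C f \<in> Ob C"
    and id_hom: "X \<in> Ob C \<Longrightarrow> Id C X \<in> Hom C X X"
    and cmp_hom: "f \<in> Hom C X Y \<Longrightarrow> g \<in> Hom C Y Z \<Longrightarrow> g \<bullet> f \<in> Hom C X Z"
    and id_left: "f \<in> Hom C X Y \<Longrightarrow> Id C Y \<bullet> f = f"
    and id_right: "f \<in> Hom C X Y \<Longrightarrow> f \<bullet> Id C X = f"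
    and cmp_assoc:
      "f \<in> Hom C W X \<Longrightarrow> g \<in> Hom C X Y \<Longrightarrow> h \<in> Hom C Y Z \<Longrightarrow> (h \<bullet> g) \<bullet> f = h \<bullet> (g \<bullet> f)"

definition inverse_mor :: "('o, 'm, 'x) cat_scheme \<Rightarrow> 'm \<Rightarrow> 'm \<Rightarrow> bool" where
  "inverse_mor C f g \<longleftrightarrow> f \<in> Mor C \<and> g \<in> Hom C (Cod C f) (Dom C f) \<and>
     g \<bullet>\<^bsub>C\<^esub> f = Id C (Dom C f) \<and> f \<bullet>\<^bsub>C\<^esub> g = Id C (Cod C f)"

definition is_iso :: "('o, 'm, 'x) cat_scheme \<Rightarrow> 'm \<Rightarrow> bool" where
  "is_iso C f \<longleftrightarrow> (\<exists>g. inverse_mor C f g)"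

definition inv_mor :: "('o, 'm, 'x) cat_scheme \<Rightarrow> 'm \<Rightarrow> 'm" where
  "inv_mor C f = (THE g. inverse_mor C f g)"

definition isomorphic :: "('o, 'm, 'x) cat_scheme \<Rightarrow> 'o \<Rightarrow> 'o \<Rightarrow> bool" where
  "isomorphic C X Y \<longleftrightarrow> (\<exists>f \<in> Hom C X Y. is_iso C f)"

definition mono_mor :: "('o, 'm, 'x) cat_scheme \<Rightarrow> 'm \<Rightarrow> bool" where
  "mono_mor C f \<longleftrightarrow> f \<in> Mor C \<and>
     (\<forall>Z. \<forall>g \<in> Hom C Z (Dom C f). \<forall>h \<in> Hom C Z (Dom C f). f \<bullet>\<^bsub>C\<^esub> g = f \<bullet>\<^bsub>C\<^esub> h \<longrightarrow> g = h)"

definition epi_mor :: "('o, 'm, 'x) cat_scheme \<Rightarrow> 'm \<Rightarrow> bool" where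
  "epi_mor C f \<longleftrightarrow> f \<in> Mor C \<and>
     (\<forall>Z. \<forall>g \<in> Hom C (Cod C f) Z. \<forall>h \<in> Hom C (Cod C f) Z. g \<bullet>\<^bsub>C\<^esub> f = h \<bullet>\<^bsub>C\<^esub> f \<longrightarrow> g = h)"

definition zero_object :: "('o, 'm, 'x) cat_scheme \<Rightarrow> 'o \<Rightarrow> bool" where
  "zero_object C X \<longleftrightarrow> X \<in> Ob C \<and>
     (\<forall>Y \<in> Ob C. (\<exists>!f. f \<in> Hom C X Y) \<and> (\<exists>!f. f \<in> Hom C Y X))"

definition zobj :: "('o, 'm, 'x) cat_scheme \<Rightarrow> 'o" where
  "zobj C = (SOME X. zero_object C X)"

definition simple_object :: "('o, 'm, 'x) cat_scheme \<Rightarrow> 'o \<Rightarrow> bool" where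
  "simple_object C X \<longleftrightarrow> X \<in> Ob C \<and> \<not> zero_object C X \<and>
     (\<forall>f. mono_mor C f \<and> Cod C f = X \<longrightarrow> is_iso C f \<or> zero_object C (Dom C f))"

record ('o, 'm, 'k) lincat = "('o, 'm) cat" +
  Zero :: "'o \<Rightarrow> 'o \<Rightarrow> 'm"
  Add :: "'m \<Rightarrow> 'm \<Rightarrow> 'm"
  Scale :: "'k \<Rightarrow> 'm \<Rightarrow> 'm"

definition field_ring :: "'k::field ring" where
  "field_ring = \<lparr>carrier = UNIV, monoid.mult = (*), one = 1, zero = 0, add = (+)\<rparr>"

text \<open>The fields \<open>mult\<close> and \<open>one\<close> of the record are irrelevant for a module.\<close>

definition hom_space :: "('o, 'm, 'k, 'x) lincat_scheme \<Rightarrow> 'o \<Rightarrow> 'o \<Rightarrow> ('k, 'm) module" where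
  "hom_space C X Y = \<lparr>carrier = Hom C X Y, monoid.mult = undefined, one = undefined,
     zero = Zero C X Y, add = Add C, module.smult = Scale C\<rparr>"

abbreviation hsum ::
  "('o, 'm, 'k, 'x) lincat_scheme \<Rightarrow> 'o \<Rightarrow> 'o \<Rightarrow> ('i \<Rightarrow> 'm) \<Rightarrow> 'i set \<Rightarrow> 'm" where
  "hsum C X Y f I \<equiv> finsum (hom_space C X Y) f I"

locale linear_category = category C
  for C :: "('o, 'm, 'k::field, 'x) lincat_scheme" (structure) +
  assumes hom_module: "X \<in> Ob C \<Longrightarrow> Y \<in> Ob C \<Longrightarrow>
        Module.module (field_ring :: 'k ring) (hom_space C X Y)"
    and cmp_add_left: "f \<in> Hom C X Y \<Longrightarrow> g \<in> Hom C Y Z \<Longrightarrow> g' \<in> Hom C Y Z \<Longrightarrow>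
        Add C g g' \<bullet> f = Add C (g \<bullet> f) (g' \<bullet> f)"
    and cmp_add_right: "f \<in> Hom C X Y \<Longrightarrow> f' \<in> Hom C X Y \<Longrightarrow> g \<in> Hom C Y Z \<Longrightarrow>
        g \<bullet> Add C f f' = Add C (g \<bullet> f) (g \<bullet> f')"
    and cmp_scale_left: "f \<in> Hom C X Y \<Longrightarrow> g \<in> Hom C Y Z \<Longrightarrow>
        Scale C c g \<bullet> f = Scale C c (g \<bullet> f)"
    and cmp_scale_right: "f \<in> Hom C X Y \<Longrightarrow> g \<in> Hom C Y Z \<Longrightarrow>
        g \<bullet> Scale C c f = Scale C c (g \<bullet> f)"

definition is_biprod :: "('o, 'm, 'k, 'x) lincat_scheme \<Rightarrow> 'i set \<Rightarrow> ('i \<Rightarrow> 'o) \<Rightarrow>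
    'o \<Rightarrow> ('i \<Rightarrow> 'm) \<Rightarrow> ('i \<Rightarrow> 'm) \<Rightarrow> bool" where
  "is_biprod C I X B \<iota> \<pi> \<longleftrightarrow> finite I \<and> B \<in> Ob C \<and>
     (\<forall>i \<in> I. X i \<in> Ob C \<and> \<iota> i \<in> Hom C (X i) B \<and> \<pi> i \<in> Hom C B (X i)) \<and>
     (\<forall>i \<in> I. \<forall>j \<in> I. \<pi> j \<bullet>\<^bsub>C\<^esub> \<iota> i = (if i = j then Id C (X i) else Zero C (X i) (X j))) \<and>
     hsum C B B (\<lambda>i. \<iota> i \<bullet>\<^bsub>C\<^esub> \<pi> i) I = Id C B"

definition chosen_biprod :: "('o, 'm, 'k, 'x) lincat_scheme \<Rightarrow> 'i set \<Rightarrow> ('i \<Rightarrow> 'o) \<Rightarrow>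
    'o \<times> ('i \<Rightarrow> 'm) \<times> ('i \<Rightarrow> 'm)" where
  "chosen_biprod C I X = (SOME (B, \<iota>, \<pi>). is_biprod C I X B \<iota> \<pi>)"

definition bp_ob :: "('o, 'm, 'k, 'x) lincat_scheme \<Rightarrow> 'i set \<Rightarrow> ('i \<Rightarrow> 'o) \<Rightarrow> 'o" where
  "bp_ob C I X = fst (chosen_biprod C I X)"

text \<open>Inclusions and projections are extended by zero to indices outside \<open>I\<close>.\<close>

definition bp_in :: "('o, 'm, 'k, 'x) lincat_scheme \<Rightarrow> 'i set \<Rightarrow> ('i \<Rightarrow> 'o) \<Rightarrow> 'i \<Rightarrow> 'm" where
  "bp_in C I X i =
     (if i \<in> I then fst (snd (chosen_biprod C I X)) i else Zero C (X i) (bp_ob C I X))"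

definition bp_pr :: "('o, 'm, 'k, 'x) lincat_scheme \<Rightarrow> 'i set \<Rightarrow> ('i \<Rightarrow> 'o) \<Rightarrow> 'i \<Rightarrow> 'm" where
  "bp_pr C I X i =
     (if i \<in> I then snd (snd (chosen_biprod C I X)) i else Zero C (bp_ob C I X) (X i))"

definition is_kernel :: "('o, 'm, 'k, 'x) lincat_scheme \<Rightarrow> 'm \<Rightarrow> 'm \<Rightarrow> bool" where
  "is_kernel C f k \<longleftrightarrow> f \<in> Mor C \<and> k \<in> Mor C \<and> Cod C k = Dom C f \<and>
     f \<bullet>\<^bsub>C\<^esub> k = Zero C (Dom C k) (Cod C f) \<and>
     (\<forall>Z. \<forall>g \<in> Hom C Z (Dom C f). f \<bullet>\<^bsub>C\<^esub> g = Zero C Z (Cod C f) \<longrightarrow>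
        (\<exists>!h. h \<in> Hom C Z (Dom C k) \<and> k \<bullet>\<^bsub>C\<^esub> h = g))"

definition is_cokernel :: "('o, 'm, 'k, 'x) lincat_scheme \<Rightarrow> 'm \<Rightarrow> 'm \<Rightarrow> bool" where
  "is_cokernel C f q \<longleftrightarrow> f \<in> Mor C \<and> q \<in> Mor C \<and> Dom C q = Cod C f \<and>
     q \<bullet>\<^bsub>C\<^esub> f = Zero C (Dom C f) (Cod C q) \<and>
     (\<forall>Z. \<forall>g \<in> Hom C (Cod C f) Z. g \<bullet>\<^bsub>C\<^esub> f = Zero C (Dom C f) Z \<longrightarrow>
        (\<exists>!h. h \<in> Hom C (Cod C q) Z \<and> h \<bullet>\<^bsub>C\<^esub> q = g))"

locale abelian_category = linear_category C
  for C :: "('o, 'm, 'k::field, 'x) lincat_scheme" (structure) +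
  assumes ex_zero: "\<exists>X. zero_object C X"
    and ex_biprod: "X \<in> Ob C \<Longrightarrow> Y \<in> Ob C \<Longrightarrow>
        \<exists>B \<iota> \<pi>. is_biprod C (UNIV :: bool set) (\<lambda>b. if b then X else Y) B \<iota> \<pi>"
    and ex_kernel: "f \<in> Mor C \<Longrightarrow> \<exists>k. is_kernel C f k"
    and ex_cokernel: "f \<in> Mor C \<Longrightarrow> \<exists>q. is_cokernel C f q"
    and mono_normal: "mono_mor C f \<Longrightarrow> \<exists>g. is_kernel C g f"
    and epi_normal: "epi_mor C f \<Longrightarrow> \<exists>g. is_cokernel C g f"

inductive finite_length :: "('o, 'm, 'k, 'x) lincat_scheme \<Rightarrow> 'o \<Rightarrow> bool"
  for C :: "('o, 'm, 'k, 'x) lincat_scheme" where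
  zero: "zero_object C X \<Longrightarrow> finite_length C X"
| extension: "finite_length C X' \<Longrightarrow> simple_object C S \<Longrightarrow> i \<in> Hom C X' X \<Longrightarrow> p \<in> Hom C X S \<Longrightarrow>
     is_kernel C p i \<Longrightarrow> is_cokernel C i p \<Longrightarrow> finite_length C X"

definition direct_summand :: "('o, 'm, 'k, 'x) lincat_scheme \<Rightarrow> 'o \<Rightarrow> 'o \<Rightarrow> bool" where
  "direct_summand C Z W \<longleftrightarrow>
     (\<exists>Z' \<iota> \<pi>. is_biprod C (UNIV :: bool set) (\<lambda>b. if b then Z else Z') W \<iota> \<pi>)"


section \<open>Tensor categories\<close>

record ('o, 'm, 'k) moncat = "('o, 'm, 'k) lincat" +
  Unit :: "'o" (\<open>\<one>\<^sub>\<otimes>\<index>\<close>)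
  TensO :: "'o \<Rightarrow> 'o \<Rightarrow> 'o" (infixr \<open>\<boxtimes>\<index>\<close> 80)
  TensM :: "'m \<Rightarrow> 'm \<Rightarrow> 'm" (infixr \<open>\<star>\<index>\<close> 80)
  Assoc :: "'o \<Rightarrow> 'o \<Rightarrow> 'o \<Rightarrow> 'm"
  LUnit :: "'o \<Rightarrow> 'm"
  RUnit :: "'o \<Rightarrow> 'm"

locale monoidal_category = category C
  for C :: "('o, 'm, 'k, 'x) moncat_scheme" (structure) +
  assumes unit_ob: "\<one>\<^sub>\<otimes> \<in> Ob C"
    and tens_ob: "X \<in> Ob C \<Longrightarrow> Y \<in> Ob C \<Longrightarrow> X \<boxtimes> Y \<in> Ob C"
    and tens_hom: "f \<in> Hom C X X' \<Longrightarrow> g \<in> Hom C Y Y' \<Longrightarrow> f \<star> g \<in> Hom C (X \<boxtimes> Y) (X' \<boxtimes> Y')"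
    and tens_id: "X \<in> Ob C \<Longrightarrow> Y \<in> Ob C \<Longrightarrow> Id C X \<star> Id C Y = Id C (X \<boxtimes> Y)"
    and tens_cmp: "f \<in> Hom C X X' \<Longrightarrow> f' \<in> Hom C X' X'' \<Longrightarrow> g \<in> Hom C Y Y' \<Longrightarrow> g' \<in> Hom C Y' Y'' \<Longrightarrow>
        (f' \<bullet> f) \<star> (g' \<bullet> g) = (f' \<star> g') \<bullet> (f \<star> g)"
    and assoc_hom: "X \<in> Ob C \<Longrightarrow> Y \<in> Ob C \<Longrightarrow> Z \<in> Ob C \<Longrightarrow>
        Assoc C X Y Z \<in> Hom C ((X \<boxtimes> Y) \<boxtimes> Z) (X \<boxtimes> (Y \<boxtimes> Z)) \<and> is_iso C (Assoc C X Y Z)"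
    and assoc_nat: "f \<in> Hom C X X' \<Longrightarrow> g \<in> Hom C Y Y' \<Longrightarrow> h \<in> Hom C Z Z' \<Longrightarrow>
        Assoc C X' Y' Z' \<bullet> ((f \<star> g) \<star> h) = (f \<star> (g \<star> h)) \<bullet> Assoc C X Y Z"
    and lunit_hom: "X \<in> Ob C \<Longrightarrow> LUnit C X \<in> Hom C (\<one>\<^sub>\<otimes> \<boxtimes> X) X \<and> is_iso C (LUnit C X)"
    and lunit_nat: "f \<in> Hom C X X' \<Longrightarrow> LUnit C X' \<bullet> (Id C \<one>\<^sub>\<otimes> \<star> f) = f \<bullet> LUnit C X"
    and runit_hom: "X \<in> Ob C \<Longrightarrow> RUnit C X \<in> Hom C (X \<boxtimes> \<one>\<^sub>\<otimes>) X \<and> is_iso C (RUnit C X)"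
    and runit_nat: "f \<in> Hom C X X' \<Longrightarrow> RUnit C X' \<bullet> (f \<star> Id C \<one>\<^sub>\<otimes>) = f \<bullet> RUnit C X"
    and pentagon: "W \<in> Ob C \<Longrightarrow> X \<in> Ob C \<Longrightarrow> Y \<in> Ob C \<Longrightarrow> Z \<in> Ob C \<Longrightarrow>
        (Id C W \<star> Assoc C X Y Z) \<bullet> Assoc C W (X \<boxtimes> Y) Z \<bullet> (Assoc C W X Y \<star> Id C Z) =
        Assoc C W X (Y \<boxtimes> Z) \<bullet> Assoc C (W \<boxtimes> X) Y Z"
    and triangle: "X \<in> Ob C \<Longrightarrow> Y \<in> Ob C \<Longrightarrow>
        (Id C X \<star> LUnit C Y) \<bullet> Assoc C X \<one>\<^sub>\<otimes> Y = RUnit C X \<star> Id C Y"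

text \<open>\<open>Y\<close> is a left dual of \<open>X\<close> with evaluation \<open>Y \<boxtimes> X \<rightarrow> 1\<close> and coevaluation \<open>1 \<rightarrow> X \<boxtimes> Y\<close>;
  equivalently \<open>X\<close> is a right dual of \<open>Y\<close>.\<close>

definition is_left_dual :: "('o, 'm, 'k, 'x) moncat_scheme \<Rightarrow> 'o \<Rightarrow> 'o \<Rightarrow> bool" where
  "is_left_dual C X Y \<longleftrightarrow> X \<in> Ob C \<and> Y \<in> Ob C \<and>
     (\<exists>ev \<in> Hom C (Y \<boxtimes>\<^bsub>C\<^esub> X) \<one>\<^sub>\<otimes>\<^bsub>C\<^esub>. \<exists>coev \<in> Hom C \<one>\<^sub>\<otimes>\<^bsub>C\<^esub> (X \<boxtimes>\<^bsub>C\<^esub> Y).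
        RUnit C X \<bullet>\<^bsub>C\<^esub> (Id C X \<star>\<^bsub>C\<^esub> ev) \<bullet>\<^bsub>C\<^esub> Assoc C X Y X \<bullet>\<^bsub>C\<^esub> (coev \<star>\<^bsub>C\<^esub> Id C X) = LUnit C X \<and>
        LUnit C Y \<bullet>\<^bsub>C\<^esub> (ev \<star>\<^bsub>C\<^esub> Id C Y) \<bullet>\<^bsub>C\<^esub> inv_mor C (Assoc C Y X Y) \<bullet>\<^bsub>C\<^esub> (Id C Y \<star>\<^bsub>C\<^esub> coev)
          = RUnit C Y)"

locale tensor_category = abelian_category C + monoidal_category C
  for C :: "('o, 'm, 'k::field, 'x) moncat_scheme" (structure) +
  assumes tens_add_left: "f \<in> Hom C X X' \<Longrightarrow> f' \<in> Hom C X X' \<Longrightarrow> g \<in> Hom C Y Y' \<Longrightarrow>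
        Add C f f' \<star> g = Add C (f \<star> g) (f' \<star> g)"
    and tens_add_right: "f \<in> Hom C X X' \<Longrightarrow> g \<in> Hom C Y Y' \<Longrightarrow> g' \<in> Hom C Y Y' \<Longrightarrow>
        f \<star> Add C g g' = Add C (f \<star> g) (f \<star> g')"
    and tens_scale_left: "f \<in> Hom C X X' \<Longrightarrow> g \<in> Hom C Y Y' \<Longrightarrow>
        Scale C c f \<star> g = Scale C c (f \<star> g)"
    and tens_scale_right: "f \<in> Hom C X X' \<Longrightarrow> g \<in> Hom C Y Y' \<Longrightarrow>
        f \<star> Scale C c g = Scale C c (f \<star> g)"
    and rigid: "X \<in> Ob C \<Longrightarrow> (\<exists>Y. is_left_dual C X Y) \<and> (\<exists>Y. is_left_dual C Y X)"
    and hom_finite_dim: "X \<in> Ob C \<Longrightarrow> Y \<in> Ob C \<Longrightarrow>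
        \<exists>B. finite B \<and> B \<subseteq> Hom C X Y \<and>
          (\<forall>f \<in> Hom C X Y. \<exists>c :: 'm \<Rightarrow> 'k. f = hsum C X Y (\<lambda>b. Scale C (c b) b) B)"
    and ob_finite_length: "X \<in> Ob C \<Longrightarrow> finite_length C X"
    and unit_simple: "simple_object C \<one>\<^sub>\<otimes>"
    and unit_end: "bij_betw (\<lambda>c. Scale C c (Id C \<one>\<^sub>\<otimes>)) UNIV (Hom C \<one>\<^sub>\<otimes> \<one>\<^sub>\<otimes>)"

locale semisimple_tensor_category = tensor_category C
  for C :: "('o, 'm, 'k::field, 'x) moncat_scheme" (structure) +
  assumes semisimple: "X \<in> Ob C \<Longrightarrow> \<exists>(n::nat) S \<iota> \<pi>.
        (\<forall>i<n. simple_object C (S i)) \<and> is_biprod C {..<n} S X \<iota> \<pi>"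


section \<open>Functors\<close>

record ('o, 'm, 'p, 'n) fctr =
  FO :: "'o \<Rightarrow> 'p"
  FM :: "'m \<Rightarrow> 'n"

definition is_functor ::
  "('o, 'm, 'x) cat_scheme \<Rightarrow> ('p, 'n, 'y) cat_scheme \<Rightarrow> ('o, 'm, 'p, 'n, 'z) fctr_scheme \<Rightarrow> bool" where
  "is_functor C D F \<longleftrightarrow>
     (\<forall>X \<in> Ob C. FO F X \<in> Ob D \<and> FM F (Id C X) = Id D (FO F X)) \<and>
     (\<forall>X Y. \<forall>f \<in> Hom C X Y. FM F f \<in> Hom D (FO F X) (FO F Y)) \<and>
     (\<forall>X Y Z. \<forall>f \<in> Hom C X Y. \<forall>g \<in> Hom C Y Z. FM F (g \<bullet>\<^bsub>C\<^esub> f) = FM F g \<bullet>\<^bsub>D\<^esub> FM F f)"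

definition linear_functor :: "('o, 'm, 'k, 'x) lincat_scheme \<Rightarrow> ('p, 'n, 'k, 'y) lincat_scheme \<Rightarrow>
    ('o, 'm, 'p, 'n, 'z) fctr_scheme \<Rightarrow> bool" where
  "linear_functor C D F \<longleftrightarrow> is_functor C D F \<and>
     (\<forall>X Y. \<forall>f \<in> Hom C X Y. \<forall>g \<in> Hom C X Y. FM F (Add C f g) = Add D (FM F f) (FM F g)) \<and>
     (\<forall>c. \<forall>f \<in> Mor C. FM F (Scale C c f) = Scale D c (FM F f))"

definition id_functor :: "('o, 'm, 'o, 'm) fctr" where
  "id_functor = \<lparr>FO = (\<lambda>X. X), FM = (\<lambda>f. f)\<rparr>"

definition cmp_functor ::
  "('p, 'n, 'q, 'l, 'y) fctr_scheme \<Rightarrow> ('o, 'm, 'p, 'n, 'z) fctr_scheme \<Rightarrow> ('o, 'm, 'q, 'l) fctr"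
  (infixr \<open>\<circ>\<^sub>F\<close> 70) where
  "G \<circ>\<^sub>F F = \<lparr>FO = (\<lambda>X. FO G (FO F X)), FM = (\<lambda>f. FM G (FM F f))\<rparr>"

definition natural_iso :: "('o, 'm, 'x) cat_scheme \<Rightarrow> ('p, 'n, 'y) cat_scheme \<Rightarrow>
    ('o, 'm, 'p, 'n, 'z) fctr_scheme \<Rightarrow> ('o, 'm, 'p, 'n, 'w) fctr_scheme \<Rightarrow> ('o \<Rightarrow> 'n) \<Rightarrow> bool" where
  "natural_iso C D F G \<phi> \<longleftrightarrow>
     (\<forall>X \<in> Ob C. \<phi> X \<in> Hom D (FO F X) (FO G X) \<and> is_iso D (\<phi> X)) \<and>
     (\<forall>X Y. \<forall>f \<in> Hom C X Y. \<phi> Y \<bullet>\<^bsub>D\<^esub> FM F f = FM G f \<bullet>\<^bsub>D\<^esub> \<phi> X)"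

definition equivalence ::
  "('o, 'm, 'x) cat_scheme \<Rightarrow> ('p, 'n, 'y) cat_scheme \<Rightarrow> ('o, 'm, 'p, 'n, 'z) fctr_scheme \<Rightarrow> bool" where
  "equivalence C D F \<longleftrightarrow> is_functor C D F \<and>
     (\<exists>(G :: ('p, 'n, 'o, 'm) fctr) \<eta> \<epsilon>. is_functor D C G \<and>
        natural_iso C C id_functor (G \<circ>\<^sub>F F) \<eta> \<and> natural_iso D D (F \<circ>\<^sub>F G) id_functor \<epsilon>)"


section \<open>Quotients and localizations\<close>

text \<open>Quotient by a congruence \<open>R\<close> relating only parallel morphisms; the new morphisms are the
  \<open>R\<close>-classes.\<close>

definition quot_cat ::
  "('o, 'm, 'k, 'x) moncat_scheme \<Rightarrow> ('m \<times> 'm) set \<Rightarrow> ('o, 'm set, 'k) moncat" where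
  "quot_cat C R = \<lparr>
     Ob = Ob C, Mor = Mor C // R,
     Dom = (\<lambda>a. the_elem (Dom C ` a)), Cod = (\<lambda>a. the_elem (Cod C ` a)),
     Id = (\<lambda>X. R `` {Id C X}),
     Cmp = (\<lambda>b a. \<Union>g\<in>b. \<Union>f\<in>a. R `` {g \<bullet>\<^bsub>C\<^esub> f}),
     Zero = (\<lambda>X Y. R `` {Zero C X Y}),
     Add = (\<lambda>a b. \<Union>f\<in>a. \<Union>g\<in>b. R `` {Add C f g}),
     Scale = (\<lambda>c a. \<Union>f\<in>a. R `` {Scale C c f}),
     Unit = \<one>\<^sub>\<otimes>\<^bsub>C\<^esub>, TensO = TensO C,
     TensM = (\<lambda>a b. \<Union>f\<in>a. \<Union>g\<in>b. R `` {f \<star>\<^bsub>C\<^esub> g}),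
     Assoc = (\<lambda>X Y Z. R `` {Assoc C X Y Z}),
     LUnit = (\<lambda>X. R `` {LUnit C X}),
     RUnit = (\<lambda>X. R `` {RUnit C X})\<rparr>"

definition quot_lift ::
  "('n \<times> 'n) set \<Rightarrow> ('o, 'm, 'p, 'n) fctr \<Rightarrow> ('o, 'm set, 'p, 'n set) fctr" where
  "quot_lift R F = \<lparr>FO = FO F, FM = (\<lambda>a. \<Union>f\<in>a. R `` {FM F f})\<rparr>"

text \<open>Localization at a class \<open>W\<close> admitting a calculus of fractions.  A roof \<open>(s, f)\<close> with
  \<open>s : M \<rightarrow> X\<close> in \<open>W\<close> and \<open>f : M \<rightarrow> Y\<close> represents \<open>f s\<^sup>-\<^sup>1 : X \<rightarrow> Y\<close>.  Composition goes through any completion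
  of two roofs by an Ore square, addition through any representatives with a common denominator.\<close>

definition roofs :: "('o, 'm, 'x) cat_scheme \<Rightarrow> 'm set \<Rightarrow> ('m \<times> 'm) set" where
  "roofs C W = {(s, f). s \<in> W \<and> f \<in> Mor C \<and> Dom C s = Dom C f}"

definition roof_eq ::
  "('o, 'm, 'x) cat_scheme \<Rightarrow> 'm set \<Rightarrow> (('m \<times> 'm) \<times> ('m \<times> 'm)) set" where
  "roof_eq C W = {((s, f), (s', f')). (s, f) \<in> roofs C W \<and> (s', f') \<in> roofs C W \<and>
     Cod C s = Cod C s' \<and> Cod C f = Cod C f' \<and>
     (\<exists>M u u'. u \<in> Hom C M (Dom C s) \<and> u' \<in> Hom C M (Dom C s') \<and>
        s \<bullet>\<^bsub>C\<^esub> u = s' \<bullet>\<^bsub>C\<^esub> u' \<and> f \<bullet>\<^bsub>C\<^esub> u = f' \<bullet>\<^bsub>C\<^esub> u' \<and> s \<bullet>\<^bsub>C\<^esub> u \<in> W)}"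

definition frac ::
  "('o, 'm, 'x) cat_scheme \<Rightarrow> 'm set \<Rightarrow> 'm \<Rightarrow> 'm \<Rightarrow> ('m \<times> 'm) set" where
  "frac C W s f = roof_eq C W `` {(s, f)}"

definition loc_mor :: "('o, 'm, 'x) cat_scheme \<Rightarrow> 'm set \<Rightarrow> 'm \<Rightarrow> ('m \<times> 'm) set" where
  "loc_mor C W f = frac C W (Id C (Dom C f)) f"

definition loc_cat ::
  "('o, 'm, 'k, 'x) moncat_scheme \<Rightarrow> 'm set \<Rightarrow> ('o, ('m \<times> 'm) set, 'k) moncat" where
  "loc_cat C W = \<lparr>
     Ob = Ob C, Mor = roofs C W // roof_eq C W,
     Dom = (\<lambda>a. the_elem ((\<lambda>(s, f). Cod C s) ` a)),
     Cod = (\<lambda>a. the_elem ((\<lambda>(s, f). Cod C f) ` a)),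
     Id = (\<lambda>X. loc_mor C W (Id C X)),
     Cmp = (\<lambda>b a. \<Union> {frac C W (s \<bullet>\<^bsub>C\<^esub> u) (g \<bullet>\<^bsub>C\<^esub> v) | s f t g u v.
        (s, f) \<in> a \<and> (t, g) \<in> b \<and> u \<in> W \<and> v \<in> Mor C \<and> Dom C u = Dom C v \<and>
        Cod C u = Dom C s \<and> Cod C v = Dom C t \<and> f \<bullet>\<^bsub>C\<^esub> u = t \<bullet>\<^bsub>C\<^esub> v}),
     Zero = (\<lambda>X Y. loc_mor C W (Zero C X Y)),
     Add = (\<lambda>a b. \<Union> {frac C W s (Add C f g) | s f g. (s, f) \<in> a \<and> (s, g) \<in> b}),
     Scale = (\<lambda>c a. \<Union> {frac C W s (Scale C c f) | s f. (s, f) \<in> a}),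
     Unit = \<one>\<^sub>\<otimes>\<^bsub>C\<^esub>, TensO = TensO C,
     TensM = (\<lambda>a b. \<Union> {frac C W (s \<star>\<^bsub>C\<^esub> t) (f \<star>\<^bsub>C\<^esub> g) | s f t g. (s, f) \<in> a \<and> (t, g) \<in> b}),
     Assoc = (\<lambda>X Y Z. loc_mor C W (Assoc C X Y Z)),
     LUnit = (\<lambda>X. loc_mor C W (LUnit C X)),
     RUnit = (\<lambda>X. loc_mor C W (RUnit C X))\<rparr>"

definition loc_lift :: "('p, 'n, 'x) cat_scheme \<Rightarrow> 'n set \<Rightarrow> ('o, 'm, 'p, 'n) fctr \<Rightarrow>
    ('o, ('m \<times> 'm) set, 'p, ('n \<times> 'n) set) fctr" where
  "loc_lift D W F = \<lparr>FO = FO F, FM = (\<lambda>a. \<Union>(s, f)\<in>a. frac D W (FM F s) (FM F f))\<rparr>"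


section \<open>Bounded complexes\<close>

record ('o, 'm) cpx =
  cO :: "int \<Rightarrow> 'o"
  cD :: "int \<Rightarrow> 'm"

record ('o, 'm) cmap =
  src :: "('o, 'm) cpx"
  tgt :: "('o, 'm) cpx"
  cm :: "int \<Rightarrow> 'm"

definition bounded_complexes :: "('o, 'm, 'k, 'x) lincat_scheme \<Rightarrow> ('o, 'm) cpx set" where
  "bounded_complexes C = {K.
     (\<forall>i. cO K i \<in> Ob C \<and> cD K i \<in> Hom C (cO K i) (cO K (i + 1)) \<and>
          cD K (i + 1) \<bullet>\<^bsub>C\<^esub> cD K i = Zero C (cO K i) (cO K (i + 1 + 1))) \<and>
     (\<exists>N. \<forall>i. \<bar>i\<bar> > N \<longrightarrow> zero_object C (cO K i))}"

definition chain_maps :: "('o, 'm, 'k, 'x) lincat_scheme \<Rightarrow> ('o, 'm) cmap set" where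
  "chain_maps C = {f. src f \<in> bounded_complexes C \<and> tgt f \<in> bounded_complexes C \<and>
     (\<forall>i. cm f i \<in> Hom C (cO (src f) i) (cO (tgt f) i) \<and>
          cD (tgt f) i \<bullet>\<^bsub>C\<^esub> cm f i = cm f (i + 1) \<bullet>\<^bsub>C\<^esub> cD (src f) i)}"

definition alt_sign :: "int \<Rightarrow> 'k::field" where
  "alt_sign i = (if even i then 1 else - 1)"

definition conc :: "('o, 'm, 'k, 'x) lincat_scheme \<Rightarrow> 'o \<Rightarrow> ('o, 'm) cpx" where
  "conc C X = (let K = (\<lambda>i. if i = 0 then X else zobj C)
     in \<lparr>cO = K, cD = (\<lambda>i. Zero C (K i) (K (i + 1)))\<rparr>)"

text \<open>Total tensor product of complexes: \<open>(K \<otimes> L)\<^sup>n\<close> is the biproduct of the \<open>K\<^sup>i \<otimes> L\<^sup>n\<^sup>-\<^sup>i\<close> over the finitely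
  many \<open>i\<close> for which both factors are nonzero; the differential is
  \<open>d \<otimes> 1 + (-1)\<^sup>i 1 \<otimes> d\<close> on \<open>K\<^sup>i \<otimes> L\<^sup>j\<close>.\<close>

definition tot_idx ::
  "('o, 'm, 'k, 'x) moncat_scheme \<Rightarrow> ('o, 'm) cpx \<Rightarrow> ('o, 'm) cpx \<Rightarrow> int \<Rightarrow> int set" where
  "tot_idx C K L n = {i. \<not> zero_object C (cO K i) \<and> \<not> zero_object C (cO L (n - i))}"

definition tot_fam ::
  "('o, 'm, 'k, 'x) moncat_scheme \<Rightarrow> ('o, 'm) cpx \<Rightarrow> ('o, 'm) cpx \<Rightarrow> int \<Rightarrow> int \<Rightarrow> 'o" where
  "tot_fam C K L n i = cO K i \<boxtimes>\<^bsub>C\<^esub> cO L (n - i)"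

definition tot_ob ::
  "('o, 'm, 'k, 'x) moncat_scheme \<Rightarrow> ('o, 'm) cpx \<Rightarrow> ('o, 'm) cpx \<Rightarrow> int \<Rightarrow> 'o" where
  "tot_ob C K L n = bp_ob C (tot_idx C K L n) (tot_fam C K L n)"

definition tot_in ::
  "('o, 'm, 'k, 'x) moncat_scheme \<Rightarrow> ('o, 'm) cpx \<Rightarrow> ('o, 'm) cpx \<Rightarrow> int \<Rightarrow> int \<Rightarrow> 'm" where
  "tot_in C K L i j = bp_in C (tot_idx C K L (i + j)) (tot_fam C K L (i + j)) i"

definition tot_pr ::
  "('o, 'm, 'k, 'x) moncat_scheme \<Rightarrow> ('o, 'm) cpx \<Rightarrow> ('o, 'm) cpx \<Rightarrow> int \<Rightarrow> int \<Rightarrow> 'm" where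
  "tot_pr C K L i j = bp_pr C (tot_idx C K L (i + j)) (tot_fam C K L (i + j)) i"

definition tot_diff ::
  "('o, 'm, 'k::field, 'x) moncat_scheme \<Rightarrow> ('o, 'm) cpx \<Rightarrow> ('o, 'm) cpx \<Rightarrow> int \<Rightarrow> 'm" where
  "tot_diff C K L n = hsum C (tot_ob C K L n) (tot_ob C K L (n + 1))
     (\<lambda>i. Add C
        (tot_in C K L (i + 1) (n - i) \<bullet>\<^bsub>C\<^esub> (cD K i \<star>\<^bsub>C\<^esub> Id C (cO L (n - i))) \<bullet>\<^bsub>C\<^esub> tot_pr C K L i (n - i))
        (Scale C (alt_sign i)
          (tot_in C K L i (n - i + 1) \<bullet>\<^bsub>C\<^esub> (Id C (cO K i) \<star>\<^bsub>C\<^esub> cD L (n - i)) \<bullet>\<^bsub>C\<^esub> tot_pr C K L i (n - i))))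
     (tot_idx C K L n)"

definition tot_cpx ::
  "('o, 'm, 'k::field, 'x) moncat_scheme \<Rightarrow> ('o, 'm) cpx \<Rightarrow> ('o, 'm) cpx \<Rightarrow> ('o, 'm) cpx" where
  "tot_cpx C K L = \<lparr>cO = tot_ob C K L, cD = tot_diff C K L\<rparr>"

definition tot_map ::
  "('o, 'm, 'k::field, 'x) moncat_scheme \<Rightarrow> ('o, 'm) cmap \<Rightarrow> ('o, 'm) cmap \<Rightarrow> ('o, 'm) cmap" where
  "tot_map C f g = \<lparr>src = tot_cpx C (src f) (src g), tgt = tot_cpx C (tgt f) (tgt g),
     cm = (\<lambda>n. hsum C (tot_ob C (src f) (src g) n) (tot_ob C (tgt f) (tgt g) n)
       (\<lambda>i. tot_in C (tgt f) (tgt g) i (n - i) \<bullet>\<^bsub>C\<^esub> (cm f i \<star>\<^bsub>C\<^esub> cm g (n - i)) \<bullet>\<^bsub>C\<^esub>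
            tot_pr C (src f) (src g) i (n - i))
       (tot_idx C (src f) (src g) n))\<rparr>"

definition tot_assoc :: "('o, 'm, 'k::field, 'x) moncat_scheme \<Rightarrow>
    ('o, 'm) cpx \<Rightarrow> ('o, 'm) cpx \<Rightarrow> ('o, 'm) cpx \<Rightarrow> ('o, 'm) cmap" where
  "tot_assoc C K L M = (let KL = tot_cpx C K L; LM = tot_cpx C L M in
     \<lparr>src = tot_cpx C KL M, tgt = tot_cpx C K LM,
      cm = (\<lambda>n. hsum C (tot_ob C KL M n) (tot_ob C K LM n)
        (\<lambda>(i, j). let l = n - (i + j) in
           tot_in C K LM i (j + l) \<bullet>\<^bsub>C\<^esub> (Id C (cO K i) \<star>\<^bsub>C\<^esub> tot_in C L M j l) \<bullet>\<^bsub>C\<^esub>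
           Assoc C (cO K i) (cO L j) (cO M l) \<bullet>\<^bsub>C\<^esub>
           (tot_pr C K L i j \<star>\<^bsub>C\<^esub> Id C (cO M l)) \<bullet>\<^bsub>C\<^esub> tot_pr C KL M (i + j) l)
        {(i, j). \<not> zero_object C (cO K i) \<and> \<not> zero_object C (cO L j) \<and>
                 \<not> zero_object C (cO M (n - (i + j)))})\<rparr>)"

definition tot_lunit ::
  "('o, 'm, 'k::field, 'x) moncat_scheme \<Rightarrow> ('o, 'm) cpx \<Rightarrow> ('o, 'm) cmap" where
  "tot_lunit C K = (let E = conc C \<one>\<^sub>\<otimes>\<^bsub>C\<^esub> in
     \<lparr>src = tot_cpx C E K, tgt = K, cm = (\<lambda>n. LUnit C (cO K n) \<bullet>\<^bsub>C\<^esub> tot_pr C E K 0 n)\<rparr>)"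

definition tot_runit ::
  "('o, 'm, 'k::field, 'x) moncat_scheme \<Rightarrow> ('o, 'm) cpx \<Rightarrow> ('o, 'm) cmap" where
  "tot_runit C K = (let E = conc C \<one>\<^sub>\<otimes>\<^bsub>C\<^esub> in
     \<lparr>src = tot_cpx C K E, tgt = K, cm = (\<lambda>n. RUnit C (cO K n) \<bullet>\<^bsub>C\<^esub> tot_pr C K E n 0)\<rparr>)"

definition Cb :: "('o, 'm, 'k::field, 'x) moncat_scheme \<Rightarrow> (('o, 'm) cpx, ('o, 'm) cmap, 'k) moncat" where
  "Cb C = \<lparr>
     Ob = bounded_complexes C, Mor = chain_maps C, Dom = src, Cod = tgt,
     Id = (\<lambda>K. \<lparr>src = K, tgt = K, cm = (\<lambda>i. Id C (cO K i))\<rparr>),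
     Cmp = (\<lambda>g f. \<lparr>src = src f, tgt = tgt g, cm = (\<lambda>i. cm g i \<bullet>\<^bsub>C\<^esub> cm f i)\<rparr>),
     Zero = (\<lambda>K L. \<lparr>src = K, tgt = L, cm = (\<lambda>i. Zero C (cO K i) (cO L i))\<rparr>),
     Add = (\<lambda>f g. \<lparr>src = src f, tgt = tgt f, cm = (\<lambda>i. Add C (cm f i) (cm g i))\<rparr>),
     Scale = (\<lambda>c f. \<lparr>src = src f, tgt = tgt f, cm = (\<lambda>i. Scale C c (cm f i))\<rparr>),
     Unit = conc C \<one>\<^sub>\<otimes>\<^bsub>C\<^esub>, TensO = tot_cpx C, TensM = tot_map C,
     Assoc = tot_assoc C, LUnit = tot_lunit C, RUnit = tot_runit C\<rparr>"

definition homotopy :: "('o, 'm, 'k::field, 'x) moncat_scheme \<Rightarrow> (('o, 'm) cmap \<times> ('o, 'm) cmap) set" where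
  "homotopy C = {(f, g). f \<in> chain_maps C \<and> g \<in> chain_maps C \<and> src f = src g \<and> tgt f = tgt g \<and>
     (\<exists>h. \<forall>i. h i \<in> Hom C (cO (src f) i) (cO (tgt f) (i - 1)) \<and>
        cm f i = Add C (cm g i)
          (Add C (cD (tgt f) (i - 1) \<bullet>\<^bsub>C\<^esub> h i) (h (i + 1) \<bullet>\<^bsub>C\<^esub> cD (src f) i)))}"

definition Kb ::
  "('o, 'm, 'k::field, 'x) moncat_scheme \<Rightarrow> (('o, 'm) cpx, ('o, 'm) cmap set, 'k) moncat" where
  "Kb C = quot_cat (Cb C) (homotopy C)"


section \<open>Cohomology and quasi-isomorphisms\<close>

text \<open>\<open>H\<^sup>i(K)\<close> is the cokernel of the map \<open>K\<^sup>i\<^sup>-\<^sup>1 \<rightarrow> Ker d\<^sup>i\<close> induced by \<open>d\<^sup>i\<^sup>-\<^sup>1\<close>.\<close>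

definition cycles :: "('o, 'm, 'k, 'x) lincat_scheme \<Rightarrow> ('o, 'm) cpx \<Rightarrow> int \<Rightarrow> 'm" where
  "cycles C K i = (SOME z. is_kernel C (cD K i) z)"

definition boundary :: "('o, 'm, 'k, 'x) lincat_scheme \<Rightarrow> ('o, 'm) cpx \<Rightarrow> int \<Rightarrow> 'm" where
  "boundary C K i = (THE b. b \<in> Hom C (cO K (i - 1)) (Dom C (cycles C K i)) \<and>
     cycles C K i \<bullet>\<^bsub>C\<^esub> b = cD K (i - 1))"

definition cohom_pr :: "('o, 'm, 'k, 'x) lincat_scheme \<Rightarrow> ('o, 'm) cpx \<Rightarrow> int \<Rightarrow> 'm" where
  "cohom_pr C K i = (SOME q. is_cokernel C (boundary C K i) q)"

definition cohom :: "('o, 'm, 'k, 'x) lincat_scheme \<Rightarrow> ('o, 'm) cpx \<Rightarrow> int \<Rightarrow> 'o" where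
  "cohom C K i = Cod C (cohom_pr C K i)"

definition cohom_map :: "('o, 'm, 'k, 'x) lincat_scheme \<Rightarrow> ('o, 'm) cmap \<Rightarrow> int \<Rightarrow> 'm" where
  "cohom_map C f i = (THE h. h \<in> Hom C (cohom C (src f) i) (cohom C (tgt f) i) \<and>
     (\<exists>z \<in> Hom C (Dom C (cycles C (src f) i)) (Dom C (cycles C (tgt f) i)).
        cycles C (tgt f) i \<bullet>\<^bsub>C\<^esub> z = cm f i \<bullet>\<^bsub>C\<^esub> cycles C (src f) i \<and>
        h \<bullet>\<^bsub>C\<^esub> cohom_pr C (src f) i = cohom_pr C (tgt f) i \<bullet>\<^bsub>C\<^esub> z))"

definition quasi_iso :: "('o, 'm, 'k, 'x) lincat_scheme \<Rightarrow> ('o, 'm) cmap \<Rightarrow> bool" where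
  "quasi_iso C f \<longleftrightarrow> f \<in> chain_maps C \<and> (\<forall>i. is_iso C (cohom_map C f i))"

definition qis :: "('o, 'm, 'k::field, 'x) moncat_scheme \<Rightarrow> ('o, 'm) cmap set set" where
  "qis C = {a \<in> Mor (Kb C). \<exists>f \<in> a. quasi_iso C f}"


section \<open>The bounded derived category\<close>

type_synonym ('o, 'm) dmor = "(('o, 'm) cmap set \<times> ('o, 'm) cmap set) set"

definition to_Db :: "('o, 'm, 'k::field, 'x) moncat_scheme \<Rightarrow> ('o, 'm) cmap \<Rightarrow> ('o, 'm) dmor" where
  "to_Db C f = loc_mor (Kb C) (qis C) (homotopy C `` {f})"

text \<open>The functor induced on derived categories by a functor on complexes that preserves homotopies
  and quasi-isomorphisms.\<close>

definition Db_lift :: "('p, 'n, 'k::field, 'x) moncat_scheme \<Rightarrow>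
    (('o, 'm) cpx, ('o, 'm) cmap, ('p, 'n) cpx, ('p, 'n) cmap) fctr \<Rightarrow>
    (('o, 'm) cpx, ('o, 'm) dmor, ('p, 'n) cpx, ('p, 'n) dmor) fctr" where
  "Db_lift D F = loc_lift (Kb D) (qis D) (quot_lift (homotopy D) F)"

text \<open>\<open>K[a]\<^sup>i = K\<^sup>i\<^sup>+\<^sup>a\<close> with differential \<open>(-1)\<^sup>a d\<close>.\<close>

definition shift_cpx ::
  "('o, 'm, 'k::field, 'x) lincat_scheme \<Rightarrow> int \<Rightarrow> ('o, 'm) cpx \<Rightarrow> ('o, 'm) cpx" where
  "shift_cpx C a K = \<lparr>cO = (\<lambda>i. cO K (i + a)), cD = (\<lambda>i. Scale C (alt_sign a) (cD K (i + a)))\<rparr>"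

definition shift_map ::
  "('o, 'm, 'k::field, 'x) lincat_scheme \<Rightarrow> int \<Rightarrow> ('o, 'm) cmap \<Rightarrow> ('o, 'm) cmap" where
  "shift_map C a f = \<lparr>src = shift_cpx C a (src f), tgt = shift_cpx C a (tgt f),
     cm = (\<lambda>i. cm f (i + a))\<rparr>"

text \<open>The cone of \<open>f : K \<rightarrow> L\<close> is \<open>K\<^sup>n\<^sup>+\<^sup>1 \<oplus> L\<^sup>n\<close> with differential \<open>(k, l) \<mapsto> (-d k, f k + d l)\<close>; the index
  \<open>True\<close> belongs to the summand from \<open>K\<close>.\<close>

definition cone_fam :: "('o, 'm) cmap \<Rightarrow> int \<Rightarrow> bool \<Rightarrow> 'o" where
  "cone_fam f n b = (if b then cO (src f) (n + 1) else cO (tgt f) n)"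

definition cone_ob :: "('o, 'm, 'k, 'x) lincat_scheme \<Rightarrow> ('o, 'm) cmap \<Rightarrow> int \<Rightarrow> 'o" where
  "cone_ob C f n = bp_ob C UNIV (cone_fam f n)"

definition cone_in :: "('o, 'm, 'k, 'x) lincat_scheme \<Rightarrow> ('o, 'm) cmap \<Rightarrow> int \<Rightarrow> bool \<Rightarrow> 'm" where
  "cone_in C f n = bp_in C UNIV (cone_fam f n)"

definition cone_pr :: "('o, 'm, 'k, 'x) lincat_scheme \<Rightarrow> ('o, 'm) cmap \<Rightarrow> int \<Rightarrow> bool \<Rightarrow> 'm" where
  "cone_pr C f n = bp_pr C UNIV (cone_fam f n)"

definition cone :: "('o, 'm, 'k::field, 'x) lincat_scheme \<Rightarrow> ('o, 'm) cmap \<Rightarrow> ('o, 'm) cpx" where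
  "cone C f = \<lparr>cO = cone_ob C f,
     cD = (\<lambda>n. Add C
       (Add C
         (Scale C (- 1)
           (cone_in C f (n + 1) True \<bullet>\<^bsub>C\<^esub> cD (src f) (n + 1) \<bullet>\<^bsub>C\<^esub> cone_pr C f n True))
         (cone_in C f (n + 1) False \<bullet>\<^bsub>C\<^esub> cm f (n + 1) \<bullet>\<^bsub>C\<^esub> cone_pr C f n True))
       (cone_in C f (n + 1) False \<bullet>\<^bsub>C\<^esub> cD (tgt f) n \<bullet>\<^bsub>C\<^esub> cone_pr C f n False))\<rparr>"

definition to_cone :: "('o, 'm, 'k::field, 'x) lincat_scheme \<Rightarrow> ('o, 'm) cmap \<Rightarrow> ('o, 'm) cmap" where
  "to_cone C f = \<lparr>src = tgt f, tgt = cone C f, cm = (\<lambda>n. cone_in C f n False)\<rparr>"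

definition from_cone :: "('o, 'm, 'k::field, 'x) lincat_scheme \<Rightarrow> ('o, 'm) cmap \<Rightarrow> ('o, 'm) cmap" where
  "from_cone C f = \<lparr>src = cone C f, tgt = shift_cpx C 1 (src f), cm = (\<lambda>n. cone_pr C f n True)\<rparr>"

record ('o, 'm, 'k) ttcat = "('o, 'm, 'k) moncat" +
  Sh :: "('o, 'm, 'o, 'm) fctr"
  Tri :: "('m \<times> 'm \<times> 'm) set"

definition Db_cat ::
  "('o, 'm, 'k::field, 'x) moncat_scheme \<Rightarrow> (('o, 'm) cpx, ('o, 'm) dmor, 'k) moncat" where
  "Db_cat C = loc_cat (Kb C) (qis C)"

definition Db_shift :: "('o, 'm, 'k::field, 'x) moncat_scheme \<Rightarrow>
    (('o, 'm) cpx, ('o, 'm) dmor, ('o, 'm) cpx, ('o, 'm) dmor) fctr" where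
  "Db_shift C = Db_lift C \<lparr>FO = shift_cpx C 1, FM = shift_map C 1\<rparr>"

text \<open>Distinguished triangles: those isomorphic to
  \<open>K \<rightarrow> L \<rightarrow> cone f \<rightarrow> K[1]\<close> for some chain map \<open>f : K \<rightarrow> L\<close>.\<close>

definition Db_triangles ::
  "('o, 'm, 'k::field, 'x) moncat_scheme \<Rightarrow> (('o, 'm) dmor \<times> ('o, 'm) dmor \<times> ('o, 'm) dmor) set" where
  "Db_triangles C = {(u, v, w). \<exists>X Y Z.
     u \<in> Hom (Db_cat C) X Y \<and> v \<in> Hom (Db_cat C) Y Z \<and>
     w \<in> Hom (Db_cat C) Z (FO (Db_shift C) X) \<and>
     (\<exists>f \<in> chain_maps C. \<exists>a \<in> Hom (Db_cat C) X (src f). \<exists>b \<in> Hom (Db_cat C) Y (tgt f).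
      \<exists>c \<in> Hom (Db_cat C) Z (cone C f).
        is_iso (Db_cat C) a \<and> is_iso (Db_cat C) b \<and> is_iso (Db_cat C) c \<and>
        b \<bullet>\<^bsub>Db_cat C\<^esub> u = to_Db C f \<bullet>\<^bsub>Db_cat C\<^esub> a \<and>
        c \<bullet>\<^bsub>Db_cat C\<^esub> v = to_Db C (to_cone C f) \<bullet>\<^bsub>Db_cat C\<^esub> b \<and>
        FM (Db_shift C) a \<bullet>\<^bsub>Db_cat C\<^esub> w = to_Db C (from_cone C f) \<bullet>\<^bsub>Db_cat C\<^esub> c)}"

definition Db ::
  "('o, 'm, 'k::field, 'x) moncat_scheme \<Rightarrow> (('o, 'm) cpx, ('o, 'm) dmor, 'k) ttcat" where
  "Db C = moncat.extend (Db_cat C) (ttcat.fields (Db_shift C) (Db_triangles C))"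

definition Db_le0 :: "('o, 'm, 'k::field, 'x) moncat_scheme \<Rightarrow> ('o, 'm) cpx set" where
  "Db_le0 C = {K \<in> Ob (Db C). \<forall>i>0. zero_object C (cohom C K i)}"

definition Db_ge0 :: "('o, 'm, 'k::field, 'x) moncat_scheme \<Rightarrow> ('o, 'm) cpx set" where
  "Db_ge0 C = {K \<in> Ob (Db C). \<forall>i<0. zero_object C (cohom C K i)}"

definition t_exact :: "('o, 'm, 'k::field, 'x) moncat_scheme \<Rightarrow> ('p, 'n, 'k, 'y) moncat_scheme \<Rightarrow>
    (('o, 'm) cpx, ('o, 'm) dmor, ('p, 'n) cpx, ('p, 'n) dmor, 'z) fctr_scheme \<Rightarrow> bool" where
  "t_exact C D F \<longleftrightarrow> FO F ` Db_le0 C \<subseteq> Db_le0 D \<and> FO F ` Db_ge0 C \<subseteq> Db_ge0 D"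


section \<open>Monoidal triangulated equivalences\<close>

text \<open>A functor together with comparison maps \<open>F(X[1]) \<rightarrow> (F X)[1]\<close>, \<open>1 \<rightarrow> F 1\<close> and
  \<open>F X \<otimes> F Y \<rightarrow> F (X \<otimes> Y)\<close>.\<close>

record ('o, 'm, 'p, 'n) mtfctr = "('o, 'm, 'p, 'n) fctr" +
  sh_iso :: "'o \<Rightarrow> 'n"
  unit_iso :: "'n"
  tens_iso :: "'o \<Rightarrow> 'o \<Rightarrow> 'n"

definition triangulated_functor :: "('o, 'm, 'k, 'x) ttcat_scheme \<Rightarrow> ('p, 'n, 'k, 'y) ttcat_scheme \<Rightarrow>
    ('o, 'm, 'p, 'n, 'z) mtfctr_scheme \<Rightarrow> bool" where
  "triangulated_functor S T F \<longleftrightarrow> linear_functor S T F \<and>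
     natural_iso S T (F \<circ>\<^sub>F Sh S) (Sh T \<circ>\<^sub>F F) (sh_iso F) \<and>
     (\<forall>(u, v, w) \<in> Tri S. (FM F u, FM F v, sh_iso F (Dom S u) \<bullet>\<^bsub>T\<^esub> FM F w) \<in> Tri T)"

definition strong_monoidal :: "('o, 'm, 'k, 'x) moncat_scheme \<Rightarrow> ('p, 'n, 'k, 'y) moncat_scheme \<Rightarrow>
    ('o, 'm, 'p, 'n, 'z) mtfctr_scheme \<Rightarrow> bool" where
  "strong_monoidal S T F \<longleftrightarrow> is_functor S T F \<and>
     unit_iso F \<in> Hom T \<one>\<^sub>\<otimes>\<^bsub>T\<^esub> (FO F \<one>\<^sub>\<otimes>\<^bsub>S\<^esub>) \<and> is_iso T (unit_iso F) \<and>
     (\<forall>X \<in> Ob S. \<forall>Y \<in> Ob S.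
        tens_iso F X Y \<in> Hom T (FO F X \<boxtimes>\<^bsub>T\<^esub> FO F Y) (FO F (X \<boxtimes>\<^bsub>S\<^esub> Y)) \<and> is_iso T (tens_iso F X Y)) \<and>
     (\<forall>X X' Y Y'. \<forall>f \<in> Hom S X X'. \<forall>g \<in> Hom S Y Y'.
        tens_iso F X' Y' \<bullet>\<^bsub>T\<^esub> (FM F f \<star>\<^bsub>T\<^esub> FM F g) = FM F (f \<star>\<^bsub>S\<^esub> g) \<bullet>\<^bsub>T\<^esub> tens_iso F X Y) \<and>
     (\<forall>X \<in> Ob S. \<forall>Y \<in> Ob S. \<forall>Z \<in> Ob S.
        FM F (Assoc S X Y Z) \<bullet>\<^bsub>T\<^esub> tens_iso F (X \<boxtimes>\<^bsub>S\<^esub> Y) Z \<bullet>\<^bsub>T\<^esub> (tens_iso F X Y \<star>\<^bsub>T\<^esub> Id T (FO F Z)) =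
        tens_iso F X (Y \<boxtimes>\<^bsub>S\<^esub> Z) \<bullet>\<^bsub>T\<^esub> (Id T (FO F X) \<star>\<^bsub>T\<^esub> tens_iso F Y Z) \<bullet>\<^bsub>T\<^esub>
          Assoc T (FO F X) (FO F Y) (FO F Z)) \<and>
     (\<forall>X \<in> Ob S.
        FM F (LUnit S X) \<bullet>\<^bsub>T\<^esub> tens_iso F \<one>\<^sub>\<otimes>\<^bsub>S\<^esub> X \<bullet>\<^bsub>T\<^esub> (unit_iso F \<star>\<^bsub>T\<^esub> Id T (FO F X)) = LUnit T (FO F X) \<and>
        FM F (RUnit S X) \<bullet>\<^bsub>T\<^esub> tens_iso F X \<one>\<^sub>\<otimes>\<^bsub>S\<^esub> \<bullet>\<^bsub>T\<^esub> (Id T (FO F X) \<star>\<^bsub>T\<^esub> unit_iso F) = RUnit T (FO F X))"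

definition monoidal_triangulated_equivalence ::
  "('o, 'm, 'k, 'x) ttcat_scheme \<Rightarrow> ('p, 'n, 'k, 'y) ttcat_scheme \<Rightarrow>
    ('o, 'm, 'p, 'n, 'z) mtfctr_scheme \<Rightarrow> bool" where
  "monoidal_triangulated_equivalence S T F \<longleftrightarrow>
     triangulated_functor S T F \<and> equivalence S T F \<and> strong_monoidal S T F"


section \<open>The universal grading group\<close>

definition iso_class :: "('o, 'm, 'x) cat_scheme \<Rightarrow> 'o \<Rightarrow> 'o set" where
  "iso_class C X = {Y \<in> Ob C. isomorphic C X Y}"

definition Irr :: "('o, 'm, 'x) cat_scheme \<Rightarrow> 'o set set" where
  "Irr C = iso_class C ` {X. simple_object C X}"

definition is_grading :: "('o, 'm, 'k, 'x) moncat_scheme \<Rightarrow> ('g, 'y) monoid_scheme \<Rightarrow>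
    ('o set \<Rightarrow> 'g) \<Rightarrow> bool" where
  "is_grading C G d \<longleftrightarrow> d \<in> Irr C \<rightarrow> carrier G \<and>
     (\<forall>X Y Z. simple_object C X \<and> simple_object C Y \<and> simple_object C Z \<and>
        direct_summand C Z (X \<boxtimes>\<^bsub>C\<^esub> Y) \<longrightarrow>
        d (iso_class C Z) = d (iso_class C X) \<otimes>\<^bsub>G\<^esub> d (iso_class C Y))"

text \<open>The group is presented by the generators \<open>Irr C\<close> and the relations \<open>[Z] = [X] [Y]\<close>.  Words have
  letters \<open>(e, x)\<close>, standing for \<open>x\<close> if \<open>e\<close> holds and for the inverse of \<open>x\<close> otherwise.  The lemmas
  below show that this is the universal grading.\<close>

definition gr_words :: "('o, 'm, 'x) cat_scheme \<Rightarrow> (bool \<times> 'o set) list set" where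
  "gr_words C = lists (UNIV \<times> Irr C)"

inductive_set gr_rel ::
  "('o, 'm, 'k, 'x) moncat_scheme \<Rightarrow> ((bool \<times> 'o set) list \<times> (bool \<times> 'o set) list) set"
  for C :: "('o, 'm, 'k, 'x) moncat_scheme" where
  refl: "w \<in> gr_words C \<Longrightarrow> (w, w) \<in> gr_rel C"
| sym: "(v, w) \<in> gr_rel C \<Longrightarrow> (w, v) \<in> gr_rel C"
| trans: "(u, v) \<in> gr_rel C \<Longrightarrow> (v, w) \<in> gr_rel C \<Longrightarrow> (u, w) \<in> gr_rel C"
| cong: "(v, w) \<in> gr_rel C \<Longrightarrow> a \<in> gr_words C \<Longrightarrow> b \<in> gr_words C \<Longrightarrow> (a @ v @ b, a @ w @ b) \<in> gr_rel C"
| cancel: "x \<in> Irr C \<Longrightarrow> ([(e, x), (\<not> e, x)], []) \<in> gr_rel C"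
| tens: "simple_object C X \<Longrightarrow> simple_object C Y \<Longrightarrow> simple_object C Z \<Longrightarrow>
     direct_summand C Z (X \<boxtimes>\<^bsub>C\<^esub> Y) \<Longrightarrow>
     ([(True, iso_class C Z)], [(True, iso_class C X), (True, iso_class C Y)]) \<in> gr_rel C"

definition grading_group ::
  "('o, 'm, 'k, 'x) moncat_scheme \<Rightarrow> (bool \<times> 'o set) list set monoid" where
  "grading_group C = \<lparr>carrier = gr_words C // gr_rel C,
     monoid.mult = (\<lambda>a b. \<Union>v\<in>a. \<Union>w\<in>b. gr_rel C `` {v @ w}), one = gr_rel C `` {[]}\<rparr>"

definition gdeg :: "('o, 'm, 'k, 'x) moncat_scheme \<Rightarrow> 'o set \<Rightarrow> (bool \<times> 'o set) list set" where
  "gdeg C x = gr_rel C `` {[(True, x)]}"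

lemma gr_rel_words: "(v, w) \<in> gr_rel C \<Longrightarrow> v \<in> gr_words C \<and> w \<in> gr_words C"
  by (induction rule: gr_rel.induct) (auto simp: gr_words_def Irr_def)

lemma gr_words_append: "v \<in> gr_words C \<Longrightarrow> w \<in> gr_words C \<Longrightarrow> v @ w \<in> gr_words C"
  by (simp add: gr_words_def)

lemma gr_words_Nil: "[] \<in> gr_words C"
  by (simp add: gr_words_def)

lemma equiv_gr_rel: "equiv (gr_words C) (gr_rel C)"
  by (intro equivI refl_onI symI transI subsetI) (auto dest: gr_rel_words intro: gr_rel.intros)

lemma gr_rel_append:
  assumes "(v, v') \<in> gr_rel C" "(w, w') \<in> gr_rel C"
  shows "(v @ w, v' @ w') \<in> gr_rel C"
proof -
  have "([] @ v @ w, [] @ v' @ w) \<in> gr_rel C"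
    using assms gr_rel_words by (intro gr_rel.cong) (auto simp: gr_words_Nil)
  moreover have "(v' @ w @ [], v' @ w' @ []) \<in> gr_rel C"
    using assms gr_rel_words by (intro gr_rel.cong) (auto simp: gr_words_Nil)
  ultimately show ?thesis by (auto intro: gr_rel.trans)
qed

lemma grading_group_mult:
  assumes "v \<in> gr_words C" "w \<in> gr_words C"
  shows "gr_rel C `` {v} \<otimes>\<^bsub>grading_group C\<^esub> gr_rel C `` {w} = gr_rel C `` {v @ w}"
proof -
  have "congruent2 (gr_rel C) (gr_rel C) (\<lambda>v w. gr_rel C `` {v @ w})"
    by (auto simp: congruent2_def intro!: equiv_class_eq[OF equiv_gr_rel] gr_rel_append)
  then show ?thesis
    using UN_equiv_class2[OF equiv_gr_rel equiv_gr_rel _ assms]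
    by (simp add: grading_group_def)
qed

lemma grading_group_carrier: "carrier (grading_group C) = (\<lambda>w. gr_rel C `` {w}) ` gr_words C"
  by (auto simp: grading_group_def quotient_def)

lemma grading_group_one: "\<one>\<^bsub>grading_group C\<^esub> = gr_rel C `` {[]}"
  by (simp add: grading_group_def)

lemma gr_rel_left_inverse:
  assumes "w \<in> gr_words C"
  shows "\<exists>v \<in> gr_words C. (v @ w, []) \<in> gr_rel C"
  using assms
proof (induction w)
  case Nil
  show ?case by (auto simp: gr_words_Nil intro!: bexI[of _ "[]"] gr_rel.refl)
next
  case (Cons l w)
  obtain e x where l: "l = (e, x)" by (cases l)
  have x: "x \<in> Irr C" and w: "w \<in> gr_words C" using Cons.prems by (auto simp: gr_words_def l)
  obtain v where v: "v \<in> gr_words C" "(v @ w, []) \<in> gr_rel C" using Cons.IH w by blast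
  have "(v @ [(\<not> e, x), (\<not> \<not> e, x)] @ w, v @ [] @ w) \<in> gr_rel C"
    by (intro gr_rel.cong gr_rel.cancel v w x)
  then have "((v @ [(\<not> e, x)]) @ l # w, []) \<in> gr_rel C"
    using v(2) by (auto simp: l intro: gr_rel.trans)
  moreover have "v @ [(\<not> e, x)] \<in> gr_words C"
    using v(1) x by (auto simp: gr_words_def)
  ultimately show ?case by blast
qed

lemma group_grading_group: "group (grading_group C)"
proof (rule groupI)
  fix a assume "a \<in> carrier (grading_group C)"
  then obtain w where w: "w \<in> gr_words C" "a = gr_rel C `` {w}"
    by (auto simp: grading_group_carrier)
  obtain v where v: "v \<in> gr_words C" "(v @ w, []) \<in> gr_rel C"
    using gr_rel_left_inverse[OF w(1)] by blast
  have "gr_rel C `` {v} \<otimes>\<^bsub>grading_group C\<^esub> a = \<one>\<^bsub>grading_group C\<^esub>"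
    using v w by (simp add: grading_group_mult grading_group_one equiv_class_eq[OF equiv_gr_rel])
  then show "\<exists>b \<in> carrier (grading_group C). b \<otimes>\<^bsub>grading_group C\<^esub> a = \<one>\<^bsub>grading_group C\<^esub>"
    using v by (auto simp: grading_group_carrier)
qed (auto simp: grading_group_carrier grading_group_mult grading_group_one gr_words_append gr_words_Nil)

lemma gdeg_is_grading: "is_grading C (grading_group C) (gdeg C)"
proof -
  have w: "[(True, x)] \<in> gr_words C" if "x \<in> Irr C" for x
    using that by (simp add: gr_words_def)
  have s: "iso_class C X \<in> Irr C" if "simple_object C X" for X
    using that by (simp add: Irr_def)
  show ?thesis
    by (auto simp: is_grading_def gdeg_def grading_group_carrier grading_group_mult w s
        intro!: equiv_class_eq[OF equiv_gr_rel] gr_rel.tens)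
qed

lemma grading_group_universal:
  fixes C :: "('o, 'm, 'k, 'x) moncat_scheme" and G :: "('g, 'y) monoid_scheme"
  assumes "group G" "is_grading C G d"
  shows "\<exists>!h. h \<in> hom (grading_group C) G \<inter> extensional (carrier (grading_group C)) \<and>
     (\<forall>x \<in> Irr C. h (gdeg C x) = d x)"
proof -
  interpret group G by fact
  interpret U: group "grading_group C" by (rule group_grading_group)
  define l where "l = (\<lambda>(e, x). if e then d x else inv\<^bsub>G\<^esub> (d x))"
  define val where "val = (\<lambda>w. foldr (\<lambda>a b. l a \<otimes>\<^bsub>G\<^esub> b) w \<one>\<^bsub>G\<^esub>)"
  have dG: "d x \<in> carrier G" if "x \<in> Irr C" for x
    using assms(2) that by (auto simp: is_grading_def)
  have lG: "l a \<in> carrier G" if "a \<in> UNIV \<times> Irr C" for a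
    using that dG by (auto simp: l_def)
  have val_simps: "val [] = \<one>\<^bsub>G\<^esub>" "val (a # w) = l a \<otimes>\<^bsub>G\<^esub> val w" for a w
    by (simp_all add: val_def)
  have valG: "val w \<in> carrier G" if "w \<in> gr_words C" for w
    using that by (induction w) (auto simp: gr_words_def val_simps intro!: m_closed lG)
  have val_app: "val (v @ w) = val v \<otimes>\<^bsub>G\<^esub> val w"
    if "v \<in> gr_words C" "w \<in> gr_words C" for v w
    using that
  proof (induction v)
    case (Cons a v)
    then have a: "l a \<in> carrier G" and v: "v \<in> gr_words C"
      using lG by (auto simp: gr_words_def)
    show ?case using Cons a v valG by (simp add: val_simps m_assoc)
  qed (simp add: val_simps valG)
  have val_rel: "val v = val w" if "(v, w) \<in> gr_rel C" for v w
    using that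
  proof (induction rule: gr_rel.induct)
    case (cong v w a b)
    then show ?case using gr_rel_words[OF cong.hyps(1)] by (simp add: val_app gr_words_append)
  next
    case (cancel x e)
    then show ?case using dG[OF cancel] by (cases e) (simp_all add: val_simps l_def)
  next
    case (tens X Y Z)
    then have "iso_class C X \<in> Irr C" "iso_class C Y \<in> Irr C" "iso_class C Z \<in> Irr C"
      by (auto simp: Irr_def)
    then show ?case using tens assms(2) dG by (auto simp: is_grading_def val_simps l_def)
  qed simp_all
  define h where "h = (\<lambda>u \<in> carrier (grading_group C). val (SOME w. w \<in> u))"
  have h: "h (gr_rel C `` {w}) = val w" if w: "w \<in> gr_words C" for w
  proof -
    have "w \<in> gr_rel C `` {w}" using w by (auto intro: gr_rel.refl)
    then have "(SOME v. v \<in> gr_rel C `` {w}) \<in> gr_rel C `` {w}" by (rule someI)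
    then show ?thesis using w val_rel by (auto simp: h_def grading_group_carrier)
  qed
  have gd: "gdeg C x \<in> carrier (grading_group C)" if "x \<in> Irr C" for x
    using gdeg_is_grading[of C] that by (auto simp: is_grading_def)
  show ?thesis
  proof (rule ex1I[of _ h], intro conjI IntI ballI)
    show "h \<in> hom (grading_group C) G"
      by (rule homI)
        (auto simp: grading_group_carrier grading_group_mult h valG val_app gr_words_append)
    show "h \<in> extensional (carrier (grading_group C))" by (simp add: h_def)
    show "h (gdeg C x) = d x" if "x \<in> Irr C" for x
      using that dG by (simp add: gdeg_def h gr_words_def val_simps l_def)
  next
    fix h' assume h': "h' \<in> hom (grading_group C) G \<inter> extensional (carrier (grading_group C)) \<and>
      (\<forall>x \<in> Irr C. h' (gdeg C x) = d x)"
    then have hom': "group_hom (grading_group C) G h'"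
      by (simp add: group_hom_def group_hom_axioms_def U.group_axioms group_axioms)
    interpret h': group_hom "grading_group C" G h' by (rule hom')
    have letter: "h' (gr_rel C `` {[(e, x)]}) = l (e, x)" if x: "x \<in> Irr C" for e x
    proof (cases e)
      case True
      then show ?thesis using h' x by (auto simp: l_def gdeg_def)
    next
      case False
      have words: "[(b, x)] \<in> gr_words C" for b using x by (simp add: gr_words_def)
      have c: "gr_rel C `` {[(b, x)]} \<in> carrier (grading_group C)" for b
        using words by (auto simp: grading_group_carrier)
      have "gr_rel C `` {[(False, x)]} \<otimes>\<^bsub>grading_group C\<^esub> gr_rel C `` {[(True, x)]} = \<one>\<^bsub>grading_group C\<^esub>"
        using gr_rel.cancel[OF x, of False] words
        by (simp add: grading_group_mult grading_group_one equiv_class_eq[OF equiv_gr_rel])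
      then have "h' (gr_rel C `` {[(False, x)]}) \<otimes>\<^bsub>G\<^esub> h' (gr_rel C `` {[(True, x)]}) = \<one>\<^bsub>G\<^esub>"
        using c by (metis h'.hom_mult h'.hom_one)
      then have "h' (gr_rel C `` {[(False, x)]}) \<otimes>\<^bsub>G\<^esub> d x = \<one>\<^bsub>G\<^esub>"
        using h' x by (auto simp: gdeg_def)
      then have "h' (gr_rel C `` {[(False, x)]}) = inv\<^bsub>G\<^esub> (d x)"
        using dG[OF x] c h'.hom_closed by (metis inv_equality inv_inv inv_closed)
      then show ?thesis using False by (simp add: l_def)
    qed
    have "h' (gr_rel C `` {w}) = val w" if "w \<in> gr_words C" for w
      using that
    proof (induction w)
      case Nil
      then show ?case using h'.hom_one by (simp add: val_simps grading_group_one)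
    next
      case (Cons a w)
      obtain e x where a: "a = (e, x)" by (cases a)
      have x: "x \<in> Irr C" and w: "w \<in> gr_words C" and ax: "[a] \<in> gr_words C"
        using Cons.prems by (auto simp: gr_words_def a)
      have "h' (gr_rel C `` {a # w}) = h' (gr_rel C `` {[a]} \<otimes>\<^bsub>grading_group C\<^esub> gr_rel C `` {w})"
        using w ax by (simp add: grading_group_mult)
      also have "\<dots> = h' (gr_rel C `` {[a]}) \<otimes>\<^bsub>G\<^esub> h' (gr_rel C `` {w})"
        using w ax by (intro h'.hom_mult) (auto simp: grading_group_carrier)
      finally show ?case using Cons.IH w letter[OF x] by (simp add: val_simps a)
    qed
    then have "h' u = h u" if "u \<in> carrier (grading_group C)" for u
      using that h by (auto simp: grading_group_carrier)
    then show "h' = h" using h' by (intro extensionalityI[of _ "carrier (grading_group C)"]) (auto simp: h_def)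
  qed
qed

text \<open>Homomorphisms are made extensional so that they are determined by their values on the group.\<close>

definition grading_homs ::
  "('o, 'm, 'k, 'x) moncat_scheme \<Rightarrow> ((bool \<times> 'o set) list set \<Rightarrow> int) set" where
  "grading_homs C = hom (grading_group C) integer_group \<inter> extensional (carrier (grading_group C))"

definition neg_hom :: "('o, 'm, 'k, 'x) moncat_scheme \<Rightarrow>
    ((bool \<times> 'o set) list set \<Rightarrow> int) \<Rightarrow> (bool \<times> 'o set) list set \<Rightarrow> int" where
  "neg_hom C \<eta> = (\<lambda>u \<in> carrier (grading_group C). - \<eta> u)"

definition zero_hom ::
  "('o, 'm, 'k, 'x) moncat_scheme \<Rightarrow> (bool \<times> 'o set) list set \<Rightarrow> int" where
  "zero_hom C = (\<lambda>u \<in> carrier (grading_group C). 0)"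


section \<open>The twist by a grading\<close>

text \<open>In a semisimple category the full subcategory generated by the simple objects of degree \<open>n\<close>
  consists of their finite direct sums.  The homogeneous projections come from a chosen decomposition
  of every object; since there are no nonzero maps between different degrees, they are functorial.\<close>

definition homogeneous :: "('o, 'm, 'k, 'x) moncat_scheme \<Rightarrow>
    ((bool \<times> 'o set) list set \<Rightarrow> int) \<Rightarrow> int \<Rightarrow> 'o \<Rightarrow> bool" where
  "homogeneous C \<eta> n X \<longleftrightarrow> (\<exists>(m::nat) S \<iota> \<pi>.
     (\<forall>i<m. simple_object C (S i) \<and> \<eta> (gdeg C (iso_class C (S i))) = n) \<and>
     is_biprod C {..<m} S X \<iota> \<pi>)"

definition hom_decomp :: "('o, 'm, 'k, 'x) moncat_scheme \<Rightarrow> ((bool \<times> 'o set) list set \<Rightarrow> int) \<Rightarrow>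
    'o \<Rightarrow> (int \<Rightarrow> 'o) \<times> (int \<Rightarrow> 'm) \<times> (int \<Rightarrow> 'm)" where
  "hom_decomp C \<eta> X = (SOME (P, \<iota>, \<pi>).
     (\<forall>n. homogeneous C \<eta> n (P n) \<and> \<iota> n \<in> Hom C (P n) X \<and> \<pi> n \<in> Hom C X (P n)) \<and>
     is_biprod C {n. \<not> zero_object C (P n)} P X \<iota> \<pi>)"

definition comp_ob :: "('o, 'm, 'k, 'x) moncat_scheme \<Rightarrow> ((bool \<times> 'o set) list set \<Rightarrow> int) \<Rightarrow>
    int \<Rightarrow> 'o \<Rightarrow> 'o" where
  "comp_ob C \<eta> n X = fst (hom_decomp C \<eta> X) n"

definition comp_mor :: "('o, 'm, 'k, 'x) moncat_scheme \<Rightarrow> ((bool \<times> 'o set) list set \<Rightarrow> int) \<Rightarrow>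
    int \<Rightarrow> 'm \<Rightarrow> 'm" where
  "comp_mor C \<eta> n f = snd (snd (hom_decomp C \<eta> (Cod C f))) n \<bullet>\<^bsub>C\<^esub> f \<bullet>\<^bsub>C\<^esub>
     fst (snd (hom_decomp C \<eta> (Dom C f))) n"

definition comp_cpx :: "('o, 'm, 'k, 'x) moncat_scheme \<Rightarrow> ((bool \<times> 'o set) list set \<Rightarrow> int) \<Rightarrow>
    int \<Rightarrow> ('o, 'm) cpx \<Rightarrow> ('o, 'm) cpx" where
  "comp_cpx C \<eta> n K = \<lparr>cO = (\<lambda>i. comp_ob C \<eta> n (cO K i)), cD = (\<lambda>i. comp_mor C \<eta> n (cD K i))\<rparr>"

definition comp_cmap :: "('o, 'm, 'k, 'x) moncat_scheme \<Rightarrow> ((bool \<times> 'o set) list set \<Rightarrow> int) \<Rightarrow>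
    int \<Rightarrow> ('o, 'm) cmap \<Rightarrow> ('o, 'm) cmap" where
  "comp_cmap C \<eta> n f = \<lparr>src = comp_cpx C \<eta> n (src f), tgt = comp_cpx C \<eta> n (tgt f),
     cm = (\<lambda>i. comp_mor C \<eta> n (cm f i))\<rparr>"

text \<open>Degreewise finite direct sums of families of complexes.\<close>

definition sum_idx :: "('o, 'm, 'k, 'x) lincat_scheme \<Rightarrow> ('i \<Rightarrow> ('o, 'm) cpx) \<Rightarrow> int \<Rightarrow> 'i set" where
  "sum_idx C K i = {n. \<not> zero_object C (cO (K n) i)}"

definition sum_ob :: "('o, 'm, 'k, 'x) lincat_scheme \<Rightarrow> ('i \<Rightarrow> ('o, 'm) cpx) \<Rightarrow> int \<Rightarrow> 'o" where
  "sum_ob C K i = bp_ob C (sum_idx C K i) (\<lambda>n. cO (K n) i)"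

definition sum_in :: "('o, 'm, 'k, 'x) lincat_scheme \<Rightarrow> ('i \<Rightarrow> ('o, 'm) cpx) \<Rightarrow> int \<Rightarrow> 'i \<Rightarrow> 'm" where
  "sum_in C K i = bp_in C (sum_idx C K i) (\<lambda>n. cO (K n) i)"

definition sum_pr :: "('o, 'm, 'k, 'x) lincat_scheme \<Rightarrow> ('i \<Rightarrow> ('o, 'm) cpx) \<Rightarrow> int \<Rightarrow> 'i \<Rightarrow> 'm" where
  "sum_pr C K i = bp_pr C (sum_idx C K i) (\<lambda>n. cO (K n) i)"

definition sum_cpx :: "('o, 'm, 'k, 'x) lincat_scheme \<Rightarrow> ('i \<Rightarrow> ('o, 'm) cpx) \<Rightarrow> ('o, 'm) cpx" where
  "sum_cpx C K = \<lparr>cO = sum_ob C K,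
     cD = (\<lambda>i. hsum C (sum_ob C K i) (sum_ob C K (i + 1))
       (\<lambda>n. sum_in C K (i + 1) n \<bullet>\<^bsub>C\<^esub> cD (K n) i \<bullet>\<^bsub>C\<^esub> sum_pr C K i n) (sum_idx C K i))\<rparr>"

definition sum_cmap :: "('o, 'm, 'k, 'x) lincat_scheme \<Rightarrow> ('i \<Rightarrow> ('o, 'm) cmap) \<Rightarrow> ('o, 'm) cmap" where
  "sum_cmap C f = (let K = (\<lambda>n. src (f n)); L = (\<lambda>n. tgt (f n)) in
     \<lparr>src = sum_cpx C K, tgt = sum_cpx C L,
      cm = (\<lambda>i. hsum C (sum_ob C K i) (sum_ob C L i)
        (\<lambda>n. sum_in C L i n \<bullet>\<^bsub>C\<^esub> cm (f n) i \<bullet>\<^bsub>C\<^esub> sum_pr C K i n) (sum_idx C K i))\<rparr>)"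

text \<open>\<open>K \<mapsto> \<Oplus>\<^sub>n K\<^sub>n[n]\<close>\<close>

definition twist :: "('o, 'm, 'k::field, 'x) moncat_scheme \<Rightarrow> ((bool \<times> 'o set) list set \<Rightarrow> int) \<Rightarrow>
    (('o, 'm) cpx, ('o, 'm) dmor, ('o, 'm) cpx, ('o, 'm) dmor) fctr" where
  "twist C \<eta> = Db_lift C
     \<lparr>FO = (\<lambda>K. sum_cpx C (\<lambda>n. shift_cpx C n (comp_cpx C \<eta> n K))),
      FM = (\<lambda>f. sum_cmap C (\<lambda>n. shift_map C n (comp_cmap C \<eta> n f)))\<rparr>"

end

theory Submission
  imports Defs
begin

text \<open>Over a semisimple category every complex is homotopy equivalent to its cohomology, so
  quasi-isomorphisms are homotopy equivalences and the bounded derived category is the homotopy category.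
  The shifts of simple objects are characterized categorically: they are the nonzero objects out of
  which every nonzero map splits.  An equivalence \<open>F\<close> therefore induces a bijection between shifts of
  simple objects, and for every simple \<open>Z\<close> of the target there is exactly one integer \<open>m\<close> such that
  \<open>Z[m]\<close> is isomorphic to \<open>F W\<close> with \<open>W\<close> simple.  If \<open>Z\<close> is a direct summand of \<open>X \<otimes> Y\<close>, where
  \<open>X[a] \<cong> F V\<close> and \<open>Y[b] \<cong> F W\<close>, then \<open>Z\<close> occurs in degree \<open>- (a + b)\<close> of \<open>F (V \<otimes> W)\<close>; as \<open>V \<otimes> W\<close> is
  concentrated in degree \<open>0\<close>, the integer of \<open>Z\<close> is \<open>a + b\<close>.  Hence \<open>Z \<mapsto> m\<close> is a grading and defines \<open>\<chi>\<close>;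
  the twist by \<open>-\<chi>\<close> undoes exactly these shifts.  The monoidal structure enters only through the
  isomorphisms \<open>F V \<otimes> F W \<cong> F (V \<otimes> W)\<close>, and the triangulated structure only through \<open>F (K[1]) \<cong> (F K)[1]\<close>.\<close>


section \<open>Linear categories\<close>

text \<open>Everything is read off from one invariant, \<open>occurs C S i K\<close>, which says
  that the simple object \<open>S\<close> is a constituent of the cohomology of \<open>K\<close> in
  degree \<open>i\<close>. It decides where cohomology vanishes, hence membership in the two halves
  of the t-structure; it is also the existence of a morphism from \<open>S[-i]\<close> to
  \<open>K\<close> that is not zero in the derived category, hence it is invariant under isomorphism
  and can be carried through \<open>F\<close>. The shift, the twist and \<open>F\<close> itself act
  on it by translating the degree, so t-exactness turns into an equality of integers. Since it is
  tested on the simple objects of the target, what matters about \<open>F\<close> is that every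
  simple \<open>Z\<close> comes from some simple \<open>W\<close>.

  The signs follow from the fact that \<open>Z[m]\<close> has its cohomology in degree
  \<open>-m\<close>: if \<open>F W\<close> is isomorphic to \<open>Z[m]\<close>, then
  \<open>Z\<close> occurs in degree \<open>i\<close> of \<open>F K\<close> exactly when
  \<open>W\<close> occurs in degree \<open>i + m\<close> of \<open>K\<close>, and the twist by
  \<open>-\<chi>\<close> moves this occurrence of \<open>Z\<close> from degree \<open>i\<close> to
  \<open>i + m\<close>, where \<open>m\<close> is the value of \<open>\<chi>\<close> at
  \<open>Z\<close>.\<close>

context category
begin

lemma HomI [intro]: "f \<in> Mor C \<Longrightarrow> Dom C f = X \<Longrightarrow> Cod C f = Y \<Longrightarrow> f \<in> Hom C X Y"
  by (simp add: Hom_def)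

lemma Hom_self: "f \<in> Mor C \<Longrightarrow> f \<in> Hom C (Dom C f) (Cod C f)"
  by (simp add: Hom_def)

lemma HomD:
  assumes "f \<in> Hom C X Y"
  shows "f \<in> Mor C" "Dom C f = X" "Cod C f = Y" "X \<in> Ob C" "Y \<in> Ob C"
  using assms dom_cod[of f] by (auto simp: Hom_def)

lemma Dom_Ob [simp]: "f \<in> Mor C \<Longrightarrow> Dom C f \<in> Ob C"
  and Cod_Ob [simp]: "f \<in> Mor C \<Longrightarrow> Cod C f \<in> Ob C"
  using dom_cod by auto

lemma Id_arrow [simp]:
  assumes "X \<in> Ob C"
  shows "Id C X \<in> Mor C" "Dom C (Id C X) = X" "Cod C (Id C X) = X"
  using id_hom[OF assms] by (auto simp: Hom_def)

lemma cmp_arrow [simp]: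
  assumes "f \<in> Mor C" "g \<in> Mor C" "Cod C f = Dom C g"
  shows "g \<bullet> f \<in> Mor C" "Dom C (g \<bullet> f) = Dom C f" "Cod C (g \<bullet> f) = Cod C g"
  using cmp_hom[of f "Dom C f" "Cod C f" g "Cod C g"] assms by (auto simp: Hom_def)

text \<open>Composites are normalized to right-nested form, with typing expressed through
  \<open>Dom\<close> and \<open>Cod\<close> so that the simplifier can discharge it. The price is
  that a relation such as \<open>d \<bullet> d = 0\<close> is hidden inside a longer composite; many
  later steps therefore re-bracket explicitly before unfolding the relation.\<close>

lemma cmp_assoc_arrow [simp]:
  "f \<in> Mor C \<Longrightarrow> g \<in> Mor C \<Longrightarrow> h \<in> Mor C \<Longrightarrow> Cod C f = Dom C g \<Longrightarrow> Cod C g = Dom C h \<Longrightarrow>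
    (h \<bullet> g) \<bullet> f = h \<bullet> (g \<bullet> f)"
  using cmp_assoc[of f "Dom C f" "Cod C f" g "Cod C g" h "Cod C h"] by (auto simp: Hom_def)

lemma Id_left_arrow [simp]: "f \<in> Mor C \<Longrightarrow> Cod C f = X \<Longrightarrow> Id C X \<bullet> f = f"
  and Id_right_arrow [simp]: "f \<in> Mor C \<Longrightarrow> Dom C f = X \<Longrightarrow> f \<bullet> Id C X = f"
  using id_left[of f "Dom C f" "Cod C f"] id_right[of f "Dom C f" "Cod C f"] by (auto simp: Hom_def)

lemma is_isoE:
  assumes "is_iso C f"
  obtains g where "f \<in> Mor C" "g \<in> Mor C" "Dom C g = Cod C f" "Cod C g = Dom C f"
    "g \<bullet> f = Id C (Dom C f)" "f \<bullet> g = Id C (Cod C f)"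
  using assms unfolding is_iso_def inverse_mor_def Hom_def by auto

lemma is_isoI:
  assumes "f \<in> Hom C X Y" "g \<in> Hom C Y X" "g \<bullet> f = Id C X" "f \<bullet> g = Id C Y"
  shows "is_iso C f"
  using assms unfolding is_iso_def inverse_mor_def Hom_def by auto

lemma isomorphicE:
  assumes "isomorphic C X Y"
  obtains f g where "f \<in> Hom C X Y" "g \<in> Hom C Y X" "g \<bullet> f = Id C X" "f \<bullet> g = Id C Y"
  using assms unfolding isomorphic_def is_iso_def inverse_mor_def Hom_def by auto

lemma isomorphicI:
  assumes "f \<in> Hom C X Y" "g \<in> Hom C Y X" "g \<bullet> f = Id C X" "f \<bullet> g = Id C Y"
  shows "isomorphic C X Y"
  using assms is_isoI[of f X Y g] unfolding isomorphic_def by blast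

lemma isomorphic_sym: "isomorphic C X Y \<Longrightarrow> isomorphic C Y X"
  by (erule isomorphicE, rule isomorphicI) auto

lemma isomorphic_trans:
  assumes "isomorphic C X Y" "isomorphic C Y Z"
  shows "isomorphic C X Z"
proof -
  obtain f f' where f: "f \<in> Hom C X Y" "f' \<in> Hom C Y X" "f' \<bullet> f = Id C X" "f \<bullet> f' = Id C Y"
    using assms(1) by (rule isomorphicE)
  obtain g g' where g: "g \<in> Hom C Y Z" "g' \<in> Hom C Z Y" "g' \<bullet> g = Id C Y" "g \<bullet> g' = Id C Z"
    using assms(2) by (rule isomorphicE)
  show ?thesis
  proof (rule isomorphicI)
    show "g \<bullet> f \<in> Hom C X Z" "f' \<bullet> g' \<in> Hom C Z X" using f g cmp_hom by blast+
    have "(f' \<bullet> g') \<bullet> (g \<bullet> f) = f' \<bullet> ((g' \<bullet> g) \<bullet> f)"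
      using f g HomD by (metis cmp_arrow cmp_assoc_arrow)
    then show "(f' \<bullet> g') \<bullet> (g \<bullet> f) = Id C X" using f g HomD[OF f(1)] by simp
    have "(g \<bullet> f) \<bullet> (f' \<bullet> g') = g \<bullet> ((f \<bullet> f') \<bullet> g')"
      using f g HomD by (metis cmp_arrow cmp_assoc_arrow)
    then show "(g \<bullet> f) \<bullet> (f' \<bullet> g') = Id C Z" using f g HomD[OF g(2)] by simp
  qed
qed

lemma iso_class_eq:
  assumes "isomorphic C X Y"
  shows "iso_class C X = iso_class C Y"
  using assms isomorphic_sym isomorphic_trans unfolding iso_class_def by blast

end

section \<open>Hom spaces as modules, zero objects and finite sums of morphisms\<close>

context linear_category
begin

lemma hom_space_simps [simp]:
  "carrier (hom_space C X Y) = Hom C X Y" "zero (hom_space C X Y) = Zero C X Y"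
  "add (hom_space C X Y) = Add C" "module.smult (hom_space C X Y) = Scale C"
  by (simp_all add: hom_space_def)

lemma field_ring_simps [simp]:
  "carrier field_ring = UNIV" "monoid.mult field_ring = (*)" "one field_ring = 1"
  "zero field_ring = 0" "add field_ring = (+)"
  by (simp_all add: field_ring_def)

lemma Zero_arrow [simp]:
  assumes "X \<in> Ob C" "Y \<in> Ob C"
  shows "Zero C X Y \<in> Mor C" "Dom C (Zero C X Y) = X" "Cod C (Zero C X Y) = Y"
proof -
  interpret Module.module "field_ring :: 'k ring" "hom_space C X Y" by (rule hom_module[OF assms])
  show "Zero C X Y \<in> Mor C" "Dom C (Zero C X Y) = X" "Cod C (Zero C X Y) = Y"
    using M.zero_closed by (auto simp: Hom_def)
qed

lemma Add_arrow [simp]: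
  assumes "f \<in> Mor C" "g \<in> Mor C" "Dom C g = Dom C f" "Cod C g = Cod C f"
  shows "Add C f g \<in> Mor C" "Dom C (Add C f g) = Dom C f" "Cod C (Add C f g) = Cod C f"
proof -
  interpret Module.module "field_ring :: 'k ring" "hom_space C (Dom C f) (Cod C f)"
    by (rule hom_module) (use assms in auto)
  show "Add C f g \<in> Mor C" "Dom C (Add C f g) = Dom C f" "Cod C (Add C f g) = Cod C f"
    using M.add.m_closed[of f g] assms by (auto simp: Hom_def)
qed

lemma Scale_arrow [simp]:
  assumes "f \<in> Mor C"
  shows "Scale C c f \<in> Mor C" "Dom C (Scale C c f) = Dom C f" "Cod C (Scale C c f) = Cod C f"
proof -
  interpret Module.module "field_ring :: 'k ring" "hom_space C (Dom C f) (Cod C f)"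
    by (rule hom_module) (use assms in auto)
  show "Scale C c f \<in> Mor C" "Dom C (Scale C c f) = Dom C f" "Cod C (Scale C c f) = Cod C f"
    using smult_closed[of c f] assms by (auto simp: Hom_def)
qed

lemma Scale_simps [simp]:
  assumes "f \<in> Mor C"
  shows "Scale C 1 f = f" "Scale C 0 f = Zero C (Dom C f) (Cod C f)"
    "Scale C c (Scale C d f) = Scale C (c * d) f"
proof -
  interpret Module.module "field_ring :: 'k ring" "hom_space C (Dom C f) (Cod C f)"
    by (rule hom_module) (use assms in auto)
  show "Scale C 1 f = f" "Scale C 0 f = Zero C (Dom C f) (Cod C f)"
    "Scale C c (Scale C d f) = Scale C (c * d) f"
    using smult_one[of f] smult_l_null[of f] smult_assoc1[of c d f] assms by (auto simp: Hom_def)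
qed

lemma Scale_Zero [simp]:
  assumes "X \<in> Ob C" "Y \<in> Ob C"
  shows "Scale C c (Zero C X Y) = Zero C X Y"
proof -
  interpret Module.module "field_ring :: 'k ring" "hom_space C X Y" by (rule hom_module[OF assms])
  show ?thesis using smult_r_null[of c] by simp
qed

lemma Scale_Add [simp]:
  assumes "f \<in> Mor C" "g \<in> Mor C" "Dom C g = Dom C f" "Cod C g = Cod C f"
  shows "Scale C c (Add C f g) = Add C (Scale C c f) (Scale C c g)"
proof -
  interpret Module.module "field_ring :: 'k ring" "hom_space C (Dom C f) (Cod C f)"
    by (rule hom_module) (use assms in auto)
  show ?thesis using smult_r_distr[of c f g] assms by (auto simp: Hom_def)
qed

lemma Add_Zero [simp]:
  assumes "f \<in> Mor C" "Dom C f = X" "Cod C f = Y"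
  shows "Add C (Zero C X Y) f = f" "Add C f (Zero C X Y) = f"
proof -
  interpret Module.module "field_ring :: 'k ring" "hom_space C X Y"
    by (rule hom_module) (use assms in auto)
  show "Add C (Zero C X Y) f = f" "Add C f (Zero C X Y) = f"
    using M.l_zero[of f] M.r_zero[of f] assms by (auto simp: Hom_def)
qed

lemma Add_assoc:
  assumes "f \<in> Mor C" "g \<in> Mor C" "h \<in> Mor C" "Dom C g = Dom C f" "Cod C g = Cod C f"
    "Dom C h = Dom C f" "Cod C h = Cod C f"
  shows "Add C (Add C f g) h = Add C f (Add C g h)"
proof -
  interpret Module.module "field_ring :: 'k ring" "hom_space C (Dom C f) (Cod C f)"
    by (rule hom_module) (use assms in auto)
  show ?thesis using M.a_assoc[of f g h] assms by (auto simp: Hom_def)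
qed

lemma Add_commute:
  assumes "f \<in> Mor C" "g \<in> Mor C" "Dom C g = Dom C f" "Cod C g = Cod C f"
  shows "Add C f g = Add C g f"
proof -
  interpret Module.module "field_ring :: 'k ring" "hom_space C (Dom C f) (Cod C f)"
    by (rule hom_module) (use assms in auto)
  show ?thesis using M.a_comm[of f g] assms by (auto simp: Hom_def)
qed

lemma Add_left_commute:
  assumes "f \<in> Mor C" "g \<in> Mor C" "h \<in> Mor C" "Dom C g = Dom C f" "Cod C g = Cod C f"
    "Dom C h = Dom C f" "Cod C h = Cod C f"
  shows "Add C f (Add C g h) = Add C g (Add C f h)"
  using Add_assoc[of f g h] Add_assoc[of g f h] Add_commute[of f g] assms by simp

lemmas Add_ac = Add_assoc Add_commute Add_left_commute

lemma Scale_distrib: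
  assumes "f \<in> Mor C"
  shows "Scale C (c + d) f = Add C (Scale C c f) (Scale C d f)"
proof -
  interpret Module.module "field_ring :: 'k ring" "hom_space C (Dom C f) (Cod C f)"
    by (rule hom_module) (use assms in auto)
  show ?thesis using smult_l_distr[of c d f] assms by (auto simp: Hom_def)
qed

lemma Add_minus [simp]:
  assumes "f \<in> Mor C"
  shows "Add C f (Scale C (- 1) f) = Zero C (Dom C f) (Cod C f)"
    "Add C (Scale C (- 1) f) f = Zero C (Dom C f) (Cod C f)"
  using Scale_distrib[OF assms, of 1 "- 1"] Scale_distrib[OF assms, of "- 1" 1] assms by simp_all

lemma Add_minus_cancel [simp]:
  assumes "f \<in> Mor C" "g \<in> Mor C" "Dom C g = Dom C f" "Cod C g = Cod C f"
  shows "Add C f (Add C (Scale C (- 1) f) g) = g" "Add C (Scale C (- 1) f) (Add C f g) = g"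
  using assms Add_assoc[of f "Scale C (- 1) f" g] Add_assoc[of "Scale C (- 1) f" f g] by simp_all

lemma cmp_Add [simp]:
  assumes "f \<in> Mor C" "g \<in> Mor C" "g' \<in> Mor C" "Cod C f = Dom C g" "Dom C g' = Dom C g" "Cod C g' = Cod C g"
  shows "Add C g g' \<bullet> f = Add C (g \<bullet> f) (g' \<bullet> f)"
  using assms cmp_add_left[of f "Dom C f" "Dom C g" g "Cod C g" g'] by (auto simp: Hom_def)

lemma Add_cmp [simp]:
  assumes "f \<in> Mor C" "f' \<in> Mor C" "g \<in> Mor C" "Cod C f = Dom C g" "Dom C f' = Dom C f" "Cod C f' = Cod C f"
  shows "g \<bullet> Add C f f' = Add C (g \<bullet> f) (g \<bullet> f')"
  using assms cmp_add_right[of f "Dom C f" "Dom C g" f' g "Cod C g"] by (auto simp: Hom_def)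

lemma cmp_Scale [simp]:
  assumes "f \<in> Mor C" "g \<in> Mor C" "Cod C f = Dom C g"
  shows "Scale C c g \<bullet> f = Scale C c (g \<bullet> f)" "g \<bullet> Scale C c f = Scale C c (g \<bullet> f)"
  using assms cmp_scale_left[of f "Dom C f" "Dom C g" g "Cod C g"]
    cmp_scale_right[of f "Dom C f" "Dom C g" g "Cod C g"] by (auto simp: Hom_def)

text \<open>A zero morphism is \<open>0\<close> times itself, and scalars pass through
  composition.\<close>

lemma cmp_Zero [simp]:
  assumes "f \<in> Mor C" "X \<in> Ob C"
  shows "Cod C f = Y \<Longrightarrow> Zero C Y X \<bullet> f = Zero C (Dom C f) X"
    "Dom C f = Y \<Longrightarrow> f \<bullet> Zero C X Y = Zero C X (Cod C f)"
proof -
  have *: "Y \<in> Ob C" if "Cod C f = Y \<or> Dom C f = Y" using assms that by auto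
  { assume "Cod C f = Y"
    then show "Zero C Y X \<bullet> f = Zero C (Dom C f) X"
      using cmp_Scale(1)[of f "Zero C Y X" 0] assms * by simp }
  { assume "Dom C f = Y"
    then show "f \<bullet> Zero C X Y = Zero C X (Cod C f)"
      using cmp_Scale(2)[of "Zero C X Y" f 0] assms * by simp }
qed

lemma zero_object_Ob: "zero_object C X \<Longrightarrow> X \<in> Ob C"
  by (simp add: zero_object_def)

lemma into_zero_object:
  assumes "zero_object C Y" "f \<in> Mor C" "Cod C f = Y"
  shows "f = Zero C (Dom C f) Y"
proof -
  have "f \<in> Hom C (Dom C f) Y" "Zero C (Dom C f) Y \<in> Hom C (Dom C f) Y"
    using assms by (auto simp: zero_object_def)
  then show ?thesis using assms(1) zero_object_def
    by (metis Dom_Ob assms(2))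
qed

lemma from_zero_object:
  assumes "zero_object C X" "f \<in> Mor C" "Dom C f = X"
  shows "f = Zero C X (Cod C f)"
proof -
  have "f \<in> Hom C X (Cod C f)" "Zero C X (Cod C f) \<in> Hom C X (Cod C f)"
    using assms by (auto simp: zero_object_def)
  then show ?thesis using assms(1) zero_object_def
    by (metis Cod_Ob assms(2))
qed

text \<open>Every morphism into or out of \<open>X\<close> equals its composite with
  \<open>Id C X\<close>, so all of them vanish as soon as the identity does.\<close>

lemma zero_object_iff: "zero_object C X \<longleftrightarrow> X \<in> Ob C \<and> Id C X = Zero C X X"
proof
  assume "zero_object C X"
  then show "X \<in> Ob C \<and> Id C X = Zero C X X"
    using into_zero_object[of X "Id C X"] zero_object_Ob by force
next
  assume X: "X \<in> Ob C \<and> Id C X = Zero C X X"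
  have 1: "f = Zero C X Y" if "f \<in> Hom C X Y" for f Y
  proof -
    have "f \<bullet> Id C X = f \<bullet> Zero C X X" using X by simp
    then show ?thesis using HomD[OF that] X by (metis Id_right_arrow cmp_Zero(2))
  qed
  have 2: "f = Zero C Y X" if "f \<in> Hom C Y X" for f Y
  proof -
    have "Id C X \<bullet> f = Zero C X X \<bullet> f" using X by simp
    then show ?thesis using HomD[OF that] X by (metis Id_left_arrow cmp_Zero(1))
  qed
  show "zero_object C X"
    unfolding zero_object_def
  proof (intro conjI ballI)
    show "X \<in> Ob C" using X by simp
    fix Y assume Y: "Y \<in> Ob C"
    show "\<exists>!f. f \<in> Hom C X Y" using X Y 1 by (intro ex1I[of _ "Zero C X Y"]) auto
    show "\<exists>!f. f \<in> Hom C Y X" using X Y 2 by (intro ex1I[of _ "Zero C Y X"]) auto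
  qed
qed

lemma mor_zero_retract:
  assumes "zero_object C Z" "f \<in> Hom C X Z" "g \<in> Hom C Z X" "g \<bullet> f = Id C X"
  shows "zero_object C X"
proof -
  have "f = Zero C X Z" using into_zero_object[OF assms(1), of f] HomD[OF assms(2)] by simp
  then show ?thesis
    using assms HomD[OF assms(2)] HomD[OF assms(3)] by (simp add: zero_object_iff)
qed

abbreviation Sub :: "'m \<Rightarrow> 'm \<Rightarrow> 'm" where "Sub f g \<equiv> Add C f (Scale C (- 1) g)"

lemma Sub_eq_Zero:
  assumes "Sub f g = Zero C X Y" "f \<in> Mor C" "g \<in> Mor C" "Dom C g = Dom C f" "Cod C g = Cod C f"
    "Dom C f = X" "Cod C f = Y"
  shows "f = g"
proof -
  have "Add C (Sub f g) g = g" using assms(2-) unfolding assms(1) by simp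
  then show ?thesis using assms(2-) by (simp add: Add_assoc)
qed

lemma add_Sub:
  assumes "f \<in> Mor C" "g \<in> Mor C" "Dom C g = Dom C f" "Cod C g = Cod C f"
  shows "Add C g (Sub f g) = f"
  using assms by (simp add: Add_commute[of f] flip: Add_assoc)

lemma Hom_abelian_group:
  assumes "X \<in> Ob C" "Y \<in> Ob C"
  shows "abelian_group (hom_space C X Y)"
  using hom_module[OF assms] by (rule Module.module.axioms(2))

lemma Hom_abelian_monoid:
  "X \<in> Ob C \<Longrightarrow> Y \<in> Ob C \<Longrightarrow> abelian_monoid (hom_space C X Y)"
  using Hom_abelian_group by (simp add: abelian_group_def)

lemma hsum_empty [simp]: "X \<in> Ob C \<Longrightarrow> Y \<in> Ob C \<Longrightarrow> hsum C X Y f {} = Zero C X Y"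
  using abelian_monoid.finsum_empty[OF Hom_abelian_monoid] by simp

lemma hsum_insert [simp]:
  assumes "X \<in> Ob C" "Y \<in> Ob C" "finite I" "i \<notin> I" "\<And>j. j \<in> insert i I \<Longrightarrow> f j \<in> Hom C X Y"
  shows "hsum C X Y f (insert i I) = Add C (f i) (hsum C X Y f I)"
  using abelian_monoid.finsum_insert[OF Hom_abelian_monoid, of X Y I i f] assms by auto

lemma hsum_cong:
  assumes "X \<in> Ob C" "Y \<in> Ob C" "\<And>j. j \<in> I \<Longrightarrow> g j \<in> Hom C X Y" "\<And>j. j \<in> I \<Longrightarrow> f j = g j"
  shows "hsum C X Y f I = hsum C X Y g I"
  using abelian_monoid.finsum_cong'[OF Hom_abelian_monoid, of X Y I I g f] assms by auto

lemma hsum_Hom: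
  assumes "X \<in> Ob C" "Y \<in> Ob C" "\<And>j. j \<in> I \<Longrightarrow> f j \<in> Hom C X Y"
  shows "hsum C X Y f I \<in> Hom C X Y"
  using abelian_monoid.finsum_closed[OF Hom_abelian_monoid, of X Y f I] assms by auto

lemma hsum_zero:
  assumes "X \<in> Ob C" "Y \<in> Ob C" "\<And>j. j \<in> I \<Longrightarrow> f j = Zero C X Y"
  shows "hsum C X Y f I = Zero C X Y"
proof -
  have "hsum C X Y f I = hsum C X Y (\<lambda>_. Zero C X Y) I" using assms by (intro hsum_cong) auto
  then show ?thesis using abelian_monoid.finsum_zero[OF Hom_abelian_monoid, of X Y I] assms by simp
qed

lemma hsum_single:
  assumes "X \<in> Ob C" "Y \<in> Ob C" "finite I" "j \<in> I" "f j \<in> Hom C X Y"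
    "\<And>i. i \<in> I \<Longrightarrow> i \<noteq> j \<Longrightarrow> f i = Zero C X Y"
  shows "hsum C X Y f I = f j"
proof -
  have *: "f i \<in> Hom C X Y" if "i \<in> I" for i using assms that by (cases "i = j") auto
  have "hsum C X Y f (insert j (I - {j})) = Add C (f j) (hsum C X Y f (I - {j}))"
    using assms * by (intro hsum_insert) auto
  moreover have "hsum C X Y f (I - {j}) = Zero C X Y" using assms by (intro hsum_zero) auto
  ultimately show ?thesis using assms by (simp add: insert_absorb Hom_def)
qed

lemma hsum_cmp_left:
  assumes "finite I" "g \<in> Hom C Y Z" "X \<in> Ob C" "\<And>j. j \<in> I \<Longrightarrow> f j \<in> Hom C X Y"
  shows "g \<bullet> hsum C X Y f I = hsum C X Z (\<lambda>j. g \<bullet> f j) I"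
  using assms(1,4)
proof (induction I)
  case empty
  then show ?case using HomD[OF assms(2)] assms(3) by simp
next
  case (insert i I)
  note Ob = HomD[OF assms(2)]
  have "hsum C X Y f I \<in> Hom C X Y" using insert Ob assms(3) by (intro hsum_Hom) auto
  moreover have "hsum C X Z (\<lambda>j. g \<bullet> f j) (insert i I) = Add C (g \<bullet> f i) (hsum C X Z (\<lambda>j. g \<bullet> f j) I)"
    using insert Ob assms(2,3) by (intro hsum_insert) (auto simp: Hom_def)
  moreover have "f i \<in> Hom C X Y" "hsum C X Y f (insert i I) = Add C (f i) (hsum C X Y f I)"
    using insert Ob assms(3) by (auto intro!: hsum_insert)
  ultimately show ?case using insert Ob assms(3) by (simp add: Hom_def)
qed

lemma hsum_cmp_right:
  assumes "finite I" "g \<in> Hom C X Y" "Z \<in> Ob C" "\<And>j. j \<in> I \<Longrightarrow> f j \<in> Hom C Y Z"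
  shows "hsum C Y Z f I \<bullet> g = hsum C X Z (\<lambda>j. f j \<bullet> g) I"
  using assms(1,4)
proof (induction I)
  case empty
  then show ?case using HomD[OF assms(2)] assms(3) by simp
next
  case (insert i I)
  note Ob = HomD[OF assms(2)]
  have "hsum C Y Z f I \<in> Hom C Y Z" using insert Ob assms(3) by (intro hsum_Hom) auto
  moreover have "hsum C X Z (\<lambda>j. f j \<bullet> g) (insert i I) = Add C (f i \<bullet> g) (hsum C X Z (\<lambda>j. f j \<bullet> g) I)"
    using insert Ob assms(2,3) by (intro hsum_insert) (auto simp: Hom_def)
  moreover have "f i \<in> Hom C Y Z" "hsum C Y Z f (insert i I) = Add C (f i) (hsum C Y Z f I)"
    using insert Ob assms(3) by (auto intro!: hsum_insert)
  ultimately show ?case using insert Ob assms(3) by (simp add: Hom_def)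
qed

section \<open>Biproducts: morphisms and their components\<close>

lemma is_biprodD:
  assumes "is_biprod C I X B \<iota> \<pi>"
  shows "finite I" "B \<in> Ob C"
    "\<And>i. i \<in> I \<Longrightarrow> X i \<in> Ob C" "\<And>i. i \<in> I \<Longrightarrow> \<iota> i \<in> Hom C (X i) B" "\<And>i. i \<in> I \<Longrightarrow> \<pi> i \<in> Hom C B (X i)"
    "\<And>i. i \<in> I \<Longrightarrow> \<pi> i \<bullet> \<iota> i = Id C (X i)"
    "\<And>i j. i \<in> I \<Longrightarrow> j \<in> I \<Longrightarrow> i \<noteq> j \<Longrightarrow> \<pi> j \<bullet> \<iota> i = Zero C (X i) (X j)"
    "hsum C B B (\<lambda>i. \<iota> i \<bullet> \<pi> i) I = Id C B"
  using assms unfolding is_biprod_def by auto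

lemma biprod_eqI_pr:
  assumes "is_biprod C I X B \<iota> \<pi>" "f \<in> Hom C Y B" "g \<in> Hom C Y B"
    "\<And>i. i \<in> I \<Longrightarrow> \<pi> i \<bullet> f = \<pi> i \<bullet> g"
  shows "f = g"
proof -
  note b = is_biprodD[OF assms(1)]
  have *: "h = hsum C Y B (\<lambda>i. \<iota> i \<bullet> (\<pi> i \<bullet> h)) I" if h: "h \<in> Hom C Y B" for h
  proof -
    have "h = hsum C B B (\<lambda>i. \<iota> i \<bullet> \<pi> i) I \<bullet> h" using b h by (simp add: Hom_def)
    also have "\<dots> = hsum C Y B (\<lambda>i. (\<iota> i \<bullet> \<pi> i) \<bullet> h) I"
      using b h by (intro hsum_cmp_right) (auto simp: Hom_def)
    also have "\<dots> = hsum C Y B (\<lambda>i. \<iota> i \<bullet> (\<pi> i \<bullet> h)) I"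
      using b h HomD[OF h] by (intro hsum_cong) (auto simp: Hom_def)
    finally show ?thesis .
  qed
  have "hsum C Y B (\<lambda>i. \<iota> i \<bullet> (\<pi> i \<bullet> f)) I = hsum C Y B (\<lambda>i. \<iota> i \<bullet> (\<pi> i \<bullet> g)) I"
    using b assms HomD[OF assms(2)] by (intro hsum_cong) (auto simp: Hom_def)
  then show ?thesis using *[OF assms(2)] *[OF assms(3)] by simp
qed

lemma biprod_eqI_in:
  assumes "is_biprod C I X B \<iota> \<pi>" "f \<in> Hom C B Y" "g \<in> Hom C B Y"
    "\<And>i. i \<in> I \<Longrightarrow> f \<bullet> \<iota> i = g \<bullet> \<iota> i"
  shows "f = g"
proof -
  note b = is_biprodD[OF assms(1)]
  have *: "h = hsum C B Y (\<lambda>i. (h \<bullet> \<iota> i) \<bullet> \<pi> i) I" if h: "h \<in> Hom C B Y" for h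
  proof -
    have "h = h \<bullet> hsum C B B (\<lambda>i. \<iota> i \<bullet> \<pi> i) I" using b h by (simp add: Hom_def)
    also have "\<dots> = hsum C B Y (\<lambda>i. h \<bullet> (\<iota> i \<bullet> \<pi> i)) I"
      using b h by (intro hsum_cmp_left) (auto simp: Hom_def)
    also have "\<dots> = hsum C B Y (\<lambda>i. (h \<bullet> \<iota> i) \<bullet> \<pi> i) I"
      using b h HomD[OF h] by (intro hsum_cong) (auto simp: Hom_def)
    finally show ?thesis .
  qed
  have "hsum C B Y (\<lambda>i. (f \<bullet> \<iota> i) \<bullet> \<pi> i) I = hsum C B Y (\<lambda>i. (g \<bullet> \<iota> i) \<bullet> \<pi> i) I"
    using b assms HomD[OF assms(2)] by (intro hsum_cong) (auto simp: Hom_def)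
  then show ?thesis using *[OF assms(2)] *[OF assms(3)] by simp
qed

lemma biprod_lift:
  assumes "is_biprod C I X B \<iota> \<pi>" "Y \<in> Ob C" "\<And>i. i \<in> I \<Longrightarrow> u i \<in> Hom C Y (X i)"
  obtains v where "v \<in> Hom C Y B" "\<And>i. i \<in> I \<Longrightarrow> \<pi> i \<bullet> v = u i"
proof
  note b = is_biprodD[OF assms(1)]
  let ?v = "hsum C Y B (\<lambda>i. \<iota> i \<bullet> u i) I"
  show "?v \<in> Hom C Y B" using b assms by (intro hsum_Hom) (auto simp: Hom_def)
  fix i assume i: "i \<in> I"
  have *: "\<pi> i \<bullet> (\<iota> j \<bullet> u j) = (if j = i then u i else Zero C Y (X i))" if j: "j \<in> I" for j
  proof -
    have "\<pi> i \<bullet> (\<iota> j \<bullet> u j) = (\<pi> i \<bullet> \<iota> j) \<bullet> u j"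
      using b assms i j by (intro cmp_assoc[symmetric]) auto
    then show ?thesis using b(3,6,7) assms(3)[OF j] i j by (auto simp: Hom_def)
  qed
  have "\<pi> i \<bullet> ?v = hsum C Y (X i) (\<lambda>j. \<pi> i \<bullet> (\<iota> j \<bullet> u j)) I"
    using b assms i by (intro hsum_cmp_left) (auto simp: Hom_def)
  also have "\<dots> = \<pi> i \<bullet> (\<iota> i \<bullet> u i)" using b assms i * by (intro hsum_single) auto
  finally show "\<pi> i \<bullet> ?v = u i" using * i by simp
qed

lemma biprod_colift:
  assumes "is_biprod C I X B \<iota> \<pi>" "Y \<in> Ob C" "\<And>i. i \<in> I \<Longrightarrow> u i \<in> Hom C (X i) Y"
  obtains v where "v \<in> Hom C B Y" "\<And>i. i \<in> I \<Longrightarrow> v \<bullet> \<iota> i = u i"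
proof
  note b = is_biprodD[OF assms(1)]
  let ?v = "hsum C B Y (\<lambda>i. u i \<bullet> \<pi> i) I"
  show "?v \<in> Hom C B Y" using b assms by (intro hsum_Hom) (auto simp: Hom_def)
  fix i assume i: "i \<in> I"
  have *: "(u j \<bullet> \<pi> j) \<bullet> \<iota> i = (if j = i then u i else Zero C (X i) Y)" if j: "j \<in> I" for j
  proof -
    have "(u j \<bullet> \<pi> j) \<bullet> \<iota> i = u j \<bullet> (\<pi> j \<bullet> \<iota> i)"
      using b assms i j by (intro cmp_assoc) auto
    then show ?thesis using b(3,6,7) assms(3)[OF j] i j by (auto simp: Hom_def)
  qed
  have "?v \<bullet> \<iota> i = hsum C (X i) Y (\<lambda>j. (u j \<bullet> \<pi> j) \<bullet> \<iota> i) I"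
    using b assms i by (intro hsum_cmp_right) (auto simp: Hom_def)
  also have "\<dots> = (u i \<bullet> \<pi> i) \<bullet> \<iota> i" using b assms i * by (intro hsum_single) auto
  finally show "?v \<bullet> \<iota> i = u i" using * i by simp
qed

end

section \<open>Finite biproducts in an abelian category\<close>

context abelian_category
begin

lemma zobj_zero: "zero_object C (zobj C)"
  unfolding zobj_def using ex_zero by (rule someI_ex)

lemma zobj_Ob [simp]: "zobj C \<in> Ob C"
  using zobj_zero by (rule zero_object_Ob)

text \<open>The axioms supply a zero object and binary biproducts. A new summand \<open>X k\<close>
  is adjoined to the biproduct \<open>B\<close> of the others by a binary biproduct with index
  \<open>True\<close> for \<open>X k\<close> and \<open>False\<close> for \<open>B\<close>; the old
  inclusions and projections are composed with those of \<open>B\<close>.\<close>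

lemma finite_biprod_exists:
  assumes "finite I" "\<And>i. i \<in> I \<Longrightarrow> X i \<in> Ob C"
  shows "\<exists>B \<iota> \<pi>. is_biprod C I X B \<iota> \<pi>"
  using assms
proof (induction I)
  case empty
  have "is_biprod C {} X (zobj C) undefined undefined"
    using zobj_zero by (simp add: is_biprod_def zero_object_iff)
  then show ?case by blast
next
  case (insert k I)
  then obtain B \<iota> \<pi> where B: "is_biprod C I X B \<iota> \<pi>" by auto
  note b = is_biprodD[OF B]
  have k: "X k \<in> Ob C" using insert by simp
  obtain B' a p where B': "is_biprod C (UNIV :: bool set) (\<lambda>c. if c then X k else B) B' a p"
    using ex_biprod[OF k b(2)] by blast
  have b': "B' \<in> Ob C" "hsum C B' B' (\<lambda>i. a i \<bullet> p i) UNIV = Id C B'"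
    using is_biprodD(2,8)[OF B'] by auto
  have a: "a True \<in> Hom C (X k) B'" "a False \<in> Hom C B B'" "p True \<in> Hom C B' (X k)" "p False \<in> Hom C B' B"
    using is_biprodD(4,5)[OF B', of True] is_biprodD(4,5)[OF B', of False] by auto
  have pa: "p True \<bullet> a True = Id C (X k)" "p False \<bullet> a False = Id C B"
    "p False \<bullet> a True = Zero C (X k) B" "p True \<bullet> a False = Zero C B (X k)"
    using is_biprodD(6)[OF B', of True] is_biprodD(6)[OF B', of False]
      is_biprodD(7)[OF B', of True False] is_biprodD(7)[OF B', of False True] by auto
  have s: "Add C (a True \<bullet> p True) (a False \<bullet> p False) = Id C B'"
  proof -
    have ap: "a c \<bullet> p c \<in> Hom C B' B'" for c using a by (cases c) (auto simp: Hom_def)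
    have "hsum C B' B' (\<lambda>i. a i \<bullet> p i) {True, False} = Id C B'"
      using b'(2) by (simp add: UNIV_bool insert_commute)
    moreover have "hsum C B' B' (\<lambda>i. a i \<bullet> p i) {True, False}
        = Add C (a True \<bullet> p True) (hsum C B' B' (\<lambda>i. a i \<bullet> p i) {False})"
      using b'(1) ap by (intro hsum_insert) auto
    moreover have "hsum C B' B' (\<lambda>i. a i \<bullet> p i) {False} = a False \<bullet> p False"
      using b'(1) ap by (intro hsum_single) auto
    ultimately show ?thesis by simp
  qed
  define \<iota>' where "\<iota>' = (\<lambda>i. if i = k then a True else a False \<bullet> \<iota> i)"
  define \<pi>' where "\<pi>' = (\<lambda>i. if i = k then p True else \<pi> i \<bullet> p False)"
  have nk: "i \<noteq> k" if "i \<in> I" for i using insert that by auto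
  have hom: "\<iota>' i \<in> Hom C (X i) B'" "\<pi>' i \<in> Hom C B' (X i)" if "i \<in> insert k I" for i
    using that a b(4,5)[of i] nk by (auto simp: \<iota>'_def \<pi>'_def intro: cmp_hom)
  have mid: "x \<bullet> (p c \<bullet> (a d \<bullet> y)) = x \<bullet> ((p c \<bullet> a d) \<bullet> y)" if "y \<in> Mor C" "Cod C y = Dom C (a d)" for x y c d
    using that a by (cases c; cases d) (auto simp: Hom_def)
  have pi_iota: "\<pi>' j \<bullet> \<iota>' i = (if i = j then Id C (X i) else Zero C (X i) (X j))"
    if "i \<in> insert k I" "j \<in> insert k I" for i j
  proof -
    have 1: "(p True \<bullet> a False) \<bullet> \<iota> i = Zero C (X i) (X k)" if "i \<in> I"
      using b(4)[OF that] k pa by (simp add: Hom_def)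
    have 2: "\<pi> j \<bullet> (p False \<bullet> a True) = Zero C (X k) (X j)" if "j \<in> I"
      using b(5)[OF that] k pa by (simp add: Hom_def)
    have 3: "\<pi> j \<bullet> ((p False \<bullet> a False) \<bullet> \<iota> i) = \<pi> j \<bullet> \<iota> i" if "i \<in> I" "j \<in> I"
      using b(4)[OF that(1)] pa by (simp add: Hom_def)
    show ?thesis
      using that nk a pa(1) 1 2 3 b(4,5,6,7) by (auto simp: \<iota>'_def \<pi>'_def Hom_def)
  qed
  have "hsum C B' B' (\<lambda>i. \<iota>' i \<bullet> \<pi>' i) (insert k I)
      = Add C (\<iota>' k \<bullet> \<pi>' k) (hsum C B' B' (\<lambda>i. \<iota>' i \<bullet> \<pi>' i) I)"
    using insert b'(1) hom by (intro hsum_insert) (auto simp: Hom_def)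
  moreover have "hsum C B' B' (\<lambda>i. \<iota>' i \<bullet> \<pi>' i) I = a False \<bullet> p False"
  proof -
    have "a False \<bullet> p False = a False \<bullet> (hsum C B B (\<lambda>i. \<iota> i \<bullet> \<pi> i) I \<bullet> p False)"
      using a b(8) by (simp add: Hom_def)
    also have "hsum C B B (\<lambda>i. \<iota> i \<bullet> \<pi> i) I \<bullet> p False = hsum C B' B (\<lambda>i. (\<iota> i \<bullet> \<pi> i) \<bullet> p False) I"
      using a b by (intro hsum_cmp_right) (auto simp: Hom_def)
    also have "a False \<bullet> \<dots> = hsum C B' B' (\<lambda>i. a False \<bullet> ((\<iota> i \<bullet> \<pi> i) \<bullet> p False)) I"
      using a b b'(1) by (intro hsum_cmp_left) (auto simp: Hom_def)
    also have "\<dots> = hsum C B' B' (\<lambda>i. \<iota>' i \<bullet> \<pi>' i) I"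
    proof (rule hsum_cong)
      fix i assume i: "i \<in> I"
      show "\<iota>' i \<bullet> \<pi>' i \<in> Hom C B' B'" using hom i by (auto simp: Hom_def)
      show "a False \<bullet> ((\<iota> i \<bullet> \<pi> i) \<bullet> p False) = \<iota>' i \<bullet> \<pi>' i"
        using i nk[OF i] a b(4,5)[OF i] by (simp add: \<iota>'_def \<pi>'_def Hom_def)
    qed (use b' in auto)
    finally show ?thesis by simp
  qed
  ultimately have "hsum C B' B' (\<lambda>i. \<iota>' i \<bullet> \<pi>' i) (insert k I) = Id C B'"
    using s by (simp add: \<iota>'_def \<pi>'_def)
  then have "is_biprod C (insert k I) X B' \<iota>' \<pi>'"
    unfolding is_biprod_def using insert b'(1) hom pi_iota by auto
  then show ?case by blast
qed

text \<open>The chosen biproduct satisfies the equations for its own structure maps.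
  \<open>bp_in\<close> and \<open>bp_pr\<close> are tied to these on \<open>I\<close> only, so the
  sum that represents the identity is compared term by term over \<open>I\<close>.\<close>

lemma bp_biprod:
  assumes "finite I" "\<And>i. i \<in> I \<Longrightarrow> X i \<in> Ob C"
  shows "is_biprod C I X (bp_ob C I X) (bp_in C I X) (bp_pr C I X)"
proof -
  have "\<exists>z. case z of (B, \<iota>, \<pi>) \<Rightarrow> is_biprod C I X B \<iota> \<pi>"
    using finite_biprod_exists[OF assms] by auto
  then have "case chosen_biprod C I X of (B, \<iota>, \<pi>) \<Rightarrow> is_biprod C I X B \<iota> \<pi>"
    unfolding chosen_biprod_def by (rule someI_ex)
  then have *: "is_biprod C I X (bp_ob C I X) (fst (snd (chosen_biprod C I X))) (snd (snd (chosen_biprod C I X)))"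
    by (simp add: bp_ob_def case_prod_beta)
  note b = is_biprodD[OF *]
  have "hsum C (bp_ob C I X) (bp_ob C I X) (\<lambda>i. bp_in C I X i \<bullet> bp_pr C I X i) I = Id C (bp_ob C I X)"
    unfolding b(8)[symmetric]
    using b by (intro hsum_cong) (auto simp: bp_in_def bp_pr_def intro: cmp_hom)
  then show ?thesis
    unfolding is_biprod_def using b by (auto simp: bp_in_def bp_pr_def)
qed

end

section \<open>Semisimplicity\<close>

context linear_category
begin

lemma mono_cancel:
  assumes "mono_mor C f" "g \<in> Mor C" "h \<in> Mor C" "Dom C g = Dom C h" "Cod C g = Dom C f"
    "Cod C h = Dom C f" "f \<bullet> g = f \<bullet> h"
  shows "g = h"
proof -
  have "g \<in> Hom C (Dom C h) (Dom C f)" "h \<in> Hom C (Dom C h) (Dom C f)" using assms by auto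
  then show ?thesis using assms(1,7) unfolding mono_mor_def by blast
qed

lemma epi_cancel:
  assumes "epi_mor C f" "g \<in> Mor C" "h \<in> Mor C" "Cod C g = Cod C h" "Dom C g = Cod C f"
    "Dom C h = Cod C f" "g \<bullet> f = h \<bullet> f"
  shows "g = h"
proof -
  have "g \<in> Hom C (Cod C f) (Cod C h)" "h \<in> Hom C (Cod C f) (Cod C h)" using assms by auto
  then show ?thesis using assms(1,7) unfolding epi_mor_def by blast
qed

lemma is_kernelD:
  assumes "is_kernel C f k"
  shows "f \<in> Mor C" "k \<in> Mor C" "Cod C k = Dom C f" "f \<bullet> k = Zero C (Dom C k) (Cod C f)" "mono_mor C k"
proof -
  show *: "f \<in> Mor C" "k \<in> Mor C" "Cod C k = Dom C f" "f \<bullet> k = Zero C (Dom C k) (Cod C f)"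
    using assms unfolding is_kernel_def by auto
  show "mono_mor C k"
    unfolding mono_mor_def
  proof (intro conjI allI ballI impI)
    fix Z g h assume g: "g \<in> Hom C Z (Dom C k)" and h: "h \<in> Hom C Z (Dom C k)" and eq: "k \<bullet> g = k \<bullet> h"
    have "f \<bullet> (k \<bullet> g) = (f \<bullet> k) \<bullet> g" using *(1-3) g by (simp add: Hom_def)
    also have "\<dots> = Zero C Z (Cod C f)" unfolding *(4) using * g by (simp add: Hom_def)
    finally have "f \<bullet> (k \<bullet> g) = Zero C Z (Cod C f)" .
    moreover have "k \<bullet> g \<in> Hom C Z (Dom C f)" using * g by (simp add: Hom_def)
    ultimately have "\<exists>!x. x \<in> Hom C Z (Dom C k) \<and> k \<bullet> x = k \<bullet> g"
      using assms unfolding is_kernel_def by blast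
    then show "g = h" using g h eq by auto
  qed (rule *(2))
qed

lemma is_kernel_factor:
  assumes "is_kernel C f k" "g \<in> Mor C" "Cod C g = Dom C f" "f \<bullet> g = Zero C (Dom C g) (Cod C f)"
  obtains h where "h \<in> Mor C" "Dom C h = Dom C g" "Cod C h = Dom C k" "k \<bullet> h = g"
proof -
  have "g \<in> Hom C (Dom C g) (Dom C f)" using assms by auto
  then obtain h where "h \<in> Hom C (Dom C g) (Dom C k)" "k \<bullet> h = g"
    using assms(1,4) unfolding is_kernel_def by blast
  then show ?thesis using that HomD by blast
qed

lemma is_cokernelD:
  assumes "is_cokernel C f q"
  shows "f \<in> Mor C" "q \<in> Mor C" "Dom C q = Cod C f" "q \<bullet> f = Zero C (Dom C f) (Cod C q)" "epi_mor C q"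
proof -
  show *: "f \<in> Mor C" "q \<in> Mor C" "Dom C q = Cod C f" "q \<bullet> f = Zero C (Dom C f) (Cod C q)"
    using assms unfolding is_cokernel_def by auto
  show "epi_mor C q"
    unfolding epi_mor_def
  proof (intro conjI allI ballI impI)
    fix Z g h assume g: "g \<in> Hom C (Cod C q) Z" and h: "h \<in> Hom C (Cod C q) Z" and eq: "g \<bullet> q = h \<bullet> q"
    have "(g \<bullet> q) \<bullet> f = Zero C (Dom C f) Z" using * g HomD(5)[OF g] by (simp add: Hom_def)
    moreover have "g \<bullet> q \<in> Hom C (Cod C f) Z" using * g by (simp add: Hom_def)
    ultimately have "\<exists>!x. x \<in> Hom C (Cod C q) Z \<and> x \<bullet> q = g \<bullet> q"
      using assms unfolding is_cokernel_def by blast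
    then show "g = h" using g h eq by auto
  qed (rule *(2))
qed

lemma is_cokernel_factor:
  assumes "is_cokernel C f q" "g \<in> Mor C" "Dom C g = Cod C f" "g \<bullet> f = Zero C (Dom C f) (Cod C g)"
  obtains h where "h \<in> Mor C" "Cod C h = Cod C g" "Dom C h = Cod C q" "h \<bullet> q = g"
proof -
  have "g \<in> Hom C (Cod C f) (Cod C g)" using assms by auto
  then obtain h where "h \<in> Hom C (Cod C q) (Cod C g)" "h \<bullet> q = g"
    using assms(1,4) unfolding is_cokernel_def by blast
  then show ?thesis using that HomD by blast
qed

text \<open>If \<open>f \<bullet> g = f \<bullet> h\<close>, then the difference of \<open>g\<close>
  and \<open>h\<close> factors through the kernel, which is a zero object.\<close>

lemma mono_of_zero_kernel:
  assumes k: "is_kernel C f k" and z: "zero_object C (Dom C k)"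
  shows "mono_mor C f"
  unfolding mono_mor_def
proof (intro conjI allI ballI impI)
  note kD = is_kernelD[OF k]
  show "f \<in> Mor C" by (rule kD)
  fix Z g h assume g: "g \<in> Hom C Z (Dom C f)" and h: "h \<in> Hom C Z (Dom C f)" and eq: "f \<bullet> g = f \<bullet> h"
  have "f \<bullet> Sub g h = Zero C Z (Cod C f)" using kD(1) g h eq by (simp add: Hom_def)
  then obtain x where x: "x \<in> Mor C" "Dom C x = Z" "Cod C x = Dom C k" "k \<bullet> x = Sub g h"
    using is_kernel_factor[OF k, of "Sub g h"] g h by (auto simp: Hom_def)
  have "x = Zero C Z (Dom C k)" using into_zero_object[OF z x(1,3)] x by simp
  then have "Sub g h = Zero C Z (Dom C f)" using x(4) kD HomD[OF g] by simp
  then show "g = h" using Sub_eq_Zero g h by (auto simp: Hom_def)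
qed

end

section \<open>Schur's lemma\<close>

context abelian_category
begin

text \<open>Simplicity is a condition on monomorphisms into the object. Applied to the kernel of
  \<open>f\<close>, which cannot be invertible because \<open>f\<close> is nonzero, it makes
  \<open>f\<close> a monomorphism; applied to \<open>f\<close> itself, whose domain is not zero, it
  makes \<open>f\<close> invertible.\<close>

lemma Schur:
  assumes S: "simple_object C S" and T: "simple_object C T" and f: "f \<in> Hom C S T" "f \<noteq> Zero C S T"
  shows "is_iso C f"
proof -
  note fD = HomD[OF f(1)]
  obtain k where k: "is_kernel C f k" using ex_kernel fD(1) by blast
  note kD = is_kernelD[OF k]
  have "\<not> is_iso C k"
  proof
    assume "is_iso C k"
    then obtain l where l: "l \<in> Mor C" "Dom C l = S" "Cod C l = Dom C k" "k \<bullet> l = Id C S"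
      using kD(3) fD by (elim is_isoE) auto
    have "f = f \<bullet> (k \<bullet> l)" using l fD by simp
    also have "\<dots> = (f \<bullet> k) \<bullet> l" using l(1-3) fD kD(1-3) by simp
    also have "\<dots> = Zero C S T" using l(1-3) fD kD by simp
    finally show False using f(2) by simp
  qed
  then have "zero_object C (Dom C k)"
    using S kD fD unfolding simple_object_def by auto
  then have "mono_mor C f" using k mono_of_zero_kernel by blast
  then show ?thesis using T S fD unfolding simple_object_def by auto
qed

lemma Schur_zero:
  assumes "simple_object C S" "simple_object C T" "f \<in> Hom C S T" "\<not> isomorphic C S T"
  shows "f = Zero C S T"
  using Schur[OF assms(1,2,3)] assms(3,4) unfolding isomorphic_def by blast

lemma simple_object_Ob: "simple_object C S \<Longrightarrow> S \<in> Ob C"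
  by (simp add: simple_object_def)

lemma simple_Id: "simple_object C S \<Longrightarrow> Id C S \<noteq> Zero C S S"
  by (simp add: simple_object_def zero_object_iff)

end

section \<open>Splittings over a semisimple category\<close>

context semisimple_tensor_category
begin

text \<open>Some component of \<open>y\<close> in a decomposition of \<open>X\<close> into simple
  objects is nonzero, hence invertible by Schur's lemma. The projection to that summand followed by
  the inverse is the retraction.\<close>

lemma simple_split:
  assumes S: "simple_object C S" and y: "y \<in> Hom C S X" "y \<noteq> Zero C S X"
  obtains t where "t \<in> Hom C X S" "t \<bullet> y = Id C S"
proof -
  note yD = HomD[OF y(1)]
  obtain n T \<iota> \<pi> where T: "\<forall>i<n. simple_object C (T i)" and B: "is_biprod C {..<n::nat} T X \<iota> \<pi>"
    using semisimple[OF yD(5)] by blast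
  note b = is_biprodD[OF B]
  have "\<exists>i<n. \<pi> i \<bullet> y \<noteq> Zero C S (T i)"
  proof (rule ccontr)
    assume *: "\<not> ?thesis"
    have "y = Zero C S X"
    proof (rule biprod_eqI_pr[OF B y(1)])
      fix i assume "i \<in> {..<n}"
      then show "\<pi> i \<bullet> y = \<pi> i \<bullet> Zero C S X" using * b(5)[of i] yD by (simp add: Hom_def)
    qed (use yD in auto)
    then show False using y(2) by simp
  qed
  then obtain i where i: "i < n" "\<pi> i \<bullet> y \<noteq> Zero C S (T i)" by blast
  have pi: "\<pi> i \<in> Hom C X (T i)" using b(5)[of i] i by simp
  have "is_iso C (\<pi> i \<bullet> y)"
    using Schur[OF S _ _ i(2)] T i(1) cmp_hom[OF y(1) pi] by blast
  then obtain g where g: "g \<in> Mor C" "Dom C g = T i" "Cod C g = S" "g \<bullet> (\<pi> i \<bullet> y) = Id C S"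
    using yD pi by (elim is_isoE) (auto simp: Hom_def)
  show ?thesis
    by (rule that[of "g \<bullet> \<pi> i"]) (use g pi yD in \<open>auto simp: Hom_def\<close>)
qed

lemma nonzero_simple_map:
  assumes "X \<in> Ob C" "\<not> zero_object C X"
  shows "\<exists>S. simple_object C S \<and> (\<exists>y \<in> Hom C S X. y \<noteq> Zero C S X)"
proof (rule ccontr)
  assume *: "\<not> ?thesis"
  obtain n T \<iota> \<pi> where T: "\<forall>i<n. simple_object C (T i)" and B: "is_biprod C {..<n::nat} T X \<iota> \<pi>"
    using semisimple[OF assms(1)] by blast
  have "Id C X = Zero C X X"
  proof (rule biprod_eqI_in[OF B])
    fix i assume i: "i \<in> {..<n}"
    have "\<iota> i = Zero C (T i) X" using * T i is_biprodD(4)[OF B i] by auto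
    then show "Id C X \<bullet> \<iota> i = Zero C X X \<bullet> \<iota> i"
      using is_biprodD(3)[OF B i] assms(1) by simp
  qed (use assms in auto)
  then show False using assms by (simp add: zero_object_iff)
qed

text \<open>Every morphism has a generalized inverse; applied to differentials, this is the source
  of all homotopies that split complexes. The induction is on the number of simple summands of the
  domain on which \<open>f\<close> does not vanish: a retraction of one such summand removes it, and
  the generalized inverse of the remaining part is corrected to one of \<open>f\<close>.\<close>

lemma regular:
  assumes "f \<in> Hom C X Y"
  shows "\<exists>g \<in> Hom C Y X. f \<bullet> (g \<bullet> f) = f"
proof -
  note Ob = HomD(4,5)[OF assms]
  obtain n T \<iota> \<pi> where T: "\<forall>i<n. simple_object C (T i)" and B: "is_biprod C {..<n::nat} T X \<iota> \<pi>"
    using semisimple[OF Ob(1)] by blast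
  note b = is_biprodD[OF B]
  show ?thesis
    using assms
  proof (induction "card {i. i < n \<and> f \<bullet> \<iota> i \<noteq> Zero C (T i) Y}" arbitrary: f rule: less_induct)
    case less
    note fD = HomD[OF less.prems]
    show ?case
    proof (cases "\<exists>i<n. f \<bullet> \<iota> i \<noteq> Zero C (T i) Y")
      case False
      have "f = Zero C X Y"
      proof (rule biprod_eqI_in[OF B less.prems])
        fix i assume "i \<in> {..<n}"
        then show "f \<bullet> \<iota> i = Zero C X Y \<bullet> \<iota> i" using False b(4)[of i] Ob by (simp add: Hom_def)
      qed (use Ob in auto)
      then show ?thesis using Ob by (intro bexI[of _ "Zero C Y X"]) auto
    next
      case True
      then obtain i where i: "i < n" "f \<bullet> \<iota> i \<noteq> Zero C (T i) Y" by blast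
      have io: "\<iota> i \<in> Mor C" "Dom C (\<iota> i) = T i" "Cod C (\<iota> i) = X" using b(4)[of i] i by (auto simp: Hom_def)
      obtain t where t: "t \<in> Hom C Y (T i)" "t \<bullet> (f \<bullet> \<iota> i) = Id C (T i)"
        using simple_split[of "T i" "f \<bullet> \<iota> i" Y] T i cmp_hom[of "\<iota> i" "T i" X f Y] io less.prems by blast
      note tD = HomD[OF t(1)]
      define a where "a = \<iota> i \<bullet> t"
      have a: "a \<in> Mor C" "Dom C a = Y" "Cod C a = X" using io tD by (auto simp: a_def)
      \<comment> \<open>As \<open>t\<close> retracts \<open>f \<bullet> \<iota> i\<close>, the
        morphism \<open>a\<close> satisfies \<open>a f a = a\<close>, so \<open>P\<close> and
        \<open>Q\<close> are the idempotents complementary to \<open>a f\<close> and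
        \<open>f a\<close>. The relation \<open>f P = Q f\<close> turns a generalized inverse
        \<open>c\<close> of \<open>Q f\<close> into \<open>a + P c Q\<close> for
        \<open>f\<close>.\<close>
      define P where "P = Sub (Id C X) (a \<bullet> f)"
      define Q where "Q = Sub (Id C Y) (f \<bullet> a)"
      have PQ: "P \<in> Mor C" "Dom C P = X" "Cod C P = X" "Q \<in> Mor C" "Dom C Q = Y" "Cod C Q = Y"
        using a fD Ob by (auto simp: P_def Q_def)
      have fPQ: "f \<bullet> P = Q \<bullet> f" using a fD Ob by (simp add: P_def Q_def)
      have decomp: "Add C (f \<bullet> (a \<bullet> f)) (Q \<bullet> f) = f"
        using a fD Ob add_Sub[of f "f \<bullet> (a \<bullet> f)"] by (simp add: Q_def)
      have kill: "(Q \<bullet> f) \<bullet> \<iota> i = Zero C (T i) Y"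
        using a fD Ob io t(2) tD by (simp add: Q_def a_def)
      have keep: "(Q \<bullet> f) \<bullet> \<iota> j = Zero C (T j) Y" if "j < n" "f \<bullet> \<iota> j = Zero C (T j) Y" for j
        using that PQ fD b(3,4)[of j] by (simp add: Hom_def)
      have "{j. j < n \<and> (Q \<bullet> f) \<bullet> \<iota> j \<noteq> Zero C (T j) Y} \<subset> {j. j < n \<and> f \<bullet> \<iota> j \<noteq> Zero C (T j) Y}"
        using kill keep i by (intro psubsetI subsetI) blast+
      then have "card {j. j < n \<and> (Q \<bullet> f) \<bullet> \<iota> j \<noteq> Zero C (T j) Y} < card {j. j < n \<and> f \<bullet> \<iota> j \<noteq> Zero C (T j) Y}"
        by (intro psubset_card_mono finite_Collect_conjI) simp_all
      moreover have "Q \<bullet> f \<in> Hom C X Y" using PQ fD by (auto simp: Hom_def)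
      ultimately have "\<exists>c \<in> Hom C Y X. (Q \<bullet> f) \<bullet> (c \<bullet> (Q \<bullet> f)) = Q \<bullet> f"
        by (rule less.hyps)
      then obtain c where c: "c \<in> Hom C Y X" "(Q \<bullet> f) \<bullet> (c \<bullet> (Q \<bullet> f)) = Q \<bullet> f" by blast
      note cD = HomD[OF c(1)]
      have "f \<bullet> (P \<bullet> (c \<bullet> (Q \<bullet> f))) = (f \<bullet> P) \<bullet> (c \<bullet> (Q \<bullet> f))"
        using PQ fD cD by simp
      also have "\<dots> = Q \<bullet> f" unfolding fPQ by (rule c(2))
      finally have e2: "f \<bullet> (P \<bullet> (c \<bullet> (Q \<bullet> f))) = Q \<bullet> f" .
      have "f \<bullet> (Add C a (P \<bullet> (c \<bullet> Q)) \<bullet> f) = Add C (f \<bullet> (a \<bullet> f)) (f \<bullet> (P \<bullet> (c \<bullet> (Q \<bullet> f))))"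
        using PQ fD(1-3) cD(1-3) a by simp
      also have "\<dots> = f" unfolding e2 by (rule decomp)
      finally have "f \<bullet> (Add C a (P \<bullet> (c \<bullet> Q)) \<bullet> f) = f" .
      moreover have "Add C a (P \<bullet> (c \<bullet> Q)) \<in> Hom C Y X"
        using PQ cD(1-3) a by auto
      ultimately show ?thesis by blast
    qed
  qed
qed

end

section \<open>Cohomology of complexes over a semisimple category\<close>

lemma bounded_complexesD:
  assumes "category C" "K \<in> bounded_complexes C"
  shows "cO K i \<in> Ob C" "cD K i \<in> Mor C" "Dom C (cD K i) = cO K i" "Cod C (cD K i) = cO K (i + 1)"
    "cD K (i + 1) \<bullet>\<^bsub>C\<^esub> cD K i = Zero C (cO K i) (cO K (i + 1 + 1))"
    "cD K i \<bullet>\<^bsub>C\<^esub> cD K (i - 1) = Zero C (cO K (i - 1)) (cO K (i + 1))"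
proof -
  show *: "cO K i \<in> Ob C" "cD K i \<in> Mor C" "Dom C (cD K i) = cO K i" "Cod C (cD K i) = cO K (i + 1)"
    "cD K (i + 1) \<bullet>\<^bsub>C\<^esub> cD K i = Zero C (cO K i) (cO K (i + 1 + 1))" for i
    using assms(2) by (auto simp: bounded_complexes_def Hom_def)
  show "cD K i \<bullet>\<^bsub>C\<^esub> cD K (i - 1) = Zero C (cO K (i - 1)) (cO K (i + 1))"
    using *(5)[of "i - 1"] by simp
qed

lemma chain_mapsD:
  assumes "category C" "f \<in> chain_maps C"
  shows "src f \<in> bounded_complexes C" "tgt f \<in> bounded_complexes C"
    "cm f i \<in> Mor C" "Dom C (cm f i) = cO (src f) i" "Cod C (cm f i) = cO (tgt f) i"
    "cD (tgt f) i \<bullet>\<^bsub>C\<^esub> cm f i = cm f (i + 1) \<bullet>\<^bsub>C\<^esub> cD (src f) i"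
    "cm f i \<bullet>\<^bsub>C\<^esub> cD (src f) (i - 1) = cD (tgt f) (i - 1) \<bullet>\<^bsub>C\<^esub> cm f (i - 1)"
proof -
  show *: "src f \<in> bounded_complexes C" "tgt f \<in> bounded_complexes C"
    "cm f i \<in> Mor C" "Dom C (cm f i) = cO (src f) i" "Cod C (cm f i) = cO (tgt f) i"
    "cD (tgt f) i \<bullet>\<^bsub>C\<^esub> cm f i = cm f (i + 1) \<bullet>\<^bsub>C\<^esub> cD (src f) i" for i
    using assms by (auto simp: chain_maps_def Hom_def)
  show "cm f i \<bullet>\<^bsub>C\<^esub> cD (src f) (i - 1) = cD (tgt f) (i - 1) \<bullet>\<^bsub>C\<^esub> cm f (i - 1)"
    using *(6)[of "i - 1"] by simp
qed

text \<open>The maps \<open>p\<close> and \<open>j\<close> make the cohomology a retract of the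
  terms of the complex, and \<open>h\<close> is a homotopy from the identity to \<open>j p\<close>.
  The last clause ties \<open>p\<close> to the quotient map selected by \<open>cohom_pr\<close>, so
  that maps induced on cohomology can be computed with \<open>p\<close> and
  \<open>j\<close>.\<close>

definition cohom_data :: "('o, 'm, 'k, 'x) lincat_scheme \<Rightarrow> ('o, 'm) cpx \<Rightarrow>
    (int \<Rightarrow> 'm) \<Rightarrow> (int \<Rightarrow> 'm) \<Rightarrow> (int \<Rightarrow> 'm) \<Rightarrow> bool" where
  "cohom_data C K p j h \<longleftrightarrow> (\<forall>i.
     cohom C K i \<in> Ob C \<and> p i \<in> Hom C (cO K i) (cohom C K i) \<and> j i \<in> Hom C (cohom C K i) (cO K i) \<and>
     h i \<in> Hom C (cO K i) (cO K (i - 1)) \<and>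
     p i \<bullet>\<^bsub>C\<^esub> j i = Id C (cohom C K i) \<and>
     cD K i \<bullet>\<^bsub>C\<^esub> j i = Zero C (cohom C K i) (cO K (i + 1)) \<and>
     p i \<bullet>\<^bsub>C\<^esub> cD K (i - 1) = Zero C (cO K (i - 1)) (cohom C K i) \<and>
     Add C (j i \<bullet>\<^bsub>C\<^esub> p i) (Add C (cD K (i - 1) \<bullet>\<^bsub>C\<^esub> h i) (h (i + 1) \<bullet>\<^bsub>C\<^esub> cD K i)) = Id C (cO K i) \<and>
     p i \<bullet>\<^bsub>C\<^esub> cycles C K i = cohom_pr C K i)"

context semisimple_tensor_category
begin

lemma cat: "category C" ..

lemmas cpxD [simp] = bounded_complexesD[OF cat]
lemmas cmapD = chain_mapsD[OF cat]

lemma cycles_kernel: "K \<in> bounded_complexes C \<Longrightarrow> is_kernel C (cD K i) (cycles C K i)"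
  unfolding cycles_def by (rule someI_ex) (simp add: ex_kernel)

lemma boundary_arrow:
  assumes K: "K \<in> bounded_complexes C"
  shows "boundary C K i \<in> Mor C" "Dom C (boundary C K i) = cO K (i - 1)"
    "Cod C (boundary C K i) = Dom C (cycles C K i)" "cycles C K i \<bullet> boundary C K i = cD K (i - 1)"
proof -
  note z = cycles_kernel[OF K, of i]
  have "\<exists>!b. b \<in> Hom C (cO K (i - 1)) (Dom C (cycles C K i)) \<and> cycles C K i \<bullet> b = cD K (i - 1)"
  proof -
    have "cD K (i - 1) \<in> Hom C (cO K (i - 1)) (Dom C (cD K i))"
      "cD K i \<bullet> cD K (i - 1) = Zero C (cO K (i - 1)) (Cod C (cD K i))"
      using K by auto
    then show ?thesis using z unfolding is_kernel_def by blast
  qed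
  then have "boundary C K i \<in> Hom C (cO K (i - 1)) (Dom C (cycles C K i)) \<and>
      cycles C K i \<bullet> boundary C K i = cD K (i - 1)"
    unfolding boundary_def by (rule theI')
  then show "boundary C K i \<in> Mor C" "Dom C (boundary C K i) = cO K (i - 1)"
    "Cod C (boundary C K i) = Dom C (cycles C K i)" "cycles C K i \<bullet> boundary C K i = cD K (i - 1)"
    by (auto simp: Hom_def)
qed

lemma cohom_pr_cokernel: "K \<in> bounded_complexes C \<Longrightarrow> is_cokernel C (boundary C K i) (cohom_pr C K i)"
  unfolding cohom_pr_def by (rule someI_ex) (simp add: ex_cokernel boundary_arrow)

text \<open>If \<open>h\<close> and \<open>h'\<close> are generalized inverses of the two differentials, then \<open>e = 1 - d h - h' d\<close> is
  annihilated by the differentials on both sides, so it factors through the cohomology.\<close>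

lemma cohom_data_local:
  assumes K: "K \<in> bounded_complexes C"
    and h: "h \<in> Hom C (cO K i) (cO K (i - 1))" "cD K (i - 1) \<bullet> (h \<bullet> cD K (i - 1)) = cD K (i - 1)"
    and h': "h' \<in> Hom C (cO K (i + 1)) (cO K i)" "cD K i \<bullet> (h' \<bullet> cD K i) = cD K i"
  obtains p j e where "p \<in> Hom C (cO K i) (cohom C K i)" "j \<in> Hom C (cohom C K i) (cO K i)"
    "e \<in> Hom C (cO K i) (cO K i)" "e \<bullet> cD K (i - 1) = Zero C (cO K (i - 1)) (cO K i)"
    "p \<bullet> j = Id C (cohom C K i)" "cD K i \<bullet> j = Zero C (cohom C K i) (cO K (i + 1))"
    "p \<bullet> cD K (i - 1) = Zero C (cO K (i - 1)) (cohom C K i)"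
    "Add C (j \<bullet> p) (Add C (cD K (i - 1) \<bullet> Add C h (h \<bullet> e)) (h' \<bullet> cD K i)) = Id C (cO K i)"
    "p \<bullet> cycles C K i = cohom_pr C K i"
proof -
  define dm d z b q where "dm = cD K (i - 1)" and "d = cD K i" and "z = cycles C K i"
    and "b = boundary C K i" and "q = cohom_pr C K i"
  let ?X = "cO K i"
  have X [simp]: "?X \<in> Ob C" "cO K (i - 1) \<in> Ob C" "cO K (i + 1) \<in> Ob C" using K by auto
  have d [simp]: "dm \<in> Mor C" "Dom C dm = cO K (i - 1)" "Cod C dm = ?X"
    "d \<in> Mor C" "Dom C d = ?X" "Cod C d = cO K (i + 1)"
    using K cpxD(4)[OF K, of "i - 1"] by (auto simp: dm_def d_def)
  have dd: "d \<bullet> dm = Zero C (cO K (i - 1)) (cO K (i + 1))" using K by (simp add: d_def dm_def)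
  have kz: "is_kernel C d z" using cycles_kernel[OF K] by (simp add: d_def z_def)
  have cq: "is_cokernel C b q" using cohom_pr_cokernel[OF K] by (simp add: b_def q_def)
  have b [simp]: "b \<in> Mor C" "Dom C b = cO K (i - 1)" "Cod C b = Dom C z" and zb: "z \<bullet> b = dm"
    using boundary_arrow[OF K, of i] by (auto simp: b_def z_def dm_def)
  note zD = is_kernelD[OF kz] and qD = is_cokernelD[OF cq]
  have z [simp]: "z \<in> Mor C" "Cod C z = ?X" and dz: "d \<bullet> z = Zero C (Dom C z) (cO K (i + 1))"
    using zD by auto
  have q [simp]: "q \<in> Mor C" "Dom C q = Dom C z" "Cod C q = cohom C K i"
    and qb: "q \<bullet> b = Zero C (cO K (i - 1)) (cohom C K i)"
    using qD by (auto simp: cohom_def q_def)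
  have [simp]: "Dom C z \<in> Ob C" "cohom C K i \<in> Ob C"
    using Dom_Ob[OF z(1)] Cod_Ob[OF q(1)] by auto
  have hh [simp]: "h \<in> Mor C" "Dom C h = ?X" "Cod C h = cO K (i - 1)" and dhd: "dm \<bullet> (h \<bullet> dm) = dm"
    using h by (auto simp: Hom_def dm_def)
  have hh' [simp]: "h' \<in> Mor C" "Dom C h' = cO K (i + 1)" "Cod C h' = ?X" and dhd': "d \<bullet> (h' \<bullet> d) = d"
    using h' by (auto simp: Hom_def d_def)
  define u where "u = Add C (dm \<bullet> h) (h' \<bullet> d)"
  have u [simp]: "u \<in> Mor C" "Dom C u = ?X" "Cod C u = ?X" by (auto simp: u_def)
  define e where "e = Sub (Id C ?X) u"
  have e [simp]: "e \<in> Mor C" "Dom C e = ?X" "Cod C e = ?X" by (auto simp: e_def)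
  have udm: "u \<bullet> dm = dm" using dhd dd by (simp add: u_def)
  have ed: "e \<bullet> dm = Zero C (cO K (i - 1)) ?X" using udm by (simp add: e_def)
  have "d \<bullet> (dm \<bullet> h) = (d \<bullet> dm) \<bullet> h" by simp
  also have "\<dots> = Zero C ?X (cO K (i + 1))" unfolding dd by simp
  finally have ddh: "d \<bullet> (dm \<bullet> h) = Zero C ?X (cO K (i + 1))" .
  have du: "d \<bullet> u = d" using dhd' ddh by (simp add: u_def)
  have de: "d \<bullet> e = Zero C ?X (cO K (i + 1))" using du by (simp add: e_def)
  obtain e' where e' [simp]: "e' \<in> Mor C" "Dom C e' = ?X" "Cod C e' = Dom C z" and ze': "z \<bullet> e' = e"
    using is_kernel_factor[OF kz, of e] de by auto
  define p where "p = q \<bullet> e'"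
  have p [simp]: "p \<in> Mor C" "Dom C p = ?X" "Cod C p = cohom C K i" by (auto simp: p_def)
  have e'dm: "e' \<bullet> dm = Zero C (cO K (i - 1)) (Dom C z)"
  proof (rule mono_cancel[OF zD(5)])
    have "z \<bullet> (e' \<bullet> dm) = (z \<bullet> e') \<bullet> dm" by simp
    then show "z \<bullet> (e' \<bullet> dm) = z \<bullet> Zero C (cO K (i - 1)) (Dom C z)" unfolding ze' ed by simp
  qed auto
  have pdm: "p \<bullet> dm = Zero C (cO K (i - 1)) (cohom C K i)" using e'dm by (simp add: p_def)
  have ez: "e \<bullet> z = Sub z (dm \<bullet> (h \<bullet> z))" using dz by (simp add: e_def u_def)
  have e'z: "e' \<bullet> z = Sub (Id C (Dom C z)) (b \<bullet> (h \<bullet> z))"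
  proof (rule mono_cancel[OF zD(5)])
    have "z \<bullet> (e' \<bullet> z) = (z \<bullet> e') \<bullet> z" by simp
    moreover have "z \<bullet> (b \<bullet> (h \<bullet> z)) = (z \<bullet> b) \<bullet> (h \<bullet> z)" by simp
    ultimately show "z \<bullet> (e' \<bullet> z) = z \<bullet> Sub (Id C (Dom C z)) (b \<bullet> (h \<bullet> z))"
      unfolding ze' zb ez by (simp add: zb)
  qed auto
  \<comment> \<open>On cycles \<open>e'\<close> differs from the identity by a boundary, which the
    quotient map \<open>q\<close> kills. This makes \<open>p\<close> an extension of
    \<open>q\<close> to all of \<open>cO K i\<close>.\<close>
  have qe'z: "q \<bullet> (e' \<bullet> z) = q"
  proof -
    have "q \<bullet> (b \<bullet> (h \<bullet> z)) = (q \<bullet> b) \<bullet> (h \<bullet> z)" by simp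
    then show ?thesis unfolding e'z by (simp add: qb)
  qed
  have ezb: "(e \<bullet> z) \<bullet> b = Zero C (cO K (i - 1)) ?X" using ed zb by simp
  obtain j where j [simp]: "j \<in> Mor C" "Dom C j = cohom C K i" "Cod C j = ?X" and jq: "j \<bullet> q = e \<bullet> z"
    using is_cokernel_factor[OF cq, of "e \<bullet> z"] ezb by auto
  have pj: "p \<bullet> j = Id C (cohom C K i)"
  proof (rule epi_cancel[OF qD(5)])
    have "(p \<bullet> j) \<bullet> q = p \<bullet> (j \<bullet> q)" by simp
    also have "\<dots> = q \<bullet> (e' \<bullet> ((z \<bullet> e') \<bullet> z))" unfolding jq ze' by (simp add: p_def)
    also have "\<dots> = (q \<bullet> (e' \<bullet> z)) \<bullet> (e' \<bullet> z)" by simp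
    also have "\<dots> = q" unfolding qe'z ..
    finally show "(p \<bullet> j) \<bullet> q = Id C (cohom C K i) \<bullet> q" by simp
  qed auto
  have dj: "d \<bullet> j = Zero C (cohom C K i) (cO K (i + 1))"
  proof (rule epi_cancel[OF qD(5)])
    have "(d \<bullet> j) \<bullet> q = d \<bullet> (j \<bullet> q)" by simp
    also have "\<dots> = (d \<bullet> e) \<bullet> z" unfolding jq by simp
    finally show "(d \<bullet> j) \<bullet> q = Zero C (cohom C K i) (cO K (i + 1)) \<bullet> q" unfolding de by simp
  qed auto
  have jp: "j \<bullet> p = e \<bullet> e"
  proof -
    have "j \<bullet> p = (j \<bullet> q) \<bullet> e'" by (simp add: p_def)
    also have "\<dots> = e \<bullet> (z \<bullet> e')" unfolding jq by simp
    finally show ?thesis unfolding ze' .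
  qed
  \<comment> \<open>\<open>e\<close> need not be idempotent: its square falls short of
    \<open>e\<close> by \<open>dm h e\<close>. As \<open>j p\<close> is this square, the defect is
    absorbed into the homotopy, which becomes \<open>h + h e\<close> in place of
    \<open>h\<close>.\<close>
  have ee: "e \<bullet> e = Sub e (dm \<bullet> (h \<bullet> e))"
  proof -
    have "e \<bullet> e = Sub e (u \<bullet> e)" by (subst (1) e_def) simp
    also have "u \<bullet> e = dm \<bullet> (h \<bullet> e)" using de by (simp add: u_def)
    finally show ?thesis .
  qed
  have "Add C (j \<bullet> p) (Add C (dm \<bullet> Add C h (h \<bullet> e)) (h' \<bullet> d))
      = Add C (dm \<bullet> (h \<bullet> e)) (Add C (Scale C (- 1) (dm \<bullet> (h \<bullet> e))) (Add C e u))"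
    unfolding jp ee by (simp add: u_def Add_ac)
  also have "\<dots> = Add C e u" by (rule Add_minus_cancel) auto
  also have "\<dots> = Add C u e" by (rule Add_commute) auto
  also have "\<dots> = Id C ?X" unfolding e_def by (rule add_Sub) auto
  finally have decomp: "Add C (j \<bullet> p) (Add C (dm \<bullet> Add C h (h \<bullet> e)) (h' \<bullet> d)) = Id C ?X" .
  have homs: "p \<in> Hom C ?X (cohom C K i)" "j \<in> Hom C (cohom C K i) ?X" "e \<in> Hom C ?X ?X" by auto
  have pz: "p \<bullet> z = q" using qe'z by (simp add: p_def)
  show ?thesis
    by (rule that[OF homs ed[unfolded dm_def] pj dj[unfolded d_def] pdm[unfolded dm_def]
          decomp[unfolded dm_def d_def] pz[unfolded z_def q_def]])
qed

lemma cohom_data_exists: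
  assumes K: "K \<in> bounded_complexes C"
  shows "\<exists>p j h. cohom_data C K p j h"
proof -
  have "\<forall>i. \<exists>g. g \<in> Hom C (cO K i) (cO K (i - 1)) \<and> cD K (i - 1) \<bullet> (g \<bullet> cD K (i - 1)) = cD K (i - 1)"
  proof
    fix i
    have "cD K (i - 1) \<in> Hom C (cO K (i - 1)) (cO K i)" using K cpxD(4)[OF K, of "i - 1"] by auto
    then show "\<exists>g. g \<in> Hom C (cO K i) (cO K (i - 1)) \<and> cD K (i - 1) \<bullet> (g \<bullet> cD K (i - 1)) = cD K (i - 1)"
      using regular by blast
  qed
  from choice[OF this] obtain g where g: "\<And>i. g i \<in> Hom C (cO K i) (cO K (i - 1))"
    "\<And>i. cD K (i - 1) \<bullet> (g i \<bullet> cD K (i - 1)) = cD K (i - 1)" by blast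
  \<comment> \<open>The three maps in degree \<open>i\<close> depend on each other, so they are
    chosen together as a triple. The generalized inverses \<open>g\<close> are fixed beforehand
    because degree \<open>i\<close> uses both \<open>g i\<close> and \<open>g (i + 1)\<close>, and
    neighbouring degrees have to share them.\<close>
  define Q where "Q = (\<lambda>i (p, j, e). p \<in> Hom C (cO K i) (cohom C K i) \<and> j \<in> Hom C (cohom C K i) (cO K i) \<and>
    e \<in> Hom C (cO K i) (cO K i) \<and> e \<bullet> cD K (i - 1) = Zero C (cO K (i - 1)) (cO K i) \<and>
    p \<bullet> j = Id C (cohom C K i) \<and> cD K i \<bullet> j = Zero C (cohom C K i) (cO K (i + 1)) \<and>
    p \<bullet> cD K (i - 1) = Zero C (cO K (i - 1)) (cohom C K i) \<and>
    Add C (j \<bullet> p) (Add C (cD K (i - 1) \<bullet> Add C (g i) (g i \<bullet> e)) (g (i + 1) \<bullet> cD K i)) = Id C (cO K i) \<and>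
    p \<bullet> cycles C K i = cohom_pr C K i)"
  have "\<forall>i. \<exists>x. Q i x"
  proof
    fix i
    obtain p j e where "p \<in> Hom C (cO K i) (cohom C K i)" "j \<in> Hom C (cohom C K i) (cO K i)"
      "e \<in> Hom C (cO K i) (cO K i)" "e \<bullet> cD K (i - 1) = Zero C (cO K (i - 1)) (cO K i)"
      "p \<bullet> j = Id C (cohom C K i)" "cD K i \<bullet> j = Zero C (cohom C K i) (cO K (i + 1))"
      "p \<bullet> cD K (i - 1) = Zero C (cO K (i - 1)) (cohom C K i)"
      "Add C (j \<bullet> p) (Add C (cD K (i - 1) \<bullet> Add C (g i) (g i \<bullet> e)) (g (i + 1) \<bullet> cD K i)) = Id C (cO K i)"
      "p \<bullet> cycles C K i = cohom_pr C K i"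
      using cohom_data_local[OF K g(1)[of i] g(2)[of i], of "g (i + 1)"] g(1)[of "i + 1"] g(2)[of "i + 1"]
      by auto
    then show "\<exists>x. Q i x" by (intro exI[of _ "(p, j, e)"]) (simp add: Q_def)
  qed
  from choice[OF this] obtain r where r: "\<And>i. Q i (r i)" by blast
  define p j e where "p = (\<lambda>i. fst (r i))" and "j = (\<lambda>i. fst (snd (r i)))" and "e = (\<lambda>i. snd (snd (r i)))"
  have Q: "Q i (p i, j i, e i)" for i using r[of i] by (simp add: p_def j_def e_def)
  define h where "h = (\<lambda>i. Add C (g i) (g i \<bullet> e i))"
  have "cohom_data C K p j h"
    unfolding cohom_data_def
  proof (intro allI)
    fix i
    have q: "Q i (p i, j i, e i)" by (rule Q)
    \<comment> \<open>The local statement uses \<open>g (i + 1)\<close> next to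
      \<open>cD K i\<close>, whereas the homotopy has \<open>h (i + 1)\<close>. The correction term
      \<open>g e\<close> makes no difference there because \<open>e (i + 1)\<close> annihilates the
      incoming differential.\<close>
    have "e (i + 1) \<bullet> cD K i = Zero C (cO K i) (cO K (i + 1))" "e (i + 1) \<in> Hom C (cO K (i + 1)) (cO K (i + 1))"
      using Q[of "i + 1"] by (auto simp: Q_def)
    then have "h (i + 1) \<bullet> cD K i = g (i + 1) \<bullet> cD K i"
      using g(1)[of "i + 1"] K by (simp add: h_def Hom_def)
    moreover have "h i \<in> Hom C (cO K i) (cO K (i - 1))"
      using q g(1)[of i] by (auto simp: h_def Q_def Hom_def)
    moreover have "cohom C K i \<in> Ob C" using q unfolding Q_def using HomD(5) by blast
    ultimately show "cohom C K i \<in> Ob C \<and> p i \<in> Hom C (cO K i) (cohom C K i) \<and> j i \<in> Hom C (cohom C K i) (cO K i) \<and>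
     h i \<in> Hom C (cO K i) (cO K (i - 1)) \<and>
     p i \<bullet>\<^bsub>C\<^esub> j i = Id C (cohom C K i) \<and>
     cD K i \<bullet>\<^bsub>C\<^esub> j i = Zero C (cohom C K i) (cO K (i + 1)) \<and>
     p i \<bullet>\<^bsub>C\<^esub> cD K (i - 1) = Zero C (cO K (i - 1)) (cohom C K i) \<and>
     Add C (j i \<bullet>\<^bsub>C\<^esub> p i) (Add C (cD K (i - 1) \<bullet>\<^bsub>C\<^esub> h i) (h (i + 1) \<bullet>\<^bsub>C\<^esub> cD K i)) = Id C (cO K i) \<and>
     p i \<bullet>\<^bsub>C\<^esub> cycles C K i = cohom_pr C K i"
      using q by (simp add: Q_def h_def)
  qed
  then show ?thesis by blast
qed

lemma cohom_dataD:
  assumes "cohom_data C K p j h"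
  shows "cohom C K i \<in> Ob C" "p i \<in> Mor C" "Dom C (p i) = cO K i" "Cod C (p i) = cohom C K i"
    "j i \<in> Mor C" "Dom C (j i) = cohom C K i" "Cod C (j i) = cO K i"
    "h i \<in> Mor C" "Dom C (h i) = cO K i" "Cod C (h i) = cO K (i - 1)"
    "p i \<bullet> j i = Id C (cohom C K i)"
    "cD K i \<bullet> j i = Zero C (cohom C K i) (cO K (i + 1))"
    "p i \<bullet> cD K (i - 1) = Zero C (cO K (i - 1)) (cohom C K i)"
    "Add C (j i \<bullet> p i) (Add C (cD K (i - 1) \<bullet> h i) (h (i + 1) \<bullet> cD K i)) = Id C (cO K i)"
    "p i \<bullet> cycles C K i = cohom_pr C K i"
  using assms unfolding cohom_data_def Hom_def by auto

text \<open>By the homotopy identity a cycle \<open>z\<close> is \<open>j q\<close> plus a boundary.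
  A chain map sends boundaries to boundaries and \<open>p'\<close> kills those, so
  \<open>p' f j\<close> makes the square that defines \<open>cohom_map\<close> commute. Since
  \<open>cycles\<close> is monic and \<open>cohom_pr\<close> is epic, nothing else does.\<close>

lemma cohom_map_eq:
  assumes f: "f \<in> chain_maps C"
    and K: "cohom_data C (src f) p j h" and L: "cohom_data C (tgt f) p' j' h'"
  shows "cohom_map C f i = p' i \<bullet> (cm f i \<bullet> j i)"
proof -
  note fD = cmapD[OF f]
  note KD = cohom_dataD[OF K] and LD = cohom_dataD[OF L]
  let ?K = "src f" and ?L = "tgt f"
  note KO = cpxD[OF fD(1)] and LO = cpxD[OF fD(2)]
  define z z' q q' where "z = cycles C ?K i" and "z' = cycles C ?L i"
    and "q = cohom_pr C ?K i" and "q' = cohom_pr C ?L i"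
  have kz: "is_kernel C (cD ?K i) z" "is_kernel C (cD ?L i) z'"
    using cycles_kernel fD by (auto simp: z_def z'_def)
  note zD = is_kernelD[OF kz(1)] and zD' = is_kernelD[OF kz(2)]
  have cq: "is_cokernel C (boundary C ?K i) q" "is_cokernel C (boundary C ?L i) q'"
    using cohom_pr_cokernel fD by (auto simp: q_def q'_def)
  note qD = is_cokernelD[OF cq(1)] and qD' = is_cokernelD[OF cq(2)]
  have pz: "p i \<bullet> z = q" "p' i \<bullet> z' = q'" using KD(15) LD(15) by (auto simp: z_def z'_def q_def q'_def)
  have z: "z \<in> Mor C" "Cod C z = cO ?K i" "z' \<in> Mor C" "Cod C z' = cO ?L i" "Dom C z \<in> Ob C" "Dom C z' \<in> Ob C"
    and dz: "cD ?K i \<bullet> z = Zero C (Dom C z) (cO ?K (i + 1))"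
    using zD zD' fD KO LO by auto
  have q: "q \<in> Mor C" "Dom C q = Dom C z" "Cod C q = cohom C ?K i" "q' \<in> Mor C" "Dom C q' = Dom C z'"
     "Cod C q' = cohom C ?L i"
    using qD qD' boundary_arrow(3)[OF fD(1), of i] boundary_arrow(3)[OF fD(2), of i]
    by (auto simp: cohom_def q_def q'_def z_def z'_def)
  have "cD ?L i \<bullet> (cm f i \<bullet> z) = (cD ?L i \<bullet> cm f i) \<bullet> z" using fD(3-5) z LO by simp
  also have "\<dots> = cm f (i + 1) \<bullet> (cD ?K i \<bullet> z)" unfolding fD(6) using fD(3-5) z KO by simp
  also have "\<dots> = Zero C (Dom C z) (cO ?L (i + 1))" unfolding dz using fD(3-5) z by simp
  finally obtain w where w: "w \<in> Mor C" "Dom C w = Dom C z" "Cod C w = Dom C z'" "z' \<bullet> w = cm f i \<bullet> z"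
    using is_kernel_factor[OF kz(2), of "cm f i \<bullet> z"] fD(3-5) z LO by auto
  let ?\<phi> = "p' i \<bullet> (cm f i \<bullet> j i)"
  have phi: "?\<phi> \<in> Hom C (cohom C ?K i) (cohom C ?L i)"
    using KD(1-10)[of i] LD(1-10)[of i] fD(3-5) by (auto simp: Hom_def)
  have jq: "Add C (j i \<bullet> q) (cD ?K (i - 1) \<bullet> (h i \<bullet> z)) = z"
  proof -
    have "z = Add C (j i \<bullet> p i) (Add C (cD ?K (i - 1) \<bullet> h i) (h (i + 1) \<bullet> cD ?K i)) \<bullet> z"
      unfolding KD(14) using z by simp
    also have "\<dots> = Add C (j i \<bullet> (p i \<bullet> z)) (cD ?K (i - 1) \<bullet> (h i \<bullet> z))"
      using KD(1-10)[of i] KD(1-10)[of "i + 1"] z KO dz cpxD(4)[OF fD(1), of "i - 1"] by simp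
    finally show ?thesis unfolding pz by simp
  qed
  have "?\<phi> \<bullet> q = p' i \<bullet> (cm f i \<bullet> (j i \<bullet> q))"
    using KD(1-10)[of i] LD(1-10)[of i] fD(3-5) q z by simp
  also have "\<dots> = p' i \<bullet> (cm f i \<bullet> z)"
  proof -
    have "p' i \<bullet> (cm f i \<bullet> (cD ?K (i - 1) \<bullet> (h i \<bullet> z))) = p' i \<bullet> ((cm f i \<bullet> cD ?K (i - 1)) \<bullet> (h i \<bullet> z))"
      using KD(1-10)[of i] LD(1-10)[of i] fD(3-5) q z KO cpxD(4)[OF fD(1), of "i - 1"] by simp
    also have "\<dots> = (p' i \<bullet> cD ?L (i - 1)) \<bullet> (cm f (i - 1) \<bullet> (h i \<bullet> z))"
      unfolding fD(7)
      using KD(1-10)[of i] LD(1-10)[of i] fD(3-5) q z LO cpxD(4)[OF fD(2), of "i - 1"] by simp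
    also have "\<dots> = Zero C (Dom C z) (cohom C ?L i)"
      unfolding LD(13) using KD(1-10)[of i] LD(1-10)[of i] fD(3-5) q z LO by simp
    finally have 0: "p' i \<bullet> (cm f i \<bullet> (cD ?K (i - 1) \<bullet> (h i \<bullet> z))) = Zero C (Dom C z) (cohom C ?L i)" .
    have "p' i \<bullet> (cm f i \<bullet> z) = p' i \<bullet> (cm f i \<bullet> Add C (j i \<bullet> q) (cD ?K (i - 1) \<bullet> (h i \<bullet> z)))"
      unfolding jq ..
    also have "\<dots> = Add C (p' i \<bullet> (cm f i \<bullet> (j i \<bullet> q))) (p' i \<bullet> (cm f i \<bullet> (cD ?K (i - 1) \<bullet> (h i \<bullet> z))))"
      using KD(1-10)[of i] LD(1-10)[of i] fD(3-5) q z KO cpxD(4)[OF fD(1), of "i - 1"] by simp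
    also have "\<dots> = p' i \<bullet> (cm f i \<bullet> (j i \<bullet> q))"
      unfolding 0 using KD(1-10)[of i] LD(1-10)[of i] fD(3-5) q z by simp
    finally show ?thesis by simp
  qed
  also have "\<dots> = (p' i \<bullet> z') \<bullet> w" using w LD(1-10)[of i] z by simp
  also have "\<dots> = q' \<bullet> w" unfolding pz ..
  finally have sq: "?\<phi> \<bullet> q = q' \<bullet> w" .
  show ?thesis
    unfolding cohom_map_def z_def[symmetric] z'_def[symmetric] q_def[symmetric] q'_def[symmetric]
  proof (rule the_equality)
    have "w \<in> Hom C (Dom C z) (Dom C z')" using w(1-3) by auto
    then show "?\<phi> \<in> Hom C (cohom C ?K i) (cohom C ?L i) \<and>
      (\<exists>x \<in> Hom C (Dom C z) (Dom C z'). z' \<bullet> x = cm f i \<bullet> z \<and> ?\<phi> \<bullet> q = q' \<bullet> x)"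
      using phi w(4) sq by blast
  next
    fix y assume "y \<in> Hom C (cohom C ?K i) (cohom C ?L i) \<and>
      (\<exists>x \<in> Hom C (Dom C z) (Dom C z'). z' \<bullet> x = cm f i \<bullet> z \<and> y \<bullet> q = q' \<bullet> x)"
    then obtain x where y: "y \<in> Hom C (cohom C ?K i) (cohom C ?L i)"
      and x: "x \<in> Hom C (Dom C z) (Dom C z')" "z' \<bullet> x = cm f i \<bullet> z" "y \<bullet> q = q' \<bullet> x" by blast
    note yD = HomD[OF y] and xD = HomD[OF x(1)] and phiD = HomD[OF phi]
    have "x = w"
      by (rule mono_cancel[OF zD'(5) xD(1) w(1)]) (simp_all only: xD w x)
    then have "y \<bullet> q = ?\<phi> \<bullet> q" unfolding sq x(3) by simp
    then show "y = ?\<phi>"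
      by (intro epi_cancel[OF qD(5) yD(1) phiD(1)]) (simp_all only: yD phiD q)
  qed
qed

end

section \<open>Quotients and localizations at isomorphisms\<close>

text \<open>The identity on objects and a surjection on morphisms, compatible with composition;
  hence \<open>B\<close> inherits the category axioms. The passages from complexes to the homotopy
  category, from there to the derived category, and their composite all have this shape.\<close>

locale quotient_functor = A: category A
  for A :: "('o, 'm, 'x) cat_scheme" +
  fixes B :: "('o, 'n, 'y) cat_scheme" and \<Phi> :: "'m \<Rightarrow> 'n"
  assumes Ob_eq: "Ob B = Ob A"
    and Mor_eq: "Mor B = \<Phi> ` Mor A"
    and Dom_eq: "f \<in> Mor A \<Longrightarrow> Dom B (\<Phi> f) = Dom A f"
    and Cod_eq: "f \<in> Mor A \<Longrightarrow> Cod B (\<Phi> f) = Cod A f"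
    and Id_eq: "X \<in> Ob A \<Longrightarrow> Id B X = \<Phi> (Id A X)"
    and Cmp_eq: "f \<in> Mor A \<Longrightarrow> g \<in> Mor A \<Longrightarrow> Cod A f = Dom A g \<Longrightarrow>
      \<Phi> g \<bullet>\<^bsub>B\<^esub> \<Phi> f = \<Phi> (g \<bullet>\<^bsub>A\<^esub> f)"
begin

lemma Hom_eq: "Hom B X Y = \<Phi> ` Hom A X Y"
  unfolding Hom_def Mor_eq by (auto simp: Dom_eq Cod_eq)

lemma quotient_category: "category B"
proof
  show "Dom B f \<in> Ob B \<and> Cod B f \<in> Ob B" if "f \<in> Mor B" for f
    using that by (auto simp: Mor_eq Ob_eq Dom_eq Cod_eq)
  show "Id B X \<in> Hom B X X" if "X \<in> Ob B" for X
    using that A.id_hom by (simp add: Ob_eq Hom_eq Id_eq)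
  show "g \<bullet>\<^bsub>B\<^esub> f \<in> Hom B X Z" if "f \<in> Hom B X Y" "g \<in> Hom B Y Z" for f g X Y Z
    using that A.cmp_hom by (auto simp: Hom_eq Cmp_eq A.HomD)
  show "Id B Y \<bullet>\<^bsub>B\<^esub> f = f" "f \<bullet>\<^bsub>B\<^esub> Id B X = f" if "f \<in> Hom B X Y" for f X Y
    using that by (auto simp: Hom_eq Id_eq Cmp_eq A.HomD)
  show "(h \<bullet>\<^bsub>B\<^esub> g) \<bullet>\<^bsub>B\<^esub> f = h \<bullet>\<^bsub>B\<^esub> (g \<bullet>\<^bsub>B\<^esub> f)"
    if "f \<in> Hom B W X" "g \<in> Hom B X Y" "h \<in> Hom B Y Z" for f g h W X Y Z
    using that by (auto simp: Hom_eq Cmp_eq A.HomD)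
qed

end

text \<open>The operations of \<open>quot_cat\<close> are unions over representatives. The
  congruence property makes all members of such a union equal, and reflexivity of \<open>R\<close>
  makes the union nonempty.\<close>

lemma quot_cat_quotient_functor:
  fixes C :: "('o, 'm, 'k, 'x) moncat_scheme"
  assumes "category C" and R: "equiv (Mor C) R"
    and par: "\<And>f g. (f, g) \<in> R \<Longrightarrow> Dom C f = Dom C g \<and> Cod C f = Cod C g"
    and cong: "\<And>f f' g g'. (f, f') \<in> R \<Longrightarrow> (g, g') \<in> R \<Longrightarrow> Cod C f = Dom C g \<Longrightarrow>
      (g \<bullet>\<^bsub>C\<^esub> f, g' \<bullet>\<^bsub>C\<^esub> f') \<in> R"
  shows "quotient_functor C (quot_cat C R) (\<lambda>f. R `` {f})"
proof -
  interpret category C by fact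
  have self: "f \<in> R `` {f}" if "f \<in> Mor C" for f using R that by (auto simp: equiv_def refl_on_def)
  show ?thesis
  proof
    show "Ob (quot_cat C R) = Ob C" by (simp add: quot_cat_def)
    show "Mor (quot_cat C R) = (\<lambda>f. R `` {f}) ` Mor C" by (auto simp: quot_cat_def quotient_def)
    show "Dom (quot_cat C R) (R `` {f}) = Dom C f" "Cod (quot_cat C R) (R `` {f}) = Cod C f"
      if f: "f \<in> Mor C" for f
    proof -
      have "Dom C ` (R `` {f}) = (\<lambda>_. Dom C f) ` (R `` {f})" "Cod C ` (R `` {f}) = (\<lambda>_. Cod C f) ` (R `` {f})"
        by (intro image_cong HOL.refl; use par[of f] in \<open>metis Image_singleton_iff\<close>)+
      then have "Dom C ` (R `` {f}) = {Dom C f}" "Cod C ` (R `` {f}) = {Cod C f}"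
        using image_constant[OF self[OF f]] by simp_all
      then show "Dom (quot_cat C R) (R `` {f}) = Dom C f" "Cod (quot_cat C R) (R `` {f}) = Cod C f"
        by (simp_all add: quot_cat_def)
    qed
    show "Id (quot_cat C R) X = R `` {Id C X}" for X by (simp add: quot_cat_def)
    fix f g assume fg: "f \<in> Mor C" "g \<in> Mor C" "Cod C f = Dom C g"
    have *: "R `` {g' \<bullet>\<^bsub>C\<^esub> f'} = R `` {g \<bullet>\<^bsub>C\<^esub> f}" if "g' \<in> R `` {g}" "f' \<in> R `` {f}" for g' f'
      using cong[of f f' g g'] that fg by (auto intro!: equiv_class_eq[OF R, symmetric])
    show "R `` {g} \<bullet>\<^bsub>quot_cat C R\<^esub> R `` {f} = R `` {g \<bullet>\<^bsub>C\<^esub> f}"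
    proof -
      have "(\<Union>g'\<in>R `` {g}. \<Union>f'\<in>R `` {f}. R `` {g' \<bullet>\<^bsub>C\<^esub> f'}) =
          (\<Union>g'\<in>R `` {g}. \<Union>f'\<in>R `` {f}. R `` {g \<bullet>\<^bsub>C\<^esub> f})"
        by (intro SUP_cong HOL.refl *)
      also have "\<dots> = R `` {g \<bullet>\<^bsub>C\<^esub> f}" using self[OF fg(1)] self[OF fg(2)] by blast
      finally show ?thesis by (simp add: quot_cat_def)
    qed
  qed
qed

text \<open>If every morphism of \<open>W\<close> is invertible, then the roof \<open>(s, g s)\<close> represents \<open>g\<close>, and every roof is of
  this form; so localizing at \<open>W\<close> changes nothing.\<close>

locale trivial_localization = category C
  for C :: "('o, 'm, 'k, 'x) moncat_scheme" (structure) +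
  fixes W :: "'m set"
  assumes W_Mor: "W \<subseteq> Mor C" and W_iso: "s \<in> W \<Longrightarrow> is_iso C s" and W_Id: "X \<in> Ob C \<Longrightarrow> Id C X \<in> W"
begin

text \<open>If a roof \<open>(t, f)\<close> is equivalent to \<open>(s, g s)\<close>, the common
  denominator \<open>s u = t u'\<close> has an inverse \<open>l\<close>; then \<open>u' l\<close> is
  inverse to \<open>t\<close>, which forces \<open>f = g t\<close>. Conversely, two roofs of this
  form have a common refinement with apex \<open>Dom C t\<close>, given by the inverse of
  \<open>s\<close> followed after \<open>t\<close>, and by the identity.\<close>

lemma frac_eq:
  assumes s: "s \<in> W" and g: "g \<in> Mor C" "Cod C s = Dom C g"
  shows "frac C W s (g \<bullet> s) = {(t, g \<bullet> t) | t. t \<in> W \<and> Cod C t = Dom C g}"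
proof (intro equalityI subsetI)
  fix x assume "x \<in> frac C W s (g \<bullet> s)"
  then obtain t f M u u' where x: "x = (t, f)" and t: "t \<in> W" "Cod C t = Cod C s"
    and f: "f \<in> Mor C" "Dom C t = Dom C f" "Cod C f = Cod C (g \<bullet> s)"
    and u: "u \<in> Hom C M (Dom C s)" "u' \<in> Hom C M (Dom C t)" "s \<bullet> u = t \<bullet> u'"
      "(g \<bullet> s) \<bullet> u = f \<bullet> u'" "s \<bullet> u \<in> W"
    by (auto simp: frac_def roof_eq_def roofs_def)
  note uD = HomD[OF u(1)] HomD[OF u(2)]
  have st: "s \<in> Mor C" "t \<in> Mor C" using s t W_Mor by auto
  obtain l where l: "l \<in> Mor C" "Dom C l = Cod C (t \<bullet> u')" "Cod C l = Dom C (t \<bullet> u')"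
    "(t \<bullet> u') \<bullet> l = Id C (Cod C (t \<bullet> u'))"
    using W_iso[OF u(5)] unfolding u(3) by (elim is_isoE) auto
  obtain r where r: "r \<in> Mor C" "Dom C r = Cod C t" "Cod C r = Dom C t" "r \<bullet> t = Id C (Dom C t)"
    using W_iso[OF t(1)] by (elim is_isoE) auto
  have u'l: "u' \<bullet> l = r"
  proof -
    have "u' \<bullet> l = (r \<bullet> t) \<bullet> (u' \<bullet> l)" unfolding r(4) using uD l(1-3) st by simp
    also have "\<dots> = r \<bullet> ((t \<bullet> u') \<bullet> l)" using uD l(1-3) r(1-3) st by simp
    also have "\<dots> = r" unfolding l(4) using uD r(1-3) st by simp
    finally show ?thesis .
  qed
  have "f = f \<bullet> ((u' \<bullet> l) \<bullet> t)" unfolding u'l r(4) using f by simp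
  also have "\<dots> = (f \<bullet> u') \<bullet> (l \<bullet> t)" using f uD l(1-3) st by simp
  also have "\<dots> = g \<bullet> ((s \<bullet> u) \<bullet> (l \<bullet> t))" unfolding u(4)[symmetric] using g uD l(1-3) st t(2) by simp
  also have "\<dots> = g \<bullet> (((t \<bullet> u') \<bullet> l) \<bullet> t)" unfolding u(3) using uD l(1-3) st by simp
  also have "\<dots> = g \<bullet> t" unfolding l(4) using uD st by simp
  finally show "x \<in> {(t, g \<bullet> t) | t. t \<in> W \<and> Cod C t = Dom C g}" using x t g by auto
next
  fix x assume "x \<in> {(t, g \<bullet> t) | t. t \<in> W \<and> Cod C t = Dom C g}"
  then obtain t where x: "x = (t, g \<bullet> t)" and t: "t \<in> W" "Cod C t = Dom C g" by blast
  have st: "s \<in> Mor C" "t \<in> Mor C" using s t W_Mor by auto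
  obtain r where r: "r \<in> Mor C" "Dom C r = Cod C s" "Cod C r = Dom C s" "s \<bullet> r = Id C (Cod C s)"
    using W_iso[OF s] by (elim is_isoE) auto
  have sr: "s \<bullet> (r \<bullet> t) = t"
  proof -
    have "s \<bullet> (r \<bullet> t) = (s \<bullet> r) \<bullet> t" using r(1-3) st t(2) g by simp
    then show ?thesis unfolding r(4) using st t(2) g by simp
  qed
  have gsr: "(g \<bullet> s) \<bullet> (r \<bullet> t) = g \<bullet> t"
  proof -
    have "(g \<bullet> s) \<bullet> (r \<bullet> t) = g \<bullet> (s \<bullet> (r \<bullet> t))" using r(1-3) st t(2) g by simp
    then show ?thesis unfolding sr .
  qed
  have "r \<bullet> t \<in> Hom C (Dom C t) (Dom C s)" "Id C (Dom C t) \<in> Hom C (Dom C t) (Dom C t)"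
    using r(1-3) st t(2) g by auto
  moreover have "s \<bullet> (r \<bullet> t) = t \<bullet> Id C (Dom C t)" "(g \<bullet> s) \<bullet> (r \<bullet> t) = (g \<bullet> t) \<bullet> Id C (Dom C t)"
    "s \<bullet> (r \<bullet> t) \<in> W"
    unfolding sr gsr using st t g by auto
  moreover have "(s, g \<bullet> s) \<in> roofs C W" "(t, g \<bullet> t) \<in> roofs C W" "Cod C s = Cod C t"
    "Cod C (g \<bullet> s) = Cod C (g \<bullet> t)"
    using s t st g by (auto simp: roofs_def)
  ultimately show "x \<in> frac C W s (g \<bullet> s)"
    unfolding x frac_def roof_eq_def by blast
qed

lemma frac_empty: "s \<notin> W \<Longrightarrow> frac C W s f = {}"
  by (auto simp: frac_def roof_eq_def roofs_def)

lemma loc_mor_eq: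
  assumes "g \<in> Mor C"
  shows "loc_mor C W g = {(t, g \<bullet> t) | t. t \<in> W \<and> Cod C t = Dom C g}"
  using frac_eq[of "Id C (Dom C g)" g] assms W_Id by (simp add: loc_mor_def)

lemma frac_loc_mor:
  "s \<in> W \<Longrightarrow> g \<in> Mor C \<Longrightarrow> Cod C s = Dom C g \<Longrightarrow> frac C W s (g \<bullet> s) = loc_mor C W g"
  by (simp add: frac_eq loc_mor_eq)

lemma Id_in_loc_mor: "g \<in> Mor C \<Longrightarrow> (Id C (Dom C g), g) \<in> loc_mor C W g"
  unfolding loc_mor_eq using W_Id by force

text \<open>The class of \<open>f\<close> contains the roof with identity denominator, and by the
  explicit description of classes its numerator is determined.\<close>

lemma loc_mor_inj:
  assumes "f \<in> Mor C" "g \<in> Mor C" "loc_mor C W f = loc_mor C W g"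
  shows "f = g"
proof -
  have "(Id C (Dom C f), f) \<in> {(t, g \<bullet> t) | t. t \<in> W \<and> Cod C t = Dom C g}"
    using Id_in_loc_mor[OF assms(1)] unfolding assms(3) loc_mor_eq[OF assms(2)] .
  then have "f = g \<bullet> Id C (Dom C f)" "Cod C (Id C (Dom C f)) = Dom C g" by blast+
  then have "f = g \<bullet> Id C (Dom C g)" using assms(1) by simp
  then show ?thesis using Id_right_arrow[OF assms(2) HOL.refl] by simp
qed

lemma loc_quotient_functor: "quotient_functor C (loc_cat C W) (loc_mor C W)"
proof
  show "Ob (loc_cat C W) = Ob C" by (simp add: loc_cat_def)
  show "Mor (loc_cat C W) = loc_mor C W ` Mor C"
  proof (intro equalityI subsetI)
    fix x assume "x \<in> Mor (loc_cat C W)"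
    then obtain s f where x: "x = frac C W s f" and s: "s \<in> W" "f \<in> Mor C" "Dom C s = Dom C f"
      by (auto simp: loc_cat_def quotient_def roofs_def frac_def)
    have sM: "s \<in> Mor C" using s W_Mor by auto
    obtain r where r: "r \<in> Mor C" "Dom C r = Cod C s" "Cod C r = Dom C s" "r \<bullet> s = Id C (Dom C s)"
      using W_iso[OF s(1)] by (elim is_isoE) auto
    have "(f \<bullet> r) \<bullet> s = f" using s r sM by simp
    then have "x = loc_mor C W (f \<bullet> r)"
      using frac_loc_mor[of s "f \<bullet> r"] s r sM x by simp
    then show "x \<in> loc_mor C W ` Mor C" using s r by auto
  next
    fix x assume "x \<in> loc_mor C W ` Mor C"
    then obtain g where g: "g \<in> Mor C" "x = loc_mor C W g" by blast
    then have "(Id C (Dom C g), g) \<in> roofs C W" using W_Id by (auto simp: roofs_def)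
    then show "x \<in> Mor (loc_cat C W)"
      using g by (auto simp: loc_cat_def loc_mor_def frac_def intro: quotientI)
  qed
  show "Id (loc_cat C W) X = loc_mor C W (Id C X)" for X by (simp add: loc_cat_def)
  fix f assume f: "f \<in> Mor C"
  have 1: "(\<lambda>(s, f). Cod C s) ` loc_mor C W f = {Dom C f}"
    using Id_in_loc_mor[OF f] f by (force simp: loc_mor_eq)
  have 2: "(\<lambda>(s, f). Cod C f) ` loc_mor C W f = {Cod C f}"
    using Id_in_loc_mor[OF f] f W_Mor by (force simp: loc_mor_eq)
  show "Dom (loc_cat C W) (loc_mor C W f) = Dom C f" "Cod (loc_cat C W) (loc_mor C W f) = Cod C f"
    using 1 2 by (simp_all add: loc_cat_def)
  fix g assume g: "g \<in> Mor C" "Cod C f = Dom C g"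
  let ?S = "{frac C W (s \<bullet> u) (g' \<bullet> v) | s f' t g' u v. (s, f') \<in> loc_mor C W f \<and>
    (t, g') \<in> loc_mor C W g \<and> u \<in> W \<and> v \<in> Mor C \<and> Dom C u = Dom C v \<and>
    Cod C u = Dom C s \<and> Cod C v = Dom C t \<and> f' \<bullet> u = t \<bullet> v}"
  have "x = loc_mor C W (g \<bullet> f) \<or> x = {}" if xS: "x \<in> ?S" for x
  proof -
    obtain s t u v where x: "x = frac C W (s \<bullet> u) ((g \<bullet> t) \<bullet> v)" and s: "s \<in> W" "Cod C s = Dom C f"
      and t: "t \<in> W" "Cod C t = Dom C g" and u: "u \<in> W" "v \<in> Mor C" "Dom C u = Dom C v"
      "Cod C u = Dom C s" "Cod C v = Dom C t" "(f \<bullet> s) \<bullet> u = t \<bullet> v"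
      using xS unfolding loc_mor_eq[OF f] loc_mor_eq[OF g(1)] by blast
    have M: "s \<in> Mor C" "t \<in> Mor C" "u \<in> Mor C" using s t u W_Mor by auto
    have "(g \<bullet> t) \<bullet> v = g \<bullet> ((f \<bullet> s) \<bullet> u)" unfolding u(6) using M g t u(2-5) by simp
    also have "\<dots> = (g \<bullet> f) \<bullet> (s \<bullet> u)" using M f g s u(2-5) by simp
    finally have e: "(g \<bullet> t) \<bullet> v = (g \<bullet> f) \<bullet> (s \<bullet> u)" .
    show ?thesis
    \<comment> \<open>The union that defines composition ranges over all Ore completions. One whose
      denominator falls outside \<open>W\<close> gives the empty class and does not disturb the
      union.\<close>
    proof (cases "s \<bullet> u \<in> W")
      case True
      then show ?thesis unfolding x e using frac_loc_mor[of "s \<bullet> u" "g \<bullet> f"] M f g s u(2-5) by simp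
    next
      case False
      then show ?thesis unfolding x by (simp add: frac_empty)
    qed
  qed
  \<comment> \<open>The completion by identities shows that the expected class is attained, so the
    union is not empty.\<close>
  moreover have "loc_mor C W (g \<bullet> f) \<in> ?S"
  proof -
    have "loc_mor C W (g \<bullet> f) = frac C W (Id C (Dom C f) \<bullet> Id C (Dom C f)) (g \<bullet> f)"
      using f g by (simp add: loc_mor_def)
    moreover have "f \<bullet> Id C (Dom C f) = Id C (Dom C g) \<bullet> f" using f g by simp
    ultimately show ?thesis
      using Id_in_loc_mor[OF f] Id_in_loc_mor[OF g(1)] W_Id[of "Dom C f"] f g by force
  qed
  ultimately have "\<Union> ?S = loc_mor C W (g \<bullet> f)" by blast
  then show "loc_mor C W g \<bullet>\<^bsub>loc_cat C W\<^esub> loc_mor C W f = loc_mor C W (g \<bullet> f)"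
    by (simp add: loc_cat_def)
qed

end

section \<open>The bounded derived category of a semisimple category\<close>

lemma Cb_simps:
  "Ob (Cb C) = bounded_complexes C" "Mor (Cb C) = chain_maps C" "Dom (Cb C) = src" "Cod (Cb C) = tgt"
  "Id (Cb C) = (\<lambda>K. \<lparr>src = K, tgt = K, cm = (\<lambda>i. Id C (cO K i))\<rparr>)"
  "Cmp (Cb C) = (\<lambda>g f. \<lparr>src = src f, tgt = tgt g, cm = (\<lambda>i. cm g i \<bullet>\<^bsub>C\<^esub> cm f i)\<rparr>)"
  by (simp_all add: Cb_def)

lemma chain_mapsI:
  assumes "src f \<in> bounded_complexes C" "tgt f \<in> bounded_complexes C"
    "\<And>i. cm f i \<in> Hom C (cO (src f) i) (cO (tgt f) i)"
    "\<And>i. cD (tgt f) i \<bullet>\<^bsub>C\<^esub> cm f i = cm f (i + 1) \<bullet>\<^bsub>C\<^esub> cD (src f) i"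
  shows "f \<in> chain_maps C"
  using assms by (auto simp: chain_maps_def)

context semisimple_tensor_category
begin

lemma category_Cb: "category (Cb C)"
proof
  show "Dom (Cb C) f \<in> Ob (Cb C) \<and> Cod (Cb C) f \<in> Ob (Cb C)" if "f \<in> Mor (Cb C)" for f
    using cmapD that by (simp add: Cb_simps)
  show "Id (Cb C) K \<in> Hom (Cb C) K K" if "K \<in> Ob (Cb C)" for K
    using that by (auto simp: Cb_simps Hom_def[of "Cb C"] intro!: chain_mapsI)
  show "g \<bullet>\<^bsub>Cb C\<^esub> f \<in> Hom (Cb C) X Z" if "f \<in> Hom (Cb C) X Y" "g \<in> Hom (Cb C) Y Z" for f g X Y Z
  proof -
    have f: "f \<in> chain_maps C" "src f = X" "tgt f = Y" and g: "g \<in> chain_maps C" "src g = Y" "tgt g = Z"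
      using that by (auto simp: Cb_simps Hom_def)
    note fD = cmapD[OF f(1), unfolded f] and gD = cmapD[OF g(1), unfolded g]
    have "\<lparr>src = X, tgt = Z, cm = (\<lambda>i. cm g i \<bullet> cm f i)\<rparr> \<in> chain_maps C"
    proof (rule chain_mapsI)
      fix i
      have "cD Z i \<bullet> (cm g i \<bullet> cm f i) = (cD Z i \<bullet> cm g i) \<bullet> cm f i"
        using fD(1-5) gD(1-5) by simp
      also have "\<dots> = cm g (i + 1) \<bullet> (cD Y i \<bullet> cm f i)" unfolding gD(6) using fD(1-5) gD(1-5) by simp
      also have "\<dots> = (cm g (i + 1) \<bullet> cm f (i + 1)) \<bullet> cD X i" unfolding fD(6) using fD(1-5) gD(1-5) by simp
      finally show "cD (tgt \<lparr>src = X, tgt = Z, cm = (\<lambda>i. cm g i \<bullet> cm f i)\<rparr>) i \<bullet>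
         cm \<lparr>src = X, tgt = Z, cm = (\<lambda>i. cm g i \<bullet> cm f i)\<rparr> i =
         cm \<lparr>src = X, tgt = Z, cm = (\<lambda>i. cm g i \<bullet> cm f i)\<rparr> (i + 1) \<bullet>
         cD (src \<lparr>src = X, tgt = Z, cm = (\<lambda>i. cm g i \<bullet> cm f i)\<rparr>) i" by simp
    qed (use fD(1-5) gD(1-5) in auto)
    then show ?thesis using f g by (simp add: Cb_simps Hom_def)
  qed
  show "Id (Cb C) Y \<bullet>\<^bsub>Cb C\<^esub> f = f" "f \<bullet>\<^bsub>Cb C\<^esub> Id (Cb C) X = f" if "f \<in> Hom (Cb C) X Y" for f X Y
  proof -
    have f: "f \<in> chain_maps C" "src f = X" "tgt f = Y" using that by (auto simp: Cb_simps Hom_def)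
    then show "Id (Cb C) Y \<bullet>\<^bsub>Cb C\<^esub> f = f" "f \<bullet>\<^bsub>Cb C\<^esub> Id (Cb C) X = f"
      using cmapD[OF f(1)] by (auto simp: Cb_simps intro!: cmap.equality)
  qed
  show "(h \<bullet>\<^bsub>Cb C\<^esub> g) \<bullet>\<^bsub>Cb C\<^esub> f = h \<bullet>\<^bsub>Cb C\<^esub> (g \<bullet>\<^bsub>Cb C\<^esub> f)"
    if "f \<in> Hom (Cb C) W X" "g \<in> Hom (Cb C) X Y" "h \<in> Hom (Cb C) Y Z" for f g h W X Y Z
  proof -
    have f: "f \<in> chain_maps C" "src f = W" "tgt f = X" and g: "g \<in> chain_maps C" "src g = X" "tgt g = Y"
      and h: "h \<in> chain_maps C" "src h = Y" "tgt h = Z"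
      using that by (auto simp: Cb_simps Hom_def)
    then show ?thesis
      using cmapD(3-5)[OF f(1)] cmapD(3-5)[OF g(1)] cmapD(3-5)[OF h(1)] by (simp add: Cb_simps)
  qed
qed

end

sublocale semisimple_tensor_category \<subseteq> Cb: category "Cb C"
  by (rule category_Cb)

context semisimple_tensor_category
begin

section \<open>Chain homotopy is a congruence\<close>

lemma homotopyI:
  assumes "f \<in> chain_maps C" "g \<in> chain_maps C" "src f = src g" "tgt f = tgt g"
    "\<And>i. h i \<in> Hom C (cO (src f) i) (cO (tgt f) (i - 1))"
    "\<And>i. cm f i = Add C (cm g i) (Add C (cD (tgt f) (i - 1) \<bullet> h i) (h (i + 1) \<bullet> cD (src f) i))"
  shows "(f, g) \<in> homotopy C"
  using assms unfolding homotopy_def by blast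

lemma homotopyD:
  assumes "(f, g) \<in> homotopy C"
  shows "f \<in> chain_maps C" "g \<in> chain_maps C" "src f = src g" "tgt f = tgt g"
  using assms by (auto simp: homotopy_def)

lemma homotopy_ex:
  assumes "(f, g) \<in> homotopy C"
  shows "\<exists>h. \<forall>i. h i \<in> Mor C \<and> Dom C (h i) = cO (src g) i \<and> Cod C (h i) = cO (tgt g) (i - 1) \<and>
    cm f i = Add C (cm g i) (Add C (cD (tgt g) (i - 1) \<bullet> h i) (h (i + 1) \<bullet> cD (src g) i))"
proof -
  obtain h where h: "\<forall>i. h i \<in> Hom C (cO (src f) i) (cO (tgt f) (i - 1)) \<and>
        cm f i = Add C (cm g i)
          (Add C (cD (tgt f) (i - 1) \<bullet> h i) (h (i + 1) \<bullet> cD (src f) i))"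
    using assms unfolding homotopy_def by blast
  then show ?thesis using homotopyD(3,4)[OF assms] by (intro exI[of _ h]) (simp add: Hom_def)
qed

lemma cod_pred [simp]: "K \<in> bounded_complexes C \<Longrightarrow> Cod C (cD K (i - 1)) = cO K i"
  using cpxD(4)[of K "i - 1"] by simp

lemma homotopy_refl: "f \<in> chain_maps C \<Longrightarrow> (f, f) \<in> homotopy C"
  using cmapD[of f] by (intro homotopyI[of f f "\<lambda>i. Zero C (cO (src f) i) (cO (tgt f) (i - 1))"]) auto

lemma homotopy_sym:
  assumes "(f, g) \<in> homotopy C"
  shows "(g, f) \<in> homotopy C"
proof -
  note h0 = homotopyD[OF assms]
  obtain h where h1:
    "\<And>i. h i \<in> Mor C" "\<And>i. Dom C (h i) = cO (src g) i" "\<And>i. Cod C (h i) = cO (tgt g) (i - 1)"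
    "\<And>i. cm f i = Add C (cm g i) (Add C (cD (tgt g) (i - 1) \<bullet> h i) (h (i + 1) \<bullet> cD (src g) i))"
    using homotopy_ex[OF assms] by blast
  note h = h0 h1
  note gD = cmapD(1-5)[OF h(2)]
  show ?thesis
  proof (rule homotopyI[OF h(2,1) h(3)[symmetric] h(4)[symmetric]])
    fix i
    show "Scale C (- 1) (h i) \<in> Hom C (cO (src g) i) (cO (tgt g) (i - 1))" using h(5-7) by auto
    define u where "u = Add C (cD (tgt g) (i - 1) \<bullet> h i) (h (i + 1) \<bullet> cD (src g) i)"
    have u: "u \<in> Mor C" "Dom C u = cO (src g) i" "Cod C u = cO (tgt g) i"
      using h(5-7)[of i] h(5-7)[of "i + 1"] gD by (auto simp: u_def)
    have "Add C (cD (tgt g) (i - 1) \<bullet> Scale C (- 1) (h i)) (Scale C (- 1) (h (i + 1)) \<bullet> cD (src g) i)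
        = Scale C (- 1) u"
      using h(5-7)[of i] h(5-7)[of "i + 1"] gD by (simp add: u_def)
    moreover have "cm g i = Add C (Add C (cm g i) u) (Scale C (- 1) u)"
      using u gD by (simp add: Add_assoc)
    ultimately show "cm g i = Add C (cm f i) (Add C (cD (tgt g) (i - 1) \<bullet> Scale C (- 1) (h i))
        (Scale C (- 1) (h (i + 1)) \<bullet> cD (src g) i))"
      unfolding h(8) u_def by simp
  qed
qed

lemma homotopy_trans:
  assumes "(f, g) \<in> homotopy C" "(g, k) \<in> homotopy C"
  shows "(f, k) \<in> homotopy C"
proof -
  note h0 = homotopyD[OF assms(1)]
  obtain h where h1:
    "\<And>i. h i \<in> Mor C" "\<And>i. Dom C (h i) = cO (src g) i" "\<And>i. Cod C (h i) = cO (tgt g) (i - 1)"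
    "\<And>i. cm f i = Add C (cm g i) (Add C (cD (tgt g) (i - 1) \<bullet> h i) (h (i + 1) \<bullet> cD (src g) i))"
    using homotopy_ex[OF assms(1)] by blast
  note h = h0 h1
  note l0 = homotopyD[OF assms(2)]
  obtain l where l1:
    "\<And>i. l i \<in> Mor C" "\<And>i. Dom C (l i) = cO (src k) i" "\<And>i. Cod C (l i) = cO (tgt k) (i - 1)"
    "\<And>i. cm g i = Add C (cm k i) (Add C (cD (tgt k) (i - 1) \<bullet> l i) (l (i + 1) \<bullet> cD (src k) i))"
    using homotopy_ex[OF assms(2)] by blast
  note l = l0 l1
  note kD = cmapD(1-5)[OF l(2)]
  show ?thesis
  proof (rule homotopyI[OF h(1) l(2)])
    fix i
    note hl = h(5-7)[of i, unfolded l] h(5-7)[of "i + 1", unfolded l] l(5-7)[of i] l(5-7)[of "i + 1"]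
    show "Add C (h i) (l i) \<in> Hom C (cO (src f) i) (cO (tgt f) (i - 1))" using hl h(3,4) l(3,4) by auto
    show "cm f i = Add C (cm k i) (Add C (cD (tgt f) (i - 1) \<bullet> Add C (h i) (l i))
        (Add C (h (i + 1)) (l (i + 1)) \<bullet> cD (src f) i))"
      unfolding h(8) l(8) h(3,4) l(3,4) using hl kD by (simp add: Add_ac)
  qed (use h l in auto)
qed

lemma equiv_homotopy: "equiv (chain_maps C) (homotopy C)"
  by (intro equivI refl_onI symI transI subsetI)
    (auto intro: homotopy_refl homotopy_sym homotopy_trans dest: homotopyD)

lemma homotopy_cmp_left:
  assumes "(f, f') \<in> homotopy C" "g \<in> chain_maps C" "tgt f = src g"
  shows "(g \<bullet>\<^bsub>Cb C\<^esub> f, g \<bullet>\<^bsub>Cb C\<^esub> f') \<in> homotopy C"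
proof -
  note h0 = homotopyD[OF assms(1)]
  obtain h where h1:
    "\<And>i. h i \<in> Mor C" "\<And>i. Dom C (h i) = cO (src f') i" "\<And>i. Cod C (h i) = cO (tgt f') (i - 1)"
    "\<And>i. cm f i = Add C (cm f' i) (Add C (cD (tgt f') (i - 1) \<bullet> h i) (h (i + 1) \<bullet> cD (src f') i))"
    using homotopy_ex[OF assms(1)] by blast
  note h = h0 h1
  have t: "tgt f' = src g" using assms(3) h(4) by simp
  note fD = cmapD[OF h(2), unfolded t] and gD = cmapD[OF assms(2)]
  have c: "g \<bullet>\<^bsub>Cb C\<^esub> f \<in> chain_maps C" "g \<bullet>\<^bsub>Cb C\<^esub> f' \<in> chain_maps C"
    using Cb.cmp_arrow(1)[of f g] Cb.cmp_arrow(1)[of f' g] h assms(2) t by (auto simp: Cb_simps)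
  show ?thesis
  proof (rule homotopyI[OF c])
    fix i
    note hi = h(5-7)[of i, unfolded t] h(5-7)[of "i + 1", unfolded t]
    \<comment> \<open>The homotopy \<open>h i\<close> lowers the degree by one, so \<open>g\<close>
      enters with index \<open>i - 1\<close>; the chain map relation for \<open>g\<close> then moves
      it past the differential.\<close>
    show "cm g (i - 1) \<bullet> h i \<in> Hom C (cO (src (g \<bullet>\<^bsub>Cb C\<^esub> f)) i) (cO (tgt (g \<bullet>\<^bsub>Cb C\<^esub> f)) (i - 1))"
      using hi gD(3-5) h(3) by (auto simp: Cb_simps)
    have "cm g i \<bullet> (cD (src g) (i - 1) \<bullet> h i) = (cm g i \<bullet> cD (src g) (i - 1)) \<bullet> h i"
      using hi gD(1-5) by simp
    also have "\<dots> = cD (tgt g) (i - 1) \<bullet> (cm g (i - 1) \<bullet> h i)"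
      unfolding gD(7) using hi gD(1-5) by simp
    finally have e: "cm g i \<bullet> (cD (src g) (i - 1) \<bullet> h i) = cD (tgt g) (i - 1) \<bullet> (cm g (i - 1) \<bullet> h i)" .
    have "cm g i \<bullet> cm f i = Add C (cm g i \<bullet> cm f' i) (Add C (cm g i \<bullet> (cD (src g) (i - 1) \<bullet> h i))
        ((cm g i \<bullet> h (i + 1)) \<bullet> cD (src f') i))"
      unfolding h(8) t using hi gD(1-5) fD(1-5) by simp
    then show "cm (g \<bullet>\<^bsub>Cb C\<^esub> f) i = Add C (cm (g \<bullet>\<^bsub>Cb C\<^esub> f') i)
        (Add C (cD (tgt (g \<bullet>\<^bsub>Cb C\<^esub> f)) (i - 1) \<bullet> (cm g (i - 1) \<bullet> h i))
          ((cm g (i + 1 - 1) \<bullet> h (i + 1)) \<bullet> cD (src (g \<bullet>\<^bsub>Cb C\<^esub> f)) i))"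
      unfolding e using h(3) by (simp add: Cb_simps)
  qed (use h in \<open>auto simp: Cb_simps\<close>)
qed

lemma homotopy_cmp_right:
  assumes "(f, f') \<in> homotopy C" "g \<in> chain_maps C" "tgt g = src f"
  shows "(f \<bullet>\<^bsub>Cb C\<^esub> g, f' \<bullet>\<^bsub>Cb C\<^esub> g) \<in> homotopy C"
proof -
  note h0 = homotopyD[OF assms(1)]
  obtain h where h1:
    "\<And>i. h i \<in> Mor C" "\<And>i. Dom C (h i) = cO (src f') i" "\<And>i. Cod C (h i) = cO (tgt f') (i - 1)"
    "\<And>i. cm f i = Add C (cm f' i) (Add C (cD (tgt f') (i - 1) \<bullet> h i) (h (i + 1) \<bullet> cD (src f') i))"
    using homotopy_ex[OF assms(1)] by blast
  note h = h0 h1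
  have t: "src f' = tgt g" using assms(3) h(3) by simp
  note fD = cmapD[OF h(2), unfolded t] and gD = cmapD[OF assms(2)]
  have c: "f \<bullet>\<^bsub>Cb C\<^esub> g \<in> chain_maps C" "f' \<bullet>\<^bsub>Cb C\<^esub> g \<in> chain_maps C"
    using Cb.cmp_arrow(1)[of g f] Cb.cmp_arrow(1)[of g f'] h assms(2) t by (auto simp: Cb_simps)
  show ?thesis
  proof (rule homotopyI[OF c])
    fix i
    note hi = h(5-7)[of i, unfolded t] h(5-7)[of "i + 1", unfolded t]
    show "h i \<bullet> cm g i \<in> Hom C (cO (src (f \<bullet>\<^bsub>Cb C\<^esub> g)) i) (cO (tgt (f \<bullet>\<^bsub>Cb C\<^esub> g)) (i - 1))"
      using hi gD(3-5) h(4) by (auto simp: Cb_simps)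
    have "cm f i \<bullet> cm g i = Add C (cm f' i \<bullet> cm g i) (Add C (cD (tgt f') (i - 1) \<bullet> (h i \<bullet> cm g i))
        (h (i + 1) \<bullet> (cD (tgt g) i \<bullet> cm g i)))"
      unfolding h(8) t using hi gD(1-5) fD(1-5) by simp
    also have "h (i + 1) \<bullet> (cD (tgt g) i \<bullet> cm g i) = (h (i + 1) \<bullet> cm g (i + 1)) \<bullet> cD (src g) i"
      unfolding gD(6) using hi gD(1-5) by simp
    finally show "cm (f \<bullet>\<^bsub>Cb C\<^esub> g) i = Add C (cm (f' \<bullet>\<^bsub>Cb C\<^esub> g) i)
        (Add C (cD (tgt (f \<bullet>\<^bsub>Cb C\<^esub> g)) (i - 1) \<bullet> (h i \<bullet> cm g i))
          ((h (i + 1) \<bullet> cm g (i + 1)) \<bullet> cD (src (f \<bullet>\<^bsub>Cb C\<^esub> g)) i))"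
      using h(4) by (simp add: Cb_simps)
  qed (use h in \<open>auto simp: Cb_simps\<close>)
qed

lemma Kb_quotient_functor: "quotient_functor (Cb C) (Kb C) (\<lambda>f. homotopy C `` {f})"
  unfolding Kb_def
proof (rule quot_cat_quotient_functor[OF category_Cb])
  show "equiv (Mor (Cb C)) (homotopy C)" using equiv_homotopy by (simp add: Cb_simps)
  show "Dom (Cb C) f = Dom (Cb C) g \<and> Cod (Cb C) f = Cod (Cb C) g" if "(f, g) \<in> homotopy C" for f g
    using that by (auto simp: Cb_simps dest: homotopyD)
  show "(g \<bullet>\<^bsub>Cb C\<^esub> f, g' \<bullet>\<^bsub>Cb C\<^esub> f') \<in> homotopy C"
    if "(f, f') \<in> homotopy C" "(g, g') \<in> homotopy C" "Cod (Cb C) f = Dom (Cb C) g" for f f' g g'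
  proof (rule homotopy_trans)
    show "(g \<bullet>\<^bsub>Cb C\<^esub> f, g \<bullet>\<^bsub>Cb C\<^esub> f') \<in> homotopy C"
      using that by (intro homotopy_cmp_left) (auto simp: Cb_simps dest: homotopyD)
    show "(g \<bullet>\<^bsub>Cb C\<^esub> f', g' \<bullet>\<^bsub>Cb C\<^esub> f') \<in> homotopy C"
      using that by (intro homotopy_cmp_right) (auto simp: Cb_simps dest: homotopyD)
  qed
qed

end

sublocale semisimple_tensor_category \<subseteq> Kb: quotient_functor "Cb C" "Kb C" "\<lambda>f. homotopy C `` {f}"
  by (rule Kb_quotient_functor)

sublocale semisimple_tensor_category \<subseteq> Kb: category "Kb C"
  by (rule Kb.quotient_category)

section \<open>Quasi-isomorphisms are homotopy equivalences\<close>

context semisimple_tensor_category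
begin

lemma class_eq: "f \<in> chain_maps C \<Longrightarrow> g \<in> chain_maps C \<Longrightarrow>
    homotopy C `` {f} = homotopy C `` {g} \<longleftrightarrow> (f, g) \<in> homotopy C"
  by (rule eq_equiv_class_iff[OF equiv_homotopy])

text \<open>The endomorphism \<open>j p\<close> projects onto a copy of the cohomology inside the
  complex. The maps \<open>h\<close> of \<open>cohom_data\<close> are the required homotopy as they
  stand.\<close>

lemma harmonic_homotopic:
  assumes K: "K \<in> bounded_complexes C" and d: "cohom_data C K p j h"
  defines "E \<equiv> \<lparr>src = K, tgt = K, cm = (\<lambda>i. j i \<bullet> p i)\<rparr>"
  shows "(Id (Cb C) K, E) \<in> homotopy C"
proof -
  note D = cohom_dataD[OF d]
  have "E \<in> chain_maps C"
  proof (rule chain_mapsI)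
    fix i
    have "p (i + 1) \<bullet> cD K i = Zero C (cO K i) (cohom C K (i + 1))" using D(13)[of "i + 1"] by simp
    then have "(j (i + 1) \<bullet> p (i + 1)) \<bullet> cD K i = Zero C (cO K i) (cO K (i + 1))"
      using D(1-10)[of "i + 1"] K by simp
    moreover have "cD K i \<bullet> (j i \<bullet> p i) = (cD K i \<bullet> j i) \<bullet> p i" using D(1-10)[of i] K by simp
    then have "cD K i \<bullet> (j i \<bullet> p i) = Zero C (cO K i) (cO K (i + 1))"
      unfolding D(12) using D(1-10)[of i] K by simp
    ultimately show "cD (tgt E) i \<bullet> cm E i = cm E (i + 1) \<bullet> cD (src E) i" by (simp add: E_def)
  qed (use K D(1-10) in \<open>auto simp: E_def\<close>)
  moreover have "Id (Cb C) K \<in> chain_maps C" using Cb.Id_arrow[of K] K by (simp add: Cb_simps)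
  ultimately show ?thesis
    using D(8-10) D(14)[symmetric]
    by (intro homotopyI[of _ _ h]) (auto simp: Cb_simps E_def)
qed

text \<open>The inverses \<open>\<psi>\<close> on cohomology are transported to the complexes as
  \<open>g = j \<psi> p'\<close>. On the nose this gives only \<open>(g f) EK = EK\<close> and
  \<open>EL (f g) = EL\<close> for the projections onto cohomology; these projections are homotopic
  to the identities, so they may be cancelled up to homotopy.\<close>

lemma quasi_iso_homotopy_inverse:
  assumes f: "quasi_iso C f"
  obtains g where "g \<in> chain_maps C" "src g = tgt f" "tgt g = src f"
    "(g \<bullet>\<^bsub>Cb C\<^esub> f, Id (Cb C) (src f)) \<in> homotopy C" "(f \<bullet>\<^bsub>Cb C\<^esub> g, Id (Cb C) (tgt f)) \<in> homotopy C"
proof -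
  have fc: "f \<in> chain_maps C" and iso: "\<And>i. is_iso C (cohom_map C f i)"
    using f by (auto simp: quasi_iso_def)
  note fD = cmapD[OF fc]
  let ?K = "src f" and ?L = "tgt f"
  obtain p j h where K: "cohom_data C ?K p j h" using cohom_data_exists fD(1) by blast
  obtain p' j' h' where L: "cohom_data C ?L p' j' h'" using cohom_data_exists fD(2) by blast
  note KD = cohom_dataD[OF K] and LD = cohom_dataD[OF L]
  define \<phi> where "\<phi> = (\<lambda>i. p' i \<bullet> (cm f i \<bullet> j i))"
  have phi: "\<phi> i \<in> Mor C" "Dom C (\<phi> i) = cohom C ?K i" "Cod C (\<phi> i) = cohom C ?L i" for i
    using KD(1-10)[of i] LD(1-10)[of i] fD(3-5)[of i] by (auto simp: \<phi>_def)
  have "\<forall>i. \<exists>y. y \<in> Mor C \<and> Dom C y = cohom C ?L i \<and> Cod C y = cohom C ?K i \<and>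
      y \<bullet> \<phi> i = Id C (cohom C ?K i) \<and> \<phi> i \<bullet> y = Id C (cohom C ?L i)"
  proof
    fix i
    have "is_iso C (\<phi> i)" using iso[of i] cohom_map_eq[OF fc K L, of i] by (simp add: \<phi>_def)
    then show "\<exists>y. y \<in> Mor C \<and> Dom C y = cohom C ?L i \<and> Cod C y = cohom C ?K i \<and>
      y \<bullet> \<phi> i = Id C (cohom C ?K i) \<and> \<phi> i \<bullet> y = Id C (cohom C ?L i)"
      using phi[of i] by (elim is_isoE) auto
  qed
  from choice[OF this] obtain \<psi> where psi: "\<And>i. \<psi> i \<in> Mor C" "\<And>i. Dom C (\<psi> i) = cohom C ?L i"
    "\<And>i. Cod C (\<psi> i) = cohom C ?K i" "\<And>i. \<psi> i \<bullet> \<phi> i = Id C (cohom C ?K i)"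
    "\<And>i. \<phi> i \<bullet> \<psi> i = Id C (cohom C ?L i)" by blast
  define g where "g = \<lparr>src = ?L, tgt = ?K, cm = (\<lambda>i. j i \<bullet> (\<psi> i \<bullet> p' i))\<rparr>"
  define EK where "EK = \<lparr>src = ?K, tgt = ?K, cm = (\<lambda>i. j i \<bullet> p i)\<rparr>"
  define EL where "EL = \<lparr>src = ?L, tgt = ?L, cm = (\<lambda>i. j' i \<bullet> p' i)\<rparr>"
  have EK: "(Id (Cb C) ?K, EK) \<in> homotopy C" unfolding EK_def by (rule harmonic_homotopic[OF fD(1) K])
  have EL: "(Id (Cb C) ?L, EL) \<in> homotopy C" unfolding EL_def by (rule harmonic_homotopic[OF fD(2) L])
  have g: "g \<in> chain_maps C"
  proof (rule chain_mapsI)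
    fix i
    have "p' (i + 1) \<bullet> cD ?L i = Zero C (cO ?L i) (cohom C ?L (i + 1))" using LD(13)[of "i + 1"] by simp
    then have "(j (i + 1) \<bullet> (\<psi> (i + 1) \<bullet> p' (i + 1))) \<bullet> cD ?L i = Zero C (cO ?L i) (cO ?K (i + 1))"
      using KD(1-10)[of "i + 1"] LD(1-10)[of "i + 1"] psi(1-3)[of "i + 1"] fD(1,2) by simp
    moreover have "cD ?K i \<bullet> (j i \<bullet> (\<psi> i \<bullet> p' i)) = (cD ?K i \<bullet> j i) \<bullet> (\<psi> i \<bullet> p' i)"
      using KD(1-10)[of i] LD(1-10)[of i] psi(1-3)[of i] fD(1,2) by simp
    then have "cD ?K i \<bullet> (j i \<bullet> (\<psi> i \<bullet> p' i)) = Zero C (cO ?L i) (cO ?K (i + 1))"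
      unfolding KD(12) using KD(1-10)[of i] LD(1-10)[of i] psi(1-3)[of i] fD(1,2) by simp
    ultimately show "cD (tgt g) i \<bullet> cm g i = cm g (i + 1) \<bullet> cD (src g) i" by (simp add: g_def)
  qed (use fD(1,2) KD(1-10) LD(1-10) psi(1-3) in \<open>auto simp: g_def\<close>)
  have 1: "(g \<bullet>\<^bsub>Cb C\<^esub> f) \<bullet>\<^bsub>Cb C\<^esub> EK = EK"
  proof -
    have "((j i \<bullet> (\<psi> i \<bullet> p' i)) \<bullet> cm f i) \<bullet> (j i \<bullet> p i) = j i \<bullet> p i" for i
    proof -
      have "((j i \<bullet> (\<psi> i \<bullet> p' i)) \<bullet> cm f i) \<bullet> (j i \<bullet> p i) = j i \<bullet> ((\<psi> i \<bullet> \<phi> i) \<bullet> p i)"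
        using KD(1-10)[of i] LD(1-10)[of i] psi(1-3)[of i] fD(3-5)[of i] by (simp add: \<phi>_def)
      then show ?thesis unfolding psi(4) using KD(1-10)[of i] by simp
    qed
    then show ?thesis by (simp add: Cb_simps g_def EK_def)
  qed
  have 2: "EL \<bullet>\<^bsub>Cb C\<^esub> (f \<bullet>\<^bsub>Cb C\<^esub> g) = EL"
  proof -
    have "(j' i \<bullet> p' i) \<bullet> (cm f i \<bullet> (j i \<bullet> (\<psi> i \<bullet> p' i))) = j' i \<bullet> p' i" for i
    proof -
      have "(j' i \<bullet> p' i) \<bullet> (cm f i \<bullet> (j i \<bullet> (\<psi> i \<bullet> p' i))) = j' i \<bullet> ((\<phi> i \<bullet> \<psi> i) \<bullet> p' i)"
        using KD(1-10)[of i] LD(1-10)[of i] psi(1-3)[of i] fD(3-5)[of i] by (simp add: \<phi>_def)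
      then show ?thesis unfolding psi(5) using LD(1-10)[of i] by simp
    qed
    then show ?thesis by (simp add: Cb_simps g_def EL_def)
  qed
  have gf: "g \<bullet>\<^bsub>Cb C\<^esub> f \<in> chain_maps C" "f \<bullet>\<^bsub>Cb C\<^esub> g \<in> chain_maps C"
    using Cb.cmp_arrow(1)[of f g] Cb.cmp_arrow(1)[of g f] fc g by (auto simp: Cb_simps g_def)
  have st: "src (g \<bullet>\<^bsub>Cb C\<^esub> f) = ?K" "tgt (f \<bullet>\<^bsub>Cb C\<^esub> g) = ?L" by (auto simp: Cb_simps g_def)
  show ?thesis
  proof (rule that[OF g])
    have "((g \<bullet>\<^bsub>Cb C\<^esub> f) \<bullet>\<^bsub>Cb C\<^esub> Id (Cb C) ?K, (g \<bullet>\<^bsub>Cb C\<^esub> f) \<bullet>\<^bsub>Cb C\<^esub> EK) \<in> homotopy C"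
      using gf st by (intro homotopy_cmp_left[OF EK]) (auto simp: Cb_simps)
    moreover have "(g \<bullet>\<^bsub>Cb C\<^esub> f) \<bullet>\<^bsub>Cb C\<^esub> Id (Cb C) ?K = g \<bullet>\<^bsub>Cb C\<^esub> f"
      using gf(1) st(1) by (intro Cb.Id_right_arrow) (auto simp: Cb_simps)
    ultimately show "(g \<bullet>\<^bsub>Cb C\<^esub> f, Id (Cb C) ?K) \<in> homotopy C"
      unfolding 1 using homotopy_trans homotopy_sym[OF EK] by metis
    have "(Id (Cb C) ?L \<bullet>\<^bsub>Cb C\<^esub> (f \<bullet>\<^bsub>Cb C\<^esub> g), EL \<bullet>\<^bsub>Cb C\<^esub> (f \<bullet>\<^bsub>Cb C\<^esub> g)) \<in> homotopy C"
      using gf st by (intro homotopy_cmp_right[OF EL]) (auto simp: Cb_simps)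
    moreover have "Id (Cb C) ?L \<bullet>\<^bsub>Cb C\<^esub> (f \<bullet>\<^bsub>Cb C\<^esub> g) = f \<bullet>\<^bsub>Cb C\<^esub> g"
      using gf(2) st(2) by (intro Cb.Id_left_arrow) (auto simp: Cb_simps)
    ultimately show "(f \<bullet>\<^bsub>Cb C\<^esub> g, Id (Cb C) ?L) \<in> homotopy C"
      unfolding 2 using homotopy_trans homotopy_sym[OF EL] by metis
  qed (auto simp: g_def)
qed

lemma qis_iso:
  assumes "a \<in> qis C"
  shows "is_iso (Kb C) a"
proof -
  obtain f where f: "f \<in> a" "quasi_iso C f" and a: "a \<in> Mor (Kb C)" using assms by (auto simp: qis_def)
  have fc: "f \<in> chain_maps C" using f by (simp add: quasi_iso_def)
  have a_eq: "a = homotopy C `` {f}"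
    using a f(1) unfolding Kb.Mor_eq by (auto simp: Cb_simps intro!: equiv_class_eq[OF equiv_homotopy])
  obtain g where g: "g \<in> chain_maps C" "src g = tgt f" "tgt g = src f"
    "(g \<bullet>\<^bsub>Cb C\<^esub> f, Id (Cb C) (src f)) \<in> homotopy C" "(f \<bullet>\<^bsub>Cb C\<^esub> g, Id (Cb C) (tgt f)) \<in> homotopy C"
    using quasi_iso_homotopy_inverse[OF f(2)] .
  have Hf: "f \<in> Hom (Cb C) (src f) (tgt f)" "g \<in> Hom (Cb C) (tgt f) (src f)"
    using fc g by (auto simp: Hom_def Cb_simps)
  note Hf' = Cb.HomD[OF Hf(1)] Cb.HomD[OF Hf(2)]
  show ?thesis
  proof (rule Kb.is_isoI)
    show "a \<in> Hom (Kb C) (src f) (tgt f)" "homotopy C `` {g} \<in> Hom (Kb C) (tgt f) (src f)"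
      using Hf by (auto simp: a_eq Kb.Hom_eq)
    show "homotopy C `` {g} \<bullet>\<^bsub>Kb C\<^esub> a = Id (Kb C) (src f)" "a \<bullet>\<^bsub>Kb C\<^esub> homotopy C `` {g} = Id (Kb C) (tgt f)"
      using g(4,5) Hf' by (simp_all add: a_eq Kb.Cmp_eq Kb.Id_eq equiv_class_eq[OF equiv_homotopy])
  qed
qed

lemma Id_qis:
  assumes "K \<in> Ob (Kb C)"
  shows "Id (Kb C) K \<in> qis C"
proof -
  have K: "K \<in> bounded_complexes C" using assms by (simp add: Kb.Ob_eq Cb_simps)
  have I: "Id (Cb C) K \<in> chain_maps C" using Cb.Id_arrow(1)[of K] K by (simp add: Cb_simps)
  obtain p j h where d: "cohom_data C K p j h" using cohom_data_exists K by blast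
  note D = cohom_dataD[OF d]
  have "cohom_map C (Id (Cb C) K) i = Id C (cohom C K i)" for i
    using cohom_map_eq[OF I, of p j h p j h i] d D(1-10)[of i] D(11)[of i] by (simp add: Cb_simps)
  moreover have "is_iso C (Id C X)" if "X \<in> Ob C" for X
    using that by (intro is_isoI[of _ X X "Id C X"]) auto
  ultimately have "quasi_iso C (Id (Cb C) K)" using I D(1) by (simp add: quasi_iso_def)
  moreover have "Id (Cb C) K \<in> homotopy C `` {Id (Cb C) K}" using homotopy_refl[OF I] by simp
  moreover have "Id (Kb C) K = homotopy C `` {Id (Cb C) K}" using K by (simp add: Kb.Id_eq Cb_simps)
  moreover have "Id (Kb C) K \<in> Mor (Kb C)" using assms by simp
  ultimately show ?thesis by (auto simp: qis_def)
qed

lemma trivial_localization: "trivial_localization (Kb C) (qis C)"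
  by unfold_locales (auto simp: qis_iso Id_qis, simp add: qis_def)

end

sublocale semisimple_tensor_category \<subseteq> loc: trivial_localization "Kb C" "qis C"
  by (rule trivial_localization)

lemma Db_simps:
  "Ob (Db C) = Ob (Db_cat C)" "Mor (Db C) = Mor (Db_cat C)" "Dom (Db C) = Dom (Db_cat C)"
  "Cod (Db C) = Cod (Db_cat C)" "Id (Db C) = Id (Db_cat C)" "Cmp (Db C) = Cmp (Db_cat C)"
  "TensO (Db C) = tot_cpx C" "Sh (Db C) = Db_shift C"
  by (simp_all add: Db_def moncat.defs ttcat.defs Db_cat_def loc_cat_def Kb_def quot_cat_def Cb_def)

context semisimple_tensor_category
begin

lemma Db_quotient_functor: "quotient_functor (Cb C) (Db C) (to_Db C)"
proof -
  interpret L: quotient_functor "Kb C" "Db_cat C" "loc_mor (Kb C) (qis C)"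
    unfolding Db_cat_def by (rule loc.loc_quotient_functor)
  show ?thesis
  proof
    show "Ob (Db C) = Ob (Cb C)" by (simp add: Db_simps L.Ob_eq Kb.Ob_eq)
    show "Mor (Db C) = to_Db C ` Mor (Cb C)"
      by (simp add: Db_simps L.Mor_eq Kb.Mor_eq to_Db_def image_image)
    show "Id (Db C) X = to_Db C (Id (Cb C) X)" if "X \<in> Ob (Cb C)" for X
      using that by (simp add: Db_simps L.Id_eq Kb.Id_eq Kb.Ob_eq to_Db_def)
    fix f assume f: "f \<in> Mor (Cb C)"
    then have F: "homotopy C `` {f} \<in> Mor (Kb C)" by (simp add: Kb.Mor_eq)
    show "Dom (Db C) (to_Db C f) = Dom (Cb C) f" "Cod (Db C) (to_Db C f) = Cod (Cb C) f"
      using L.Dom_eq[OF F] L.Cod_eq[OF F] f by (simp_all add: Db_simps Kb.Dom_eq Kb.Cod_eq to_Db_def)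
    fix g assume g: "g \<in> Mor (Cb C)" "Cod (Cb C) f = Dom (Cb C) g"
    then have G: "homotopy C `` {g} \<in> Mor (Kb C)" by (simp add: Kb.Mor_eq)
    show "to_Db C g \<bullet>\<^bsub>Db C\<^esub> to_Db C f = to_Db C (g \<bullet>\<^bsub>Cb C\<^esub> f)"
      using L.Cmp_eq[OF F G] f g by (simp add: Db_simps to_Db_def Kb.Dom_eq Kb.Cod_eq Kb.Cmp_eq)
  qed
qed

text \<open>Together with the surjectivity of \<open>to_Db\<close> on morphisms this allows
  computing in the derived category with chain maps up to homotopy.\<close>

lemma to_Db_eq_iff:
  assumes "f \<in> chain_maps C" "g \<in> chain_maps C"
  shows "to_Db C f = to_Db C g \<longleftrightarrow> (f, g) \<in> homotopy C"
proof -
  have M: "homotopy C `` {f} \<in> Mor (Kb C)" "homotopy C `` {g} \<in> Mor (Kb C)"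
    using assms by (auto simp: Kb.Mor_eq Cb_simps)
  show ?thesis
    unfolding to_Db_def using loc.loc_mor_inj[OF M] class_eq[OF assms] by metis
qed

end

sublocale semisimple_tensor_category \<subseteq> Db: quotient_functor "Cb C" "Db C" "to_Db C"
  by (rule Db_quotient_functor)

sublocale semisimple_tensor_category \<subseteq> Db: category "Db C"
  by (rule Db.quotient_category)

section \<open>Occurrence of simple objects in cohomology\<close>

text \<open>For simple \<open>S\<close> this says that \<open>S\<close> is a constituent of the
  cohomology in degree \<open>i\<close>. The wording by cocycles and coboundaries avoids the chosen
  cohomology objects, so it can be tested on total complexes and twists.\<close>

definition occurs :: "('o, 'm, 'k, 'x) lincat_scheme \<Rightarrow> 'o \<Rightarrow> int \<Rightarrow> ('o, 'm) cpx \<Rightarrow> bool" where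
  "occurs C S i K \<longleftrightarrow> (\<exists>x \<in> Hom C S (cO K i). cD K i \<bullet>\<^bsub>C\<^esub> x = Zero C S (cO K (i + 1)) \<and>
     \<not> (\<exists>y \<in> Hom C S (cO K (i - 1)). x = cD K (i - 1) \<bullet>\<^bsub>C\<^esub> y))"

text \<open>This is \<open>X[-n]\<close>: the object \<open>X\<close> sits in cohomological degree
  \<open>n\<close>.\<close>

definition stalk :: "('o, 'm, 'k, 'x) lincat_scheme \<Rightarrow> 'o \<Rightarrow> int \<Rightarrow> ('o, 'm) cpx" where
  "stalk C X n = (let K = (\<lambda>i. if i = n then X else zobj C)
     in \<lparr>cO = K, cD = (\<lambda>i. Zero C (K i) (K (i + 1)))\<rparr>)"

lemma stalk_0: "stalk C X 0 = conc C X"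
  by (simp add: stalk_def conc_def)

lemma stalk_simps:
  "cO (stalk C X n) i = (if i = n then X else zobj C)"
  "cD (stalk C X n) i = Zero C (cO (stalk C X n) i) (cO (stalk C X n) (i + 1))"
  by (simp_all add: stalk_def Let_def)

text \<open>Zero morphisms and shifts of simple objects, characterized without reference to the linear
  structure, so that equivalences preserve them.\<close>

definition null_mor :: "('o, 'm, 'x) cat_scheme \<Rightarrow> 'm \<Rightarrow> bool" where
  "null_mor T u \<longleftrightarrow> (\<forall>V. \<forall>f \<in> Hom T V (Dom T u). \<forall>g \<in> Hom T V (Dom T u). u \<bullet>\<^bsub>T\<^esub> f = u \<bullet>\<^bsub>T\<^esub> g)"

definition atom :: "('o, 'm, 'x) cat_scheme \<Rightarrow> 'o \<Rightarrow> bool" where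
  "atom T X \<longleftrightarrow> X \<in> Ob T \<and> \<not> null_mor T (Id T X) \<and>
     (\<forall>Y. \<forall>u \<in> Hom T X Y. \<not> null_mor T u \<longrightarrow> (\<exists>r \<in> Hom T Y X. r \<bullet>\<^bsub>T\<^esub> u = Id T X))"

context semisimple_tensor_category
begin

text \<open>On a cocycle the homotopy identity reads \<open>x = j p x + d h x\<close>, so the class
  \<open>p x\<close> decides whether \<open>x\<close> is a coboundary.\<close>

lemma boundary_iff:
  assumes K: "K \<in> bounded_complexes C" and d: "cohom_data C K p j h"
    and x: "x \<in> Hom C S (cO K i)" "cD K i \<bullet> x = Zero C S (cO K (i + 1))"
  shows "(\<exists>y \<in> Hom C S (cO K (i - 1)). x = cD K (i - 1) \<bullet> y) \<longleftrightarrow> p i \<bullet> x = Zero C S (cohom C K i)"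
proof
  note D = cohom_dataD[OF d] and xD = HomD[OF x(1)]
  { assume "\<exists>y \<in> Hom C S (cO K (i - 1)). x = cD K (i - 1) \<bullet> y"
    then obtain y where y: "y \<in> Hom C S (cO K (i - 1))" "x = cD K (i - 1) \<bullet> y" by blast
    have "p i \<bullet> x = (p i \<bullet> cD K (i - 1)) \<bullet> y" unfolding y(2) using HomD[OF y(1)] D(1-10)[of i] K by simp
    then show "p i \<bullet> x = Zero C S (cohom C K i)"
      unfolding D(13) using HomD[OF y(1)] D(1-10)[of i] K by simp }
  assume px: "p i \<bullet> x = Zero C S (cohom C K i)"
  have "x = Add C (j i \<bullet> p i) (Add C (cD K (i - 1) \<bullet> h i) (h (i + 1) \<bullet> cD K i)) \<bullet> x"
    unfolding D(14) using xD by simp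
  also have "\<dots> = Add C (j i \<bullet> (p i \<bullet> x)) (Add C (cD K (i - 1) \<bullet> (h i \<bullet> x)) (h (i + 1) \<bullet> (cD K i \<bullet> x)))"
    using D(1-10)[of i] D(1-10)[of "i + 1"] xD K by simp
  also have "\<dots> = cD K (i - 1) \<bullet> (h i \<bullet> x)"
    unfolding px x(2) using D(1-10)[of i] D(1-10)[of "i + 1"] xD K by simp
  finally have "x = cD K (i - 1) \<bullet> (h i \<bullet> x)" .
  moreover have "h i \<bullet> x \<in> Hom C S (cO K (i - 1))" using D(8-10)[of i] xD by auto
  ultimately show "\<exists>y \<in> Hom C S (cO K (i - 1)). x = cD K (i - 1) \<bullet> y" by blast
qed

text \<open>A nonzero cohomology object receives a nonzero map \<open>y\<close> from a simple
  object; \<open>j y\<close> is a cocycle with class \<open>y\<close>. This translates the standard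
  t-structure into statements about \<open>occurs\<close>.\<close>

lemma cohom_zero_iff:
  assumes K: "K \<in> bounded_complexes C"
  shows "zero_object C (cohom C K i) \<longleftrightarrow> (\<forall>S. simple_object C S \<longrightarrow> \<not> occurs C S i K)"
proof
  obtain p j h where d: "cohom_data C K p j h" using cohom_data_exists K by blast
  note D = cohom_dataD[OF d]
  { assume z: "zero_object C (cohom C K i)"
    show "\<forall>S. simple_object C S \<longrightarrow> \<not> occurs C S i K"
    proof (intro allI impI notI)
      fix S assume "occurs C S i K"
      then obtain x where x: "x \<in> Hom C S (cO K i)" "cD K i \<bullet> x = Zero C S (cO K (i + 1))"
        and nb: "\<not> (\<exists>y \<in> Hom C S (cO K (i - 1)). x = cD K (i - 1) \<bullet> y)"
        unfolding occurs_def by blast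
      have "p i \<bullet> x = Zero C S (cohom C K i)"
        using into_zero_object[OF z, of "p i \<bullet> x"] D(1-10)[of i] HomD[OF x(1)] by simp
      then show False using nb boundary_iff[OF K d x] by blast
    qed }
  assume no: "\<forall>S. simple_object C S \<longrightarrow> \<not> occurs C S i K"
  show "zero_object C (cohom C K i)"
  proof (rule ccontr)
    assume "\<not> zero_object C (cohom C K i)"
    then obtain S y where S: "simple_object C S" and y: "y \<in> Hom C S (cohom C K i)" "y \<noteq> Zero C S (cohom C K i)"
      using nonzero_simple_map[OF D(1)] by blast
    note yD = HomD[OF y(1)]
    have x: "j i \<bullet> y \<in> Hom C S (cO K i)" using yD D(1-10)[of i] by auto
    have "cD K i \<bullet> (j i \<bullet> y) = (cD K i \<bullet> j i) \<bullet> y" using yD D(1-10)[of i] K by simp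
    then have dx: "cD K i \<bullet> (j i \<bullet> y) = Zero C S (cO K (i + 1))"
      unfolding D(12) using yD D(1-10)[of i] K by simp
    have "p i \<bullet> (j i \<bullet> y) = (p i \<bullet> j i) \<bullet> y" using yD D(1-10)[of i] by simp
    then have "p i \<bullet> (j i \<bullet> y) = y" unfolding D(11) using yD by simp
    then have "occurs C S i K"
      unfolding occurs_def using boundary_iff[OF K d x dx] y(2) x dx by auto
    then show False using no S by blast
  qed
qed

text \<open>The class \<open>p x\<close> is nonzero, so it splits in the cohomology. Composing its
  retraction with \<open>p\<close> gives one that vanishes on coboundaries, which is what allows
  extending it to a chain map or using it as a test against coboundaries.\<close>

lemma cocycle_split:
  assumes K: "K \<in> bounded_complexes C" and S: "simple_object C S"
    and x: "x \<in> Hom C S (cO K i)" "cD K i \<bullet> x = Zero C S (cO K (i + 1))"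
    and nb: "\<not> (\<exists>y \<in> Hom C S (cO K (i - 1)). x = cD K (i - 1) \<bullet> y)"
  obtains r where "r \<in> Hom C (cO K i) S" "r \<bullet> x = Id C S" "r \<bullet> cD K (i - 1) = Zero C (cO K (i - 1)) S"
proof -
  obtain p j h where d: "cohom_data C K p j h" using cohom_data_exists K by blast
  note D = cohom_dataD[OF d] and xD = HomD[OF x(1)]
  have "p i \<bullet> x \<noteq> Zero C S (cohom C K i)" using nb boundary_iff[OF K d x] by blast
  moreover have "p i \<bullet> x \<in> Hom C S (cohom C K i)" using D(1-10)[of i] xD by auto
  ultimately obtain t where t: "t \<in> Hom C (cohom C K i) S" "t \<bullet> (p i \<bullet> x) = Id C S"
    using simple_split[OF S] by blast
  note tD = HomD[OF t(1)]
  show ?thesis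
  proof (rule that[of "t \<bullet> p i"])
    show "t \<bullet> p i \<in> Hom C (cO K i) S" using tD D(1-10)[of i] by auto
    show "(t \<bullet> p i) \<bullet> x = Id C S" using tD D(1-10)[of i] xD t(2) by simp
    have "(t \<bullet> p i) \<bullet> cD K (i - 1) = t \<bullet> (p i \<bullet> cD K (i - 1))" using tD D(1-10)[of i] K by simp
    then show "(t \<bullet> p i) \<bullet> cD K (i - 1) = Zero C (cO K (i - 1)) S"
      unfolding D(13) using tD D(1-10)[of i] K by simp
  qed
qed

text \<open>Cocycles and coboundaries are seen only through morphisms out of \<open>S\<close>. Hence
  the comparison maps need to be inverse to each other, and to commute with the differentials up to
  a fixed nonzero scalar, only on such morphisms. For a shift the scalar is the sign of its
  differential; for a twist the restriction to \<open>S\<close> discards all other homogeneous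
  components.\<close>

lemma occurs_transfer:
  assumes K: "K \<in> bounded_complexes C" and L: "L \<in> bounded_complexes C" and c: "c \<noteq> 0"
    and \<phi>: "\<And>j. \<phi> j \<in> Hom C (cO K j) (cO L (j + a))" and \<psi>: "\<And>j. \<psi> j \<in> Hom C (cO L (j + a)) (cO K j)"
    and \<psi>\<phi>: "\<And>j x. x \<in> Hom C S (cO K j) \<Longrightarrow> \<psi> j \<bullet> (\<phi> j \<bullet> x) = x"
    and \<phi>\<psi>: "\<And>j y. y \<in> Hom C S (cO L (j + a)) \<Longrightarrow> \<phi> j \<bullet> (\<psi> j \<bullet> y) = y"
    and d\<phi>: "\<And>j x. x \<in> Hom C S (cO K j) \<Longrightarrow>
      \<phi> (j + 1) \<bullet> (cD K j \<bullet> x) = Scale C c (cD L (j + a) \<bullet> (\<phi> j \<bullet> x))"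
  shows "occurs C S i K \<longleftrightarrow> occurs C S (i + a) L"
proof
  have ix: "i + 1 + a = i + a + 1" "i - 1 + a = i + a - 1" by simp_all
  note \<phi>D = HomD[OF \<phi>] and \<psi>D = HomD[OF \<psi>]
  have dphi': "\<phi> i \<bullet> (cD K (i - 1) \<bullet> x) = Scale C c (cD L (i + a - 1) \<bullet> (\<phi> (i - 1) \<bullet> x))"
    if "x \<in> Hom C S (cO K (i - 1))" for x
    using d\<phi>[OF that] ix by simp
  have phi1: "\<phi> (i - 1) \<in> Hom C (cO K (i - 1)) (cO L (i + a - 1))"
    "\<psi> (i - 1) \<in> Hom C (cO L (i + a - 1)) (cO K (i - 1))"
    "\<phi> (i + 1) \<in> Hom C (cO K (i + 1)) (cO L (i + a + 1))"
    using \<phi>[of "i - 1"] \<psi>[of "i - 1"] \<phi>[of "i + 1"] by (simp_all add: ix)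
  note phi1D = HomD(1-3)[OF phi1(1)] HomD(1-3)[OF phi1(2)] HomD(1-3)[OF phi1(3)]
  { assume "occurs C S i K"
    then obtain x where x: "x \<in> Hom C S (cO K i)" "cD K i \<bullet> x = Zero C S (cO K (i + 1))"
      and nb: "\<not> (\<exists>y \<in> Hom C S (cO K (i - 1)). x = cD K (i - 1) \<bullet> y)"
      unfolding occurs_def by blast
    note xD = HomD[OF x(1)]
    define w where "w = \<phi> i \<bullet> x"
    have w: "w \<in> Hom C S (cO L (i + a))" using \<phi>D(1-3)[of i] xD by (auto simp: w_def)
    note wD = HomD[OF w]
    have "Scale C c (cD L (i + a) \<bullet> w) = Zero C S (cO L (i + a + 1))"
      using d\<phi>[OF x(1)] phi1D xD K by (simp add: x(2) w_def)
    then have "Scale C (inverse c) (Scale C c (cD L (i + a) \<bullet> w)) = Zero C S (cO L (i + a + 1))"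
      using xD L by simp
    then have dw: "cD L (i + a) \<bullet> w = Zero C S (cO L (i + a + 1))" using c wD L by simp
    have "\<not> (\<exists>y \<in> Hom C S (cO L (i + a - 1)). w = cD L (i + a - 1) \<bullet> y)"
    proof
      assume "\<exists>y \<in> Hom C S (cO L (i + a - 1)). w = cD L (i + a - 1) \<bullet> y"
      then obtain y' where y': "y' \<in> Hom C S (cO L (i + a - 1))" "w = cD L (i + a - 1) \<bullet> y'" by blast
      note y'D = HomD[OF y'(1)]
      define y where "y = \<psi> (i - 1) \<bullet> y'"
      have y: "y \<in> Hom C S (cO K (i - 1))" using phi1D y'D by (auto simp: y_def)
      note yD = HomD[OF y]
      have phy: "\<phi> (i - 1) \<bullet> y = y'" using \<phi>\<psi>[of y' "i - 1"] y'(1) by (simp add: y_def ix)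
      have "\<phi> i \<bullet> (cD K (i - 1) \<bullet> y) = Scale C c w" using dphi'[OF y] by (simp add: phy y'(2))
      also have "\<dots> = \<phi> i \<bullet> Scale C c x" using \<phi>D(1-3)[of i] xD by (simp add: w_def)
      finally have "\<psi> i \<bullet> (\<phi> i \<bullet> (cD K (i - 1) \<bullet> y)) = \<psi> i \<bullet> (\<phi> i \<bullet> Scale C c x)" by simp
      moreover have "cD K (i - 1) \<bullet> y \<in> Hom C S (cO K i)" "Scale C c x \<in> Hom C S (cO K i)"
        using yD xD K by auto
      ultimately have "cD K (i - 1) \<bullet> y = Scale C c x" using \<psi>\<phi> by metis
      then have "Scale C (inverse c) (cD K (i - 1) \<bullet> y) = x" using c xD by simp
      then have "x = cD K (i - 1) \<bullet> Scale C (inverse c) y" using yD K by simp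
      moreover have "Scale C (inverse c) y \<in> Hom C S (cO K (i - 1))" using yD by auto
      ultimately show False using nb by blast
    qed
    then show "occurs C S (i + a) L" unfolding occurs_def using w dw by blast }
  assume "occurs C S (i + a) L"
  then obtain w where w: "w \<in> Hom C S (cO L (i + a))" "cD L (i + a) \<bullet> w = Zero C S (cO L (i + a + 1))"
    and nb: "\<not> (\<exists>y \<in> Hom C S (cO L (i + a - 1)). w = cD L (i + a - 1) \<bullet> y)"
    unfolding occurs_def by blast
  note wD = HomD[OF w(1)]
  define x where "x = \<psi> i \<bullet> w"
  have x: "x \<in> Hom C S (cO K i)" using \<psi>D(1-3)[of i] wD by (auto simp: x_def)
  note xD = HomD[OF x]
  have phx: "\<phi> i \<bullet> x = w" using \<phi>\<psi>[OF w(1)] by (simp add: x_def)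
  have "\<phi> (i + 1) \<bullet> (cD K i \<bullet> x) = Zero C S (cO L (i + a + 1))"
    using d\<phi>[OF x] wD L by (simp add: phx w(2))
  then have "\<psi> (i + 1) \<bullet> (\<phi> (i + 1) \<bullet> (cD K i \<bullet> x)) = Zero C S (cO K (i + 1))"
    using \<psi>D(1-3)[of "i + 1"] wD by (simp add: ix)
  moreover have "cD K i \<bullet> x \<in> Hom C S (cO K (i + 1))" using xD K by auto
  ultimately have dx: "cD K i \<bullet> x = Zero C S (cO K (i + 1))" using \<psi>\<phi> by metis
  have "\<not> (\<exists>y \<in> Hom C S (cO K (i - 1)). x = cD K (i - 1) \<bullet> y)"
  proof
    assume "\<exists>y \<in> Hom C S (cO K (i - 1)). x = cD K (i - 1) \<bullet> y"
    then obtain y where y: "y \<in> Hom C S (cO K (i - 1))" "x = cD K (i - 1) \<bullet> y" by blast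
    note yD = HomD[OF y(1)]
    have "w = Scale C c (cD L (i + a - 1) \<bullet> (\<phi> (i - 1) \<bullet> y))"
      using dphi'[OF y(1)] by (simp add: phx flip: y(2))
    then have "w = cD L (i + a - 1) \<bullet> Scale C c (\<phi> (i - 1) \<bullet> y)" using phi1D yD L by simp
    moreover have "Scale C c (\<phi> (i - 1) \<bullet> y) \<in> Hom C S (cO L (i + a - 1))" using phi1D yD by auto
    ultimately show False using nb by blast
  qed
  then show "occurs C S i K" unfolding occurs_def using x dx by blast
qed

section \<open>Shifts and stalk complexes\<close>

lemma shift_cpx_bounded:
  assumes K: "K \<in> bounded_complexes C"
  shows "shift_cpx C a K \<in> bounded_complexes C"
proof -
  obtain N where N: "\<And>i. \<bar>i\<bar> > N \<Longrightarrow> zero_object C (cO K i)"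
    using K unfolding bounded_complexes_def by blast
  have "zero_object C (cO K (i + a))" if "\<bar>i\<bar> > N + \<bar>a\<bar>" for i
    by (rule N) (use that in linarith)
  then have bound: "\<exists>N. \<forall>i. \<bar>i\<bar> > N \<longrightarrow> zero_object C (cO (shift_cpx C a K) i)"
    unfolding shift_cpx_def cpx.simps by blast
  have ix: "i + 1 + a = i + a + 1" "i + 1 + 1 + a = i + a + 1 + 1" for i by simp_all
  have "cD K (i + a + 1) \<bullet> cD K (i + a) = Zero C (cO K (i + a)) (cO K (i + a + 1 + 1))" for i
    by (rule cpxD(5)[OF K])
  then have "Scale C (alt_sign a) (cD K (i + a + 1)) \<bullet> Scale C (alt_sign a) (cD K (i + a)) =
      Zero C (cO K (i + a)) (cO K (i + a + 1 + 1))" for i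
    using K by simp
  moreover have "cO K (i + a) \<in> Ob C"
    "Scale C (alt_sign a) (cD K (i + a)) \<in> Hom C (cO K (i + a)) (cO K (i + a + 1))" for i
    using K by auto
  ultimately have "\<forall>i. cO (shift_cpx C a K) i \<in> Ob C \<and>
      cD (shift_cpx C a K) i \<in> Hom C (cO (shift_cpx C a K) i) (cO (shift_cpx C a K) (i + 1)) \<and>
      cD (shift_cpx C a K) (i + 1) \<bullet> cD (shift_cpx C a K) i =
        Zero C (cO (shift_cpx C a K) i) (cO (shift_cpx C a K) (i + 1 + 1))"
    unfolding shift_cpx_def cpx.simps ix by blast
  then show ?thesis unfolding bounded_complexes_def using bound by blast
qed

lemma occurs_shift:
  assumes K: "K \<in> bounded_complexes C"
  shows "occurs C S i (shift_cpx C a K) \<longleftrightarrow> occurs C S (i + a) K"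
proof (rule occurs_transfer[OF shift_cpx_bounded[OF K] K, where c = "alt_sign a"
      and \<phi> = "\<lambda>j. Id C (cO K (j + a))" and \<psi> = "\<lambda>j. Id C (cO K (j + a))"])
  show "alt_sign a \<noteq> (0 :: 'k)" by (simp add: alt_sign_def)
  fix j x assume x: "x \<in> Hom C S (cO (shift_cpx C a K) j)"
  have ix: "j + 1 + a = j + a + 1" by simp
  show "Id C (cO K (j + 1 + a)) \<bullet> (cD (shift_cpx C a K) j \<bullet> x)
      = Scale C (alt_sign a) (cD K (j + a) \<bullet> (Id C (cO K (j + a)) \<bullet> x))"
    unfolding ix using HomD[OF x] K by (simp add: shift_cpx_def)
qed (use K in \<open>auto simp: shift_cpx_def Hom_def\<close>)

lemma shift_cpx_add:
  assumes "K \<in> bounded_complexes C"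
  shows "shift_cpx C a (shift_cpx C b K) = shift_cpx C (a + b) K"
proof -
  have "alt_sign a * alt_sign b = (alt_sign (a + b) :: 'k)" by (auto simp: alt_sign_def)
  then show ?thesis using assms by (simp add: shift_cpx_def add.assoc)
qed

lemma shift_cpx_0: "K \<in> bounded_complexes C \<Longrightarrow> shift_cpx C 0 K = K"
  by (simp add: shift_cpx_def alt_sign_def)

lemma stalk_bounded:
  assumes "X \<in> Ob C"
  shows "stalk C X n \<in> bounded_complexes C"
proof -
  have "cO (stalk C X n) i \<in> Ob C" for i using assms by (simp add: stalk_simps)
  moreover have "zero_object C (cO (stalk C X n) i)" if "\<bar>i\<bar> > \<bar>n\<bar>" for i
    using that zobj_zero by (auto simp: stalk_simps)
  ultimately show ?thesis
    unfolding bounded_complexes_def by (auto simp: stalk_simps(2) intro!: exI[of _ "\<bar>n\<bar>"])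
qed

lemma shift_stalk:
  assumes "X \<in> Ob C"
  shows "shift_cpx C a (stalk C X n) = stalk C X (n - a)"
proof -
  have O: "cO (stalk C X n) i \<in> Ob C" for i using assms by (simp add: stalk_simps)
  have 1: "cO (stalk C X n) (i + a) = cO (stalk C X (n - a)) i" for i
    by (auto simp: stalk_simps(1))
  have 2: "i + a + 1 = i + 1 + a" for i by simp
  have "Scale C (alt_sign a) (cD (stalk C X n) (i + a)) = cD (stalk C X (n - a)) i" for i
    using O[of "i + a"] O[of "i + 1 + a"] by (simp add: stalk_simps(2) 2 1)
  then show ?thesis using 1 by (simp add: shift_cpx_def stalk_def[of C X "n - a"] Let_def stalk_simps)
qed

lemma occurs_zero:
  assumes "K \<in> bounded_complexes C" "zero_object C (cO K i)"
  shows "\<not> occurs C S i K"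
proof
  assume "occurs C S i K"
  then obtain x where x: "x \<in> Hom C S (cO K i)" 
    and nb: "\<not> (\<exists>y \<in> Hom C S (cO K (i - 1)). x = cD K (i - 1) \<bullet> y)"
    unfolding occurs_def by blast
  note xD = HomD[OF x]
  have "x = cD K (i - 1) \<bullet> Zero C S (cO K (i - 1))"
    using into_zero_object[OF assms(2) xD(1,3)] xD assms(1) by simp
  moreover have "Zero C S (cO K (i - 1)) \<in> Hom C S (cO K (i - 1))" using xD assms(1) by auto
  ultimately show False using nb by blast
qed

lemma occurs_stalkD:
  assumes "S \<in> Ob C" "occurs C T i (stalk C S n)"
  shows "i = n"
  using assms occurs_zero[OF stalk_bounded[OF assms(1)], of n i T] zobj_zero
  by (cases "i = n") (simp_all add: stalk_simps)

lemma stalk_map: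
  assumes K: "K \<in> bounded_complexes C"
    and x: "x \<in> Hom C S (cO K i)" "cD K i \<bullet> x = Zero C S (cO K (i + 1))"
  shows "\<lparr>src = stalk C S i, tgt = K, cm = (\<lambda>j. if j = i then x else Zero C (zobj C) (cO K j))\<rparr> \<in> chain_maps C"
    (is "?f \<in> _")
proof (rule chain_mapsI)
  note xD = HomD[OF x(1)]
  show "src ?f \<in> bounded_complexes C" "tgt ?f \<in> bounded_complexes C"
    using stalk_bounded xD K by simp_all
  fix j
  show "cm ?f j \<in> Hom C (cO (src ?f) j) (cO (tgt ?f) j)" using x(1) K by (auto simp: stalk_simps)
  show "cD (tgt ?f) j \<bullet> cm ?f j = cm ?f (j + 1) \<bullet> cD (src ?f) j"
    using x(2) xD K by (auto simp: stalk_simps)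
qed

lemma stalk_comap:
  assumes K: "K \<in> bounded_complexes C"
    and r: "r \<in> Hom C (cO K i) S" "r \<bullet> cD K (i - 1) = Zero C (cO K (i - 1)) S"
  shows "\<lparr>src = K, tgt = stalk C S i, cm = (\<lambda>j. if j = i then r else Zero C (cO K j) (zobj C))\<rparr> \<in> chain_maps C"
    (is "?f \<in> _")
proof (rule chain_mapsI)
  note rD = HomD[OF r(1)]
  show "src ?f \<in> bounded_complexes C" "tgt ?f \<in> bounded_complexes C"
    using stalk_bounded rD K by simp_all
  fix j
  show "cm ?f j \<in> Hom C (cO (src ?f) j) (cO (tgt ?f) j)" using r(1) K by (auto simp: stalk_simps)
  show "cD (tgt ?f) j \<bullet> cm ?f j = cm ?f (j + 1) \<bullet> cD (src ?f) j"
  \<comment> \<open>The square from degree \<open>j\<close> to \<open>j + 1\<close> ends in a zero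
    object unless \<open>j + 1 = i\<close>; the remaining square is the condition that
    \<open>r\<close> kills the incoming differential.\<close>
  proof (cases "j + 1 = i")
    case True
    then have "j = i - 1" by simp
    then show ?thesis using r(2) rD K by (auto simp: stalk_simps)
  next
    case False
    then show ?thesis using rD K by (auto simp: stalk_simps)
  qed
qed

section \<open>Null morphisms and atoms in the derived category\<close>

definition zmap :: "('o, 'm) cpx \<Rightarrow> ('o, 'm) cpx \<Rightarrow> ('o, 'm) cmap" where
  "zmap K L = \<lparr>src = K, tgt = L, cm = (\<lambda>i. Zero C (cO K i) (cO L i))\<rparr>"

lemma zmap_chain: "K \<in> bounded_complexes C \<Longrightarrow> L \<in> bounded_complexes C \<Longrightarrow> zmap K L \<in> chain_maps C"
  by (rule chain_mapsI) (auto simp: zmap_def)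

lemma Db_HomE:
  assumes "u \<in> Hom (Db C) K L"
  obtains f where "f \<in> chain_maps C" "src f = K" "tgt f = L" "u = to_Db C f"
  using assms unfolding Db.Hom_eq by (auto simp: Hom_def Cb_simps)

lemma Db_HomI: "f \<in> chain_maps C \<Longrightarrow> src f = K \<Longrightarrow> tgt f = L \<Longrightarrow> to_Db C f \<in> Hom (Db C) K L"
  unfolding Db.Hom_eq by (auto simp: Hom_def Cb_simps)

text \<open>A null morphism cannot distinguish the identity of its source from the zero
  endomorphism, so it equals its composite with the latter, which is zero.\<close>

lemma null_mor_to_Db:
  assumes f: "f \<in> chain_maps C"
  shows "null_mor (Db C) (to_Db C f) \<longleftrightarrow> (f, zmap (src f) (tgt f)) \<in> homotopy C"
proof
  note fD = cmapD[OF f]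
  let ?K = "src f" and ?L = "tgt f"
  have f': "f \<in> Mor (Cb C)" using f by (simp add: Cb_simps)
  have zm: "zmap ?K ?K \<in> Mor (Cb C)" "zmap ?K ?L \<in> chain_maps C"
    using zmap_chain fD by (auto simp: Cb_simps)
  have fz: "f \<bullet>\<^bsub>Cb C\<^esub> zmap ?K ?K = zmap ?K ?L" using fD by (simp add: Cb_simps zmap_def)
  have dom: "Dom (Db C) (to_Db C f) = ?K" using Db.Dom_eq[OF f'] by (simp add: Cb_simps)
  { assume n: "null_mor (Db C) (to_Db C f)"
    have "Id (Db C) ?K \<in> Hom (Db C) ?K ?K" using fD by (intro Db.id_hom) (simp add: Db.Ob_eq Cb_simps)
    moreover have "to_Db C (zmap ?K ?K) \<in> Hom (Db C) ?K ?K"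
      using zmap_chain fD by (intro Db_HomI) (auto simp: zmap_def)
    ultimately have "to_Db C f \<bullet>\<^bsub>Db C\<^esub> Id (Db C) ?K = to_Db C f \<bullet>\<^bsub>Db C\<^esub> to_Db C (zmap ?K ?K)"
      using n unfolding null_mor_def dom by blast
    moreover have "to_Db C f \<bullet>\<^bsub>Db C\<^esub> Id (Db C) ?K = to_Db C f"
      using f' dom by (intro Db.Id_right_arrow) (auto simp: Db.Mor_eq)
    moreover have "to_Db C f \<bullet>\<^bsub>Db C\<^esub> to_Db C (zmap ?K ?K) = to_Db C (zmap ?K ?L)"
      using Db.Cmp_eq[OF zm(1) f'] fz by (simp add: Cb_simps zmap_def)
    ultimately show "(f, zmap ?K ?L) \<in> homotopy C" using to_Db_eq_iff[OF f zm(2)] by simp }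
  assume hz: "(f, zmap ?K ?L) \<in> homotopy C"
  have "to_Db C f \<bullet>\<^bsub>Db C\<^esub> a = to_Db C (zmap V ?L)" if a: "a \<in> Hom (Db C) V ?K" for V a
  proof -
    obtain x where x: "x \<in> chain_maps C" "src x = V" "tgt x = ?K" "a = to_Db C x"
      using a by (rule Db_HomE)
    note xD = cmapD[OF x(1)]
    have "to_Db C f \<bullet>\<^bsub>Db C\<^esub> a = to_Db C (f \<bullet>\<^bsub>Cb C\<^esub> x)"
      unfolding x(4) using f' x(1,3) by (intro Db.Cmp_eq) (auto simp: Cb_simps)
    moreover have "(f \<bullet>\<^bsub>Cb C\<^esub> x, zmap ?K ?L \<bullet>\<^bsub>Cb C\<^esub> x) \<in> homotopy C"
      using homotopy_cmp_right[OF hz x(1)] x(3) by simp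
    moreover have "zmap ?K ?L \<bullet>\<^bsub>Cb C\<^esub> x = zmap V ?L"
      using xD(3-5) fD(2) x(2,3) by (simp add: Cb_simps zmap_def)
    ultimately show ?thesis
      using to_Db_eq_iff homotopyD(1,2) by metis
  qed
  then show "null_mor (Db C) (to_Db C f)" unfolding null_mor_def dom by metis
qed

text \<open>A homotopy out of a stalk complex starts at a zero object in every degree except
  \<open>i\<close>, and the stalk complex has zero differentials; what is left is the single
  component \<open>y\<close> in degree \<open>i\<close>.\<close>

lemma null_stalk_iff:
  assumes f: "f \<in> chain_maps C" "src f = stalk C S i"
  shows "null_mor (Db C) (to_Db C f) \<longleftrightarrow> (\<exists>y \<in> Hom C S (cO (tgt f) (i - 1)). cm f i = cD (tgt f) (i - 1) \<bullet> y)"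
  unfolding null_mor_to_Db[OF f(1)]
proof
  note fD = cmapD[OF f(1), unfolded f(2)]
  let ?L = "tgt f" and ?K = "stalk C S i"
  have S [simp]: "S \<in> Ob C" using Dom_Ob[OF fD(3)[of i]] fD(4)[of i] by (simp add: stalk_simps)
  { assume "(f, zmap (src f) ?L) \<in> homotopy C"
    from homotopy_ex[OF this] obtain h where h: "\<And>j. h j \<in> Mor C" "\<And>j. Dom C (h j) = cO ?K j"
      "\<And>j. Cod C (h j) = cO ?L (j - 1)"
      "\<And>j. cm f j = Add C (Zero C (cO ?K j) (cO ?L j)) (Add C (cD ?L (j - 1) \<bullet> h j) (h (j + 1) \<bullet> cD ?K j))"
      unfolding f(2) zmap_def by auto
    have "cm f i = cD ?L (i - 1) \<bullet> h i"
      using h(4)[of i] h(1-3)[of i] h(1-3)[of "i + 1"] fD(1,2) by (simp add: stalk_simps)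
    moreover have "h i \<in> Hom C S (cO ?L (i - 1))" using h(1-3)[of i] by (auto simp: stalk_simps)
    ultimately show "\<exists>y \<in> Hom C S (cO ?L (i - 1)). cm f i = cD ?L (i - 1) \<bullet> y" by blast }
  assume "\<exists>y \<in> Hom C S (cO ?L (i - 1)). cm f i = cD ?L (i - 1) \<bullet> y"
  then obtain y where y: "y \<in> Hom C S (cO ?L (i - 1))" "cm f i = cD ?L (i - 1) \<bullet> y" by blast
  note yD = HomD[OF y(1)]
  define h where "h = (\<lambda>j. if j = i then y else Zero C (zobj C) (cO ?L (j - 1)))"
  show "(f, zmap (src f) ?L) \<in> homotopy C"
  proof (rule homotopyI[of _ _ h])
    show "zmap (src f) ?L \<in> chain_maps C" using zmap_chain cmapD(1,2)[OF f(1)] by simp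
    fix j
    show "h j \<in> Hom C (cO (src f) j) (cO ?L (j - 1))"
      using y(1) fD(2) by (auto simp: h_def f(2) stalk_simps)
    show "cm f j = Add C (cm (zmap (src f) ?L) j) (Add C (cD ?L (j - 1) \<bullet> h j) (h (j + 1) \<bullet> cD (src f) j))"
    proof (cases "j = i")
      case True
      then show ?thesis using y(2) yD fD(2) by (simp add: h_def f(2) zmap_def stalk_simps)
    next
      case False
      then have "cm f j = Zero C (zobj C) (cO ?L j)"
        using from_zero_object[OF zobj_zero fD(3)[of j]] fD(4,5)[of j] by (simp add: stalk_simps)
      then show ?thesis using False yD fD(2) by (auto simp: h_def f(2) zmap_def stalk_simps)
    qed
  qed (use f in \<open>auto simp: zmap_def\<close>)
qed

text \<open>Chain maps out of a stalk complex are cocycles, and the null ones are coboundaries. The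
  right-hand side mentions only composition in the derived category, which is why occurrence can be
  followed along isomorphisms and equivalences.\<close>

lemma occurs_iff_Hom:
  assumes K: "K \<in> bounded_complexes C"
  shows "occurs C S i K \<longleftrightarrow> (\<exists>u \<in> Hom (Db C) (stalk C S i) K. \<not> null_mor (Db C) u)"
proof
  assume "occurs C S i K"
  then obtain x where x: "x \<in> Hom C S (cO K i)" "cD K i \<bullet> x = Zero C S (cO K (i + 1))"
    and nb: "\<not> (\<exists>y \<in> Hom C S (cO K (i - 1)). x = cD K (i - 1) \<bullet> y)"
    unfolding occurs_def by blast
  note f = stalk_map[OF K x]
  show "\<exists>u \<in> Hom (Db C) (stalk C S i) K. \<not> null_mor (Db C) u"
    using Db_HomI[OF f, of "stalk C S i" K] null_stalk_iff[OF f, of S i] nb by (intro bexI) simp_all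
next
  assume "\<exists>u \<in> Hom (Db C) (stalk C S i) K. \<not> null_mor (Db C) u"
  then obtain f where f: "f \<in> chain_maps C" "src f = stalk C S i" "tgt f = K" "\<not> null_mor (Db C) (to_Db C f)"
    by (auto elim: Db_HomE)
  note fD = cmapD[OF f(1), unfolded f(2,3)]
  have xD: "cm f i \<in> Mor C" "Dom C (cm f i) = S" "Cod C (cm f i) = cO K i" using fD(3-5)[of i] by (auto simp: stalk_simps)
  then have x: "cm f i \<in> Hom C S (cO K i)" by auto
  have "S \<in> Ob C" using Dom_Ob[OF xD(1)] xD by simp
  then have "cD K i \<bullet> cm f i = Zero C S (cO K (i + 1))"
    using fD(6)[of i] fD(3-5)[of "i + 1"] by (simp add: stalk_simps)
  then show "occurs C S i K"
    unfolding occurs_def using x f(4) null_stalk_iff[OF f(1,2)] f(3) by blast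
qed

text \<open>A morphism out of the stalk that is not null is a cocycle that is not a coboundary. The
  retraction from \<open>cocycle_split\<close> extends by zero to a chain map and splits the
  morphism strictly, before passing to homotopy classes.\<close>

lemma atom_stalk:
  assumes S: "simple_object C S"
  shows "atom (Db C) (stalk C S i)"
proof -
  have O [simp]: "S \<in> Ob C" using S by (rule simple_object_Ob)
  let ?P = "stalk C S i"
  have P: "?P \<in> bounded_complexes C" using stalk_bounded by simp
  have I: "Id (Cb C) ?P \<in> chain_maps C" using Cb.Id_arrow(1)[of ?P] P by (simp add: Cb_simps)
  have IdP: "Id (Db C) ?P = to_Db C (Id (Cb C) ?P)" using P by (simp add: Db.Id_eq Cb_simps)
  show ?thesis
    unfolding atom_def
  proof (intro conjI allI ballI impI)
    show "?P \<in> Ob (Db C)" using P by (simp add: Db.Ob_eq Cb_simps)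
    show "\<not> null_mor (Db C) (Id (Db C) ?P)"
    proof
      assume "null_mor (Db C) (Id (Db C) ?P)"
      then have "\<exists>y \<in> Hom C S (cO ?P (i - 1)). Id C S = cD ?P (i - 1) \<bullet> y"
        unfolding IdP using null_stalk_iff[OF I, of S i] by (simp add: Cb_simps stalk_simps)
      then have "Id C S = Zero C S S" by (auto simp: stalk_simps Hom_def)
      then show False using simple_Id[OF S] by simp
    qed
    fix K u assume u: "u \<in> Hom (Db C) ?P K" "\<not> null_mor (Db C) u"
    obtain f where f: "f \<in> chain_maps C" "src f = ?P" "tgt f = K" "u = to_Db C f"
      using u(1) by (rule Db_HomE)
    note fD = cmapD[OF f(1), unfolded f(2,3)]
    have xD: "cm f i \<in> Mor C" "Dom C (cm f i) = S" "Cod C (cm f i) = cO K i"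
      using fD(3-5)[of i] by (auto simp: stalk_simps)
    then have x: "cm f i \<in> Hom C S (cO K i)" by auto
    have dx: "cD K i \<bullet> cm f i = Zero C S (cO K (i + 1))"
      using fD(6)[of i] fD(3-5)[of "i + 1"] by (simp add: stalk_simps)
    have nb: "\<not> (\<exists>y \<in> Hom C S (cO K (i - 1)). cm f i = cD K (i - 1) \<bullet> y)"
      using u(2) null_stalk_iff[OF f(1,2)] unfolding f(3,4) by blast
    obtain r where r: "r \<in> Hom C (cO K i) S" "r \<bullet> cm f i = Id C S" "r \<bullet> cD K (i - 1) = Zero C (cO K (i - 1)) S"
      using cocycle_split[OF fD(2) S x dx nb] .
    define g where "g = \<lparr>src = K, tgt = ?P, cm = (\<lambda>j. if j = i then r else Zero C (cO K j) (zobj C))\<rparr>"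
    have g: "g \<in> chain_maps C" unfolding g_def by (rule stalk_comap[OF fD(2) r(1,3)])
    \<comment> \<open>Outside degree \<open>i\<close> the composite is a zero morphism while the
      identity complex map has identities there; on the chosen zero object the two agree.\<close>
    have zz: "Id C (zobj C) = Zero C (zobj C) (zobj C)" using zobj_zero by (simp add: zero_object_iff)
    have "g \<bullet>\<^bsub>Cb C\<^esub> f = Id (Cb C) ?P"
      using f(2) r(2) fD(3-5) by (auto simp: Cb_simps g_def stalk_simps zz intro!: ext)
    then have "to_Db C g \<bullet>\<^bsub>Db C\<^esub> u = Id (Db C) ?P"
      unfolding IdP f(4) using Db.Cmp_eq[of f g] f(1,3) g by (simp add: Cb_simps g_def)
    moreover have "to_Db C g \<in> Hom (Db C) K ?P" using g by (intro Db_HomI) (auto simp: g_def)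
    ultimately show "\<exists>r \<in> Hom (Db C) K ?P. r \<bullet>\<^bsub>Db C\<^esub> u = Id (Db C) ?P" by blast
  qed
qed

text \<open>If no simple object occurs, all cohomology vanishes, so \<open>j p\<close> is the zero
  chain map; but it is homotopic to the identity.\<close>

lemma nonnull_occurs:
  assumes K: "K \<in> bounded_complexes C" and n: "\<not> null_mor (Db C) (Id (Db C) K)"
  shows "\<exists>S i. simple_object C S \<and> occurs C S i K"
proof (rule ccontr)
  assume no: "\<not> ?thesis"
  obtain p j h where d: "cohom_data C K p j h" using cohom_data_exists K by blast
  note D = cohom_dataD[OF d]
  have "zero_object C (cohom C K i)" for i using no cohom_zero_iff[OF K] by blast
  then have "p i = Zero C (cO K i) (cohom C K i)" for i
    using into_zero_object[of "cohom C K i" "p i"] D(1-4)[of i] by simp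
  then have "j i \<bullet> p i = Zero C (cO K i) (cO K i)" for i using D(1-10)[of i] K by simp
  then have "\<lparr>src = K, tgt = K, cm = (\<lambda>i. j i \<bullet> p i)\<rparr> = zmap K K" by (simp add: zmap_def)
  then have "(Id (Cb C) K, zmap K K) \<in> homotopy C" using harmonic_homotopic[OF K d] by simp
  moreover have I: "Id (Cb C) K \<in> chain_maps C" using Cb.Id_arrow(1)[of K] K by (simp add: Cb_simps)
  ultimately have "null_mor (Db C) (to_Db C (Id (Cb C) K))"
    using null_mor_to_Db[OF I] by (simp add: Cb_simps)
  then show False using n K by (simp add: Db.Id_eq Cb_simps)
qed

end

section \<open>Equivalences\<close>

context category
begin

lemma null_mor_cmp_left:
  assumes "null_mor C u" "u \<in> Hom C X Y" "a \<in> Hom C Y Z"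
  shows "null_mor C (a \<bullet> u)"
  unfolding null_mor_def
proof (intro allI ballI)
  fix V f g assume fg: "f \<in> Hom C V (Dom C (a \<bullet> u))" "g \<in> Hom C V (Dom C (a \<bullet> u))"
  note uD = HomD[OF assms(2)] and aD = HomD[OF assms(3)]
  have fg': "f \<in> Hom C V X" "g \<in> Hom C V X" using fg uD aD by auto
  then have "u \<bullet> f = u \<bullet> g" using assms(1) unfolding null_mor_def uD(2) by blast
  moreover have "(a \<bullet> u) \<bullet> f = a \<bullet> (u \<bullet> f)" "(a \<bullet> u) \<bullet> g = a \<bullet> (u \<bullet> g)"
    using cmp_assoc[OF fg'(1) assms(2,3)] cmp_assoc[OF fg'(2) assms(2,3)] by auto
  ultimately show "(a \<bullet> u) \<bullet> f = (a \<bullet> u) \<bullet> g" by simp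
qed

lemma null_mor_cmp_right:
  assumes "null_mor C u" "u \<in> Hom C X Y" "v \<in> Hom C W X"
  shows "null_mor C (u \<bullet> v)"
  unfolding null_mor_def
proof (intro allI ballI)
  fix V f g assume fg: "f \<in> Hom C V (Dom C (u \<bullet> v))" "g \<in> Hom C V (Dom C (u \<bullet> v))"
  note uD = HomD[OF assms(2)] and vD = HomD[OF assms(3)]
  have fg': "f \<in> Hom C V W" "g \<in> Hom C V W" using fg uD vD by auto
  have "v \<bullet> f \<in> Hom C V X" "v \<bullet> g \<in> Hom C V X" using cmp_hom fg' assms(3) by blast+
  then have "u \<bullet> (v \<bullet> f) = u \<bullet> (v \<bullet> g)" using assms(1) unfolding null_mor_def uD(2) by blast
  then show "(u \<bullet> v) \<bullet> f = (u \<bullet> v) \<bullet> g"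
    using cmp_assoc[OF fg'(1) assms(3,2)] cmp_assoc[OF fg'(2) assms(3,2)] by simp
qed

end

locale category_equivalence = S: category S + T: category T
  for S :: "('o, 'm, 'x) cat_scheme" and T :: "('p, 'n, 'y) cat_scheme" +
  fixes F :: "('o, 'm, 'p, 'n, 'z) fctr_scheme"
  assumes equiv: "equivalence S T F"
begin

lemma is_functor_F: "is_functor S T F"
  using equiv by (simp add: equivalence_def)

lemma FO_Ob: "X \<in> Ob S \<Longrightarrow> FO F X \<in> Ob T"
  and FM_Hom: "f \<in> Hom S X Y \<Longrightarrow> FM F f \<in> Hom T (FO F X) (FO F Y)"
  and FM_Id: "X \<in> Ob S \<Longrightarrow> FM F (Id S X) = Id T (FO F X)"
  and FM_cmp: "f \<in> Hom S X Y \<Longrightarrow> g \<in> Hom S Y Z \<Longrightarrow> FM F (g \<bullet>\<^bsub>S\<^esub> f) = FM F g \<bullet>\<^bsub>T\<^esub> FM F f"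
  using is_functor_F unfolding is_functor_def by blast+

lemma quasi_inverse:
  "\<exists>(G :: ('p, 'n, 'o, 'm) fctr) \<eta> \<epsilon>. is_functor T S G \<and>
    (\<forall>X \<in> Ob S. \<eta> X \<in> Hom S X (FO G (FO F X)) \<and> is_iso S (\<eta> X)) \<and>
    (\<forall>X Y. \<forall>f \<in> Hom S X Y. \<eta> Y \<bullet>\<^bsub>S\<^esub> f = FM G (FM F f) \<bullet>\<^bsub>S\<^esub> \<eta> X) \<and>
    (\<forall>X \<in> Ob T. \<epsilon> X \<in> Hom T (FO F (FO G X)) X \<and> is_iso T (\<epsilon> X)) \<and>
    (\<forall>X Y. \<forall>f \<in> Hom T X Y. \<epsilon> Y \<bullet>\<^bsub>T\<^esub> FM F (FM G f) = f \<bullet>\<^bsub>T\<^esub> \<epsilon> X)"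
  using equiv unfolding equivalence_def natural_iso_def id_functor_def cmp_functor_def fctr.simps
  by blast

lemma faithful:
  assumes f: "f \<in> Hom S X Y" and g: "g \<in> Hom S X Y" and eq: "FM F f = FM F g"
  shows "f = g"
proof -
  obtain G :: "('p, 'n, 'o, 'm) fctr" and \<eta> \<epsilon> where
    \<eta>: "\<And>X. X \<in> Ob S \<Longrightarrow> \<eta> X \<in> Hom S X (FO G (FO F X)) \<and> is_iso S (\<eta> X)"
    "\<And>X Y f. f \<in> Hom S X Y \<Longrightarrow> \<eta> Y \<bullet>\<^bsub>S\<^esub> f = FM G (FM F f) \<bullet>\<^bsub>S\<^esub> \<eta> X"
    using quasi_inverse by blast
  note fD = S.HomD[OF f] and gD = S.HomD[OF g]
  note hD = S.HomD[OF conjunct1[OF \<eta>(1)[OF fD(5)]]]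
  obtain l where l: "l \<in> Mor S" "Dom S l = Cod S (\<eta> Y)" "l \<bullet>\<^bsub>S\<^esub> \<eta> Y = Id S Y"
    using \<eta>(1)[OF fD(5)] hD(2) by (metis S.is_isoE)
  have "l \<bullet>\<^bsub>S\<^esub> (\<eta> Y \<bullet>\<^bsub>S\<^esub> f) = l \<bullet>\<^bsub>S\<^esub> (\<eta> Y \<bullet>\<^bsub>S\<^esub> g)" using \<eta>(2)[OF f] \<eta>(2)[OF g] eq by simp
  then have "(l \<bullet>\<^bsub>S\<^esub> \<eta> Y) \<bullet>\<^bsub>S\<^esub> f = (l \<bullet>\<^bsub>S\<^esub> \<eta> Y) \<bullet>\<^bsub>S\<^esub> g"
    using l(1,2) hD fD gD by simp
  then show ?thesis unfolding l(3) using fD gD by simp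
qed

text \<open>The candidate \<open>v\<close> is \<open>FM G w\<close> conjugated by the unit
  \<open>\<eta>\<close>. Naturality of \<open>\<eta>\<close> gives equality of \<open>v\<close> and
  \<open>w\<close> after applying \<open>G\<close> (to \<open>FM F v\<close> and \<open>w\<close>),
  and naturality of the invertible counit \<open>\<epsilon>\<close> removes
  \<open>G\<close>.\<close>

lemma full:
  assumes w: "w \<in> Hom T (FO F X) (FO F Y)" and X: "X \<in> Ob S" and Y: "Y \<in> Ob S"
  shows "\<exists>v \<in> Hom S X Y. FM F v = w"
proof -
  obtain G :: "('p, 'n, 'o, 'm) fctr" and \<eta> \<epsilon> where G: "is_functor T S G"
    and \<eta>: "\<And>X. X \<in> Ob S \<Longrightarrow> \<eta> X \<in> Hom S X (FO G (FO F X)) \<and> is_iso S (\<eta> X)"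
    "\<And>X Y f. f \<in> Hom S X Y \<Longrightarrow> \<eta> Y \<bullet>\<^bsub>S\<^esub> f = FM G (FM F f) \<bullet>\<^bsub>S\<^esub> \<eta> X"
    and \<epsilon>: "\<And>X. X \<in> Ob T \<Longrightarrow> \<epsilon> X \<in> Hom T (FO F (FO G X)) X \<and> is_iso T (\<epsilon> X)"
    "\<And>X Y f. f \<in> Hom T X Y \<Longrightarrow> \<epsilon> Y \<bullet>\<^bsub>T\<^esub> FM F (FM G f) = f \<bullet>\<^bsub>T\<^esub> \<epsilon> X"
    using quasi_inverse by blast
  note wD = T.HomD[OF w]
  have eX: "\<eta> X \<in> Hom S X (FO G (FO F X))" and eY: "\<eta> Y \<in> Hom S Y (FO G (FO F Y))" using \<eta>(1) X Y by auto
  note eXD = S.HomD[OF eX] and eYD = S.HomD[OF eY]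
  obtain l where l: "l \<in> Mor S" "Dom S l = Cod S (\<eta> Y)" "Cod S l = Y" "\<eta> Y \<bullet>\<^bsub>S\<^esub> l = Id S (Cod S (\<eta> Y))"
    using \<eta>(1)[OF Y] eYD(2) by (metis S.is_isoE)
  obtain r where r: "r \<in> Mor S" "Dom S r = Cod S (\<eta> X)" "\<eta> X \<bullet>\<^bsub>S\<^esub> r = Id S (Cod S (\<eta> X))"
    "Cod S r = X"
    using \<eta>(1)[OF X] eXD(2) by (metis S.is_isoE)
  have Gw: "FM G w \<in> Hom S (FO G (FO F X)) (FO G (FO F Y))" using G w unfolding is_functor_def by blast
  note GwD = S.HomD[OF Gw]
  define v where "v = l \<bullet>\<^bsub>S\<^esub> (FM G w \<bullet>\<^bsub>S\<^esub> \<eta> X)"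
  have v: "v \<in> Hom S X Y" using l GwD eXD eYD by (auto simp: v_def)
  have Fv: "FM F v \<in> Hom T (FO F X) (FO F Y)" by (rule FM_Hom[OF v])
  have GFv: "FM G (FM F v) \<in> Hom S (FO G (FO F X)) (FO G (FO F Y))" using G Fv unfolding is_functor_def by blast
  note GFvD = S.HomD[OF GFv]
  have "FM G (FM F v) \<bullet>\<^bsub>S\<^esub> \<eta> X = \<eta> Y \<bullet>\<^bsub>S\<^esub> v" using \<eta>(2)[OF v] by simp
  also have "\<dots> = (\<eta> Y \<bullet>\<^bsub>S\<^esub> l) \<bullet>\<^bsub>S\<^esub> (FM G w \<bullet>\<^bsub>S\<^esub> \<eta> X)" using l(1-3) GwD eXD eYD by (simp add: v_def)
  also have "\<dots> = FM G w \<bullet>\<^bsub>S\<^esub> \<eta> X" unfolding l(4) using GwD eXD eYD by simp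
  finally have "(FM G (FM F v) \<bullet>\<^bsub>S\<^esub> \<eta> X) \<bullet>\<^bsub>S\<^esub> r = (FM G w \<bullet>\<^bsub>S\<^esub> \<eta> X) \<bullet>\<^bsub>S\<^esub> r" by simp
  then have "FM G (FM F v) \<bullet>\<^bsub>S\<^esub> (\<eta> X \<bullet>\<^bsub>S\<^esub> r) = FM G w \<bullet>\<^bsub>S\<^esub> (\<eta> X \<bullet>\<^bsub>S\<^esub> r)"
    using r(1,2,4) GFvD GwD eXD by simp
  then have GG: "FM G (FM F v) = FM G w" unfolding r(3) using GFvD GwD eXD by simp
  have xX: "\<epsilon> (FO F X) \<in> Hom T (FO F (FO G (FO F X))) (FO F X)" using \<epsilon>(1) FO_Ob X by blast
  note xXD = T.HomD[OF xX]
  obtain t where t: "t \<in> Mor T" "Cod T t = Dom T (\<epsilon> (FO F X))" "\<epsilon> (FO F X) \<bullet>\<^bsub>T\<^esub> t = Id T (FO F X)"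
    using \<epsilon>(1)[OF FO_Ob[OF X]] xXD(3) by (metis T.is_isoE)
  have "FM F v \<bullet>\<^bsub>T\<^esub> \<epsilon> (FO F X) = w \<bullet>\<^bsub>T\<^esub> \<epsilon> (FO F X)"
    using \<epsilon>(2)[OF Fv] \<epsilon>(2)[OF w] GG by simp
  then have "(FM F v \<bullet>\<^bsub>T\<^esub> \<epsilon> (FO F X)) \<bullet>\<^bsub>T\<^esub> t = (w \<bullet>\<^bsub>T\<^esub> \<epsilon> (FO F X)) \<bullet>\<^bsub>T\<^esub> t" by simp
  then have "FM F v \<bullet>\<^bsub>T\<^esub> (\<epsilon> (FO F X) \<bullet>\<^bsub>T\<^esub> t) = w \<bullet>\<^bsub>T\<^esub> (\<epsilon> (FO F X) \<bullet>\<^bsub>T\<^esub> t)"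
    using t(1,2) xXD T.HomD[OF Fv] wD by simp
  then have "FM F v = w" unfolding t(3) using T.HomD[OF Fv] wD by simp
  then show ?thesis using v by blast
qed

lemma ess_surj:
  assumes "Y \<in> Ob T"
  obtains X a b where "X \<in> Ob S" "a \<in> Hom T (FO F X) Y" "b \<in> Hom T Y (FO F X)"
    "b \<bullet>\<^bsub>T\<^esub> a = Id T (FO F X)" "a \<bullet>\<^bsub>T\<^esub> b = Id T Y"
proof -
  obtain G :: "('p, 'n, 'o, 'm) fctr" and \<eta> \<epsilon> where G: "is_functor T S G"
    and \<epsilon>: "\<And>X. X \<in> Ob T \<Longrightarrow> \<epsilon> X \<in> Hom T (FO F (FO G X)) X \<and> is_iso T (\<epsilon> X)"
    using quasi_inverse by blast
  have GY: "FO G Y \<in> Ob S" using G assms unfolding is_functor_def by blast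
  have "isomorphic T (FO F (FO G Y)) Y" using \<epsilon>[OF assms] unfolding isomorphic_def by blast
  then obtain a b where "a \<in> Hom T (FO F (FO G Y)) Y" "b \<in> Hom T Y (FO F (FO G Y))"
    "b \<bullet>\<^bsub>T\<^esub> a = Id T (FO F (FO G Y))" "a \<bullet>\<^bsub>T\<^esub> b = Id T Y"
    by (rule T.isomorphicE)
  then show ?thesis using that GY by blast
qed

text \<open>Reflection uses faithfulness. For preservation, an arbitrary test object of
  \<open>T\<close> is replaced by an isomorphic one in the image of \<open>F\<close>, where fullness
  lifts the test morphisms to \<open>S\<close>.\<close>

lemma null_mor_FM:
  assumes u: "u \<in> Hom S X Y"
  shows "null_mor T (FM F u) \<longleftrightarrow> null_mor S u"
proof
  note uD = S.HomD[OF u] and Fu = FM_Hom[OF u]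
  note FuD = T.HomD[OF Fu]
  { assume n: "null_mor T (FM F u)"
    show "null_mor S u"
      unfolding null_mor_def uD(2)
    proof (intro allI ballI)
      fix V f g assume f: "f \<in> Hom S V X" and g: "g \<in> Hom S V X"
      have "FM F u \<bullet>\<^bsub>T\<^esub> FM F f = FM F u \<bullet>\<^bsub>T\<^esub> FM F g"
        using n FM_Hom[OF f] FM_Hom[OF g] unfolding null_mor_def FuD(2) by blast
      then have "FM F (u \<bullet>\<^bsub>S\<^esub> f) = FM F (u \<bullet>\<^bsub>S\<^esub> g)" using FM_cmp[OF f u] FM_cmp[OF g u] by simp
      then show "u \<bullet>\<^bsub>S\<^esub> f = u \<bullet>\<^bsub>S\<^esub> g" using faithful S.cmp_hom[OF f u] S.cmp_hom[OF g u] by blast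
    qed }
  assume n: "null_mor S u"
  show "null_mor T (FM F u)"
    unfolding null_mor_def FuD(2)
  proof (intro allI ballI)
    fix V f g assume f: "f \<in> Hom T V (FO F X)" and g: "g \<in> Hom T V (FO F X)"
    obtain W a b where W: "W \<in> Ob S" "a \<in> Hom T (FO F W) V" "b \<in> Hom T V (FO F W)"
      "a \<bullet>\<^bsub>T\<^esub> b = Id T V"
      using ess_surj[OF T.HomD(4)[OF f]] by metis
    obtain f' where f': "f' \<in> Hom S W X" "FM F f' = f \<bullet>\<^bsub>T\<^esub> a"
      using full[OF T.cmp_hom[OF W(2) f] W(1) uD(4)] by blast
    obtain g' where g': "g' \<in> Hom S W X" "FM F g' = g \<bullet>\<^bsub>T\<^esub> a"
      using full[OF T.cmp_hom[OF W(2) g] W(1) uD(4)] by blast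
    have "u \<bullet>\<^bsub>S\<^esub> f' = u \<bullet>\<^bsub>S\<^esub> g'" using n f' g' unfolding null_mor_def uD(2) by blast
    then have "FM F u \<bullet>\<^bsub>T\<^esub> (f \<bullet>\<^bsub>T\<^esub> a) = FM F u \<bullet>\<^bsub>T\<^esub> (g \<bullet>\<^bsub>T\<^esub> a)"
      using FM_cmp[OF f'(1) u] FM_cmp[OF g'(1) u] f'(2) g'(2) by simp
    then have "(FM F u \<bullet>\<^bsub>T\<^esub> (f \<bullet>\<^bsub>T\<^esub> a)) \<bullet>\<^bsub>T\<^esub> b = (FM F u \<bullet>\<^bsub>T\<^esub> (g \<bullet>\<^bsub>T\<^esub> a)) \<bullet>\<^bsub>T\<^esub> b" by simp
    then have "FM F u \<bullet>\<^bsub>T\<^esub> (f \<bullet>\<^bsub>T\<^esub> (a \<bullet>\<^bsub>T\<^esub> b)) = FM F u \<bullet>\<^bsub>T\<^esub> (g \<bullet>\<^bsub>T\<^esub> (a \<bullet>\<^bsub>T\<^esub> b))"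
      using FuD T.HomD[OF f] T.HomD[OF g] T.HomD[OF W(2)] T.HomD[OF W(3)] by simp
    then show "FM F u \<bullet>\<^bsub>T\<^esub> f = FM F u \<bullet>\<^bsub>T\<^esub> g"
      unfolding W(4) using T.HomD[OF f] T.HomD[OF g] by simp
  qed
qed

text \<open>The target of a given morphism is moved into the image of \<open>F\<close>, the morphism
  is lifted by fullness and split in \<open>S\<close>; the splitting is then mapped back and
  composed with the isomorphism.\<close>

lemma atom_FO:
  assumes "atom S X"
  shows "atom T (FO F X)"
  unfolding atom_def
proof (intro conjI allI ballI impI)
  have X: "X \<in> Ob S" and nn: "\<not> null_mor S (Id S X)"
    and split: "\<And>Y u. u \<in> Hom S X Y \<Longrightarrow> \<not> null_mor S u \<Longrightarrow> \<exists>r \<in> Hom S Y X. r \<bullet>\<^bsub>S\<^esub> u = Id S X"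
    using assms unfolding atom_def by blast+
  show "FO F X \<in> Ob T" using FO_Ob X .
  show "\<not> null_mor T (Id T (FO F X))"
    using null_mor_FM[OF S.id_hom[OF X]] nn FM_Id[OF X] by simp
  fix Y w assume w: "w \<in> Hom T (FO F X) Y" "\<not> null_mor T w"
  obtain Y' a b where Y': "Y' \<in> Ob S" "a \<in> Hom T (FO F Y') Y" "b \<in> Hom T Y (FO F Y')"
    "a \<bullet>\<^bsub>T\<^esub> b = Id T Y"
    using ess_surj[OF T.HomD(5)[OF w(1)]] by metis
  have bw: "b \<bullet>\<^bsub>T\<^esub> w \<in> Hom T (FO F X) (FO F Y')" using T.cmp_hom[OF w(1) Y'(3)] .
  obtain v where v: "v \<in> Hom S X Y'" "FM F v = b \<bullet>\<^bsub>T\<^esub> w" using full[OF bw X Y'(1)] by blast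
  have "\<not> null_mor S v"
  proof
    assume "null_mor S v"
    then have "null_mor T (b \<bullet>\<^bsub>T\<^esub> w)" using null_mor_FM[OF v(1)] v(2) by simp
    then have "null_mor T (a \<bullet>\<^bsub>T\<^esub> (b \<bullet>\<^bsub>T\<^esub> w))" using T.null_mor_cmp_left bw Y'(2) by blast
    moreover have "a \<bullet>\<^bsub>T\<^esub> (b \<bullet>\<^bsub>T\<^esub> w) = (a \<bullet>\<^bsub>T\<^esub> b) \<bullet>\<^bsub>T\<^esub> w" using T.cmp_assoc[OF w(1) Y'(3,2)] by simp
    ultimately have "null_mor T w" unfolding Y'(4) using T.id_left[OF w(1)] by simp
    then show False using w(2) by simp
  qed
  then obtain r where r: "r \<in> Hom S Y' X" "r \<bullet>\<^bsub>S\<^esub> v = Id S X" using split[OF v(1)] by blast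
  have "FM F r \<bullet>\<^bsub>T\<^esub> (b \<bullet>\<^bsub>T\<^esub> w) = Id T (FO F X)"
    using FM_cmp[OF v(1) r(1)] r(2) FM_Id[OF X] v(2) by simp
  then have "(FM F r \<bullet>\<^bsub>T\<^esub> b) \<bullet>\<^bsub>T\<^esub> w = Id T (FO F X)"
    using T.cmp_assoc[OF w(1) Y'(3) FM_Hom[OF r(1)]] by simp
  then show "\<exists>r \<in> Hom T Y (FO F X). r \<bullet>\<^bsub>T\<^esub> w = Id T (FO F X)"
    using T.cmp_hom[OF Y'(3) FM_Hom[OF r(1)]] by blast
qed

end

section \<open>Occurrence is invariant under isomorphism\<close>

context semisimple_tensor_category
begin

lemma Db_Ob: "Ob (Db C) = bounded_complexes C"
  by (simp add: Db.Ob_eq Cb_simps)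

lemma occurs_iso_imp:
  assumes iso: "isomorphic (Db C) K L" and o: "occurs C S i K"
  shows "occurs C S i L"
proof -
  obtain a b where a: "a \<in> Hom (Db C) K L" and b: "b \<in> Hom (Db C) L K" and ba: "b \<bullet>\<^bsub>Db C\<^esub> a = Id (Db C) K"
    using iso by (rule Db.isomorphicE)
  have KL: "K \<in> bounded_complexes C" "L \<in> bounded_complexes C"
    using Db.HomD(4,5)[OF a] by (auto simp: Db_Ob)
  obtain u where u: "u \<in> Hom (Db C) (stalk C S i) K" "\<not> null_mor (Db C) u"
    using o occurs_iff_Hom[OF KL(1)] by blast
  have au: "a \<bullet>\<^bsub>Db C\<^esub> u \<in> Hom (Db C) (stalk C S i) L" using Db.cmp_hom[OF u(1) a] .
  have "\<not> null_mor (Db C) (a \<bullet>\<^bsub>Db C\<^esub> u)"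
  proof
    assume "null_mor (Db C) (a \<bullet>\<^bsub>Db C\<^esub> u)"
    then have "null_mor (Db C) (b \<bullet>\<^bsub>Db C\<^esub> (a \<bullet>\<^bsub>Db C\<^esub> u))" using Db.null_mor_cmp_left au b by blast
    then show False
      using Db.cmp_assoc[OF u(1) a b] ba Db.id_left[OF u(1)] u(2) by simp
  qed
  then show ?thesis using occurs_iff_Hom[OF KL(2)] au by blast
qed

lemma occurs_iso:
  "isomorphic (Db C) K L \<Longrightarrow> occurs C S i K \<longleftrightarrow> occurs C S i L"
  using occurs_iso_imp Db.isomorphic_sym by blast

end

section \<open>Occurrence along the equivalence \<open>F\<close>\<close>

locale monoidal_triangulated_equivalence_between =
  C: semisimple_tensor_category C + D: semisimple_tensor_category D
  for C :: "('o, 'm, 'k::field, 'x) moncat_scheme" and D :: "('p, 'n, 'k, 'y) moncat_scheme" +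
  fixes F :: "(('o, 'm) cpx, ('o, 'm) dmor, ('p, 'n) cpx, ('p, 'n) dmor, 'z) mtfctr_scheme"
  assumes mte: "monoidal_triangulated_equivalence (Db C) (Db D) F"

sublocale monoidal_triangulated_equivalence_between \<subseteq> F: category_equivalence "Db C" "Db D" F
  by unfold_locales (use mte in \<open>simp add: monoidal_triangulated_equivalence_def\<close>)

lemma FO_Db_shift: "FO (Db_shift C) = shift_cpx C 1"
  by (simp add: Db_shift_def Db_lift_def loc_lift_def quot_lift_def)

context monoidal_triangulated_equivalence_between
begin

lemma FO_bounded: "K \<in> bounded_complexes C \<Longrightarrow> FO F K \<in> bounded_complexes D"
  using F.FO_Ob by (simp add: C.Db_Ob D.Db_Ob)

lemma shift_isomorphic:
  assumes "K \<in> bounded_complexes C"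
  shows "isomorphic (Db D) (FO F (shift_cpx C 1 K)) (shift_cpx D 1 (FO F K))"
proof -
  have "natural_iso (Db C) (Db D) (F \<circ>\<^sub>F Sh (Db C)) (Sh (Db D) \<circ>\<^sub>F F) (sh_iso F)"
    using mte unfolding monoidal_triangulated_equivalence_def triangulated_functor_def by blast
  then have "sh_iso F K \<in> Hom (Db D) (FO F (shift_cpx C 1 K)) (shift_cpx D 1 (FO F K)) \<and> is_iso (Db D) (sh_iso F K)"
    using assms unfolding natural_iso_def by (simp add: C.Db_Ob cmp_functor_def Db_simps(7,8) FO_Db_shift)
  then show ?thesis unfolding isomorphic_def by blast
qed

lemma tens_isomorphic:
  assumes "K \<in> bounded_complexes C" "L \<in> bounded_complexes C"
  shows "isomorphic (Db D) (tot_cpx D (FO F K) (FO F L)) (FO F (tot_cpx C K L))"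
proof -
  have "strong_monoidal (Db C) (Db D) F"
    using mte unfolding monoidal_triangulated_equivalence_def by blast
  then have "tens_iso F K L \<in> Hom (Db D) (tot_cpx D (FO F K) (FO F L)) (FO F (tot_cpx C K L)) \<and>
      is_iso (Db D) (tens_iso F K L)"
    using assms unfolding strong_monoidal_def by (simp add: C.Db_Ob Db_simps(7,8))
  then show ?thesis unfolding isomorphic_def by blast
qed

lemma occurs_FO_shift1:
  assumes K: "K \<in> bounded_complexes C"
  shows "occurs D Z i (FO F (shift_cpx C 1 K)) \<longleftrightarrow> occurs D Z (i + 1) (FO F K)"
  using D.occurs_iso[OF shift_isomorphic[OF K]] D.occurs_shift[OF FO_bounded[OF K]] by simp

text \<open>\<open>F\<close> comes with a comparison for the shift by \<open>1\<close> only, so the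
  integer \<open>a\<close> is reached by induction in both directions. Going down,
  \<open>K[a]\<close> is written as the shift by \<open>1\<close> of \<open>K[a - 1]\<close> and the
  equivalence for one shift is read backwards.\<close>

lemma occurs_FO_shift:
  assumes K: "K \<in> bounded_complexes C"
  shows "occurs D Z i (FO F (shift_cpx C a K)) \<longleftrightarrow> occurs D Z (i + a) (FO F K)"
proof (induction a arbitrary: i rule: int_induct[where k = 0])
  case base
  then show ?case using C.shift_cpx_0[OF K] by simp
next
  case (step1 a)
  have "shift_cpx C (a + 1) K = shift_cpx C 1 (shift_cpx C a K)"
    using C.shift_cpx_add[OF K, of 1 a] by (simp add: add.commute)
  then show ?case
    using step1(2)[of "i + 1"] occurs_FO_shift1[OF C.shift_cpx_bounded[OF K], of Z i a]
    by (simp add: algebra_simps)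
next
  case (step2 a)
  have "shift_cpx C a K = shift_cpx C 1 (shift_cpx C (a - 1) K)"
    using C.shift_cpx_add[OF K, of 1 "a - 1"] by simp
  then show ?case
    using step2(2)[of "i - 1"] occurs_FO_shift1[OF C.shift_cpx_bounded[OF K], of Z "i - 1" "a - 1"]
    by (simp add: algebra_simps)
qed

text \<open>If a shift of \<open>Z\<close> occurs in \<open>F W\<close>, then \<open>F W\<close> is isomorphic to that shift, because \<open>F W\<close> is an atom;
  so maps out of \<open>Z\<close> into \<open>F K\<close> correspond to maps out of \<open>W\<close> into \<open>K\<close>.\<close>

lemma occurs_FO_iff:
  assumes W: "simple_object C W" and Z: "simple_object D Z"
    and o: "occurs D Z (- m) (FO F (conc C W))" and K: "K \<in> bounded_complexes C"
  shows "occurs D Z i (FO F K) \<longleftrightarrow> occurs C W (i + m) K"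
proof -
  let ?P = "stalk C W 0" and ?Q = "stalk D Z (- m)"
  have P: "?P \<in> bounded_complexes C" using C.stalk_bounded C.simple_object_Ob W by blast
  have aP: "atom (Db D) (FO F ?P)" using F.atom_FO C.atom_stalk W by blast
  have aQ: "atom (Db D) ?Q" using D.atom_stalk Z by blast
  have QO: "?Q \<in> Ob (Db D)" using aQ unfolding atom_def by blast
  obtain u where u: "u \<in> Hom (Db D) ?Q (FO F ?P)" "\<not> null_mor (Db D) u"
    using o D.occurs_iff_Hom[OF FO_bounded[OF P]] by (auto simp: stalk_0)
  obtain r where r: "r \<in> Hom (Db D) (FO F ?P) ?Q" "r \<bullet>\<^bsub>Db D\<^esub> u = Id (Db D) ?Q"
    using aQ u unfolding atom_def by blast
  have "\<not> null_mor (Db D) r"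
  proof
    assume "null_mor (Db D) r"
    then have "null_mor (Db D) (r \<bullet>\<^bsub>Db D\<^esub> u)" using D.Db.null_mor_cmp_right r(1) u(1) by blast
    then show False using aQ r(2) unfolding atom_def by simp
  qed
  then obtain q where q: "q \<in> Hom (Db D) ?Q (FO F ?P)" "q \<bullet>\<^bsub>Db D\<^esub> r = Id (Db D) (FO F ?P)"
    using aP r(1) unfolding atom_def by blast
  \<comment> \<open>The retraction \<open>r\<close> of \<open>u\<close> is itself not null, so the
    atom \<open>F W\<close> supplies a left inverse \<open>q\<close> of \<open>r\<close>. A morphism
    with inverses on both sides has only one, hence \<open>q = u\<close>, and \<open>u\<close> is an
    isomorphism.\<close>
  have "q = q \<bullet>\<^bsub>Db D\<^esub> (r \<bullet>\<^bsub>Db D\<^esub> u)" using D.Db.id_right[OF q(1)] r(2) by simp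
  also have "\<dots> = (q \<bullet>\<^bsub>Db D\<^esub> r) \<bullet>\<^bsub>Db D\<^esub> u" using D.Db.cmp_assoc[OF u(1) r(1) q(1)] by simp
  also have "\<dots> = u" using q(2) D.Db.id_left[OF u(1)] by simp
  finally have ur: "u \<bullet>\<^bsub>Db D\<^esub> r = Id (Db D) (FO F ?P)" using q(2) by simp
  have key: "occurs D Z (- m) (FO F L) \<longleftrightarrow> occurs C W 0 L" if L: "L \<in> bounded_complexes C" for L
  proof
    assume "occurs D Z (- m) (FO F L)"
    then obtain w where w: "w \<in> Hom (Db D) ?Q (FO F L)" "\<not> null_mor (Db D) w"
      using D.occurs_iff_Hom[OF FO_bounded[OF L]] by blast
    have wr: "w \<bullet>\<^bsub>Db D\<^esub> r \<in> Hom (Db D) (FO F ?P) (FO F L)" using D.Db.cmp_hom[OF r(1) w(1)] .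
    obtain v where v: "v \<in> Hom (Db C) ?P L" "FM F v = w \<bullet>\<^bsub>Db D\<^esub> r"
      using F.full[OF wr] P L by (auto simp: C.Db_Ob)
    have "\<not> null_mor (Db C) v"
    proof
      assume "null_mor (Db C) v"
      then have "null_mor (Db D) (w \<bullet>\<^bsub>Db D\<^esub> r)" using F.null_mor_FM[OF v(1)] v(2) by simp
      then have "null_mor (Db D) ((w \<bullet>\<^bsub>Db D\<^esub> r) \<bullet>\<^bsub>Db D\<^esub> u)"
        using D.Db.null_mor_cmp_right wr u(1) by blast
      then show False
        using D.Db.cmp_assoc[OF u(1) r(1) w(1)] r(2) D.Db.id_right[OF w(1)] w(2) by simp
    qed
    then show "occurs C W 0 L" using C.occurs_iff_Hom[OF L] v(1) by blast
  next
    assume "occurs C W 0 L"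
    then obtain v where v: "v \<in> Hom (Db C) ?P L" "\<not> null_mor (Db C) v"
      using C.occurs_iff_Hom[OF L] by blast
    have Fv: "FM F v \<in> Hom (Db D) (FO F ?P) (FO F L)" using F.FM_Hom[OF v(1)] .
    have Fvu: "FM F v \<bullet>\<^bsub>Db D\<^esub> u \<in> Hom (Db D) ?Q (FO F L)" using D.Db.cmp_hom[OF u(1) Fv] .
    have "\<not> null_mor (Db D) (FM F v \<bullet>\<^bsub>Db D\<^esub> u)"
    proof
      assume "null_mor (Db D) (FM F v \<bullet>\<^bsub>Db D\<^esub> u)"
      then have "null_mor (Db D) ((FM F v \<bullet>\<^bsub>Db D\<^esub> u) \<bullet>\<^bsub>Db D\<^esub> r)"
        using D.Db.null_mor_cmp_right Fvu r(1) by blast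
      then have "null_mor (Db D) (FM F v)"
        using D.Db.cmp_assoc[OF r(1) u(1) Fv] ur D.Db.id_right[OF Fv] by simp
      then show False using F.null_mor_FM[OF v(1)] v(2) by simp
    qed
    then show "occurs D Z (- m) (FO F L)" using D.occurs_iff_Hom[OF FO_bounded[OF L]] Fvu by blast
  qed
  \<comment> \<open>An arbitrary degree is moved to the degree \<open>-m\<close> of the isomorphism
    by shifting \<open>K\<close>, since \<open>i = -m + (i + m)\<close>.\<close>
  have "occurs D Z i (FO F K) \<longleftrightarrow> occurs D Z (- m) (FO F (shift_cpx C (i + m) K))"
    using occurs_FO_shift[OF K, of Z "- m" "i + m"] by simp
  also have "\<dots> \<longleftrightarrow> occurs C W 0 (shift_cpx C (i + m) K)" using key C.shift_cpx_bounded[OF K] by blast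
  also have "\<dots> \<longleftrightarrow> occurs C W (i + m) K" using C.occurs_shift[OF K, of W 0 "i + m"] by simp
  finally show ?thesis .
qed

text \<open>Choose \<open>P\<close> with \<open>F P\<close> isomorphic to \<open>Z\<close>. It is
  not zero, so some simple \<open>W\<close> occurs in it in some degree \<open>j\<close>, which
  gives a morphism from \<open>F (W[-j])\<close> to \<open>Z\<close> that is not null. Its source is
  an atom, so it has a retraction, and this is a morphism from \<open>Z\<close> in the required
  direction.\<close>

lemma occurs_FO_exists:
  assumes Z: "simple_object D Z"
  shows "\<exists>W m. simple_object C W \<and> occurs D Z (- m) (FO F (conc C W))"
proof -
  let ?Q = "stalk D Z 0"
  have aQ: "atom (Db D) ?Q" using D.atom_stalk Z by blast
  have QO: "?Q \<in> Ob (Db D)" using aQ unfolding atom_def by blast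
  obtain P a b where P: "P \<in> Ob (Db C)" and a: "a \<in> Hom (Db D) (FO F P) ?Q" and b: "b \<in> Hom (Db D) ?Q (FO F P)"
    and ba: "b \<bullet>\<^bsub>Db D\<^esub> a = Id (Db D) (FO F P)" and ab: "a \<bullet>\<^bsub>Db D\<^esub> b = Id (Db D) ?Q"
    using F.ess_surj[OF QO] .
  have "\<not> null_mor (Db C) (Id (Db C) P)"
  proof
    assume "null_mor (Db C) (Id (Db C) P)"
    then have "null_mor (Db D) (Id (Db D) (FO F P))"
      using F.null_mor_FM[OF C.Db.id_hom[OF P]] F.FM_Id[OF P] by simp
    then have "null_mor (Db D) (a \<bullet>\<^bsub>Db D\<^esub> Id (Db D) (FO F P))"
      using D.Db.null_mor_cmp_left a D.Db.id_hom[OF F.FO_Ob[OF P]] by blast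
    then have "null_mor (Db D) (a \<bullet>\<^bsub>Db D\<^esub> b)"
      using D.Db.null_mor_cmp_right[OF _ a b] D.Db.id_right[OF a] by simp
    then show False using aQ ab unfolding atom_def by simp
  qed
  then obtain W j where W: "simple_object C W" and oj: "occurs C W j P"
    using C.nonnull_occurs P unfolding C.Db_Ob by blast
  let ?R = "stalk C W j"
  have PB: "P \<in> bounded_complexes C" using P by (simp add: C.Db_Ob)
  have W0: "stalk C W 0 \<in> bounded_complexes C" and RB: "?R \<in> bounded_complexes C"
    using C.stalk_bounded C.simple_object_Ob W by blast+
  have aR: "atom (Db D) (FO F ?R)" using F.atom_FO C.atom_stalk W by blast
  obtain v where v: "v \<in> Hom (Db C) ?R P" "\<not> null_mor (Db C) v"
    using oj C.occurs_iff_Hom[OF PB] by blast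
  have Fv: "FM F v \<in> Hom (Db D) (FO F ?R) (FO F P)" using F.FM_Hom[OF v(1)] .
  have aFv: "a \<bullet>\<^bsub>Db D\<^esub> FM F v \<in> Hom (Db D) (FO F ?R) ?Q" using D.Db.cmp_hom[OF Fv a] .
  have "\<not> null_mor (Db D) (a \<bullet>\<^bsub>Db D\<^esub> FM F v)"
  proof
    assume "null_mor (Db D) (a \<bullet>\<^bsub>Db D\<^esub> FM F v)"
    then have "null_mor (Db D) (b \<bullet>\<^bsub>Db D\<^esub> (a \<bullet>\<^bsub>Db D\<^esub> FM F v))" using D.Db.null_mor_cmp_left aFv b by blast
    then have "null_mor (Db D) (FM F v)" using D.Db.cmp_assoc[OF Fv a b] ba D.Db.id_left[OF Fv] by simp
    then show False using F.null_mor_FM[OF v(1)] v(2) by simp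
  qed
  then obtain r where r: "r \<in> Hom (Db D) ?Q (FO F ?R)" "r \<bullet>\<^bsub>Db D\<^esub> (a \<bullet>\<^bsub>Db D\<^esub> FM F v) = Id (Db D) (FO F ?R)"
    using aR aFv unfolding atom_def by blast
  have "\<not> null_mor (Db D) r"
  proof
    assume "null_mor (Db D) r"
    then have "null_mor (Db D) (r \<bullet>\<^bsub>Db D\<^esub> (a \<bullet>\<^bsub>Db D\<^esub> FM F v))" using D.Db.null_mor_cmp_right r(1) aFv by blast
    then show False using aR r(2) unfolding atom_def by simp
  qed
  then have "occurs D Z 0 (FO F ?R)" using D.occurs_iff_Hom[OF FO_bounded[OF RB]] r(1) by blast
  \<comment> \<open>The stalk in degree \<open>j\<close> is \<open>W[-j]\<close>, so degree
    \<open>0\<close> of its image is degree \<open>-j\<close> of the image of \<open>W\<close>; the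
    integer \<open>m\<close> is \<open>j\<close>.\<close>
  moreover have "?R = shift_cpx C (- j) (stalk C W 0)" using C.shift_stalk[of W "- j" 0] C.simple_object_Ob[OF W] by simp
  ultimately have "occurs D Z (- j) (FO F (conc C W))" using occurs_FO_shift[OF W0] by (simp add: stalk_0)
  then show ?thesis using W by blast
qed

end

section \<open>Tensor products of complexes\<close>

context abelian_category
begin

lemma bp_ob_Ob: "finite I \<Longrightarrow> (\<And>i. X i \<in> Ob C) \<Longrightarrow> bp_ob C I X \<in> Ob C"
  using is_biprodD(2)[OF bp_biprod] by blast

lemma bp_in_Hom: "finite I \<Longrightarrow> (\<And>i. X i \<in> Ob C) \<Longrightarrow> bp_in C I X i \<in> Hom C (X i) (bp_ob C I X)"
  using is_biprodD(4)[OF bp_biprod, of I X i] bp_ob_Ob[of I X] by (cases "i \<in> I") (auto simp: bp_in_def)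

lemma bp_pr_Hom: "finite I \<Longrightarrow> (\<And>i. X i \<in> Ob C) \<Longrightarrow> bp_pr C I X i \<in> Hom C (bp_ob C I X) (X i)"
  using is_biprodD(5)[OF bp_biprod, of I X i] bp_ob_Ob[of I X] by (cases "i \<in> I") (auto simp: bp_pr_def)

text \<open>Because the structure maps are extended by zero, the off-diagonal equation holds for all
  indices, inside \<open>I\<close> or not. Only the diagonal one has to know that the index belongs
  to \<open>I\<close>.\<close>

lemma bp_pr_in:
  assumes I: "finite I" and X: "\<And>i. X i \<in> Ob C"
  shows "i \<in> I \<Longrightarrow> bp_pr C I X i \<bullet> bp_in C I X i = Id C (X i)"
    "k \<noteq> i \<Longrightarrow> bp_pr C I X k \<bullet> bp_in C I X i = Zero C (X i) (X k)"
proof -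
  have b: "is_biprod C I X (bp_ob C I X) (bp_in C I X) (bp_pr C I X)"
    by (rule bp_biprod[of I X, OF I X])
  have h: "bp_in C I X i \<in> Hom C (X i) (bp_ob C I X)" "bp_pr C I X k \<in> Hom C (bp_ob C I X) (X k)"
    using bp_in_Hom[of I X] bp_pr_Hom[of I X] I X by blast+
  show "i \<in> I \<Longrightarrow> bp_pr C I X i \<bullet> bp_in C I X i = Id C (X i)" by (rule is_biprodD(6)[OF b])
  assume k: "k \<noteq> i"
  show "bp_pr C I X k \<bullet> bp_in C I X i = Zero C (X i) (X k)"
  proof (cases "i \<in> I \<and> k \<in> I")
    case True
    then show ?thesis using is_biprodD(7)[OF b] k by blast
  next
    case False
    then show ?thesis
      using HomD[OF h(1)] HomD[OF h(2)] X
      by (cases "i \<in> I") (simp_all add: bp_in_def[of C I X i] bp_pr_def[of C I X k])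
  qed
qed

lemma bp_ob_empty: "(\<And>i. X i \<in> Ob C) \<Longrightarrow> zero_object C (bp_ob C {} X)"
  using is_biprodD(2,8)[OF bp_biprod[of "{}" X]] by (simp add: zero_object_iff)

end

context monoidal_category
begin

lemma tens_arrow [simp]:
  assumes "f \<in> Mor C" "g \<in> Mor C"
  shows "f \<star> g \<in> Mor C" "Dom C (f \<star> g) = Dom C f \<boxtimes> Dom C g" "Cod C (f \<star> g) = Cod C f \<boxtimes> Cod C g"
  using tens_hom[OF Hom_self[OF assms(1)] Hom_self[OF assms(2)]] by (auto simp: Hom_def)

lemma tens_cmp_arrow:
  assumes "f \<in> Mor C" "f' \<in> Mor C" "g \<in> Mor C" "g' \<in> Mor C" "Cod C f = Dom C f'" "Cod C g = Dom C g'"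
  shows "(f' \<star> g') \<bullet> (f \<star> g) = (f' \<bullet> f) \<star> (g' \<bullet> g)"
  using assms by (intro tens_cmp[symmetric, of f "Dom C f" "Dom C f'" f' "Cod C f'" g "Dom C g" "Dom C g'" g' "Cod C g'"])
    (auto simp: Hom_def)

end

context semisimple_tensor_category
begin

lemma tens_Zero:
  assumes "g \<in> Mor C" "X \<in> Ob C" "X' \<in> Ob C"
  shows "Zero C X X' \<star> g = Zero C (X \<boxtimes> Dom C g) (X' \<boxtimes> Cod C g)"
    "g \<star> Zero C X X' = Zero C (Dom C g \<boxtimes> X) (Cod C g \<boxtimes> X')"
proof -
  have "Zero C X X' \<in> Hom C X X'" "g \<in> Hom C (Dom C g) (Cod C g)" using assms by auto
  note h = tens_scale_left[OF this, of 0] tens_scale_right[OF this(2,1), of 0]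
  show "Zero C X X' \<star> g = Zero C (X \<boxtimes> Dom C g) (X' \<boxtimes> Cod C g)"
    "g \<star> Zero C X X' = Zero C (Dom C g \<boxtimes> X) (Cod C g \<boxtimes> X')"
    using h assms by simp_all
qed

lemma tot_idx_finite:
  assumes "K \<in> bounded_complexes C"
  shows "finite (tot_idx C K L n)"
proof -
  obtain N where N: "\<And>i. \<bar>i\<bar> > N \<Longrightarrow> zero_object C (cO K i)"
    using assms unfolding bounded_complexes_def by blast
  have "tot_idx C K L n \<subseteq> {- N..N}"
  proof
    fix i assume "i \<in> tot_idx C K L n"
    then have "\<not> \<bar>i\<bar> > N" using N unfolding tot_idx_def by blast
    then show "i \<in> {- N..N}" by auto
  qed
  then show ?thesis using finite_subset by blast
qed

section \<open>The total complex and its cocycles\<close>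

context
  fixes K L :: "('o, 'm) cpx"
  assumes K: "K \<in> bounded_complexes C" and L: "L \<in> bounded_complexes C"
begin

lemma tot_fam_Ob: "tot_fam C K L n i \<in> Ob C"
  using K L by (simp add: tot_fam_def tens_ob)

lemma tot_ob_Ob: "tot_ob C K L n \<in> Ob C"
  unfolding tot_ob_def by (rule bp_ob_Ob[OF tot_idx_finite[OF K] tot_fam_Ob])

lemma tot_in_Hom: "i + j = n \<Longrightarrow> tot_in C K L i j \<in> Hom C (cO K i \<boxtimes> cO L j) (tot_ob C K L n)"
  using bp_in_Hom[of "tot_idx C K L n" "tot_fam C K L n" i, OF tot_idx_finite[OF K] tot_fam_Ob] unfolding tot_in_def tot_ob_def
  by (auto simp: tot_fam_def)

lemma tot_pr_Hom: "i + j = n \<Longrightarrow> tot_pr C K L i j \<in> Hom C (tot_ob C K L n) (cO K i \<boxtimes> cO L j)"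
  using bp_pr_Hom[of "tot_idx C K L n" "tot_fam C K L n" i, OF tot_idx_finite[OF K] tot_fam_Ob] unfolding tot_pr_def tot_ob_def
  by (auto simp: tot_fam_def)

lemma tot_pr_in:
  assumes "i + j = n"
  shows "i \<in> tot_idx C K L n \<Longrightarrow> tot_pr C K L i j \<bullet> tot_in C K L i j = Id C (cO K i \<boxtimes> cO L j)"
    "k + l = n \<Longrightarrow> k \<noteq> i \<Longrightarrow> tot_pr C K L k l \<bullet> tot_in C K L i j = Zero C (cO K i \<boxtimes> cO L j) (cO K k \<boxtimes> cO L l)"
proof -
  have j: "j = n - i" using assms by simp
  show "i \<in> tot_idx C K L n \<Longrightarrow> tot_pr C K L i j \<bullet> tot_in C K L i j = Id C (cO K i \<boxtimes> cO L j)"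
    using bp_pr_in(1)[of "tot_idx C K L n" "tot_fam C K L n" i, OF tot_idx_finite[OF K] tot_fam_Ob]
    by (simp add: tot_pr_def tot_in_def j tot_fam_def)
  assume kl: "k + l = n" "k \<noteq> i"
  then have l: "l = n - k" by simp
  show "tot_pr C K L k l \<bullet> tot_in C K L i j = Zero C (cO K i \<boxtimes> cO L j) (cO K k \<boxtimes> cO L l)"
    using bp_pr_in(2)[of "tot_idx C K L n" "tot_fam C K L n" k i, OF tot_idx_finite[OF K] tot_fam_Ob kl(2)]
    by (simp add: tot_pr_def tot_in_def j l tot_fam_def)
qed

definition tot_term :: "int \<Rightarrow> int \<Rightarrow> 'm" where
  "tot_term n i = Add C
        (tot_in C K L (i + 1) (n - i) \<bullet> (cD K i \<star> Id C (cO L (n - i))) \<bullet> tot_pr C K L i (n - i))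
        (Scale C (alt_sign i)
          (tot_in C K L i (n - i + 1) \<bullet> (Id C (cO K i) \<star> cD L (n - i)) \<bullet> tot_pr C K L i (n - i)))"

lemma tot_diff_eq: "tot_diff C K L n = hsum C (tot_ob C K L n) (tot_ob C K L (n + 1)) (tot_term n) (tot_idx C K L n)"
  by (simp add: tot_diff_def tot_term_def[abs_def])

lemma tot_term_Hom: "tot_term n i \<in> Hom C (tot_ob C K L n) (tot_ob C K L (n + 1))"
  using HomD[OF tot_in_Hom[of "i + 1" "n - i" "n + 1"]] HomD[OF tot_in_Hom[of i "n - i + 1" "n + 1"]]
    HomD[OF tot_pr_Hom[of i "n - i" n]] K L
  by (auto simp: tot_term_def)

lemma tot_diff_Hom: "tot_diff C K L n \<in> Hom C (tot_ob C K L n) (tot_ob C K L (n + 1))"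
  unfolding tot_diff_eq by (intro hsum_Hom tot_ob_Ob tot_term_Hom)

text \<open>Only the term of the differential with index \<open>i\<close> sees a morphism into the
  summand \<open>(i, j)\<close>, and both of its parts kill \<open>A\<close> by assumption.\<close>

lemma tot_diff_in_zero:
  assumes n: "i + j = n" and A: "A \<in> Hom C Q (cO K i \<boxtimes> cO L j)"
    and 1: "(cD K i \<star> Id C (cO L j)) \<bullet> A = Zero C Q (cO K (i + 1) \<boxtimes> cO L j)"
    and 2: "(Id C (cO K i) \<star> cD L j) \<bullet> A = Zero C Q (cO K i \<boxtimes> cO L (j + 1))"
  shows "tot_diff C K L n \<bullet> (tot_in C K L i j \<bullet> A) = Zero C Q (tot_ob C K L (n + 1))"
proof -
  note AD = HomD[OF A] and inD = HomD[OF tot_in_Hom[OF n]]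
  have inA: "tot_in C K L i j \<bullet> A \<in> Hom C Q (tot_ob C K L n)" using AD inD by auto
  have "tot_term n k \<bullet> (tot_in C K L i j \<bullet> A) = Zero C Q (tot_ob C K L (n + 1))" if k: "k \<in> tot_idx C K L n" for k
  proof -
    note prD = HomD[OF tot_pr_Hom[of k "n - k" n, simplified]]
    note i1D = HomD[OF tot_in_Hom[of "k + 1" "n - k" "n + 1", simplified]]
    note i2D = HomD[OF tot_in_Hom[of k "n - k + 1" "n + 1", simplified]]
    define B where "B = tot_pr C K L k (n - k) \<bullet> (tot_in C K L i j \<bullet> A)"
    have BD: "B \<in> Mor C" "Dom C B = Q" "Cod C B = cO K k \<boxtimes> cO L (n - k)" using prD inD AD by (auto simp: B_def)
    have B0: "(cD K k \<star> Id C (cO L (n - k))) \<bullet> B = Zero C Q (cO K (k + 1) \<boxtimes> cO L (n - k)) \<and>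
       (Id C (cO K k) \<star> cD L (n - k)) \<bullet> B = Zero C Q (cO K k \<boxtimes> cO L (n - k + 1))"
    proof (cases "k = i")
      case True
      then have nk: "n - k = j" using n by simp
      have "B = (tot_pr C K L i j \<bullet> tot_in C K L i j) \<bullet> A" using prD inD AD nk True by (simp add: B_def)
      also have "\<dots> = A" using tot_pr_in(1)[OF n] k True AD by simp
      finally show ?thesis using 1 2 nk True by simp
    next
      case False
      have "B = (tot_pr C K L k (n - k) \<bullet> tot_in C K L i j) \<bullet> A" using prD inD AD by (simp add: B_def)
      also have "\<dots> = Zero C Q (cO K k \<boxtimes> cO L (n - k))"
        using tot_pr_in(2)[OF n, of k "n - k"] False AD prD by simp
      finally show ?thesis using K L AD by (simp add: tens_ob)
    qed
    have "tot_term n k \<bullet> (tot_in C K L i j \<bullet> A) = Add C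
        (tot_in C K L (k + 1) (n - k) \<bullet> ((cD K k \<star> Id C (cO L (n - k))) \<bullet> B))
        (Scale C (alt_sign k) (tot_in C K L k (n - k + 1) \<bullet> ((Id C (cO K k) \<star> cD L (n - k)) \<bullet> B)))"
      using prD inD AD i1D i2D K L by (simp add: tot_term_def B_def)
    then show ?thesis using B0 i1D i2D AD by simp
  qed
  then have "hsum C Q (tot_ob C K L (n + 1)) (\<lambda>k. tot_term n k \<bullet> (tot_in C K L i j \<bullet> A)) (tot_idx C K L n)
      = Zero C Q (tot_ob C K L (n + 1))"
    using AD tot_ob_Ob by (intro hsum_zero) auto
  then show ?thesis
    unfolding tot_diff_eq hsum_cmp_right[OF tot_idx_finite[OF K] inA tot_ob_Ob tot_term_Hom] .
qed

text \<open>Dually, only the parts of the incoming differential that arrive in the summand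
  \<open>(i, j)\<close> survive the projection. They start at \<open>(i - 1, j)\<close> and
  \<open>(i, j - 1)\<close>, and \<open>A\<close> kills both.\<close>

lemma pr_tot_diff_zero:
  assumes n: "i + j = n" and i: "i \<in> tot_idx C K L n" and A: "A \<in> Hom C (cO K i \<boxtimes> cO L j) Q"
    and 1: "A \<bullet> (cD K (i - 1) \<star> Id C (cO L j)) = Zero C (cO K (i - 1) \<boxtimes> cO L j) Q"
    and 2: "A \<bullet> (Id C (cO K i) \<star> cD L (j - 1)) = Zero C (cO K i \<boxtimes> cO L (j - 1)) Q"
  shows "(A \<bullet> tot_pr C K L i j) \<bullet> tot_diff C K L (n - 1) = Zero C (tot_ob C K L (n - 1)) Q"
proof -
  note AD = HomD[OF A] and prD = HomD[OF tot_pr_Hom[OF n]]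
  have Apr: "A \<bullet> tot_pr C K L i j \<in> Hom C (tot_ob C K L n) Q" using AD prD by auto
  let ?m = "n - 1"
  have "(A \<bullet> tot_pr C K L i j) \<bullet> tot_term ?m k = Zero C (tot_ob C K L ?m) Q" for k
  proof -
    note p = HomD[OF tot_pr_Hom[of k "?m - k" ?m, simplified]]
    note i1D = HomD[OF tot_in_Hom[of "k + 1" "?m - k" n, simplified]]
    note i2D = HomD[OF tot_in_Hom[of k "?m - k + 1" n, simplified]]
    have c1: "A \<bullet> ((tot_pr C K L i j \<bullet> tot_in C K L (k + 1) l) \<bullet> (cD K k \<star> Id C (cO L l)))
        = Zero C (cO K k \<boxtimes> cO L l) Q" if l: "k + 1 + l = n" for l
    proof (cases "k + 1 = i")
      case True
      then have k: "k = i - 1" and lj: "l = j" using n l by simp_all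
      have "Id C (cO K i \<boxtimes> cO L j) \<bullet> (cD K (i - 1) \<star> Id C (cO L j)) = cD K (i - 1) \<star> Id C (cO L j)"
        using K L by simp
      then show ?thesis unfolding k lj using tot_pr_in(1)[OF n i] 1 by simp
    next
      case False
      have "tot_pr C K L i j \<bullet> tot_in C K L (k + 1) l = Zero C (cO K (k + 1) \<boxtimes> cO L l) (cO K i \<boxtimes> cO L j)"
        using tot_pr_in(2)[OF l n] False by simp
      then show ?thesis using K L AD by (simp add: tens_ob)
    qed
    have c2: "A \<bullet> ((tot_pr C K L i j \<bullet> tot_in C K L k (l + 1)) \<bullet> (Id C (cO K k) \<star> cD L l))
        = Zero C (cO K k \<boxtimes> cO L l) Q" if l: "k + (l + 1) = n" for l
    proof (cases "k = i")
      case True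
      then have lj: "l = j - 1" using n l by simp
      have "Id C (cO K i \<boxtimes> cO L j) \<bullet> (Id C (cO K i) \<star> cD L (j - 1)) = Id C (cO K i) \<star> cD L (j - 1)"
        using K L by simp
      then show ?thesis unfolding True lj using tot_pr_in(1)[OF n i] 2 by simp
    next
      case False
      have "tot_pr C K L i j \<bullet> tot_in C K L k (l + 1) = Zero C (cO K k \<boxtimes> cO L (l + 1)) (cO K i \<boxtimes> cO L j)"
        using tot_pr_in(2)[OF l n] False by simp
      then show ?thesis using K L AD by (simp add: tens_ob)
    qed
    have l: "k + 1 + (?m - k) = n" "k + (?m - k + 1) = n" by simp_all
    have "(A \<bullet> tot_pr C K L i j) \<bullet> tot_term ?m k = Add C
        ((A \<bullet> ((tot_pr C K L i j \<bullet> tot_in C K L (k + 1) (?m - k)) \<bullet> (cD K k \<star> Id C (cO L (?m - k)))))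
          \<bullet> tot_pr C K L k (?m - k))
        (Scale C (alt_sign k)
          ((A \<bullet> ((tot_pr C K L i j \<bullet> tot_in C K L k (?m - k + 1)) \<bullet> (Id C (cO K k) \<star> cD L (?m - k))))
          \<bullet> tot_pr C K L k (?m - k)))"
      using AD prD p i1D i2D K L by (simp add: tot_term_def)
    also have "\<dots> = Zero C (tot_ob C K L ?m) Q"
      unfolding c1[OF l(1)] c2[OF l(2)] using AD p by simp
    finally show ?thesis .
  qed
  then have "hsum C (tot_ob C K L ?m) Q (\<lambda>k. (A \<bullet> tot_pr C K L i j) \<bullet> tot_term ?m k) (tot_idx C K L ?m)
      = Zero C (tot_ob C K L ?m) Q"
    using AD tot_ob_Ob by (intro hsum_zero) auto
  then show ?thesis
    using hsum_cmp_left[OF tot_idx_finite[OF K] Apr tot_ob_Ob, of L ?m "tot_term ?m" ?m] tot_term_Hom[of ?m]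
    by (simp add: tot_diff_eq)
qed

text \<open>This is one half of a Kunneth formula. The tensor product of two cocycles, restricted
  along the summand \<open>Z\<close>, is a cocycle. The tensor product of their retractions,
  followed by the projection to \<open>Z\<close>, sends it to the identity and vanishes on
  coboundaries, so it is not a coboundary itself.\<close>

lemma occurs_tot:
  assumes Z: "simple_object C Z" "simple_object C Z1" "simple_object C Z2"
    and ds: "direct_summand C Z (Z1 \<boxtimes> Z2)" and o1: "occurs C Z1 i K" and o2: "occurs C Z2 j L"
  shows "occurs C Z (i + j) (tot_cpx C K L)"
proof -
  let ?n = "i + j"
  note O = Z[THEN simple_object_Ob]
  obtain x1 where x1: "x1 \<in> Hom C Z1 (cO K i)" "cD K i \<bullet> x1 = Zero C Z1 (cO K (i + 1))"
    "\<not> (\<exists>y \<in> Hom C Z1 (cO K (i - 1)). x1 = cD K (i - 1) \<bullet> y)"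
    using o1 unfolding occurs_def by blast
  obtain x2 where x2: "x2 \<in> Hom C Z2 (cO L j)" "cD L j \<bullet> x2 = Zero C Z2 (cO L (j + 1))"
    "\<not> (\<exists>y \<in> Hom C Z2 (cO L (j - 1)). x2 = cD L (j - 1) \<bullet> y)"
    using o2 unfolding occurs_def by blast
  obtain r1 where r1: "r1 \<in> Hom C (cO K i) Z1" "r1 \<bullet> x1 = Id C Z1" "r1 \<bullet> cD K (i - 1) = Zero C (cO K (i - 1)) Z1"
    using cocycle_split[OF K Z(2) x1] .
  obtain r2 where r2: "r2 \<in> Hom C (cO L j) Z2" "r2 \<bullet> x2 = Id C Z2" "r2 \<bullet> cD L (j - 1) = Zero C (cO L (j - 1)) Z2"
    using cocycle_split[OF L Z(3) x2] .
  obtain Z' \<iota> \<pi> where bp: "is_biprod C (UNIV :: bool set) (\<lambda>b. if b then Z else Z') (Z1 \<boxtimes> Z2) \<iota> \<pi>"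
    using ds unfolding direct_summand_def by blast
  define s t where "s = \<iota> True" and "t = \<pi> True"
  have s: "s \<in> Hom C Z (Z1 \<boxtimes> Z2)" and t: "t \<in> Hom C (Z1 \<boxtimes> Z2) Z" and ts: "t \<bullet> s = Id C Z"
    using is_biprodD(4)[OF bp, of True] is_biprodD(5)[OF bp, of True] is_biprodD(6)[OF bp, of True]
    by (auto simp: s_def t_def)
  note sD = HomD[OF s] and tD = HomD[OF t] and x1D = HomD[OF x1(1)] and x2D = HomD[OF x2(1)]
    and r1D = HomD[OF r1(1)] and r2D = HomD[OF r2(1)]
  \<comment> \<open>The index set of the total complex omits zero terms. Here both factors have a
    simple object as a retract, so neither is zero.\<close>
  have idx: "i \<in> tot_idx C K L ?n"
    using mor_zero_retract[of "cO K i" x1 Z1 r1] mor_zero_retract[of "cO L j" x2 Z2 r2] Z x1 x2 r1 r2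
    by (auto simp: tot_idx_def simple_object_def)
  define A where "A = (x1 \<star> x2) \<bullet> s"
  define B where "B = t \<bullet> (r1 \<star> r2)"
  have A: "A \<in> Hom C Z (cO K i \<boxtimes> cO L j)" using sD x1D x2D by (auto simp: A_def)
  have B: "B \<in> Hom C (cO K i \<boxtimes> cO L j) Z" using tD r1D r2D by (auto simp: B_def)
  note AD = HomD[OF A] and BD = HomD[OF B]
  have dA1: "(cD K i \<star> Id C (cO L j)) \<bullet> A = Zero C Z (cO K (i + 1) \<boxtimes> cO L j)"
  proof -
    have "(cD K i \<star> Id C (cO L j)) \<bullet> A = ((cD K i \<star> Id C (cO L j)) \<bullet> (x1 \<star> x2)) \<bullet> s"
      using sD x1D x2D K L by (simp add: A_def)
    also have "(cD K i \<star> Id C (cO L j)) \<bullet> (x1 \<star> x2) = (cD K i \<bullet> x1) \<star> x2"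
      using x1D x2D K L by (simp add: tens_cmp_arrow)
    finally show ?thesis unfolding x1(2) using sD x1D x2D K L by (simp add: tens_Zero tens_ob)
  qed
  have dA2: "(Id C (cO K i) \<star> cD L j) \<bullet> A = Zero C Z (cO K i \<boxtimes> cO L (j + 1))"
  proof -
    have "(Id C (cO K i) \<star> cD L j) \<bullet> A = ((Id C (cO K i) \<star> cD L j) \<bullet> (x1 \<star> x2)) \<bullet> s"
      using sD x1D x2D K L by (simp add: A_def)
    also have "(Id C (cO K i) \<star> cD L j) \<bullet> (x1 \<star> x2) = x1 \<star> (cD L j \<bullet> x2)"
      using x1D x2D K L by (simp add: tens_cmp_arrow)
    finally show ?thesis unfolding x2(2) using sD x1D x2D K L by (simp add: tens_Zero tens_ob)
  qed
  have dB1: "B \<bullet> (cD K (i - 1) \<star> Id C (cO L j)) = Zero C (cO K (i - 1) \<boxtimes> cO L j) Z"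
  proof -
    have "B \<bullet> (cD K (i - 1) \<star> Id C (cO L j)) = t \<bullet> ((r1 \<star> r2) \<bullet> (cD K (i - 1) \<star> Id C (cO L j)))"
      using tD r1D r2D K L by (simp add: B_def)
    also have "(r1 \<star> r2) \<bullet> (cD K (i - 1) \<star> Id C (cO L j)) = (r1 \<bullet> cD K (i - 1)) \<star> r2"
      using r1D r2D K L by (simp add: tens_cmp_arrow)
    finally show ?thesis unfolding r1(3) using tD r1D r2D K L by (simp add: tens_Zero tens_ob)
  qed
  have dB2: "B \<bullet> (Id C (cO K i) \<star> cD L (j - 1)) = Zero C (cO K i \<boxtimes> cO L (j - 1)) Z"
  proof -
    have "B \<bullet> (Id C (cO K i) \<star> cD L (j - 1)) = t \<bullet> ((r1 \<star> r2) \<bullet> (Id C (cO K i) \<star> cD L (j - 1)))"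
      using tD r1D r2D K L by (simp add: B_def)
    also have "(r1 \<star> r2) \<bullet> (Id C (cO K i) \<star> cD L (j - 1)) = r1 \<star> (r2 \<bullet> cD L (j - 1))"
      using r1D r2D K L by (simp add: tens_cmp_arrow)
    finally show ?thesis unfolding r2(3) using tD r1D r2D K L by (simp add: tens_Zero tens_ob)
  qed
  have BA: "B \<bullet> A = Id C Z"
  proof -
    have "B \<bullet> A = t \<bullet> (((r1 \<star> r2) \<bullet> (x1 \<star> x2)) \<bullet> s)"
      using sD tD r1D r2D x1D x2D by (simp add: A_def B_def)
    also have "(r1 \<star> r2) \<bullet> (x1 \<star> x2) = Id C (Z1 \<boxtimes> Z2)"
      using r1D r2D x1D x2D r1(2) r2(2) O by (simp add: tens_cmp_arrow tens_id)
    finally show ?thesis using sD ts by simp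
  qed
  define e where "e = tot_in C K L i j \<bullet> A"
  note inD = HomD[OF tot_in_Hom[of i j ?n, OF HOL.refl]] and prD = HomD[OF tot_pr_Hom[of i j ?n, OF HOL.refl]]
  have e: "e \<in> Hom C Z (tot_ob C K L ?n)" using inD AD by (auto simp: e_def)
  have de: "tot_diff C K L ?n \<bullet> e = Zero C Z (tot_ob C K L (?n + 1))"
    unfolding e_def by (rule tot_diff_in_zero[OF HOL.refl A dA1 dA2])
  have ret: "(B \<bullet> tot_pr C K L i j) \<bullet> e = Id C Z"
  proof -
    have "(B \<bullet> tot_pr C K L i j) \<bullet> e = B \<bullet> ((tot_pr C K L i j \<bullet> tot_in C K L i j) \<bullet> A)"
      using inD prD AD BD by (simp add: e_def)
    then show ?thesis using tot_pr_in(1)[OF HOL.refl idx] AD BA by simp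
  qed
  have nb: "\<not> (\<exists>y \<in> Hom C Z (tot_ob C K L (?n - 1)). e = tot_diff C K L (?n - 1) \<bullet> y)"
  proof
    assume "\<exists>y \<in> Hom C Z (tot_ob C K L (?n - 1)). e = tot_diff C K L (?n - 1) \<bullet> y"
    then obtain y where y: "y \<in> Hom C Z (tot_ob C K L (?n - 1))" "e = tot_diff C K L (?n - 1) \<bullet> y" by blast
    note yD = HomD[OF y(1)] and dD = HomD[OF tot_diff_Hom[of "?n - 1"], simplified]
    have "Id C Z = ((B \<bullet> tot_pr C K L i j) \<bullet> tot_diff C K L (?n - 1)) \<bullet> y"
      using ret unfolding y(2) using yD dD BD prD by simp
    also have "\<dots> = Zero C Z Z"
      unfolding pr_tot_diff_zero[OF HOL.refl idx B dB1 dB2] using yD O by simp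
    finally show False using simple_Id[OF Z(1)] by simp
  qed
  show ?thesis unfolding occurs_def tot_cpx_def cpx.simps using e de nb by blast
qed

end

text \<open>In a degree \<open>n\<close> other than \<open>0\<close> one of the two factors is zero
  for every index, so the sum is empty.\<close>

lemma tot_conc:
  assumes X: "X \<in> Ob C" and Y: "Y \<in> Ob C"
  shows "tot_cpx C (conc C X) (conc C Y) \<in> bounded_complexes C"
    "n \<noteq> 0 \<Longrightarrow> zero_object C (cO (tot_cpx C (conc C X) (conc C Y)) n)"
proof -
  let ?K = "conc C X" and ?L = "conc C Y"
  have KL: "?K \<in> bounded_complexes C" "?L \<in> bounded_complexes C"
    using stalk_bounded[of X 0] stalk_bounded[of Y 0] X Y by (simp_all add: stalk_0)
  have z: "zero_object C (tot_ob C ?K ?L n)" if "n \<noteq> 0" for n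
  proof -
    have "zero_object C (cO ?K i) \<or> zero_object C (cO ?L (n - i))" for i
      using that zobj_zero by (auto simp: stalk_simps simp flip: stalk_0)
    then have "tot_idx C ?K ?L n = {}" unfolding tot_idx_def by blast
    then show ?thesis unfolding tot_ob_def
      using bp_ob_empty[of "tot_fam C ?K ?L n", OF tot_fam_Ob[OF KL]] by simp
  qed
  then show "n \<noteq> 0 \<Longrightarrow> zero_object C (cO (tot_cpx C ?K ?L) n)" by (simp add: tot_cpx_def)
  have "tot_diff C ?K ?L (i + 1) \<bullet> tot_diff C ?K ?L i = Zero C (tot_ob C ?K ?L i) (tot_ob C ?K ?L (i + 1 + 1))" for i
  proof -
    note d = HomD[OF tot_diff_Hom[OF KL, of i]] HomD[OF tot_diff_Hom[OF KL, of "i + 1"]]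
    let ?f = "tot_diff C ?K ?L (i + 1) \<bullet> tot_diff C ?K ?L i"
    have f: "?f \<in> Mor C" "Dom C ?f = tot_ob C ?K ?L i" "Cod C ?f = tot_ob C ?K ?L (i + 1 + 1)"
      using d by simp_all
    \<comment> \<open>The composite goes from degree \<open>i\<close> to degree
      \<open>i + 2\<close>. At most one of these is \<open>0\<close>, so its source or its target is
      a zero object.\<close>
    show ?thesis
    proof (cases "i = 0")
      case True
      then show ?thesis using into_zero_object[OF z f(1,3)] f by simp
    next
      case False
      then show ?thesis using from_zero_object[OF z f(1,2)] f by simp
    qed
  qed
  then show "tot_cpx C ?K ?L \<in> bounded_complexes C"
    unfolding bounded_complexes_def tot_cpx_def
    using tot_ob_Ob[OF KL] tot_diff_Hom[OF KL] z by (auto intro!: exI[of _ 0])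
qed

end

section \<open>Homogeneous components and the twist\<close>

context semisimple_tensor_category
begin

lemma homogeneous_Ob: "homogeneous C \<eta> n X \<Longrightarrow> X \<in> Ob C"
  unfolding homogeneous_def is_biprod_def by blast

lemma simple_homogeneous:
  assumes S: "simple_object C S"
  shows "homogeneous C \<eta> (\<eta> (gdeg C (iso_class C S))) S"
proof -
  have O: "S \<in> Ob C" using S by (rule simple_object_Ob)
  have "hsum C S S (\<lambda>i. Id C S \<bullet> Id C S) {..<Suc 0} = Id C S"
    using O id_hom[OF O] hsum_single[of S S "{..<Suc 0}" 0 "\<lambda>i. Id C S \<bullet> Id C S"] by auto
  then have "is_biprod C {..<Suc 0} (\<lambda>_. S) S (\<lambda>_. Id C S) (\<lambda>_. Id C S)"
    using O by (auto simp: is_biprod_def)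
  then show ?thesis
    unfolding homogeneous_def using S
    by (intro exI[of _ "Suc 0"] exI[of _ "\<lambda>_. S"] exI[of _ "\<lambda>_. Id C S"]) simp
qed

text \<open>Isomorphic simple objects have the same class and hence the same degree. Simple summands
  of different degrees are therefore not isomorphic, and Schur's lemma kills every matrix entry of
  \<open>f\<close>.\<close>

lemma homogeneous_orthogonal:
  assumes P: "homogeneous C \<eta> n P" and Q: "homogeneous C \<eta> l Q" and nl: "n \<noteq> l" and f: "f \<in> Hom C P Q"
  shows "f = Zero C P Q"
proof -
  obtain m S \<iota> \<pi> where S: "\<forall>i<m. simple_object C (S i) \<and> \<eta> (gdeg C (iso_class C (S i))) = n"
    and b: "is_biprod C {..<m::nat} S P \<iota> \<pi>"
    using P unfolding homogeneous_def by blast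
  obtain m' S' \<iota>' \<pi>' where S': "\<forall>i<m'. simple_object C (S' i) \<and> \<eta> (gdeg C (iso_class C (S' i))) = l"
    and b': "is_biprod C {..<m'::nat} S' Q \<iota>' \<pi>'"
    using Q unfolding homogeneous_def by blast
  note fD = HomD[OF f]
  show ?thesis
  proof (rule biprod_eqI_in[OF b f])
    fix i assume i: "i \<in> {..<m}"
    note iD = HomD[OF is_biprodD(4)[OF b i]]
    show "f \<bullet> \<iota> i = Zero C P Q \<bullet> \<iota> i"
    proof (rule biprod_eqI_pr[OF b'])
      fix j assume j: "j \<in> {..<m'}"
      note jD = HomD[OF is_biprodD(5)[OF b' j]]
      have "\<not> isomorphic C (S i) (S' j)" using iso_class_eq[of "S i" "S' j"] S S' i j nl by auto
      moreover have "\<pi>' j \<bullet> (f \<bullet> \<iota> i) \<in> Hom C (S i) (S' j)" using iD jD fD by auto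
      ultimately have "\<pi>' j \<bullet> (f \<bullet> \<iota> i) = Zero C (S i) (S' j)" using Schur_zero S S' i j by blast
      then show "\<pi>' j \<bullet> (f \<bullet> \<iota> i) = \<pi>' j \<bullet> (Zero C P Q \<bullet> \<iota> i)" using iD jD fD by simp
    qed (use iD fD in auto)
  qed (use fD in auto)
qed

text \<open>The simple summands of \<open>X\<close> are collected according to their degree:
  \<open>P n\<close> is the biproduct of those of degree \<open>n\<close>, and its maps to and from
  \<open>X\<close> are assembled from the inclusions and projections of its summands.\<close>

lemma homogeneous_decomposition:
  assumes X: "X \<in> Ob C"
  shows "\<exists>P \<iota> \<pi>. (\<forall>n. homogeneous C \<eta> n (P n) \<and> \<iota> n \<in> Hom C (P n) X \<and> \<pi> n \<in> Hom C X (P n)) \<and>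
     is_biprod C {n. \<not> zero_object C (P n)} P X \<iota> \<pi>"
proof -
  obtain m S a b where S: "\<forall>i<m. simple_object C (S i)" and B: "is_biprod C {..<m::nat} S X a b"
    using semisimple[OF X] by blast
  define deg where "deg = (\<lambda>i. \<eta> (gdeg C (iso_class C (S i))))"
  define I where "I = (\<lambda>n. {i. i < m \<and> deg i = n})"
  \<comment> \<open>\<open>homogeneous\<close> asks for summands indexed by an initial segment of
    the naturals, so each set \<open>I n\<close> is enumerated by a function
    \<open>h n\<close>.\<close>
  have "\<forall>n. \<exists>h. bij_betw h {..<card (I n)} (I n)"
    using ex_bij_betw_nat_finite[of "I _"] by (simp add: I_def atLeast0LessThan)
  from choice[OF this] obtain h where h: "\<And>n. bij_betw (h n) {..<card (I n)} (I n)" by blast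
  define c where "c = (\<lambda>n. {..<card (I n)})"
  have hI: "h n i < m" "deg (h n i) = n" if "i \<in> c n" for n i
    using bij_betwE[OF h[of n]] that by (auto simp: c_def I_def)
  have hinj: "h n i = h n j \<longleftrightarrow> i = j" if "i \<in> c n" "j \<in> c n" for n i j
    using bij_betw_imp_inj_on[OF h[of n]] that by (auto simp: c_def inj_on_def)
  define P where "P = (\<lambda>n. bp_ob C (c n) (\<lambda>i. S (h n i)))"
  define u where "u = (\<lambda>n. bp_in C (c n) (\<lambda>i. S (h n i)))"
  define v where "v = (\<lambda>n. bp_pr C (c n) (\<lambda>i. S (h n i)))"
  have bp: "is_biprod C (c n) (\<lambda>i. S (h n i)) (P n) (u n) (v n)" for n
    unfolding P_def u_def v_def
    by (rule bp_biprod) (use hI is_biprodD(3)[OF B] in \<open>auto simp: c_def\<close>)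
  have PO: "P n \<in> Ob C" for n using is_biprodD(2)[OF bp] .
  note uD = HomD[OF is_biprodD(4)[OF bp]] and vD = HomD[OF is_biprodD(5)[OF bp]]
  have aH: "a (h n i) \<in> Hom C (S (h n i)) X" "b (h n i) \<in> Hom C X (S (h n i))" if "i \<in> c n" for n i
    using is_biprodD(4,5)[OF B] hI(1)[OF that] by auto
  note aD = HomD[OF aH(1)] and bD = HomD[OF aH(2)]
  have "\<forall>n. \<exists>w. w \<in> Hom C (P n) X \<and> (\<forall>i \<in> c n. w \<bullet> u n i = a (h n i))"
  proof
    fix n
    obtain w where "w \<in> Hom C (P n) X" "\<And>i. i \<in> c n \<Longrightarrow> w \<bullet> u n i = a (h n i)"
      using biprod_colift[OF bp[of n] X, of "\<lambda>i. a (h n i)"] aH(1) by blast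
    then show "\<exists>w. w \<in> Hom C (P n) X \<and> (\<forall>i \<in> c n. w \<bullet> u n i = a (h n i))" by blast
  qed
  from choice[OF this] obtain \<iota> where iota: "\<And>n. \<iota> n \<in> Hom C (P n) X" "\<And>n i. i \<in> c n \<Longrightarrow> \<iota> n \<bullet> u n i = a (h n i)"
    by blast
  have "\<forall>n. \<exists>w. w \<in> Hom C X (P n) \<and> (\<forall>i \<in> c n. v n i \<bullet> w = b (h n i))"
  proof
    fix n
    obtain w where "w \<in> Hom C X (P n)" "\<And>i. i \<in> c n \<Longrightarrow> v n i \<bullet> w = b (h n i)"
      using biprod_lift[OF bp[of n] X, of "\<lambda>i. b (h n i)"] aH(2) by blast
    then show "\<exists>w. w \<in> Hom C X (P n) \<and> (\<forall>i \<in> c n. v n i \<bullet> w = b (h n i))" by blast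
  qed
  from choice[OF this] obtain \<pi> where pi: "\<And>n. \<pi> n \<in> Hom C X (P n)" "\<And>n i. i \<in> c n \<Longrightarrow> v n i \<bullet> \<pi> n = b (h n i)"
    by blast
  note iotaD = HomD[OF iota(1)] and piD = HomD[OF pi(1)]
  \<comment> \<open>These are the entries of the matrix of
    \<open>\<pi> l \<bullet> \<iota> n\<close> with respect to the simple summands; they are read
    off from the orthogonality relations of the original decomposition.\<close>
  have ent: "v l j \<bullet> ((\<pi> l \<bullet> \<iota> n) \<bullet> u n i) = (if l = n \<and> j = i then Id C (S (h n i)) else Zero C (S (h n i)) (S (h l j)))"
    if i: "i \<in> c n" and j: "j \<in> c l" for n l i j
  proof -
    have "v l j \<bullet> ((\<pi> l \<bullet> \<iota> n) \<bullet> u n i) = (v l j \<bullet> \<pi> l) \<bullet> (\<iota> n \<bullet> u n i)"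
      using uD[OF i] vD[OF j] iotaD piD by simp
    also have "\<dots> = b (h l j) \<bullet> a (h n i)" unfolding pi(2)[OF j] iota(2)[OF i] ..
    also have "\<dots> = (if h l j = h n i then Id C (S (h n i)) else Zero C (S (h n i)) (S (h l j)))"
      using is_biprodD(6)[OF B, of "h n i"] is_biprodD(7)[OF B, of "h n i" "h l j"] hI(1)[OF i] hI(1)[OF j] by auto
    also have "h l j = h n i \<longleftrightarrow> l = n \<and> j = i"
      using hI(2)[OF i] hI(2)[OF j] hinj i j by auto
    finally show ?thesis .
  qed
  have pi_iota: "\<pi> l \<bullet> \<iota> n = (if n = l then Id C (P n) else Zero C (P n) (P l))" for n l
  proof (rule biprod_eqI_in[OF bp])
    show pil: "\<pi> l \<bullet> \<iota> n \<in> Hom C (P n) (P l)" using iotaD piD by auto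
    show rhs: "(if n = l then Id C (P n) else Zero C (P n) (P l)) \<in> Hom C (P n) (P l)" using PO by auto
    fix i assume i: "i \<in> c n"
    show "(\<pi> l \<bullet> \<iota> n) \<bullet> u n i = (if n = l then Id C (P n) else Zero C (P n) (P l)) \<bullet> u n i"
    proof (rule biprod_eqI_pr[OF bp])
      show "(\<pi> l \<bullet> \<iota> n) \<bullet> u n i \<in> Hom C (S (h n i)) (P l)"
        "(if n = l then Id C (P n) else Zero C (P n) (P l)) \<bullet> u n i \<in> Hom C (S (h n i)) (P l)"
        using uD[OF i] HomD[OF pil] HomD[OF rhs] by auto
      fix j assume j: "j \<in> c l"
      have vu: "v n j \<bullet> u n i = (if i = j then Id C (S (h n i)) else Zero C (S (h n i)) (S (h n j)))" if "j \<in> c n"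
        using is_biprodD(6)[OF bp i] is_biprodD(7)[OF bp i that] by auto
      have "v l j \<bullet> (Zero C (P n) (P l) \<bullet> u n i) = Zero C (S (h n i)) (S (h l j))"
        using uD[OF i] vD[OF j] PO by simp
      moreover have "v n j \<bullet> (Id C (P n) \<bullet> u n i) = v n j \<bullet> u n i" using uD[OF i] by simp
      ultimately show "v l j \<bullet> ((\<pi> l \<bullet> \<iota> n) \<bullet> u n i) =
          v l j \<bullet> ((if n = l then Id C (P n) else Zero C (P n) (P l)) \<bullet> u n i)"
        unfolding ent[OF i j] using vu j by (cases "n = l") auto
    qed
  qed
  have hom: "homogeneous C \<eta> n (P n)" for n
    unfolding homogeneous_def
    using bp[of n] S hI unfolding c_def deg_def
    by (intro exI[of _ "card (I n)"] exI[of _ "\<lambda>i. S (h n i)"] exI[of _ "u n"] exI[of _ "v n"]) auto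
  let ?N = "{n. \<not> zero_object C (P n)}"
  have finN: "finite ?N"
  proof (rule finite_subset)
    show "?N \<subseteq> deg ` {..<m}"
    proof
      fix n assume n: "n \<in> ?N"
      have "I n \<noteq> {}"
      proof
        assume "I n = {}"
        then have "c n = {}" by (simp add: c_def)
        then have "zero_object C (P n)"
          using is_biprodD(8)[OF bp[of n]] PO[of n] by (simp add: zero_object_iff)
        then show False using n by simp
      qed
      then show "n \<in> deg ` {..<m}" by (auto simp: I_def)
    qed
  qed simp
  have sum: "hsum C X X (\<lambda>n. \<iota> n \<bullet> \<pi> n) ?N = Id C X"
  proof (rule biprod_eqI_pr[OF B])
    have T: "\<iota> n \<bullet> \<pi> n \<in> Hom C X X" for n using iotaD piD by auto
    show "hsum C X X (\<lambda>n. \<iota> n \<bullet> \<pi> n) ?N \<in> Hom C X X" using X T by (intro hsum_Hom)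
    show "Id C X \<in> Hom C X X" using X by auto
    fix k assume k: "k \<in> {..<m}"
    \<comment> \<open>The identity is tested against the projection to each simple summand. Only the
      homogeneous component of the same degree contributes, and it is one of the nonzero components
      because it contains that summand.\<close>
    define n where "n = deg k"
    have "k \<in> I n" using k by (simp add: I_def n_def)
    then obtain i where i: "i \<in> c n" "h n i = k"
      using bij_betw_imp_surj_on[OF h[of n]] unfolding c_def by (metis imageE)
    have bk: "b k \<in> Hom C X (S k)" using is_biprodD(5)[OF B k] .
    note bkD = HomD[OF bk]
    have bk_eq: "v n i \<bullet> \<pi> n = b k" using pi(2)[OF i(1)] i(2) by simp
    have nN: "n \<in> ?N"
    proof -
      have "\<not> zero_object C (P n)"
      proof
        assume "zero_object C (P n)"
        then have "zero_object C (S (h n i))"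
          using mor_zero_retract[OF _ is_biprodD(4)[OF bp i(1)] is_biprodD(5)[OF bp i(1)] is_biprodD(6)[OF bp i(1)]]
          by blast
        then show False using S hI(1)[OF i(1)] unfolding simple_object_def by blast
      qed
      then show ?thesis by simp
    qed
    have t: "b k \<bullet> (\<iota> n' \<bullet> \<pi> n') = (if n' = n then b k else Zero C X (S k))" for n'
    proof -
      have "b k \<bullet> (\<iota> n' \<bullet> \<pi> n') = v n i \<bullet> ((\<pi> n \<bullet> \<iota> n') \<bullet> \<pi> n')"
        unfolding bk_eq[symmetric] using vD[OF i(1)] iotaD piD by simp
      also have "\<dots> = (if n' = n then v n i \<bullet> \<pi> n else Zero C X (S k))"
        unfolding pi_iota using vD[OF i(1)] piD PO i(2) by simp
      finally show ?thesis unfolding bk_eq .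
    qed
    have "b k \<bullet> hsum C X X (\<lambda>n. \<iota> n \<bullet> \<pi> n) ?N = hsum C X (S k) (\<lambda>n. b k \<bullet> (\<iota> n \<bullet> \<pi> n)) ?N"
      by (rule hsum_cmp_left[OF finN bk X T])
    also have "\<dots> = b k \<bullet> (\<iota> n \<bullet> \<pi> n)"
      using X bkD bk t by (intro hsum_single[OF _ _ finN nN]) auto
    also have "\<dots> = b k \<bullet> Id C X" unfolding t using bkD by simp
    finally show "b k \<bullet> hsum C X X (\<lambda>n. \<iota> n \<bullet> \<pi> n) ?N = b k \<bullet> Id C X" .
  qed
  have "is_biprod C ?N P X \<iota> \<pi>"
    unfolding is_biprod_def using finN X PO iota(1) pi(1) pi_iota sum by auto
  then show ?thesis using hom iota(1) pi(1) by blast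
qed

section \<open>Functoriality of the homogeneous components\<close>

context
  fixes \<eta> :: "(bool \<times> 'o set) list set \<Rightarrow> int"
begin

definition comp_in :: "int \<Rightarrow> 'o \<Rightarrow> 'm" where
  "comp_in n X = fst (snd (hom_decomp C \<eta> X)) n"

definition comp_pr :: "int \<Rightarrow> 'o \<Rightarrow> 'm" where
  "comp_pr n X = snd (snd (hom_decomp C \<eta> X)) n"

lemma comp_decomposition:
  assumes "X \<in> Ob C"
  shows "homogeneous C \<eta> n (comp_ob C \<eta> n X)" "comp_in n X \<in> Hom C (comp_ob C \<eta> n X) X"
    "comp_pr n X \<in> Hom C X (comp_ob C \<eta> n X)"
    "is_biprod C {n. \<not> zero_object C (comp_ob C \<eta> n X)} (\<lambda>n. comp_ob C \<eta> n X) X (\<lambda>n. comp_in n X) (\<lambda>n. comp_pr n X)"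
proof -
  have "\<exists>z. case z of (P, \<iota>, \<pi>) \<Rightarrow>
      (\<forall>n. homogeneous C \<eta> n (P n) \<and> \<iota> n \<in> Hom C (P n) X \<and> \<pi> n \<in> Hom C X (P n)) \<and>
     is_biprod C {n. \<not> zero_object C (P n)} P X \<iota> \<pi>"
    using homogeneous_decomposition[OF assms, of \<eta>] by auto
  then have "case hom_decomp C \<eta> X of (P, \<iota>, \<pi>) \<Rightarrow>
      (\<forall>n. homogeneous C \<eta> n (P n) \<and> \<iota> n \<in> Hom C (P n) X \<and> \<pi> n \<in> Hom C X (P n)) \<and>
     is_biprod C {n. \<not> zero_object C (P n)} P X \<iota> \<pi>"
    unfolding hom_decomp_def by (rule someI_ex)
  then show "homogeneous C \<eta> n (comp_ob C \<eta> n X)" "comp_in n X \<in> Hom C (comp_ob C \<eta> n X) X"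
    "comp_pr n X \<in> Hom C X (comp_ob C \<eta> n X)"
    "is_biprod C {n. \<not> zero_object C (comp_ob C \<eta> n X)} (\<lambda>n. comp_ob C \<eta> n X) X (\<lambda>n. comp_in n X) (\<lambda>n. comp_pr n X)"
    by (auto simp: case_prod_beta comp_ob_def comp_in_def comp_pr_def)
qed

lemmas compD = HomD[OF comp_decomposition(2)] HomD[OF comp_decomposition(3)]

lemma comp_ob_Ob: "X \<in> Ob C \<Longrightarrow> comp_ob C \<eta> n X \<in> Ob C"
  using homogeneous_Ob comp_decomposition(1) by blast

text \<open>The biproduct equations cover only the indices of nonzero components. For a zero
  component the identity is the zero morphism, so the equation persists.\<close>

lemma comp_pr_in:
  assumes X: "X \<in> Ob C"
  shows "comp_pr n X \<bullet> comp_in n X = Id C (comp_ob C \<eta> n X)"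
proof (cases "zero_object C (comp_ob C \<eta> n X)")
  case True
  then have "Id C (comp_ob C \<eta> n X) = Zero C (comp_ob C \<eta> n X) (comp_ob C \<eta> n X)"
    by (simp add: zero_object_iff)
  moreover have "comp_pr n X \<bullet> comp_in n X \<in> Mor C" "Dom C (comp_pr n X \<bullet> comp_in n X) = comp_ob C \<eta> n X"
    "Cod C (comp_pr n X \<bullet> comp_in n X) = comp_ob C \<eta> n X"
    using compD[OF X] by simp_all
  ultimately show ?thesis using into_zero_object[OF True] by metis
next
  case False
  then show ?thesis using is_biprodD(6)[OF comp_decomposition(4)[OF X]] by blast
qed

lemma comp_pr_off:
  assumes "X \<in> Ob C" "homogeneous C \<eta> n P" "n \<noteq> l" "x \<in> Hom C P X"
  shows "comp_pr l X \<bullet> x = Zero C P (comp_ob C \<eta> l X)"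
  using homogeneous_orthogonal[OF assms(2) comp_decomposition(1)[OF assms(1)] assms(3)]
    cmp_hom[OF assms(4) comp_decomposition(3)[OF assms(1)]] by blast

text \<open>A morphism out of a homogeneous object of degree \<open>n\<close> has no components in
  other degrees, so it factors through the component of degree \<open>n\<close>.\<close>

lemma comp_in_pr:
  assumes X: "X \<in> Ob C" and P: "homogeneous C \<eta> n P" and x: "x \<in> Hom C P X"
  shows "comp_in n X \<bullet> (comp_pr n X \<bullet> x) = x"
proof (rule biprod_eqI_pr[OF comp_decomposition(4)[OF X] _ x])
  note xD = HomD[OF x] and cD = compD[OF X]
  show "comp_in n X \<bullet> (comp_pr n X \<bullet> x) \<in> Hom C P X" using xD cD by auto
  fix l
  show "comp_pr l X \<bullet> (comp_in n X \<bullet> (comp_pr n X \<bullet> x)) = comp_pr l X \<bullet> x"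
  proof (cases "l = n")
    case True
    have "comp_pr n X \<bullet> (comp_in n X \<bullet> (comp_pr n X \<bullet> x)) = (comp_pr n X \<bullet> comp_in n X) \<bullet> (comp_pr n X \<bullet> x)"
      using xD cD by simp
    then show ?thesis unfolding comp_pr_in[OF X] True using xD cD by simp
  next
    case False
    have y: "comp_in n X \<bullet> (comp_pr n X \<bullet> x) \<in> Hom C P X" using xD cD by auto
    show ?thesis using comp_pr_off[OF X P _ x, of l] comp_pr_off[OF X P _ y, of l] False by simp
  qed
qed

lemma comp_mor_Hom:
  assumes f: "f \<in> Hom C X Y"
  shows "comp_mor C \<eta> n f \<in> Hom C (comp_ob C \<eta> n X) (comp_ob C \<eta> n Y)"
    "comp_mor C \<eta> n f = comp_pr n Y \<bullet> (f \<bullet> comp_in n X)"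
proof -
  note fD = HomD[OF f]
  show *: "comp_mor C \<eta> n f = comp_pr n Y \<bullet> (f \<bullet> comp_in n X)"
    using fD by (simp add: comp_mor_def comp_in_def comp_pr_def)
  show "comp_mor C \<eta> n f \<in> Hom C (comp_ob C \<eta> n X) (comp_ob C \<eta> n Y)"
    unfolding * using fD compD[OF fD(4)] compD[OF fD(5)] by auto
qed

text \<open>Restricted to the component of degree \<open>n\<close>, the morphism \<open>f\<close>
  lands in the component of degree \<open>n\<close>. Through this relation the projections preserve
  composites of differentials, and they commute with them.\<close>

lemma comp_in_natural:
  assumes f: "f \<in> Hom C X Y"
  shows "comp_in n Y \<bullet> comp_mor C \<eta> n f = f \<bullet> comp_in n X"
proof -
  note fD = HomD[OF f]
  have "f \<bullet> comp_in n X \<in> Hom C (comp_ob C \<eta> n X) Y" using fD compD[OF fD(4)] by auto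
  then show ?thesis
    unfolding comp_mor_Hom(2)[OF f] using comp_in_pr[OF fD(5) comp_decomposition(1)[OF fD(4)]] by blast
qed

lemma comp_mor_cmp_zero:
  assumes f: "f \<in> Hom C X Y" and g: "g \<in> Hom C Y Z" and gf: "g \<bullet> f = Zero C X Z"
  shows "comp_mor C \<eta> n g \<bullet> comp_mor C \<eta> n f = Zero C (comp_ob C \<eta> n X) (comp_ob C \<eta> n Z)"
proof -
  note fD = HomD[OF f] and gD = HomD[OF g]
  note c = compD[OF fD(4)] compD[OF fD(5)] compD[OF gD(5)]
  note m = HomD[OF comp_mor_Hom(1)[OF f]]
  have "comp_mor C \<eta> n g \<bullet> comp_mor C \<eta> n f = comp_pr n Z \<bullet> (g \<bullet> (comp_in n Y \<bullet> comp_mor C \<eta> n f))"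
    unfolding comp_mor_Hom(2)[OF g] using gD c m by simp
  also have "\<dots> = comp_pr n Z \<bullet> ((g \<bullet> f) \<bullet> comp_in n X)"
    unfolding comp_in_natural[OF f] using fD gD c by simp
  finally show ?thesis unfolding gf using fD gD c by simp
qed

end

section \<open>Degreewise finite direct sums of complexes\<close>

context
  fixes K :: "int \<Rightarrow> ('o, 'm) cpx"
  assumes KO: "cO (K n) i \<in> Ob C"
    and KD: "cD (K n) i \<in> Hom C (cO (K n) i) (cO (K n) (i + 1))"
    and KDD: "cD (K n) (i + 1) \<bullet> cD (K n) i = Zero C (cO (K n) i) (cO (K n) (i + 1 + 1))"
    and fin: "finite (sum_idx C K i)"
begin

lemma sum_biprod: "is_biprod C (sum_idx C K i) (\<lambda>n. cO (K n) i) (sum_ob C K i) (sum_in C K i) (sum_pr C K i)"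
  unfolding sum_ob_def sum_in_def sum_pr_def by (rule bp_biprod[OF fin KO])

lemma sum_ob_Ob: "sum_ob C K i \<in> Ob C"
  using is_biprodD(2)[OF sum_biprod] .

lemma sum_in_Hom: "sum_in C K i n \<in> Hom C (cO (K n) i) (sum_ob C K i)"
  unfolding sum_ob_def sum_in_def by (rule bp_in_Hom[of _ "\<lambda>n. cO (K n) i" n, OF fin KO])

lemma sum_pr_Hom: "sum_pr C K i n \<in> Hom C (sum_ob C K i) (cO (K n) i)"
  unfolding sum_ob_def sum_pr_def by (rule bp_pr_Hom[of _ "\<lambda>n. cO (K n) i" n, OF fin KO])

lemma sum_pr_in: "n \<noteq> l \<Longrightarrow> sum_pr C K i l \<bullet> sum_in C K i n = Zero C (cO (K n) i) (cO (K l) i)"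
  "n \<in> sum_idx C K i \<Longrightarrow> sum_pr C K i n \<bullet> sum_in C K i n = Id C (cO (K n) i)"
  unfolding sum_in_def sum_pr_def
  using bp_pr_in[of "sum_idx C K i" "\<lambda>n. cO (K n) i", OF fin KO] by metis+

text \<open>Outside the index set the structure maps are zero, but there the term itself is a zero
  object, so \<open>x\<close> is zero as well.\<close>

lemma sum_pr_in_cancel:
  assumes "x \<in> Mor C" "Cod C x = cO (K n) i"
  shows "sum_pr C K i n \<bullet> (sum_in C K i n \<bullet> x) = x"
proof -
  note h = HomD[OF sum_pr_Hom[of i n]] HomD[OF sum_in_Hom[of i n]]
  have e: "sum_pr C K i n \<bullet> (sum_in C K i n \<bullet> x) = (sum_pr C K i n \<bullet> sum_in C K i n) \<bullet> x"
    using h assms by simp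
  show ?thesis
  proof (cases "n \<in> sum_idx C K i")
    case True
    show ?thesis unfolding e sum_pr_in(2)[OF True] using assms by simp
  next
    case False
    then have z: "zero_object C (cO (K n) i)" by (simp add: sum_idx_def)
    have "sum_pr C K i n \<bullet> (sum_in C K i n \<bullet> x) \<in> Mor C" 
      "Cod C (sum_pr C K i n \<bullet> (sum_in C K i n \<bullet> x)) = cO (K n) i"
      "Dom C (sum_pr C K i n \<bullet> (sum_in C K i n \<bullet> x)) = Dom C x" using h assms by simp_all
    then show ?thesis using into_zero_object[OF z] assms by metis
  qed
qed

lemma sum_term_Hom: "sum_in C K (i + 1) n \<bullet> (cD (K n) i \<bullet> sum_pr C K i n) \<in> Hom C (sum_ob C K i) (sum_ob C K (i + 1))"
  using HomD[OF sum_pr_Hom[of i n]] HomD[OF sum_in_Hom[of "i + 1" n]] HomD[OF KD[of n i]] by auto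

lemma cD_sum_cpx: "cD (sum_cpx C K) i = hsum C (sum_ob C K i) (sum_ob C K (i + 1))
    (\<lambda>n. sum_in C K (i + 1) n \<bullet> (cD (K n) i \<bullet> sum_pr C K i n)) (sum_idx C K i)"
  by (simp add: sum_cpx_def)

lemma cD_sum_Hom: "cD (sum_cpx C K) i \<in> Hom C (sum_ob C K i) (sum_ob C K (i + 1))"
  unfolding cD_sum_cpx by (intro hsum_Hom sum_ob_Ob sum_term_Hom)

text \<open>All terms of the differential other than the one with index \<open>l\<close> are killed
  by the projection. If \<open>l\<close> is not an index in degree \<open>i\<close>, both sides
  vanish because the term of \<open>K l\<close> is zero. The relation reduces the vanishing of the
  squared differential to that for each member of the family.\<close>

lemma sum_pr_natural: "sum_pr C K (i + 1) l \<bullet> cD (sum_cpx C K) i = cD (K l) i \<bullet> sum_pr C K i l"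
proof -
  let ?t = "\<lambda>n. sum_pr C K (i + 1) l \<bullet> (sum_in C K (i + 1) n \<bullet> (cD (K n) i \<bullet> sum_pr C K i n))"
  note p = HomD[OF sum_pr_Hom[of "i + 1" l]]
  have e: "sum_pr C K (i + 1) l \<bullet> cD (sum_cpx C K) i = hsum C (sum_ob C K i) (cO (K l) (i + 1)) ?t (sum_idx C K i)"
    unfolding cD_sum_cpx by (rule hsum_cmp_left[OF fin sum_pr_Hom sum_ob_Ob sum_term_Hom])
  have off: "?t n = Zero C (sum_ob C K i) (cO (K l) (i + 1))" if "n \<noteq> l" for n
  proof -
    have "?t n = (sum_pr C K (i + 1) l \<bullet> sum_in C K (i + 1) n) \<bullet> (cD (K n) i \<bullet> sum_pr C K i n)"
      using p HomD[OF sum_in_Hom[of "i + 1" n]] HomD[OF KD[of n i]] HomD[OF sum_pr_Hom[of i n]] by simp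
    then show ?thesis
      unfolding sum_pr_in(1)[OF that] using p HomD[OF KD[of n i]] HomD[OF sum_pr_Hom[of i n]] by simp
  qed
  note q = HomD[OF KD[of l i]] HomD[OF sum_pr_Hom[of i l]]
  have on: "?t l = cD (K l) i \<bullet> sum_pr C K i l"
    using q by (intro sum_pr_in_cancel) auto
  show ?thesis
  proof (cases "l \<in> sum_idx C K i")
    case True
    have "hsum C (sum_ob C K i) (cO (K l) (i + 1)) ?t (sum_idx C K i) = ?t l"
      by (rule hsum_single[OF sum_ob_Ob KO fin True]) (use on off q in auto)
    then show ?thesis unfolding e on .
  next
    case False
    then have z: "zero_object C (cO (K l) i)" by (simp add: sum_idx_def)
    have "hsum C (sum_ob C K i) (cO (K l) (i + 1)) ?t (sum_idx C K i) = Zero C (sum_ob C K i) (cO (K l) (i + 1))"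
      by (rule hsum_zero[OF sum_ob_Ob KO], rule off) (use False in auto)
    moreover have "sum_pr C K i l = Zero C (sum_ob C K i) (cO (K l) i)"
      using into_zero_object[OF z] q by metis
    then have "cD (K l) i \<bullet> sum_pr C K i l = Zero C (sum_ob C K i) (cO (K l) (i + 1))"
      using q sum_ob_Ob by simp
    ultimately show ?thesis unfolding e by simp
  qed
qed

lemma sum_cpx_bounded:
  assumes N: "\<And>i. \<bar>i\<bar> > N \<Longrightarrow> sum_idx C K i = {}"
  shows "sum_cpx C K \<in> bounded_complexes C"
proof -
  have O: "cO (sum_cpx C K) i = sum_ob C K i" for i by (simp add: sum_cpx_def)
  have dd: "cD (sum_cpx C K) (i + 1) \<bullet> cD (sum_cpx C K) i = Zero C (sum_ob C K i) (sum_ob C K (i + 1 + 1))" for i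
  proof (rule biprod_eqI_pr[OF sum_biprod])
    note d = HomD[OF cD_sum_Hom[of i]] HomD[OF cD_sum_Hom[of "i + 1"]]
    show "cD (sum_cpx C K) (i + 1) \<bullet> cD (sum_cpx C K) i \<in> Hom C (sum_ob C K i) (sum_ob C K (i + 1 + 1))"
      "Zero C (sum_ob C K i) (sum_ob C K (i + 1 + 1)) \<in> Hom C (sum_ob C K i) (sum_ob C K (i + 1 + 1))"
      using d sum_ob_Ob by auto
    fix l
    note p = HomD[OF sum_pr_Hom[of "i + 1 + 1" l]] HomD[OF sum_pr_Hom[of "i + 1" l]] HomD[OF sum_pr_Hom[of i l]]
      and k = HomD[OF KD[of l i]] HomD[OF KD[of l "i + 1"]]
    have "sum_pr C K (i + 1 + 1) l \<bullet> (cD (sum_cpx C K) (i + 1) \<bullet> cD (sum_cpx C K) i)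
        = (sum_pr C K (i + 1 + 1) l \<bullet> cD (sum_cpx C K) (i + 1)) \<bullet> cD (sum_cpx C K) i"
      using p d by (intro cmp_assoc_arrow[symmetric]) auto
    also have "\<dots> = (cD (K l) (i + 1) \<bullet> sum_pr C K (i + 1) l) \<bullet> cD (sum_cpx C K) i"
      by (simp only: sum_pr_natural)
    also have "\<dots> = cD (K l) (i + 1) \<bullet> (sum_pr C K (i + 1) l \<bullet> cD (sum_cpx C K) i)"
      using p d k by (intro cmp_assoc_arrow) auto
    also have "\<dots> = cD (K l) (i + 1) \<bullet> (cD (K l) i \<bullet> sum_pr C K i l)"
      by (simp only: sum_pr_natural)
    also have "\<dots> = (cD (K l) (i + 1) \<bullet> cD (K l) i) \<bullet> sum_pr C K i l"
      using p k by (intro cmp_assoc_arrow[symmetric]) auto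
    also have "\<dots> = Zero C (sum_ob C K i) (cO (K l) (i + 1 + 1))"
      unfolding KDD using p k by (subst cmp_Zero(1)) auto
    also have "\<dots> = sum_pr C K (i + 1 + 1) l \<bullet> Zero C (sum_ob C K i) (sum_ob C K (i + 1 + 1))"
      using p by (subst cmp_Zero(2)) auto
    finally show "sum_pr C K (i + 1 + 1) l \<bullet> (cD (sum_cpx C K) (i + 1) \<bullet> cD (sum_cpx C K) i) =
       sum_pr C K (i + 1 + 1) l \<bullet> Zero C (sum_ob C K i) (sum_ob C K (i + 1 + 1))" .
  qed
  have z: "zero_object C (sum_ob C K i)" if "\<bar>i\<bar> > N" for i
    unfolding sum_ob_def N[OF that] by (rule bp_ob_empty[of "\<lambda>n. cO (K n) i", OF KO])
  show ?thesis
    unfolding bounded_complexes_def mem_Collect_eq O using sum_ob_Ob cD_sum_Hom dd z by blast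
qed

end

section \<open>The twist on complexes and its effect on occurrence\<close>

definition tw_cpx :: "((bool \<times> 'o set) list set \<Rightarrow> int) \<Rightarrow> ('o, 'm) cpx \<Rightarrow> ('o, 'm) cpx" where
  "tw_cpx \<eta> K = sum_cpx C (\<lambda>n. shift_cpx C n (comp_cpx C \<eta> n K))"

context
  fixes \<eta> :: "(bool \<times> 'o set) list set \<Rightarrow> int" and K :: "('o, 'm) cpx"
  assumes K: "K \<in> bounded_complexes C"
begin

definition tw_fam :: "int \<Rightarrow> ('o, 'm) cpx" where
  "tw_fam n = shift_cpx C n (comp_cpx C \<eta> n K)"

lemma tw_fam_simps:
  "cO (tw_fam n) i = comp_ob C \<eta> n (cO K (i + n))"
  "cD (tw_fam n) i = Scale C (alt_sign n) (comp_mor C \<eta> n (cD K (i + n)))"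
  by (simp_all add: tw_fam_def shift_cpx_def comp_cpx_def)

lemma cpx_Hom: "cD K i \<in> Hom C (cO K i) (cO K (i + 1))"
  using K by auto

lemma tw_fam_complex:
  "cO (tw_fam n) i \<in> Ob C"
  "cD (tw_fam n) i \<in> Hom C (cO (tw_fam n) i) (cO (tw_fam n) (i + 1))"
  "cD (tw_fam n) (i + 1) \<bullet> cD (tw_fam n) i = Zero C (cO (tw_fam n) i) (cO (tw_fam n) (i + 1 + 1))"
proof -
  have ix: "i + 1 + n = i + n + 1" "i + 1 + 1 + n = i + n + 1 + 1" by simp_all
  show "cO (tw_fam n) i \<in> Ob C" using comp_ob_Ob K by (simp add: tw_fam_simps)
  note m = comp_mor_Hom(1)[OF cpx_Hom, of \<eta> n "i + n"] comp_mor_Hom(1)[OF cpx_Hom, of \<eta> n "i + n + 1"]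
  note mD = HomD[OF m(1)] HomD[OF m(2)]
  show "cD (tw_fam n) i \<in> Hom C (cO (tw_fam n) i) (cO (tw_fam n) (i + 1))"
    unfolding tw_fam_simps ix using mD by auto
  have "comp_mor C \<eta> n (cD K (i + n + 1)) \<bullet> comp_mor C \<eta> n (cD K (i + n)) =
      Zero C (comp_ob C \<eta> n (cO K (i + n))) (comp_ob C \<eta> n (cO K (i + n + 1 + 1)))"
    by (rule comp_mor_cmp_zero[OF cpx_Hom cpx_Hom cpxD(5)[OF K]])
  then show "cD (tw_fam n) (i + 1) \<bullet> cD (tw_fam n) i = Zero C (cO (tw_fam n) i) (cO (tw_fam n) (i + 1 + 1))"
    unfolding tw_fam_simps ix using mD by simp
qed

text \<open>A nonzero term with indices \<open>n\<close> and \<open>i\<close> is the component of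
  degree \<open>n\<close> of the term of \<open>K\<close> in degree \<open>i + n\<close>.
  Boundedness of \<open>K\<close> controls \<open>i + n\<close>, and each of its finitely many
  nonzero terms has finitely many nonzero components, which controls \<open>n\<close>.\<close>

lemma tw_fam_support:
  "\<exists>N. \<forall>n i. \<not> zero_object C (cO (tw_fam n) i) \<longrightarrow> \<bar>n\<bar> \<le> N \<and> \<bar>i\<bar> \<le> N"
proof -
  obtain N where N: "\<And>i. \<bar>i\<bar> > N \<Longrightarrow> zero_object C (cO K i)"
    using K unfolding bounded_complexes_def by blast
  define A where "A = (\<Union>j \<in> {- N..N}. {n. \<not> zero_object C (comp_ob C \<eta> n (cO K j))})"
  have "finite A"
    unfolding A_def using is_biprodD(1)[OF comp_decomposition(4)] K by (intro finite_UN_I) auto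
  then have "\<bar>n\<bar> \<le> Max (abs ` A)" if "n \<in> A" for n using that by simp
  then obtain M where M: "\<And>n. n \<in> A \<Longrightarrow> \<bar>n\<bar> \<le> M" by blast
  have *: "\<bar>n\<bar> \<le> M \<and> \<bar>i + n\<bar> \<le> N" if "\<not> zero_object C (cO (tw_fam n) i)" for n i
  proof -
    have nz: "\<not> zero_object C (comp_ob C \<eta> n (cO K (i + n)))" using that by (simp add: tw_fam_simps)
    have "\<not> zero_object C (cO K (i + n))"
      using nz mor_zero_retract[OF _ comp_decomposition(2) comp_decomposition(3) comp_pr_in] K by (metis cpxD(1))
    then have "\<bar>i + n\<bar> \<le> N" using N by (meson not_le)
    moreover from this have "n \<in> A" unfolding A_def using nz by (intro UN_I[of "i + n"]) auto
    ultimately show ?thesis using M by blast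
  qed
  show ?thesis
  \<comment> \<open>The bound on \<open>i\<close> comes from those on \<open>i + n\<close> and
    \<open>n\<close> by the triangle inequality; absolute values guard against negative
    bounds.\<close>
  proof (intro exI[of _ "\<bar>M\<bar> + \<bar>N\<bar>"] allI impI)
    fix n i assume "\<not> zero_object C (cO (tw_fam n) i)"
    from *[OF this] show "\<bar>n\<bar> \<le> \<bar>M\<bar> + \<bar>N\<bar> \<and> \<bar>i\<bar> \<le> \<bar>M\<bar> + \<bar>N\<bar>" by linarith
  qed
qed

lemma tw_fam_finite: "finite (sum_idx C tw_fam i)"
proof -
  obtain N where N: "\<And>n i. \<not> zero_object C (cO (tw_fam n) i) \<Longrightarrow> \<bar>n\<bar> \<le> N \<and> \<bar>i\<bar> \<le> N"
    using tw_fam_support by blast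
  have "sum_idx C tw_fam i \<subseteq> {- N..N}"
  proof
    fix n assume "n \<in> sum_idx C tw_fam i"
    then have "\<bar>n\<bar> \<le> N" using N by (simp add: sum_idx_def)
    then show "n \<in> {- N..N}" by auto
  qed
  then show ?thesis using finite_subset by blast
qed

lemma tw_cpx_eq: "tw_cpx \<eta> K = sum_cpx C tw_fam"
  by (simp add: tw_cpx_def tw_fam_def[abs_def])

lemma tw_cpx_bounded: "tw_cpx \<eta> K \<in> bounded_complexes C"
proof -
  obtain N where N: "\<And>n i. \<not> zero_object C (cO (tw_fam n) i) \<Longrightarrow> \<bar>n\<bar> \<le> N \<and> \<bar>i\<bar> \<le> N"
    using tw_fam_support by blast
  have "sum_idx C tw_fam i = {}" if "\<bar>i\<bar> > N" for i using N that unfolding sum_idx_def by fastforce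
  then show ?thesis
    unfolding tw_cpx_eq by (rule sum_cpx_bounded[OF tw_fam_complex tw_fam_finite])
qed

text \<open>The simple object \<open>Z\<close> is homogeneous of degree \<open>a\<close>, so
  morphisms out of it see only the summand with index \<open>a\<close> of the twist and only the
  component of degree \<open>a\<close> of \<open>K\<close>. These agree up to the shift by
  \<open>a\<close> and the sign of its differential.\<close>

lemma occurs_tw_cpx:
  assumes Z: "simple_object C Z"
  shows "occurs C Z i (tw_cpx \<eta> K) \<longleftrightarrow> occurs C Z (i + \<eta> (gdeg C (iso_class C Z))) K"
proof -
  define a where "a = \<eta> (gdeg C (iso_class C Z))"
  have hZ: "homogeneous C \<eta> a Z" unfolding a_def by (rule simple_homogeneous[OF Z])
  note s = tw_fam_complex tw_fam_finite
  note biprod = sum_biprod[OF s] and prH = sum_pr_Hom[OF s] and inH = sum_in_Hom[OF s]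
    and prin = sum_pr_in[OF s] and cancel = sum_pr_in_cancel[OF s] and nat = sum_pr_natural[OF s]
    and dH = cD_sum_Hom[OF s]
  have O: "cO (tw_cpx \<eta> K) j = sum_ob C tw_fam j" for j by (simp add: tw_cpx_eq sum_cpx_def)
  define ci cp where "ci = (\<lambda>j. comp_in \<eta> a (cO K j))" and "cp = (\<lambda>j. comp_pr \<eta> a (cO K j))"
  have ci: "ci (j + a) \<in> Hom C (cO (tw_fam a) j) (cO K (j + a))"
    and cp: "cp (j + a) \<in> Hom C (cO K (j + a)) (cO (tw_fam a) j)" for j
    using comp_decomposition(2,3)[of "cO K (j + a)" \<eta> a] K by (simp_all add: ci_def cp_def tw_fam_simps)
  define \<phi> where "\<phi> = (\<lambda>j. ci (j + a) \<bullet> sum_pr C tw_fam j a)"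
  define \<psi> where "\<psi> = (\<lambda>j. sum_in C tw_fam j a \<bullet> cp (j + a))"
  show ?thesis
    unfolding a_def[symmetric]
  proof (rule occurs_transfer[OF tw_cpx_bounded K, where c = "alt_sign a" and \<phi> = \<phi> and \<psi> = \<psi>])
    show "alt_sign a \<noteq> (0 :: 'k)" by (simp add: alt_sign_def)
    show "\<phi> j \<in> Hom C (cO (tw_cpx \<eta> K) j) (cO K (j + a))" for j
      unfolding O \<phi>_def using cmp_hom[OF prH ci] .
    show "\<psi> j \<in> Hom C (cO K (j + a)) (cO (tw_cpx \<eta> K) j)" for j
      unfolding O \<psi>_def using cmp_hom[OF cp inH] .
    fix j
    note D = HomD[OF ci[of j]] HomD[OF cp[of j]] HomD[OF prH[of j a]] HomD[OF inH[of j a]]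
    { fix x assume "x \<in> Hom C Z (cO (tw_cpx \<eta> K) j)"
      then have x: "x \<in> Hom C Z (sum_ob C tw_fam j)" unfolding O .
      note xD = HomD[OF x]
      have px: "sum_pr C tw_fam j l \<bullet> x \<in> Hom C Z (cO (tw_fam l) j)" for l using cmp_hom[OF x prH] .
      note pxD = HomD[OF px[of a]]
      have "cp (j + a) \<bullet> (ci (j + a) \<bullet> (sum_pr C tw_fam j a \<bullet> x)) = (cp (j + a) \<bullet> ci (j + a)) \<bullet> (sum_pr C tw_fam j a \<bullet> x)"
        using D xD by simp
      also have "cp (j + a) \<bullet> ci (j + a) = Id C (cO (tw_fam a) j)"
        unfolding cp_def ci_def tw_fam_simps by (rule comp_pr_in) (use K in simp)
      finally have "cp (j + a) \<bullet> (ci (j + a) \<bullet> (sum_pr C tw_fam j a \<bullet> x)) = sum_pr C tw_fam j a \<bullet> x"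
        using pxD by simp
      then have 1: "\<psi> j \<bullet> (\<phi> j \<bullet> x) = sum_in C tw_fam j a \<bullet> (sum_pr C tw_fam j a \<bullet> x)"
        using D xD by (simp add: \<phi>_def \<psi>_def)
      show "\<psi> j \<bullet> (\<phi> j \<bullet> x) = x"
        unfolding 1
      proof (rule biprod_eqI_pr[OF biprod _ x])
        show "sum_in C tw_fam j a \<bullet> (sum_pr C tw_fam j a \<bullet> x) \<in> Hom C Z (sum_ob C tw_fam j)"
          using cmp_hom[OF px inH] .
        fix l
        show "sum_pr C tw_fam j l \<bullet> (sum_in C tw_fam j a \<bullet> (sum_pr C tw_fam j a \<bullet> x)) = sum_pr C tw_fam j l \<bullet> x"
        proof (cases "l = a")
          case True
          then show ?thesis using cancel pxD by blast
        next
          \<comment> \<open>The summand with index \<open>l\<close> is homogeneous of degree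
            \<open>l\<close>, so both sides are morphisms from \<open>Z\<close> into a different
            degree and vanish.\<close>
          case False
          have h: "homogeneous C \<eta> l (cO (tw_fam l) j)"
            unfolding tw_fam_simps by (rule comp_decomposition(1)) (use K in simp)
          have "y = Zero C Z (cO (tw_fam l) j)" if "y \<in> Hom C Z (cO (tw_fam l) j)" for y
            using homogeneous_orthogonal[OF hZ h _ that] False by blast
          moreover have "sum_pr C tw_fam j l \<bullet> (sum_in C tw_fam j a \<bullet> (sum_pr C tw_fam j a \<bullet> x)) \<in> Hom C Z (cO (tw_fam l) j)"
            using cmp_hom[OF cmp_hom[OF px inH] prH] .
          ultimately show ?thesis using px by metis
        qed
      qed
      have ix: "j + 1 + a = j + a + 1" by simp
      have dx: "sum_pr C tw_fam (j + 1) a \<bullet> (cD (tw_cpx \<eta> K) j \<bullet> x) = cD (tw_fam a) j \<bullet> (sum_pr C tw_fam j a \<bullet> x)"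
      proof -
        have "sum_pr C tw_fam (j + 1) a \<bullet> (cD (tw_cpx \<eta> K) j \<bullet> x)
            = (sum_pr C tw_fam (j + 1) a \<bullet> cD (sum_cpx C tw_fam) j) \<bullet> x"
          unfolding tw_cpx_eq using cmp_assoc[OF x dH prH] by simp
        also have "\<dots> = cD (tw_fam a) j \<bullet> (sum_pr C tw_fam j a \<bullet> x)"
          unfolding nat using cmp_assoc[OF x prH tw_fam_complex(2)] .
        finally show ?thesis .
      qed
      note m = comp_mor_Hom(1)[OF cpx_Hom, of \<eta> a "j + a"]
      have natK: "ci (j + 1 + a) \<bullet> comp_mor C \<eta> a (cD K (j + a)) = cD K (j + a) \<bullet> ci (j + a)"
        unfolding ci_def ix by (rule comp_in_natural[OF cpx_Hom])
      note mD = HomD[OF m, folded tw_fam_simps]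
      note D1 = HomD[OF ci[of "j + 1"]] HomD[OF prH[of "j + 1" a]]
      have cod: "cO (tw_fam a) (j + 1) = comp_ob C \<eta> a (cO K (j + a + 1))" by (simp only: tw_fam_simps ix)
      have "\<phi> (j + 1) \<bullet> (cD (tw_cpx \<eta> K) j \<bullet> x)
          = ci (j + 1 + a) \<bullet> (sum_pr C tw_fam (j + 1) a \<bullet> (cD (tw_cpx \<eta> K) j \<bullet> x))"
      proof -
        have "cD (tw_cpx \<eta> K) j \<bullet> x \<in> Hom C Z (sum_ob C tw_fam (j + 1))"
          unfolding tw_cpx_eq using cmp_hom[OF x dH] .
        then show ?thesis unfolding \<phi>_def using cmp_assoc prH ci by blast
      qed
      also have "\<dots> = ci (j + 1 + a) \<bullet> (Scale C (alt_sign a) (comp_mor C \<eta> a (cD K (j + a))) \<bullet> (sum_pr C tw_fam j a \<bullet> x))"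
        unfolding dx tw_fam_simps(2) ..
      also have "\<dots> = Scale C (alt_sign a) ((ci (j + 1 + a) \<bullet> comp_mor C \<eta> a (cD K (j + a))) \<bullet> (sum_pr C tw_fam j a \<bullet> x))"
        using D1(1-3) mD(1-3) pxD(1-3) cod by simp
      also have "\<dots> = Scale C (alt_sign a) (cD K (j + a) \<bullet> (\<phi> j \<bullet> x))"
        unfolding natK \<phi>_def using D xD K by simp
      finally show "\<phi> (j + 1) \<bullet> (cD (tw_cpx \<eta> K) j \<bullet> x) = Scale C (alt_sign a) (cD K (j + a) \<bullet> (\<phi> j \<bullet> x))" . }
    { fix y assume y: "y \<in> Hom C Z (cO K (j + a))"
      note yD = HomD[OF y]
      have "sum_pr C tw_fam j a \<bullet> (sum_in C tw_fam j a \<bullet> (cp (j + a) \<bullet> y)) = cp (j + a) \<bullet> y"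
        using D yD by (intro cancel) auto
      then have "\<phi> j \<bullet> (\<psi> j \<bullet> y) = ci (j + a) \<bullet> (cp (j + a) \<bullet> y)"
        using D yD by (simp add: \<phi>_def \<psi>_def)
      also have "\<dots> = y" unfolding ci_def cp_def by (rule comp_in_pr[OF _ hZ y]) (use K in simp)
      finally show "\<phi> j \<bullet> (\<psi> j \<bullet> y) = y" . }
  qed
qed

end

end

section \<open>The character of a monoidal triangulated equivalence\<close>

context semisimple_tensor_category
begin

lemma Db_le0_iff: "K \<in> Db_le0 C \<longleftrightarrow> K \<in> bounded_complexes C \<and>
    (\<forall>i>0. \<forall>S. simple_object C S \<longrightarrow> \<not> occurs C S i K)"
  unfolding Db_le0_def Db_Ob using cohom_zero_iff by blast

lemma Db_ge0_iff: "K \<in> Db_ge0 C \<longleftrightarrow> K \<in> bounded_complexes C \<and>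
    (\<forall>i<0. \<forall>S. simple_object C S \<longrightarrow> \<not> occurs C S i K)"
  unfolding Db_ge0_def Db_Ob using cohom_zero_iff by blast

lemma conc_bounded: "X \<in> Ob C \<Longrightarrow> conc C X \<in> bounded_complexes C"
  using stalk_bounded[of X 0] by (simp add: stalk_0)

lemma occurs_concD: "X \<in> Ob C \<Longrightarrow> occurs C S i (conc C X) \<Longrightarrow> i = 0"
  using occurs_stalkD[of X S i 0] by (simp add: stalk_0)

lemma conc_heart:
  assumes "X \<in> Ob C"
  shows "conc C X \<in> Db_le0 C" "conc C X \<in> Db_ge0 C"
  using conc_bounded[OF assms] occurs_concD[OF assms] unfolding Db_le0_iff Db_ge0_iff by force+

lemma gdeg_carrier: "simple_object C S \<Longrightarrow> gdeg C (iso_class C S) \<in> carrier (grading_group C)"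
  using gdeg_is_grading[of C] by (auto simp: is_grading_def Irr_def)

lemma FO_twist: "FO (twist C \<eta> \<circ>\<^sub>F F) K = tw_cpx \<eta> (FO F K)"
  by (simp add: twist_def cmp_functor_def Db_lift_def loc_lift_def quot_lift_def tw_cpx_def)

text \<open>The values of \<open>h\<close> on simple objects form a grading. By the universal
  property exactly one homomorphism has these values, and both \<open>h\<close> and
  \<open>h'\<close> do.\<close>

lemma grading_homs_eqI:
  assumes "h \<in> grading_homs C" "h' \<in> grading_homs C"
    and "\<And>S. simple_object C S \<Longrightarrow> h (gdeg C (iso_class C S)) = h' (gdeg C (iso_class C S))"
  shows "h = h'"
proof -
  define d where "d = (\<lambda>x. h (gdeg C x))"
  have "is_grading C integer_group d"
    unfolding is_grading_def
  proof (intro conjI allI impI)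
    show "d \<in> Irr C \<rightarrow> carrier integer_group" by (simp add: integer_group_def)
    fix X Y Z assume *: "simple_object C X \<and> simple_object C Y \<and> simple_object C Z \<and> direct_summand C Z (X \<boxtimes> Y)"
    have "gdeg C (iso_class C Z) = gdeg C (iso_class C X) \<otimes>\<^bsub>grading_group C\<^esub> gdeg C (iso_class C Y)"
      using gdeg_is_grading[of C] * unfolding is_grading_def by blast
    then show "d (iso_class C Z) = d (iso_class C X) \<otimes>\<^bsub>integer_group\<^esub> d (iso_class C Y)"
      using assms(1) gdeg_carrier * hom_mult[of h "grading_group C" integer_group]
      unfolding d_def grading_homs_def by simp
  qed
  then have "\<exists>!h. h \<in> grading_homs C \<and> (\<forall>x \<in> Irr C. h (gdeg C x) = d x)"
    using grading_group_universal[OF group_integer_group] unfolding grading_homs_def by blast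
  moreover have "\<forall>x \<in> Irr C. h (gdeg C x) = d x" "\<forall>x \<in> Irr C. h' (gdeg C x) = d x"
    using assms(3) by (auto simp: d_def Irr_def)
  ultimately show ?thesis using assms(1,2) by blast
qed

end

section \<open>Construction and uniqueness of the character\<close>

context monoidal_triangulated_equivalence_between
begin

text \<open>Through \<open>F\<close> the second occurrence makes \<open>W\<close> occur in degree
  \<open>m - m'\<close> of the complex of \<open>W'\<close>, which lives in degree \<open>0\<close>.
  The simple objects \<open>W\<close> and \<open>W'\<close> may differ a priori.\<close>

lemma occurs_FO_unique:
  assumes W: "simple_object C W" "simple_object C W'" and Z: "simple_object D Z"
    and o: "occurs D Z (- m) (FO F (conc C W))" and o': "occurs D Z (- m') (FO F (conc C W'))"
  shows "m = m'"
proof -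
  note O = W[THEN C.simple_object_Ob]
  have "occurs C W (- m' + m) (conc C W')"
    using occurs_FO_iff[OF W(1) Z o C.conc_bounded[OF O(2)]] o' by blast
  then show ?thesis using C.occurs_concD[OF O(2)] by fastforce
qed

lemma character_exists:
  "\<exists>\<chi> \<in> grading_homs D. \<forall>Z. simple_object D Z \<longrightarrow>
    (\<exists>W. simple_object C W \<and> occurs D Z (- \<chi> (gdeg D (iso_class D Z))) (FO F (conc C W)))"
proof -
  define P where "P = (\<lambda>Z m. \<exists>W. simple_object C W \<and> occurs D Z (- m) (FO F (conc C W)))"
  have P_ex: "\<exists>m. P Z m" if "simple_object D Z" for Z
    using occurs_FO_exists[OF that] unfolding P_def by blast
  have P_unique: "m = m'" if "simple_object D Z" "P Z m" "P Z m'" for Z m m'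
    using that occurs_FO_unique unfolding P_def by blast
  \<comment> \<open>A grading is a function on isomorphism classes, so the integer has to be
    independent of the representative. A cocycle out of \<open>Z\<close> is transported by composing
    with the inverse isomorphism.\<close>
  have P_iso: "P Z' m" if Z: "simple_object D Z" "Z' \<in> iso_class D Z" and P: "P Z m" for Z Z' m
  proof -
    obtain f g where f: "f \<in> Hom D Z Z'" "g \<in> Hom D Z' Z" "g \<bullet>\<^bsub>D\<^esub> f = Id D Z" "f \<bullet>\<^bsub>D\<^esub> g = Id D Z'"
      using Z(2) D.isomorphicE unfolding iso_class_def by blast
    note fD = D.HomD[OF f(1)] and gD = D.HomD[OF f(2)]
    obtain W where W: "simple_object C W" "occurs D Z (- m) (FO F (conc C W))" using P unfolding P_def by blast
    let ?K = "FO F (conc C W)"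
    have K: "?K \<in> bounded_complexes D" using FO_bounded C.conc_bounded C.simple_object_Ob W(1) by blast
    obtain x where x: "x \<in> Hom D Z (cO ?K (- m))" "cD ?K (- m) \<bullet>\<^bsub>D\<^esub> x = Zero D Z (cO ?K (- m + 1))"
      "\<not> (\<exists>y \<in> Hom D Z (cO ?K (- m - 1)). x = cD ?K (- m - 1) \<bullet>\<^bsub>D\<^esub> y)"
      using W(2) unfolding occurs_def by blast
    note xD = D.HomD[OF x(1)]
    have "x \<bullet>\<^bsub>D\<^esub> g \<in> Hom D Z' (cO ?K (- m))" using xD gD by auto
    moreover have "cD ?K (- m) \<bullet>\<^bsub>D\<^esub> (x \<bullet>\<^bsub>D\<^esub> g) = (cD ?K (- m) \<bullet>\<^bsub>D\<^esub> x) \<bullet>\<^bsub>D\<^esub> g" using xD gD K by simp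
    then have "cD ?K (- m) \<bullet>\<^bsub>D\<^esub> (x \<bullet>\<^bsub>D\<^esub> g) = Zero D Z' (cO ?K (- m + 1))"
      unfolding x(2) using xD gD K by simp
    moreover have "\<not> (\<exists>y \<in> Hom D Z' (cO ?K (- m - 1)). x \<bullet>\<^bsub>D\<^esub> g = cD ?K (- m - 1) \<bullet>\<^bsub>D\<^esub> y)"
    proof
      assume "\<exists>y \<in> Hom D Z' (cO ?K (- m - 1)). x \<bullet>\<^bsub>D\<^esub> g = cD ?K (- m - 1) \<bullet>\<^bsub>D\<^esub> y"
      then obtain y where y: "y \<in> Hom D Z' (cO ?K (- m - 1))" "x \<bullet>\<^bsub>D\<^esub> g = cD ?K (- m - 1) \<bullet>\<^bsub>D\<^esub> y" by blast
      note yD = D.HomD[OF y(1)]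
      have "x = x \<bullet>\<^bsub>D\<^esub> (g \<bullet>\<^bsub>D\<^esub> f)" unfolding f(3) using xD by simp
      also have "\<dots> = (x \<bullet>\<^bsub>D\<^esub> g) \<bullet>\<^bsub>D\<^esub> f" using xD gD fD by simp
      also have "\<dots> = cD ?K (- m - 1) \<bullet>\<^bsub>D\<^esub> (y \<bullet>\<^bsub>D\<^esub> f)" unfolding y(2) using yD fD K by simp
      finally have "x = cD ?K (- m - 1) \<bullet>\<^bsub>D\<^esub> (y \<bullet>\<^bsub>D\<^esub> f)" .
      moreover have "y \<bullet>\<^bsub>D\<^esub> f \<in> Hom D Z (cO ?K (- m - 1))" using yD fD by auto
      ultimately show False using x(3) by blast
    qed
    ultimately have "occurs D Z' (- m) ?K" unfolding occurs_def by blast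
    then show ?thesis using W(1) unfolding P_def by blast
  qed
  \<comment> \<open>The choice is made on the class as a whole and may come from any representative;
    \<open>P_iso\<close> moves it to the given one.\<close>
  define d where "d = (\<lambda>c. SOME m. \<exists>Z \<in> c. simple_object D Z \<and> P Z m)"
  have self: "Z \<in> iso_class D Z" if "simple_object D Z" for Z
    using D.isomorphicI[of "Id D Z" Z Z "Id D Z"] D.id_hom[of Z] D.simple_object_Ob[OF that]
    by (simp add: iso_class_def)
  have d: "P Z (d (iso_class D Z))" if Z: "simple_object D Z" for Z
  proof -
    have "\<exists>m. \<exists>Y \<in> iso_class D Z. simple_object D Y \<and> P Y m" using P_ex[OF Z] self[OF Z] Z by blast
    then have "\<exists>Y \<in> iso_class D Z. simple_object D Y \<and> P Y (d (iso_class D Z))"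
      unfolding d_def by (rule someI_ex)
    then obtain Y where Y: "Y \<in> iso_class D Z" "simple_object D Y" "P Y (d (iso_class D Z))" by blast
    have "isomorphic D Z Y" "Z \<in> Ob D" using Y(1) D.simple_object_Ob[OF Z] by (auto simp: iso_class_def)
    then have "Z \<in> iso_class D Y" using D.isomorphic_sym by (simp add: iso_class_def)
    then show ?thesis using P_iso[OF Y(2) _ Y(3)] by blast
  qed
  have "is_grading D integer_group d"
    unfolding is_grading_def
  proof (intro conjI allI impI)
    show "d \<in> Irr D \<rightarrow> carrier integer_group" by (simp add: integer_group_def)
    fix X Y Z assume *: "simple_object D X \<and> simple_object D Y \<and> simple_object D Z \<and> direct_summand D Z (X \<boxtimes>\<^bsub>D\<^esub> Y)"
    let ?x = "d (iso_class D X)" and ?y = "d (iso_class D Y)" and ?z = "d (iso_class D Z)"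
    obtain V where V: "simple_object C V" "occurs D X (- ?x) (FO F (conc C V))"
      using d[of X] * unfolding P_def by blast
    obtain W where W: "simple_object C W" "occurs D Y (- ?y) (FO F (conc C W))"
      using d[of Y] * unfolding P_def by blast
    obtain U where U: "simple_object C U" "occurs D Z (- ?z) (FO F (conc C U))"
      using d[of Z] * unfolding P_def by blast
    have O: "V \<in> Ob C" "W \<in> Ob C" using C.simple_object_Ob V(1) W(1) by blast+
    note bV = C.conc_bounded[OF O(1)] and bW = C.conc_bounded[OF O(2)]
    let ?T = "tot_cpx C (conc C V) (conc C W)"
    have "occurs D Z (- ?x + - ?y) (tot_cpx D (FO F (conc C V)) (FO F (conc C W)))"
      using D.occurs_tot[OF FO_bounded[OF bV] FO_bounded[OF bW] _ _ _ _ V(2) W(2)] * by blast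
    then have "occurs D Z (- ?x + - ?y) (FO F ?T)"
      using D.occurs_iso[OF tens_isomorphic[OF bV bW]] by blast
    then have "occurs C U (- ?x + - ?y + ?z) ?T"
      using occurs_FO_iff[OF U(1) _ U(2) C.tot_conc(1)[OF O]] * by blast
    then have "- ?x + - ?y + ?z = 0"
      using C.occurs_zero[OF C.tot_conc(1)[OF O]] C.tot_conc(2)[OF O] by blast
    then show "?z = ?x \<otimes>\<^bsub>integer_group\<^esub> ?y" by (simp add: integer_group_def)
  qed
  then obtain \<chi> where \<chi>: "\<chi> \<in> grading_homs D" "\<forall>x \<in> Irr D. \<chi> (gdeg D x) = d x"
    using grading_group_universal[OF group_integer_group] unfolding grading_homs_def by blast
  have "P Z (\<chi> (gdeg D (iso_class D Z)))" if "simple_object D Z" for Z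
    using \<chi>(2) d[OF that] that by (auto simp: Irr_def)
  then show ?thesis using \<chi>(1) unfolding P_def by blast
qed

text \<open>Both halves of the t-structure forbid occurrences in certain degrees. If every degree
  with an occurrence in \<open>FO G K\<close> already has one in \<open>K\<close>, both halves are
  preserved.\<close>

lemma t_exactI:
  assumes bounded: "\<And>K. K \<in> bounded_complexes C \<Longrightarrow> FO G K \<in> bounded_complexes D"
    and occ: "\<And>K i Z. K \<in> bounded_complexes C \<Longrightarrow> simple_object D Z \<Longrightarrow> occurs D Z i (FO G K) \<Longrightarrow>
      \<exists>W. simple_object C W \<and> occurs C W i K"
  shows "t_exact C D G"
  unfolding t_exact_def
proof (intro conjI subsetI; elim imageE)
  fix x K assume x: "x = FO G K"
  { assume "K \<in> Db_le0 C"
    then show "x \<in> Db_le0 D" unfolding x C.Db_le0_iff D.Db_le0_iff using bounded occ by blast }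
  assume "K \<in> Db_ge0 C"
  then show "x \<in> Db_ge0 D" unfolding x C.Db_ge0_iff D.Db_ge0_iff using bounded occ by blast
qed

lemma ex1_character: "\<exists>!\<chi>. \<chi> \<in> grading_homs D \<and> t_exact C D (twist D (neg_hom D \<chi>) \<circ>\<^sub>F F)"
proof -
  obtain \<chi> where \<chi>: "\<chi> \<in> grading_homs D"
    and occ: "\<And>Z. simple_object D Z \<Longrightarrow>
      \<exists>W. simple_object C W \<and> occurs D Z (- \<chi> (gdeg D (iso_class D Z))) (FO F (conc C W))"
    using character_exists by blast
  \<comment> \<open>The twist by a homomorphism adds its value at \<open>Z\<close> to the degree at
    which the untwisted complex is inspected; for \<open>neg_hom\<close> this value is
    \<open>-\<psi>\<close>.\<close>
  have tw: "occurs D Z i (FO (twist D (neg_hom D \<psi>) \<circ>\<^sub>F F) K) \<longleftrightarrow>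
      occurs D Z (i - \<psi> (gdeg D (iso_class D Z))) (FO F K)"
    if "simple_object D Z" "K \<in> bounded_complexes C" for Z i \<psi> K
    unfolding D.FO_twist using D.occurs_tw_cpx[OF FO_bounded[OF that(2)] that(1)] D.gdeg_carrier[OF that(1)]
    by (simp add: neg_hom_def)
  have ex: "t_exact C D (twist D (neg_hom D \<chi>) \<circ>\<^sub>F F)"
  proof (rule t_exactI)
    fix K assume K: "K \<in> bounded_complexes C"
    show "FO (twist D (neg_hom D \<chi>) \<circ>\<^sub>F F) K \<in> bounded_complexes D"
      unfolding D.FO_twist by (rule D.tw_cpx_bounded[OF FO_bounded[OF K]])
    fix i Z assume Z: "simple_object D Z" and o: "occurs D Z i (FO (twist D (neg_hom D \<chi>) \<circ>\<^sub>F F) K)"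
    obtain W where W: "simple_object C W" "occurs D Z (- \<chi> (gdeg D (iso_class D Z))) (FO F (conc C W))"
      using occ[OF Z] by blast
    \<comment> \<open>The twist subtracts the value of \<open>\<chi>\<close> and
      \<open>occurs_FO_iff\<close> adds it back, so \<open>W\<close> occurs in \<open>K\<close> in
      the same degree \<open>i\<close>.\<close>
    have "occurs C W (i - \<chi> (gdeg D (iso_class D Z)) + \<chi> (gdeg D (iso_class D Z))) K"
      using o unfolding tw[OF Z K] using occurs_FO_iff[OF W(1) Z W(2) K] by blast
    then show "\<exists>W. simple_object C W \<and> occurs C W i K" using W(1) by auto
  qed
  moreover have "\<psi> = \<chi>" if \<psi>: "\<psi> \<in> grading_homs D" "t_exact C D (twist D (neg_hom D \<psi>) \<circ>\<^sub>F F)" for \<psi>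
  proof (rule D.grading_homs_eqI[OF \<psi>(1) \<chi>])
    fix Z assume Z: "simple_object D Z"
    define g where "g = gdeg D (iso_class D Z)"
    obtain W where W: "simple_object C W" "occurs D Z (- \<chi> g) (FO F (conc C W))"
      using occ[OF Z] unfolding g_def by blast
    have O: "W \<in> Ob C" using C.simple_object_Ob W(1) by blast
    let ?T = "FO (twist D (neg_hom D \<psi>) \<circ>\<^sub>F F) (conc C W)"
    \<comment> \<open>The object \<open>W\<close> in degree \<open>0\<close> lies in the heart, so
      its image must lie in both halves of the t-structure. But \<open>Z\<close> occurs there in
      degree \<open>\<psi> g - \<chi> g\<close>, which must therefore be \<open>0\<close>.\<close>
    have "occurs D Z (\<psi> g - \<chi> g) ?T"
      unfolding tw[OF Z C.conc_bounded[OF O]] g_def[symmetric] using W(2) by simp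
    moreover have "?T \<in> Db_le0 D" "?T \<in> Db_ge0 D"
      using \<psi>(2) C.conc_heart[OF O] unfolding t_exact_def by blast+
    ultimately have "\<not> \<psi> g - \<chi> g > 0" "\<not> \<psi> g - \<chi> g < 0"
      using Z unfolding D.Db_le0_iff D.Db_ge0_iff by blast+
    then show "\<psi> (gdeg D (iso_class D Z)) = \<chi> (gdeg D (iso_class D Z))" unfolding g_def by simp
  qed
  ultimately show ?thesis using \<chi> by blast
qed

text \<open>The character is zero, so each simple \<open>Z\<close> occurs in \<open>F K\<close> in
  the same degrees as its partner \<open>W\<close> in \<open>K\<close>. The twist by zero is built
  from chosen decompositions and sums and is not literally the identity, so exactness is derived for
  \<open>F\<close> directly.\<close>

lemma t_exact_of_trivial_homs:
  assumes "grading_homs D = {zero_hom D}"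
  shows "t_exact C D F"
proof (rule t_exactI[OF FO_bounded])
  fix K i Z assume K: "K \<in> bounded_complexes C" and Z: "simple_object D Z" and o: "occurs D Z i (FO F K)"
  obtain \<chi> where \<chi>: "\<chi> \<in> grading_homs D"
    and occ: "\<And>Z. simple_object D Z \<Longrightarrow>
      \<exists>W. simple_object C W \<and> occurs D Z (- \<chi> (gdeg D (iso_class D Z))) (FO F (conc C W))"
    using character_exists by blast
  have "\<chi> (gdeg D (iso_class D Z)) = 0"
    using \<chi> assms D.gdeg_carrier[OF Z] by (simp add: zero_hom_def)
  then obtain W where W: "simple_object C W" "occurs D Z (- 0) (FO F (conc C W))" using occ[OF Z] by auto
  then have "occurs C W i K" using occurs_FO_iff[OF W(1) Z W(2) K] o by simp
  then show "\<exists>W. simple_object C W \<and> occurs C W i K" using W(1) by blast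
qed

end

theorem corollary4p5:
  fixes C :: "('o, 'm, 'k::alg_closed_field) moncat"
    and D :: "('p, 'n, 'k) moncat"
  assumes "semisimple_tensor_category C" and "semisimple_tensor_category D"
  shows "(\<forall>F :: (('o, 'm) cpx, ('o, 'm) dmor, ('p, 'n) cpx, ('p, 'n) dmor) mtfctr.
            monoidal_triangulated_equivalence (Db C) (Db D) F \<longrightarrow>
            (\<exists>!\<chi>. \<chi> \<in> grading_homs D \<and> t_exact C D (twist D (neg_hom D \<chi>) \<circ>\<^sub>F F))) \<and>
         (grading_homs D = {zero_hom D} \<longrightarrow>
           (\<forall>F :: (('o, 'm) cpx, ('o, 'm) dmor, ('p, 'n) cpx, ('p, 'n) dmor) mtfctr.
              monoidal_triangulated_equivalence (Db C) (Db D) F \<longrightarrow> t_exact C D F))"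
proof -
  have loc: "monoidal_triangulated_equivalence_between C D F"
    if "monoidal_triangulated_equivalence (Db C) (Db D) F"
    for F :: "(('o, 'm) cpx, ('o, 'm) dmor, ('p, 'n) cpx, ('p, 'n) dmor) mtfctr"
    using assms that
    by (simp add: monoidal_triangulated_equivalence_between_def monoidal_triangulated_equivalence_between_axioms_def)
  show ?thesis
    using monoidal_triangulated_equivalence_between.ex1_character[OF loc]
      monoidal_triangulated_equivalence_between.t_exact_of_trivial_homs[OF loc] by blast
qed

end
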